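(* Let $R=\Bbbk[[t^{a_1},\dots,t^{a_n}]]$ be a complete numerical semigroup ring with maximal ideal $\mathfrak m$, such that $R$ is almost Gorenstein but not Gorenstein. Then the following statements are true. (1) Suppose $R$ is of minimal reduced type. Then $\operatorname{Ref}(R)$ is of finite type if and only if $R$ is either $\Bbbk[[t^3,t^7,t^{11}]]$ or $\Bbbk[[t^3,t^8,t^{13}]]$. (2) Suppose $R$ is of maximal reduced type $2$ (that is, $s(R)=\operatorname{type}(R)=2$). If $R$ is of minimal multiplicity, then $\operatorname{CM}(R)$ (and hence $\operatorname{Ref}(R)$) is of finite type. (3) Suppose $R$ is of maximal reduced type and $e(\mathfrak m:\mathfrak m)\leq 2$. Then $\operatorname{Ref}(R)$ is of finite type if and only if $R$ is either $\Bbbk[[t^{a_1},t^{a_1+1},\dots,t^{2a_1-1}]]$ or $\Bbbk[[t^{a_1},t^{a_1+2},t^{a_1+3},\dots,t^{2a_1+1}]]$. (4) Suppose $R$ is of maximal reduced type and $e(\mathfrak m:\mathfrak m)=3$. Then $\operatorname{Ref}(R)$ is of finite type if and only if $R=\Bbbk[[t^{a_1},t^{a_1+1},t^{a_1+3},t^{a_1+4},\dots,t^{2a_1-1}]]$ with $a_1\geq 4$ (all exponents from $a_1$ to $2a_1-1$ except $a_1+2$).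
   Context: $\Bbbk$ is an algebraically closed field of characteristic $0$. A numerical semigroup is a submonoid $H$ of $\mathbb N=\{0,1,2,\dots\}$ with finite complement; here $H\ne\mathbb N$ is minimally generated by $a_1<\dots<a_n$ and $R=\Bbbk[[H]]\subseteq\overline R=\Bbbk[[t]]$. The multiplicity of $R$ is $e(R)=a_1$ and its embedding dimension is $n$; $R$ is of minimal multiplicity if $e(R)=n$. The conductor of $R$ is $\mathfrak C=R:_{\operatorname{Frac}(R)}\overline R$. The reduced type is $s(R)=\dim_\Bbbk\frac{\mathfrak C+t^{a_1}R}{t^{a_1}R}$ and the Cohen–Macaulay type is $\operatorname{type}(R)=\dim_\Bbbk\frac{t^{a_1}R:_R\mathfrak m}{t^{a_1}R}$; one has $1\le s(R)\le\operatorname{type}(R)$. $R$ is of maximal reduced type if $s(R)=\operatorname{type}(R)$ and of minimal reduced type if $s(R)=1$. $R$ is almost Gorenstein if $\ell(\overline R/R)=\ell(R/\mathfrak C)+\operatorname{type}(R)-1$, where $\ell$ denotes length. $\mathfrak m:\mathfrak m=\{\alpha\in\operatorname{Frac}(R):\alpha\mathfrak m\subseteq\mathfrak m\}\cong\operatorname{Hom}_R(\mathfrak m,\mathfrak m)$, which is again a complete numerical semigroup ring (possibly $\Bbbk[[t]]$), and $e(\cdot)$ denotes multiplicity. $\operatorname{CM}(R)$ is the category of (finitely generated) maximal Cohen–Macaulay $R$-modules, and $\operatorname{Ref}(R)$ the category of (finitely generated) reflexive $R$-modules, i.e. those $M$ for which the natural map $M\to\operatorname{Hom}_R(\operatorname{Hom}_R(M,R),R)$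 is an isomorphism. A category is of finite type if it has only finitely many indecomposable objects up to isomorphism. *)

theory Defs
  imports
    "HOL-Library.Extended_Nat"
    "HOL-Computational_Algebra.Formal_Laurent_Series"
    "HOL-Algebra.Ideal"
    "HOL-Algebra.Module"
begin

section \<open>Modules over a commutative ring\<close>

text \<open>Homomorphisms are extensional, so that equality of elements of a Hom module is equality
  of functions.\<close>

definition mod_hom ::
  "('r, 'x) ring_scheme \<Rightarrow> ('r, 'a, 'y) module_scheme \<Rightarrow> ('r, 'b, 'z) module_scheme \<Rightarrow> ('a \<Rightarrow> 'b) set"
  where "mod_hom R M N = {f \<in> carrier M \<rightarrow>\<^sub>E carrier N.
     (\<forall>x\<in>carrier M. \<forall>y\<in>carrier M. f (x \<oplus>\<^bsub>M\<^esub> y) = f x \<oplus>\<^bsub>N\<^esub> f y) \<and>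
     (\<forall>r\<in>carrier R. \<forall>x\<in>carrier M. f (r \<odot>\<^bsub>M\<^esub> x) = r \<odot>\<^bsub>N\<^esub> f x)}"

definition mod_isomorphic ::
  "('r, 'x) ring_scheme \<Rightarrow> ('r, 'a, 'y) module_scheme \<Rightarrow> ('r, 'b, 'z) module_scheme \<Rightarrow> bool"
  where "mod_isomorphic R M N \<longleftrightarrow> (\<exists>f\<in>mod_hom R M N. bij_betw f (carrier M) (carrier N))"

text \<open>The fields \<open>mult\<close> and \<open>one\<close> of the record type \<open>module\<close> play no role for modules.\<close>

definition hom_module ::
  "('r, 'x) ring_scheme \<Rightarrow> ('r, 'a, 'y) module_scheme \<Rightarrow> ('r, 'b, 'z) module_scheme \<Rightarrow> ('r, 'a \<Rightarrow> 'b) module"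
  where "hom_module R M N =
    \<lparr>carrier = mod_hom R M N, mult = undefined, one = undefined,
     zero = (\<lambda>x\<in>carrier M. \<zero>\<^bsub>N\<^esub>),
     add = (\<lambda>f g. \<lambda>x\<in>carrier M. f x \<oplus>\<^bsub>N\<^esub> g x),
     smult = (\<lambda>r f. \<lambda>x\<in>carrier M. r \<odot>\<^bsub>N\<^esub> f x)\<rparr>"

definition regular_module :: "('r, 'x) ring_scheme \<Rightarrow> ('r, 'r) module"
  where "regular_module R =
    \<lparr>carrier = carrier R, mult = mult R, one = one R, zero = zero R, add = add R,
     smult = mult R\<rparr>"

definition dual_module ::
  "('r, 'x) ring_scheme \<Rightarrow> ('r, 'a, 'y) module_scheme \<Rightarrow> ('r, 'a \<Rightarrow> 'r) module"
  where "dual_module R M = hom_module R M (regular_module R)"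

definition biduality_map ::
  "('r, 'x) ring_scheme \<Rightarrow> ('r, 'a, 'y) module_scheme \<Rightarrow> 'a \<Rightarrow> ('a \<Rightarrow> 'r) \<Rightarrow> 'r"
  where "biduality_map R M = (\<lambda>x\<in>carrier M. \<lambda>\<phi>\<in>carrier (dual_module R M). \<phi> x)"

definition fin_gen_module :: "('r, 'x) ring_scheme \<Rightarrow> ('r, 'a, 'y) module_scheme \<Rightarrow> bool"
  where "fin_gen_module R M \<longleftrightarrow> module R M \<and>
    (\<exists>X. finite X \<and> X \<subseteq> carrier M \<and> (\<forall>N. submodule N R M \<and> X \<subseteq> N \<longrightarrow> N = carrier M))"

text \<open>The biduality map is always linear, so it is an isomorphism iff it is bijective.\<close>

definition reflexive_module :: "('r, 'x) ring_scheme \<Rightarrow> ('r, 'a, 'y) module_scheme \<Rightarrow> bool"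
  where "reflexive_module R M \<longleftrightarrow> fin_gen_module R M \<and>
    bij_betw (biduality_map R M) (carrier M) (carrier (dual_module R (dual_module R M)))"

definition indecomposable_module :: "('r, 'x) ring_scheme \<Rightarrow> ('r, 'a, 'y) module_scheme \<Rightarrow> bool"
  where "indecomposable_module R M \<longleftrightarrow> module R M \<and> carrier M \<noteq> {\<zero>\<^bsub>M\<^esub>} \<and>
    (\<forall>A B. submodule A R M \<and> submodule B R M \<and> A \<inter> B = {\<zero>\<^bsub>M\<^esub>} \<and> A <+>\<^bsub>M\<^esub> B = carrier M
       \<longrightarrow> A = {\<zero>\<^bsub>M\<^esub>} \<or> B = {\<zero>\<^bsub>M\<^esub>})"

definition krull_dim :: "('r, 'x) ring_scheme \<Rightarrow> enat"
  where "krull_dim R = Sup {enat n | n. \<exists>P. (\<forall>i\<le>n. primeideal (P i) R) \<and> (\<forall>i<n. P i \<subset> P (Suc i))}"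

text \<open>Meant for local rings.\<close>

definition max_ideal :: "('r, 'x) ring_scheme \<Rightarrow> 'r set"
  where "max_ideal R = (THE I. maximalideal I R)"

text \<open>\<open>seq_times R M [x\<^sub>1, \<dots>, x\<^sub>k]\<close> is the submodule \<open>(x\<^sub>1, \<dots>, x\<^sub>k) M\<close>.\<close>

primrec seq_times ::
  "('r, 'x) ring_scheme \<Rightarrow> ('r, 'a, 'y) module_scheme \<Rightarrow> 'r list \<Rightarrow> 'a set" where
  "seq_times R M [] = {\<zero>\<^bsub>M\<^esub>}"
| "seq_times R M (x # xs) =
     {x \<odot>\<^bsub>M\<^esub> y \<oplus>\<^bsub>M\<^esub> z | y z. y \<in> carrier M \<and> z \<in> seq_times R M xs}"

definition regular_sequence ::
  "('r, 'x) ring_scheme \<Rightarrow> ('r, 'a, 'y) module_scheme \<Rightarrow> 'r list \<Rightarrow> bool"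
  where "regular_sequence R M xs \<longleftrightarrow> set xs \<subseteq> carrier R \<and>
    (\<forall>i<length xs. \<forall>y\<in>carrier M.
       (xs ! i) \<odot>\<^bsub>M\<^esub> y \<in> seq_times R M (take i xs) \<longrightarrow> y \<in> seq_times R M (take i xs)) \<and>
    seq_times R M xs \<noteq> carrier M"

definition module_depth :: "('r, 'x) ring_scheme \<Rightarrow> ('r, 'a, 'y) module_scheme \<Rightarrow> enat"
  where "module_depth R M =
    Sup {enat (length xs) | xs. set xs \<subseteq> max_ideal R \<and> regular_sequence R M xs}"

definition max_CM_module :: "('r, 'x) ring_scheme \<Rightarrow> ('r, 'a, 'y) module_scheme \<Rightarrow> bool"
  where "max_CM_module R M \<longleftrightarrow> fin_gen_module R M \<and>
    (carrier M = {\<zero>\<^bsub>M\<^esub>} \<or> module_depth R M = krull_dim R)"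


section \<open>A universe of modules over subrings of the Laurent series field\<close>

text \<open>Modules are taken with carrier contained in a fixed type which, for cardinality reasons,
  accommodates every finitely generated module up to isomorphism (lemma
  \<open>fin_gen_module_in_universe\<close> below), every submodule of a finite power of the Laurent series
  field, and all their quotients up to isomorphism.\<close>

type_synonym 'k lmodule = "('k fls, nat \<Rightarrow> 'k fls) module"

lemma fin_gen_module_in_universe:
  fixes R :: "('k::field fls, 'x) ring_scheme" and M :: "('k fls, 'b, 'y) module_scheme"
  assumes "fin_gen_module R M"
  shows "\<exists>N :: 'k lmodule. module R N \<and> mod_isomorphic R M N"
proof -
  interpret M: module R M using assms by (simp add: fin_gen_module_def)
  have gen: "\<exists>N (g :: (nat \<Rightarrow> 'k fls) \<Rightarrow> 'b). submodule N R M \<and> X \<subseteq> N \<and> N \<subseteq> range g"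
    if "finite X" "X \<subseteq> carrier M" for X
    using that
  proof (induction X rule: finite_induct)
    case empty
    have "submodule {\<zero>\<^bsub>M\<^esub>} R M" by (rule M.submoduleI) auto
    then show ?case by (intro exI[of _ "{\<zero>\<^bsub>M\<^esub>}"] exI[of _ "\<lambda>_. \<zero>\<^bsub>M\<^esub>"]) auto
  next
    case (insert x X)
    then obtain N and g :: "(nat \<Rightarrow> 'k fls) \<Rightarrow> 'b"
      where N: "submodule N R M" "X \<subseteq> N" "N \<subseteq> range g" by auto
    note sub = M.submoduleE[OF N(1)]
    have x: "x \<in> carrier M" using insert by auto
    have zN: "\<zero>\<^bsub>M\<^esub> \<in> N"
      using sub(2-5) by (metis M.M.r_neg all_not_in_conv sub(1) subsetD)
    define N' where "N' = {r \<odot>\<^bsub>M\<^esub> x \<oplus>\<^bsub>M\<^esub> y | r y. r \<in> carrier R \<and> y \<in> N}"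
    have N'I: "r \<odot>\<^bsub>M\<^esub> x \<oplus>\<^bsub>M\<^esub> y \<in> N'" if "r \<in> carrier R" "y \<in> N" for r y
      using that by (auto simp: N'_def)
    have "submodule N' R M"
    proof (rule M.submoduleI)
      show "N' \<subseteq> carrier M" using x sub(1) by (auto simp: N'_def)
      show "\<zero>\<^bsub>M\<^esub> \<in> N'" using N'I[OF M.R.zero_closed zN] x by simp
    next
      fix a assume "a \<in> N'"
      then obtain r y where a: "a = r \<odot>\<^bsub>M\<^esub> x \<oplus>\<^bsub>M\<^esub> y" "r \<in> carrier R" "y \<in> N"
        by (auto simp: N'_def)
      have yM: "y \<in> carrier M" using a sub(1) by auto
      have "\<ominus>\<^bsub>M\<^esub> a = (\<ominus>\<^bsub>R\<^esub> r) \<odot>\<^bsub>M\<^esub> x \<oplus>\<^bsub>M\<^esub> (\<ominus>\<^bsub>M\<^esub> y)"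
        using a x yM by (simp add: M.smult_l_minus M.M.minus_add)
      then show "\<ominus>\<^bsub>M\<^esub> a \<in> N'" using N'I a sub(3) by simp
    next
      fix a b assume "a \<in> N'" "b \<in> N'"
      then obtain r y s z where a: "a = r \<odot>\<^bsub>M\<^esub> x \<oplus>\<^bsub>M\<^esub> y" "r \<in> carrier R" "y \<in> N"
        and b: "b = s \<odot>\<^bsub>M\<^esub> x \<oplus>\<^bsub>M\<^esub> z" "s \<in> carrier R" "z \<in> N"
        by (auto simp: N'_def)
      have yz: "y \<in> carrier M" "z \<in> carrier M" using a b sub(1) by auto
      have "a \<oplus>\<^bsub>M\<^esub> b = (r \<oplus>\<^bsub>R\<^esub> s) \<odot>\<^bsub>M\<^esub> x \<oplus>\<^bsub>M\<^esub> (y \<oplus>\<^bsub>M\<^esub> z)"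
        using a b x yz by (simp add: M.smult_l_distr M.M.a_ac)
      then show "a \<oplus>\<^bsub>M\<^esub> b \<in> N'" using N'I a b sub(5) by simp
    next
      fix s a assume s: "s \<in> carrier R" and "a \<in> N'"
      then obtain r y where a: "a = r \<odot>\<^bsub>M\<^esub> x \<oplus>\<^bsub>M\<^esub> y" "r \<in> carrier R" "y \<in> N"
        by (auto simp: N'_def)
      have yM: "y \<in> carrier M" using a sub(1) by auto
      have "s \<odot>\<^bsub>M\<^esub> a = (s \<otimes>\<^bsub>R\<^esub> r) \<odot>\<^bsub>M\<^esub> x \<oplus>\<^bsub>M\<^esub> (s \<odot>\<^bsub>M\<^esub> y)"
        using a x yM s by (simp add: M.smult_r_distr M.smult_assoc1)
      then show "s \<odot>\<^bsub>M\<^esub> a \<in> N'" using N'I a s sub(4) by simp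
    qed
    moreover have "x \<in> N'" using N'I[OF M.R.one_closed zN] x by simp
    moreover have "X \<subseteq> N'"
    proof
      fix y assume y: "y \<in> X"
      then have "y \<in> carrier M" using insert by auto
      then show "y \<in> N'" using N'I[OF M.R.zero_closed, of y] x y N(2) by auto
    qed
    moreover have "N' \<subseteq> range (\<lambda>c. c 0 \<odot>\<^bsub>M\<^esub> x \<oplus>\<^bsub>M\<^esub> g (\<lambda>i. c (Suc i)))"
    proof
      fix a assume "a \<in> N'"
      then obtain r y where a: "a = r \<odot>\<^bsub>M\<^esub> x \<oplus>\<^bsub>M\<^esub> y" "r \<in> carrier R" "y \<in> N"
        by (auto simp: N'_def)
      then obtain c where "y = g c" using N(3) by auto
      then have "a = (\<lambda>c. c 0 \<odot>\<^bsub>M\<^esub> x \<oplus>\<^bsub>M\<^esub> g (\<lambda>i. c (Suc i))) (case_nat r c)" using a by simp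
      then show "a \<in> range (\<lambda>c. c 0 \<odot>\<^bsub>M\<^esub> x \<oplus>\<^bsub>M\<^esub> g (\<lambda>i. c (Suc i)))" by blast
    qed
    ultimately show ?case by (intro exI[of _ N'] exI conjI) auto
  qed
  obtain g :: "(nat \<Rightarrow> 'k fls) \<Rightarrow> 'b" where g: "carrier M \<subseteq> range g"
    using assms gen unfolding fin_gen_module_def by metis
  define h where "h = inv_into UNIV g"
  have gh: "g (h x) = x" if "x \<in> carrier M" for x
    using that g by (auto simp: h_def f_inv_into_f)
  define N :: "'k lmodule" where "N =
    \<lparr>carrier = h ` carrier M, mult = undefined, one = undefined, zero = h \<zero>\<^bsub>M\<^esub>,
     add = (\<lambda>u v. h (g u \<oplus>\<^bsub>M\<^esub> g v)), smult = (\<lambda>r u. h (r \<odot>\<^bsub>M\<^esub> g u))\<rparr>"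
  have "module R N"
  proof (rule moduleI)
    show "cring R" by (rule M.is_cring)
    show "abelian_group N"
    proof (rule abelian_groupI)
      fix u assume "u \<in> carrier N"
      then obtain x where x: "u = h x" "x \<in> carrier M" by (auto simp: N_def)
      then have "h (\<ominus>\<^bsub>M\<^esub> x) \<oplus>\<^bsub>N\<^esub> u = \<zero>\<^bsub>N\<^esub>" by (simp add: N_def gh M.M.l_neg)
      then show "\<exists>v\<in>carrier N. v \<oplus>\<^bsub>N\<^esub> u = \<zero>\<^bsub>N\<^esub>" using x by (auto simp: N_def)
    qed (auto simp: N_def gh M.M.a_ac)
  qed (auto simp: N_def gh M.smult_l_distr M.smult_r_distr M.smult_assoc1)
  moreover have "mod_isomorphic R M N"
  proof -
    have "restrict h (carrier M) \<in> mod_hom R M N"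
      by (auto simp: mod_hom_def N_def gh)
    moreover have "bij_betw (restrict h (carrier M)) (carrier M) (carrier N)"
      unfolding bij_betw_def N_def by (auto intro!: inj_onI) (metis gh)
    ultimately show ?thesis unfolding mod_isomorphic_def by blast
  qed
  ultimately show ?thesis by blast
qed

definition finite_type :: "('k::field fls, 'x) ring_scheme \<Rightarrow> ('k lmodule \<Rightarrow> bool) \<Rightarrow> bool"
  where "finite_type R \<C> \<longleftrightarrow> (\<exists>S :: 'k lmodule set. finite S \<and>
    (\<forall>M. \<C> M \<and> indecomposable_module R M \<longrightarrow> (\<exists>N\<in>S. mod_isomorphic R M N)))"

abbreviation CM_finite_type :: "('k::field fls, 'x) ring_scheme \<Rightarrow> bool"
  where "CM_finite_type R \<equiv> finite_type R (max_CM_module R)"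

abbreviation Ref_finite_type :: "('k::field fls, 'x) ring_scheme \<Rightarrow> bool"
  where "Ref_finite_type R \<equiv> finite_type R (reflexive_module R)"

text \<open>The universe contains copies of the ring and its ideals, so by Baer's criterion testing
  injectivity inside it is the same as testing it against all modules.\<close>

definition injective_module :: "('k::field fls, 'x) ring_scheme \<Rightarrow> 'k lmodule \<Rightarrow> bool"
  where "injective_module R E \<longleftrightarrow> module R E \<and>
    (\<forall>(M :: 'k lmodule) N. module R M \<and> submodule N R M \<longrightarrow>
      (\<forall>\<phi>\<in>mod_hom R (M\<lparr>carrier := N\<rparr>) E. \<exists>\<psi>\<in>mod_hom R M E. \<forall>x\<in>N. \<psi> x = \<phi> x))"

text \<open>Finite self-injective dimension: an exact sequence
  \<open>0 \<rightarrow> R \<rightarrow> I 0 \<rightarrow> I 1 \<rightarrow> \<dots>\<close> of injective modules with \<open>I j = 0\<close> for all large \<open>j\<close>.\<close>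

definition gorenstein :: "('k::field fls, 'x) ring_scheme \<Rightarrow> bool"
  where "gorenstein R \<longleftrightarrow> (\<exists>(I :: nat \<Rightarrow> 'k lmodule) \<epsilon> d.
    (\<forall>j. injective_module R (I j)) \<and>
    \<epsilon> \<in> mod_hom R (regular_module R) (I 0) \<and> inj_on \<epsilon> (carrier R) \<and>
    (\<forall>j. d j \<in> mod_hom R (I j) (I (Suc j))) \<and>
    {x \<in> carrier (I 0). d 0 x = \<zero>\<^bsub>I 1\<^esub>} = \<epsilon> ` carrier R \<and>
    (\<forall>j. {x \<in> carrier (I (Suc j)). d (Suc j) x = \<zero>\<^bsub>I (Suc (Suc j))\<^esub>} = d j ` carrier (I j)) \<and>
    (\<exists>r. \<forall>j>r. carrier (I j) = {\<zero>\<^bsub>I j\<^esub>}))"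


section \<open>Numerical semigroup rings\<close>

definition numerical_semigroup :: "nat set \<Rightarrow> bool"
  where "numerical_semigroup H \<longleftrightarrow>
    0 \<in> H \<and> (\<forall>x\<in>H. \<forall>y\<in>H. x + y \<in> H) \<and> finite (- H)"

inductive_set semigroup_gen :: "nat set \<Rightarrow> nat set" for A where
  zero: "0 \<in> semigroup_gen A"
| add: "a \<in> A \<Longrightarrow> x \<in> semigroup_gen A \<Longrightarrow> a + x \<in> semigroup_gen A"

definition minimally_generates :: "nat set \<Rightarrow> nat set \<Rightarrow> bool"
  where "minimally_generates A H \<longleftrightarrow>
    semigroup_gen A = H \<and> (\<forall>B. B \<subset> A \<longrightarrow> semigroup_gen B \<noteq> H)"

definition fls_subring :: "'k::field fls set \<Rightarrow> 'k fls ring"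
  where "fls_subring S = \<lparr>carrier = S, mult = (*), one = 1, zero = 0, add = (+)\<rparr>"

text \<open>The ring \<open>k[[H]]\<close> of power series with support in \<open>H\<close>, inside the field \<open>k((t))\<close> of
  Laurent series; the variable \<open>t\<close> is \<^const>\<open>fls_X\<close>.\<close>

definition semigroup_ring :: "nat set \<Rightarrow> 'k::field fls ring"
  where "semigroup_ring H = fls_subring {f. \<forall>i. fls_nth f i \<noteq> 0 \<longrightarrow> i \<in> int ` H}"

definition power_series :: "'k::field fls set"
  where "power_series = range fps_to_fls"

definition frac_of :: "'k::field fls ring \<Rightarrow> 'k fls set"
  where "frac_of R = {x / y | x y. x \<in> carrier R \<and> y \<in> carrier R \<and> y \<noteq> 0}"

text \<open>\<open>colon Q A B\<close> is \<open>A :\<^sub>Q B\<close>.\<close>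

definition colon :: "'k::field fls set \<Rightarrow> 'k fls set \<Rightarrow> 'k fls set \<Rightarrow> 'k fls set"
  where "colon Q A B = {\<alpha> \<in> Q. \<forall>b\<in>B. \<alpha> * b \<in> A}"

definition conductor :: "'k::field fls ring \<Rightarrow> 'k fls set"
  where "conductor R = colon (frac_of R) (carrier R) power_series"

definition endo_ring_max_ideal :: "'k::field fls ring \<Rightarrow> 'k fls ring"
  where "endo_ring_max_ideal R = fls_subring (colon (frac_of R) (max_ideal R) (max_ideal R))"

text \<open>The multiplicity of \<open>k[[H]]\<close> is the smallest positive element of \<open>H\<close>.\<close>

definition multiplicity_ring :: "'k::field fls ring \<Rightarrow> nat"
  where "multiplicity_ring R = (LEAST a. 0 < a \<and> fls_X ^ a \<in> carrier R)"

text \<open>For \<open>k\<close>-subspaces \<open>W \<subseteq> V\<close> of \<open>k((t))\<close>: \<open>B\<close> is a set of representatives of a finite basis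
  of \<open>V / W\<close>.\<close>

definition quotient_basis :: "'k::field fls set \<Rightarrow> 'k fls set \<Rightarrow> 'k fls set \<Rightarrow> bool"
  where "quotient_basis V W B \<longleftrightarrow> finite B \<and> B \<subseteq> V \<and>
    (\<forall>v\<in>V. \<exists>!c. c \<in> extensional B \<and> v - (\<Sum>b\<in>B. fls_const (c b) * b) \<in> W)"

definition quotient_dim :: "'k::field fls set \<Rightarrow> 'k fls set \<Rightarrow> nat"
  where "quotient_dim V W = (THE n. \<exists>B. quotient_basis V W B \<and> card B = n)"

text \<open>The Laurent series field as a module over any of its subrings.\<close>

definition laurent_module :: "('k::field fls, 'k fls) module"
  where "laurent_module = regular_module (fls_subring UNIV)"

text \<open>The length of \<open>M / N\<close> for \<open>R\<close>-submodules \<open>N \<subseteq> M\<close> of \<open>k((t))\<close>, via the correspondence of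
  submodules of \<open>M / N\<close> with submodules between \<open>N\<close> and \<open>M\<close>.\<close>

definition quotient_length :: "'k::field fls ring \<Rightarrow> 'k fls set \<Rightarrow> 'k fls set \<Rightarrow> enat"
  where "quotient_length R M N = Sup {enat n | n. \<exists>L.
    (\<forall>i\<le>n. submodule (L i) R laurent_module \<and> N \<subseteq> L i \<and> L i \<subseteq> M) \<and>
    (\<forall>i<n. L i \<subset> L (Suc i))}"

text \<open>The ideal \<open>t\<^sup>e R\<close> with \<open>e\<close> the multiplicity, i.e. the smallest minimal generator of the
  semigroup.\<close>

definition min_reduction :: "'k::field fls ring \<Rightarrow> 'k fls set"
  where "min_reduction R = (\<lambda>r. fls_X ^ multiplicity_ring R * r) ` carrier R"

definition reduced_type :: "'k::field fls ring \<Rightarrow> nat"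
  where "reduced_type R =
    quotient_dim {c + x | c x. c \<in> conductor R \<and> x \<in> min_reduction R} (min_reduction R)"

definition CM_type :: "'k::field fls ring \<Rightarrow> nat"
  where "CM_type R =
    quotient_dim (colon (carrier R) (min_reduction R) (max_ideal R)) (min_reduction R)"

text \<open>The defining equation \<open>\<ell>(k[[t]]/R) = \<ell>(R/C) + type(R) - 1\<close>, rearranged to avoid truncated
  subtraction.\<close>

definition almost_gorenstein :: "'k::field fls ring \<Rightarrow> bool"
  where "almost_gorenstein R \<longleftrightarrow>
    quotient_length R power_series (carrier R) + 1 =
    quotient_length R (carrier R) (conductor R) + enat (CM_type R)"

definition minimal_reduced_type :: "'k::field fls ring \<Rightarrow> bool"
  where "minimal_reduced_type R \<longleftrightarrow> reduced_type R = 1"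

definition maximal_reduced_type :: "'k::field fls ring \<Rightarrow> bool"
  where "maximal_reduced_type R \<longleftrightarrow> reduced_type R = CM_type R"

end

theory Submission
  imports Defs "HOL-Library.Function_Algebras"
begin

text \<open>Let \<open>F\<close> be the Frobenius number and \<open>B = m : m\<close>, the ring of \<open>H \<union> PF\<close>. Almost
  Gorenstein means that every gap \<open>x\<close> with \<open>F - x \<notin> H\<close> is a pseudo-Frobenius number, so that the
  coefficient at \<open>t^F\<close> makes \<open>m\<close> and \<open>B\<close> dual to each other.

  An indecomposable reflexive module other than \<open>R\<close> has no linear form with a unit value and is
  therefore a \<open>B\<close>-module. If \<open>B\<close> contains \<open>K = k[[t^3, t^5, t^7]]\<close>, it is a torsion-free
  \<open>K\<close>-module; if \<open>B\<close> is \<open>k[[t^3, t^4]]\<close> or \<open>k[[t^3, t^5]]\<close>, which are Gorenstein, it is \<open>B\<close> or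
  again a \<open>K\<close>-module. A torsion-free \<open>K\<close>-module sits between \<open>t^5 k[[t]]^n\<close> and \<open>k[[t]]^n\<close> and is
  given by a linear relation between its coefficients at \<open>t\<close>, \<open>t^2\<close> and \<open>t^4\<close>; following the images
  of a vector under this relation splits off one of 16 explicit modules.

  Conversely, the fractional ideals \<open>f_1 = 0, f_3 = \<mu> f_2\<close> (if \<open>B\<close> has no element of order 1, 2, 3)
  and \<open>f_1 = f_2 = 0, f_5 = \<mu> f_4\<close> (if it has none of order 1, 2, 4, 5) are reflexive by duality
  and pairwise non-isomorphic. It remains to determine \<open>H\<close>: the type counts the pseudo-Frobenius
  numbers, the reduced type the gaps above \<open>F - e\<close>, and \<open>R\<close> is Gorenstein if \<open>H\<close> is symmetric.\<close>

section \<open>Linear relations\<close>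

text \<open>The ring K comes from the E_8 singularity: it is the endomorphism ring of the maximal
  ideal of k[[t^3, t^5]], and sixteen is the number of nonfree indecomposable maximal Cohen-Macaulay
  modules there. The obstacle is that one module carries actions of several rings, none of which
  need contain the other. Everything therefore happens inside powers of k((t)): if N is the direct
  sum of two pieces stable under power series of high order, the pieces are stable under every ring
  acting on N, so a splitting found over K serves for R. Summands are not cut out by idempotents:
  maps i and p with p i unitriangular modulo t suffice, since completeness makes p i invertible. The
  order of the sixteen types is essential: the functionals that form p exist only because the
  earlier types have been excluded. In statements (3) and (4) the hypotheses leave one or two
  semigroups for each multiplicity, and both sides of the equivalence hold. The scalar of the
  fractional ideals is an invariant because an isomorphism between two of them is multiplication by
  a series g with g_0 nonzero and g_1 = 0.\<close>

definition sc :: "'k::field \<Rightarrow> (nat \<Rightarrow> 'k) \<Rightarrow> nat \<Rightarrow> 'k" where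
  "sc c v = (\<lambda>i. c * v i)"

lemma sc_apply [simp]: "sc c v i = c * v i"
  by (simp add: sc_def)

lemma sc_simps [simp]: "sc c 0 = 0" "sc 0 v = 0" "sc 1 v = v" "sc (- 1) v = - v"
  "sc c (sc d v) = sc (c * d) v"
  by (auto simp: fun_eq_iff mult.assoc)

text \<open>A linear subspace of the product, read as a partial and multivalued map: neither
  totality nor uniqueness of values is asked for.\<close>

definition linrel :: "('k \<Rightarrow> 'v \<Rightarrow> 'v) \<Rightarrow> ('k \<Rightarrow> 'w \<Rightarrow> 'w) \<Rightarrow> ('v::ab_group_add \<Rightarrow> 'w::ab_group_add \<Rightarrow> bool) \<Rightarrow> bool"
  where "linrel s1 s2 G \<longleftrightarrow> G 0 0 \<and>
    (\<forall>x y x' y'. G x y \<longrightarrow> G x' y' \<longrightarrow> G (x + x') (y + y')) \<and>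
    (\<forall>c x y. G x y \<longrightarrow> G (s1 c x) (s2 c y))"

lemma vector_space_sc: "vector_space (sc :: 'k::field \<Rightarrow> _)"
  by unfold_locales (auto simp: fun_eq_iff algebra_simps)

lemma vector_space_mult: "vector_space ((*) :: 'k::field \<Rightarrow> _)"
  by unfold_locales (auto simp: algebra_simps)

text \<open>Values are chosen only on a basis of the domain of \<open>G\<close>, so that the choice
  becomes linear; outside the domain \<open>g\<close> is an arbitrary linear extension.\<close>

lemma linear_selection:
  fixes s1 :: "'k::field \<Rightarrow> 'v::ab_group_add \<Rightarrow> 'v" and s2 :: "'k \<Rightarrow> 'w::ab_group_add \<Rightarrow> 'w"
  assumes "vector_space s1" "vector_space s2" and G: "linrel s1 s2 G"
  shows "\<exists>g. Vector_Spaces.linear s1 s2 g \<and> (\<forall>v w. G v w \<longrightarrow> G v (g v))"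
proof -
  interpret A: vector_space s1 by fact
  interpret B: vector_space s2 by fact
  interpret AB: vector_space_pair s1 s2 by unfold_locales
  define D where "D = {v. \<exists>w. G v w}"
  have D: "A.subspace D"
    using G unfolding A.subspace_def D_def linrel_def by blast
  obtain X where X: "A.independent X" "X \<subseteq> D" "D \<subseteq> A.span X"
    using A.maximal_independent_subset[of D] by metis
  define f where "f v = (SOME w. G v w)" for v
  have f: "G v (f v)" if "v \<in> X" for v
    using that X(2) someI_ex[of "G v"] unfolding D_def f_def by auto
  obtain g where g: "Vector_Spaces.linear s1 s2 g" "\<forall>x\<in>X. g x = f x"
    using AB.linear_independent_extend[OF X(1)] by metis
  interpret g: Vector_Spaces.linear s1 s2 g by fact
  have "A.span X \<subseteq> {v. G v (g v)}"
  proof (rule A.span_minimal)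
    show "X \<subseteq> {v. G v (g v)}" using f g(2) by auto
    show "A.subspace {v. G v (g v)}"
      using G by (auto simp: A.subspace_def linrel_def g.zero g.add g.scale)
  qed
  then show ?thesis using g(1) X(3) unfolding D_def by blast
qed

definition lin :: "((nat \<Rightarrow> 'k::field) \<Rightarrow> 'k) \<Rightarrow> bool"
  where "lin g \<longleftrightarrow> (\<forall>x y. g (x + y) = g x + g y) \<and> (\<forall>c x. g (sc c x) = c * g x)"

lemma lin_zero: "lin (\<lambda>_. 0)"
  by (simp add: lin_def)

lemma linD:
  assumes "lin g"
  shows "g (x + y) = g x + g y" "g (sc c x) = c * g x" "g 0 = 0" "g (- x) = - g x"
    "g (x - y) = g x - g y"
proof -
  show a: "g (x + y) = g x + g y" for x y using assms by (simp add: lin_def)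
  show s: "g (sc c x) = c * g x" for c x using assms by (simp add: lin_def)
  show z: "g 0 = 0" by (metis a add.right_neutral add_left_cancel)
  show m: "g (- x) = - g x" for x using a[of x "- x"] z by (simp add: eq_neg_iff_add_eq_0 add.commute)
  show "g (x - y) = g x - g y" using a[of x "- y"] m[of y] by simp
qed

text \<open>Two linear prescriptions that agree on common arguments fit together on the sum of their
  domains. Agreement at 0 already makes each of them single valued.\<close>

lemma functional_extension:
  fixes G :: "(nat \<Rightarrow> 'k::field) \<Rightarrow> 'k \<Rightarrow> bool"
  assumes "linrel sc (*) G" "linrel sc (*) G'"
    and "\<And>v c c'. G v c \<Longrightarrow> G' v c' \<Longrightarrow> c = c'"
  shows "\<exists>g. lin g \<and> (\<forall>v c. G v c \<longrightarrow> g v = c) \<and> (\<forall>v c. G' v c \<longrightarrow> g v = c)"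
proof -
  define K where "K = (\<lambda>v c. \<exists>v1 c1 v2 c2. G v1 c1 \<and> G' v2 c2 \<and> v = v1 + v2 \<and> c = c1 + c2)"
  have KI: "K (v1 + v2) (c1 + c2)" if "G v1 c1" "G' v2 c2" for v1 v2 c1 c2
    using that unfolding K_def by blast
  have "linrel sc (*) K"
    unfolding linrel_def
  proof (intro conjI allI impI)
    show "K 0 0" using KI[of 0 0 0 0] assms(1,2) by (simp add: linrel_def)
  next
    fix x y x' y' assume "K x y" "K x' y'"
    then obtain v1 c1 v2 c2 w1 d1 w2 d2 where
      "G v1 c1" "G' v2 c2" "x = v1 + v2" "y = c1 + c2"
      "G w1 d1" "G' w2 d2" "x' = w1 + w2" "y' = d1 + d2" unfolding K_def by blast
    then show "K (x + x') (y + y')"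
      using KI[of "v1 + w1" "c1 + d1" "v2 + w2" "c2 + d2"] assms(1,2)
      by (simp add: linrel_def add_ac)
  next
    fix c x y assume "K x y"
    then obtain v1 c1 v2 c2 where *: "G v1 c1" "G' v2 c2" "x = v1 + v2" "y = c1 + c2"
      unfolding K_def by blast
    then have "K (sc c v1 + sc c v2) (c * c1 + c * c2)"
      using assms(1,2) by (intro KI) (auto simp: linrel_def)
    moreover have "sc c v1 + sc c v2 = sc c x" using * by (auto simp: fun_eq_iff algebra_simps)
    ultimately show "K (sc c x) (c * y)" using * by (simp add: algebra_simps)
  qed
  from linear_selection[OF vector_space_sc vector_space_mult this]
  obtain g where g: "Vector_Spaces.linear sc (*) g" "\<And>v w. K v w \<Longrightarrow> K v (g v)" by blast
  interpret g: Vector_Spaces.linear sc "(*)" g by fact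
  have neg: "G' (- v) (- c)" if "G' v c" for v c
    using assms(2) that unfolding linrel_def by (metis sc_simps(4) mult_minus1)
  \<comment> \<open>If v1 + v2 = 0, then v1 = - v2 lies in both domains, where the prescriptions
    agree.\<close>
  have z: "c = 0" if K0: "K 0 c" for c
  proof -
    obtain v1 c1 v2 c2 where *: "G v1 c1" "G' v2 c2" "0 = v1 + v2" "c = c1 + c2"
      using K0 unfolding K_def by blast
    then have "- v2 = v1" by (metis add_eq_0_iff2)
    then have "c1 = - c2" using neg[OF *(2)] *(1) assms(3) by auto
    then show ?thesis using * by simp
  qed
  have neg1: "G (- v) (- c)" if "G v c" for v c
    using assms(1) that unfolding linrel_def by (metis sc_simps(4) mult_minus1)
  have val: "g v = c" if Kv: "K v c" for v c
  proof -
    have "K (- v) (- c)"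
    proof -
      obtain v1 c1 v2 c2 where *: "G v1 c1" "G' v2 c2" "v = v1 + v2" "c = c1 + c2"
        using Kv unfolding K_def by blast
      show ?thesis using KI[OF neg1[OF *(1)] neg[OF *(2)]] * by simp
    qed
    then have "K (v + - v) (g v + - c)"
      using \<open>linrel sc (*) K\<close> g(2)[OF Kv] unfolding linrel_def by blast
    then have "K 0 (g v - c)" by simp
    from z[OF this] show ?thesis by simp
  qed
  have "lin g" unfolding lin_def by (auto simp: g.add g.scale)
  moreover have "g v = c" if "G v c" for v c
    using val KI[of v c 0 0] that assms(2) by (simp add: linrel_def)
  moreover have "g v = c" if "G' v c" for v c
    using val KI[of 0 0 v c] that assms(1) by (simp add: linrel_def)
  ultimately show ?thesis by blast
qed

section \<open>A matrix problem of finite type\<close>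

definition Usp :: "nat \<Rightarrow> (nat \<Rightarrow> 'k::zero) set"
  where "Usp m = {v. \<forall>i\<ge>m. v i = 0}"

definition lmap :: "((nat \<Rightarrow> 'k::field) \<Rightarrow> nat \<Rightarrow> 'k) \<Rightarrow> bool"
  where "lmap f \<longleftrightarrow> (\<forall>x y. f (x + y) = f x + f y) \<and> (\<forall>c x. f (sc c x) = sc c (f x))"

type_synonym 'k rel = "(nat \<Rightarrow> 'k) \<Rightarrow> (nat \<Rightarrow> 'k) \<Rightarrow> bool"

text \<open>A submodule of \<open>k[[t]]^n\<close> over \<open>k[[t^3, t^5, t^7]]\<close> that contains the unit vectors is given by a space
  \<open>T\<close> of triples \<open>(x, y, z)\<close>, the coefficients at \<open>t\<close>, \<open>t^2\<close> and \<open>t^4\<close>. Below, \<open>P x y\<close> means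
  \<open>(x, y, z) \<in> T\<close> for some \<open>z\<close>, and \<open>Q y z\<close> means \<open>(0, y, z) \<in> T\<close>. The space \<open>(m, P', C)\<close> consists of the
  triples in \<open>k^m\<close> with \<open>P' x y\<close> and \<open>C y z\<close>. The lists \<open>i\<close> and \<open>p\<close> hold the coefficients at
  \<open>1, t, t^2\<close> of the matrix of a homomorphism; those at \<open>t^3\<close> and \<open>t^4\<close> can always be supplied.\<close>

definition split_data :: "(nat \<Rightarrow> 'k::field) set \<Rightarrow> 'k rel \<Rightarrow> 'k rel \<Rightarrow> nat \<Rightarrow> 'k rel \<Rightarrow> 'k rel
    \<Rightarrow> ((nat \<Rightarrow> 'k) \<Rightarrow> nat \<Rightarrow> 'k) list \<Rightarrow> ((nat \<Rightarrow> 'k) \<Rightarrow> nat \<Rightarrow> 'k) list \<Rightarrow> bool"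
  where "split_data U P Q m P' C i p \<longleftrightarrow>
    (\<forall>l<3. lmap (i ! l) \<and> lmap (p ! l)) \<and>
    (\<forall>u\<in>Usp m. (i ! 0) u \<in> U \<and> P ((i ! 1) u) ((i ! 2) u)) \<and>
    (\<forall>v. (p ! 0) v \<in> Usp m \<and> (p ! 1) v \<in> Usp m \<and> (p ! 2) v \<in> Usp m) \<and>
    (\<forall>x\<in>Usp m. \<forall>y\<in>Usp m. P' x y \<longrightarrow> P ((i ! 0) x) ((i ! 0) y + (i ! 1) x)) \<and>
    (\<forall>y\<in>Usp m. \<forall>z\<in>Usp m. P' 0 y \<and> C y z \<longrightarrow> Q ((i ! 0) y) ((i ! 0) z + (i ! 2) y)) \<and>
    (\<forall>v\<in>U. P' ((p ! 1) v) ((p ! 2) v)) \<and>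
    (\<forall>x y. P x y \<longrightarrow> P' ((p ! 0) x) ((p ! 0) y + (p ! 1) x)) \<and>
    (\<forall>y z. Q y z \<longrightarrow> C ((p ! 0) y) ((p ! 0) z + (p ! 2) y)) \<and>
    (\<forall>u\<in>Usp m. \<forall>r<m. (\<forall>j>r. u j = 0) \<longrightarrow> (p ! 0) ((i ! 0) u) r = u r)"

text \<open>The homomorphisms \<open>i\<close> and \<open>p\<close> exhibit the type as a direct summand: \<open>p \<circ> i\<close> is unitriangular
  modulo the uniformizer.\<close>

definition splits :: "(nat \<Rightarrow> 'k::field) set \<Rightarrow> 'k rel \<Rightarrow> 'k rel \<Rightarrow> nat \<times> 'k rel \<times> 'k rel \<Rightarrow> bool"
  where "splits U P Q = (\<lambda>(m, P', C). \<exists>i p. split_data U P Q m P' C i p)"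

text \<open>Subspaces are predicates, so that a partially applied relation such as
  \<open>P 0\<close> is one without conversion.\<close>

definition sub :: "((nat \<Rightarrow> 'k::field) \<Rightarrow> bool) \<Rightarrow> bool"
  where "sub S \<longleftrightarrow> S 0 \<and> (\<forall>x y. S x \<longrightarrow> S y \<longrightarrow> S (x + y)) \<and> (\<forall>c x. S x \<longrightarrow> S (sc c x))"

lemma lmap_sum: "lmap (\<lambda>x. \<Sum>i<m. sc (x i) (u i))"
proof -
  have "(\<Sum>i<m. sc (sc c x i) (u i)) = sc c (\<Sum>i<m. sc (x i) (u i))" for c and x :: "nat \<Rightarrow> 'a"
    by (induction m) (auto simp: fun_eq_iff algebra_simps)
  moreover have "sc (a + b) v = sc a v + sc b v" for a b and v :: "nat \<Rightarrow> 'a"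
    by (auto simp: fun_eq_iff algebra_simps)
  ultimately show ?thesis
    unfolding lmap_def by (simp add: sum.distrib)
qed

lemma lin_sum:
  assumes "lin g"
  shows "g (\<Sum>j<(l::nat). sc (x j) (u j)) = (\<Sum>j<l. x j * g (u j))"
proof (induction l)
  case 0
  then show ?case by (simp only: lessThan_0 sum.empty linD[OF assms])
next
  case (Suc l)
  then show ?case by (simp only: sum.lessThan_Suc linD[OF assms])
qed

text \<open>The i-th unit vector is sent to u_i + t p_i + t^2 q_i up to higher terms; the
  functionals \<open>a i\<close>, \<open>b i\<close>, \<open>c i\<close> are the rows of the
  projection at 1, t, t^2. The assumptions \<open>A\<close> to \<open>E\<close> are the conditions
  of \<open>split_data\<close> in coordinates, and \<open>tri\<close> leaves the entries above the
  diagonal free.\<close>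

lemma splitsI:
  fixes U :: "(nat \<Rightarrow> 'k::field) set"
  assumes U: "sub (\<lambda>v. v \<in> U)"
    and Plin: "linrel sc sc P"
    and u: "\<forall>i<m. u i \<in> U" "\<forall>i<m. P (p i) (q i)"
    and abc: "\<forall>i<m. lin (a i) \<and> lin (b i) \<and> lin (c i)"
    and A: "\<And>x y. P' x y \<Longrightarrow> P (\<Sum>i<m. sc (x i) (u i)) ((\<Sum>i<m. sc (y i) (u i)) + (\<Sum>i<m. sc (x i) (p i)))"
    and B: "\<And>y z. P' 0 y \<Longrightarrow> C y z \<Longrightarrow> Q (\<Sum>i<m. sc (y i) (u i)) ((\<Sum>i<m. sc (z i) (u i)) + (\<Sum>i<m. sc (y i) (q i)))"
    and Pt: "\<And>v. v \<in> U \<Longrightarrow> P' (\<lambda>i. if i < m then b i v else 0) (\<lambda>i. if i < m then c i v else 0)"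
    and D: "\<And>x y. P x y \<Longrightarrow> P' (\<lambda>i. if i < m then a i x else 0) (\<lambda>i. if i < m then a i y + b i x else 0)"
    and E: "\<And>y z. Q y z \<Longrightarrow> C (\<lambda>i. if i < m then a i y else 0) (\<lambda>i. if i < m then a i z + c i y else 0)"
    and tri: "\<forall>i<m. \<forall>j\<le>i. a i (u j) = (if j = i then 1 else 0)"
  shows "splits U P Q (m, P', C)"
proof -
  let ?v = "\<lambda>f v i. if i < m then f i v else 0"
  have s: "(\<Sum>i<l. sc (x i) (u i)) \<in> U" if "l \<le> m" for x l
    using that U u(1) unfolding sub_def by (induction l) auto
  have t: "P (\<Sum>i<l. sc (x i) (p i)) (\<Sum>i<l. sc (x i) (q i))" if "l \<le> m" for x l
    using that Plin u(2) by (induction l) (auto simp: linrel_def)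
  have lv: "lmap (?v f)" if "\<forall>i<m. lin (f i)" for f
    using that by (auto simp: lmap_def linD fun_eq_iff)
  have vU: "?v f v \<in> Usp m" for f and v :: "nat \<Rightarrow> 'k" by (auto simp: Usp_def)
  have add: "?v a y + ?v b x = (\<lambda>i. if i < m then a i y + b i x else 0)"
    for a b :: "nat \<Rightarrow> (nat \<Rightarrow> 'k) \<Rightarrow> 'k" and x y
    by (auto simp: fun_eq_iff)
  have tri': "(?v a) (\<Sum>i<m. sc (x i) (u i)) i = x i" if "\<forall>j>i. x j = 0" "i < m" for x i
  proof -
    have ai: "lin (a i)" using abc that by auto
    have "a i (\<Sum>j<m. sc (x j) (u j)) = (\<Sum>j<m. x j * a i (u j))"
      by (rule lin_sum[OF ai])
    also have "\<dots> = (\<Sum>j<m. if j = i then x i else 0)"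
    proof (intro sum.cong refl)
      fix j assume "j \<in> {..<m}"
      then show "x j * a i (u j) = (if j = i then x i else 0)"
        using that tri by (cases j i rule: linorder_cases) auto
    qed
    finally show ?thesis using that(2) by simp
  qed
  let ?i = "[\<lambda>x. \<Sum>i<m. sc (x i) (u i), \<lambda>x. \<Sum>i<m. sc (x i) (p i), \<lambda>x. \<Sum>i<m. sc (x i) (q i)]"
  let ?p = "[?v a, ?v b, ?v c]"
  have ip: "?i ! 0 = (\<lambda>x. \<Sum>i<m. sc (x i) (u i))" "?i ! 1 = (\<lambda>x. \<Sum>i<m. sc (x i) (p i))"
    "?i ! 2 = (\<lambda>x. \<Sum>i<m. sc (x i) (q i))" "?p ! 0 = ?v a" "?p ! 1 = ?v b" "?p ! 2 = ?v c"
    by simp_all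
  have "split_data U P Q m P' C ?i ?p"
    unfolding split_data_def ip
  proof (intro conjI ballI allI impI)
    fix l :: nat assume "l < 3"
    then have l: "l = 0 \<or> l = 1 \<or> l = 2" by linarith
    have "lmap (?v a)" "lmap (?v b)" "lmap (?v c)" using abc by (auto intro!: lv)
    then show "lmap (?i ! l)" "lmap (?p ! l)"
      using l lmap_sum[of u m] lmap_sum[of p m] lmap_sum[of q m] ip by (elim disjE; simp only:)+
  next
    fix x :: "nat \<Rightarrow> 'k"
    show "(\<Sum>i<m. sc (x i) (u i)) \<in> U" by (rule s) simp
    show "P (\<Sum>i<m. sc (x i) (p i)) (\<Sum>i<m. sc (x i) (q i))" by (rule t) simp
    show "?v a x \<in> Usp m" "?v b x \<in> Usp m" "?v c x \<in> Usp m" by (rule vU)+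
  next
    fix x y assume "P' x y"
    then show "P (\<Sum>i<m. sc (x i) (u i)) ((\<Sum>i<m. sc (y i) (u i)) + (\<Sum>i<m. sc (x i) (p i)))"
      by (rule A)
  next
    fix y z assume "P' 0 y \<and> C y z"
    then show "Q (\<Sum>i<m. sc (y i) (u i)) ((\<Sum>i<m. sc (z i) (u i)) + (\<Sum>i<m. sc (y i) (q i)))"
      using B by blast
  next
    fix v assume "v \<in> U"
    then show "P' (?v b v) (?v c v)" by (rule Pt)
  next
    fix x y assume "P x y"
    then show "P' (?v a x) (?v a y + ?v b x)" unfolding add by (rule D)
  next
    fix y z assume "Q y z"
    then show "C (?v a y) (?v a z + ?v c y)" unfolding add by (rule E)
  next
    fix x :: "nat \<Rightarrow> 'k" and i assume "i < m" "\<forall>j>i. x j = 0"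
    then show "?v a (\<Sum>i<m. sc (x i) (u i)) i = x i" by (intro tri')
  qed
  then show ?thesis unfolding splits_def prod.case by blast
qed

lemma sum_less_1: "(\<Sum>i<(1::nat). f i) = f 0" for f :: "nat \<Rightarrow> 'a::comm_monoid_add"
  by simp

lemma sum_less_2: "(\<Sum>i<(2::nat). f i) = f 0 + f 1" for f :: "nat \<Rightarrow> 'a::comm_monoid_add"
  by (simp add: numeral_2_eq_2)

lemma sum_less_3: "(\<Sum>i<(3::nat). f i) = f 0 + f 1 + f 2" for f :: "nat \<Rightarrow> 'a::comm_monoid_add"
  by (simp add: numeral_3_eq_3 numeral_2_eq_2)

lemma all_less_1: "(\<forall>i<(1::nat). p i) \<longleftrightarrow> p 0"
  by auto

lemma all_less_2: "(\<forall>i<(2::nat). p i) \<longleftrightarrow> p 0 \<and> p 1"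
  using less_2_cases by auto

lemma all_less_3: "(\<forall>i<(3::nat). p i) \<longleftrightarrow> p 0 \<and> p 1 \<and> p 2"
  by (auto simp: numeral_3_eq_3 less_Suc_eq numeral_2_eq_2)

lemma all_le_0: "(\<forall>i\<le>(0::nat). p i) \<longleftrightarrow> p 0"
  by auto

lemma all_le_1: "(\<forall>i\<le>(1::nat). p i) \<longleftrightarrow> p 0 \<and> p 1"
  by (auto simp: le_Suc_eq)

lemma all_le_Suc_0: "(\<forall>i\<le>Suc 0. p i) \<longleftrightarrow> p 0 \<and> p (Suc 0)"
  by (auto simp: le_Suc_eq)

lemma all_le_2: "(\<forall>i\<le>(2::nat). p i) \<longleftrightarrow> p 0 \<and> p 1 \<and> p 2"
  by (auto simp: le_Suc_eq numeral_2_eq_2)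

lemmas small_simps = sum_less_1 sum_less_2 sum_less_3 all_less_1 all_less_2 all_less_3
  all_le_0 all_le_1 all_le_Suc_0 all_le_2

lemma linrel_comp:
  assumes "linrel sc sc P" "lin g" "lin h"
  shows "linrel sc (*) (\<lambda>v c. \<exists>y. P v y \<and> c = g y + h v)"
  unfolding linrel_def
proof (intro conjI allI impI)
  show "\<exists>y. P 0 y \<and> 0 = g y + h 0"
    using assms by (intro exI[of _ 0]) (auto simp: linrel_def linD)
next
  fix x y x' y' assume "\<exists>z. P x z \<and> y = g z + h x" "\<exists>z. P x' z \<and> y' = g z + h x'"
  then obtain z z' where "P x z" "y = g z + h x" "P x' z'" "y' = g z' + h x'" by blast
  then show "\<exists>z. P (x + x') z \<and> y + y' = g z + h (x + x')"
    using assms by (intro exI[of _ "z + z'"]) (auto simp: linrel_def linD)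
next
  fix c x y assume "\<exists>z. P x z \<and> y = g z + h x"
  then obtain z where "P x z" "y = g z + h x" by blast
  then show "\<exists>z. P (sc c x) z \<and> c * y = g z + h (sc c x)"
    using assms by (intro exI[of _ "sc c z"]) (auto simp: linrel_def linD algebra_simps)
qed

text \<open>The rows of the projections are obtained in this way: the value of the new functional at
  \<open>v\<close> is dictated by known functionals at the images of \<open>v\<close>, and
  conflicting demands at a common \<open>v\<close> are the only obstruction.\<close>

lemma ext2:
  assumes "linrel sc sc P" "lin g" "lin h" "linrel sc sc Q" "lin g'" "lin h'"
    and "\<And>v y z. P v y \<Longrightarrow> Q v z \<Longrightarrow> g y + h v = g' z + h' v"
  obtains k where "lin k" "\<And>v y. P v y \<Longrightarrow> k v = g y + h v" "\<And>v z. Q v z \<Longrightarrow> k v = g' z + h' v"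
proof -
  from functional_extension[OF linrel_comp[OF assms(1-3)] linrel_comp[OF assms(4-6)]] assms(7)
  obtain k where "lin k" "\<forall>v c. (\<exists>y. P v y \<and> c = g y + h v) \<longrightarrow> k v = c"
    "\<forall>v c. (\<exists>y. Q v y \<and> c = g' y + h' v) \<longrightarrow> k v = c" by blast
  then show ?thesis by (intro that[of k]) blast+
qed

lemma linrel_sub: "sub S \<Longrightarrow> linrel sc sc (\<lambda>v w. S v \<and> w = 0)"
  by (auto simp: sub_def linrel_def fun_eq_iff)

lemma ext_sub:
  assumes "linrel sc sc P" "lin g" "lin h" "sub S" "\<And>v y. P v y \<Longrightarrow> S v \<Longrightarrow> g y + h v = 0"
  obtains k where "lin k" "\<And>v y. P v y \<Longrightarrow> k v = g y + h v" "\<And>v. S v \<Longrightarrow> k v = 0"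
proof -
  obtain k where k: "lin k" "\<And>v y. P v y \<Longrightarrow> k v = g y + h v"
    "\<And>v w. S v \<and> w = 0 \<Longrightarrow> k v = 0 + 0"
    by (rule ext2[OF assms(1-3) linrel_sub[OF assms(4)] lin_zero lin_zero]) (use assms(5) in auto)
  show ?thesis
    by (rule that[OF k(1) k(2)]) (use k(3)[of _ 0] in auto)
qed

text \<open>The images of \<open>v\<close> differ by elements of \<open>P 0\<close>, so it is enough
  that \<open>g\<close> vanishes there.\<close>

lemma ext1:
  assumes "linrel sc sc P" "lin g" "lin h" "\<And>y. P 0 y \<Longrightarrow> g y = 0"
  obtains k where "lin k" "\<And>v y. P v y \<Longrightarrow> k v = g y + h v"
proof -
  have sub0: "sub (\<lambda>v. v = (0::nat\<Rightarrow>'a))" by (auto simp: sub_def)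
  obtain k where k: "lin k" "\<And>v y. P v y \<Longrightarrow> k v = g y + h v" "\<And>v. v = 0 \<Longrightarrow> k v = 0"
    by (rule ext_sub[OF assms(1-3) sub0]) (use assms(4) linD(3)[OF assms(3)] in auto)
  show ?thesis by (rule that[OF k(1,2)])
qed

lemma sep:
  assumes "sub S" "\<not> S y"
  obtains g where "lin g" "\<And>d. S d \<Longrightarrow> g d = 0" "g y = 1"
proof -
  have 1: "linrel sc (*) (\<lambda>v c. S v \<and> c = 0)"
    using assms(1) by (auto simp: sub_def linrel_def)
  have 2: "linrel sc (*) (\<lambda>v c. v = sc c y)"
    by (auto simp: linrel_def fun_eq_iff algebra_simps)
  have 3: "c = c'" if "S v \<and> c = 0" "v = sc c' y" for v c c'
  proof (rule ccontr)
    assume "c \<noteq> c'"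
    then have "S (sc (1 / c') v)" "sc (1 / c') v = y"
      using that assms(1) unfolding sub_def by (blast, auto)
    then show False using assms(2) by simp
  qed
  obtain g where g: "lin g" "\<forall>v c. S v \<and> c = 0 \<longrightarrow> g v = c" "\<forall>v c. v = sc c y \<longrightarrow> g v = c"
    using functional_extension[OF 1 2] 3 by blast
  have "g y = 1" using g(3)[rule_format, of y 1] by simp
  with g(1,2) show ?thesis by (intro that[of g]) auto
qed

lemma lin_uminus: "lin g \<Longrightarrow> lin (\<lambda>v. - g v)"
  by (simp add: lin_def algebra_simps)

lemma linrelD:
  assumes "linrel sc sc P"
  shows "P 0 0" "P x y \<Longrightarrow> P x' y' \<Longrightarrow> P (x + x') (y + y')" "P x y \<Longrightarrow> P (sc c x) (sc c y)"
    "P x y \<Longrightarrow> P x' y' \<Longrightarrow> P (x - x') (y - y')"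
proof -
  show a: "P x y \<Longrightarrow> P x' y' \<Longrightarrow> P (x + x') (y + y')" for x y x' y' using assms by (auto simp: linrel_def)
  show s: "P x y \<Longrightarrow> P (sc c x) (sc c y)" for x y c using assms by (auto simp: linrel_def)
  show "P 0 0" using assms by (auto simp: linrel_def)
  show "P (x - x') (y - y')" if "P x y" "P x' y'"
    using a[OF that(1) s[OF that(2), of "- 1"]] by simp
qed

lemma linrel_comb2:
  assumes "linrel sc sc P" "P x y" "P x' y'"
    "\<And>i. v i = c * x i + c' * x' i" "\<And>i. w i = c * y i + c' * y' i"
  shows "P v w"
proof -
  have "v = sc c x + sc c' x'" "w = sc c y + sc c' y'" using assms(4,5) by (auto simp: fun_eq_iff)
  then show ?thesis using linrelD(2,3)[OF assms(1)] assms(2,3) by simp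
qed

lemma linrel_comb3:
  assumes "linrel sc sc P" "P x y" "P x' y'" "P x'' y''"
    "\<And>i. v i = c * x i + c' * x' i + c'' * x'' i" "\<And>i. w i = c * y i + c' * y' i + c'' * y'' i"
  shows "P v w"
proof -
  have P: "P (sc c x + sc c' x') (sc c y + sc c' y')"
    using linrelD(2,3)[OF assms(1)] assms(2,3) by simp
  show ?thesis
    by (rule linrel_comb2[OF assms(1) P assms(4), where c = 1 and c' = c'']) (simp_all add: assms)
qed

section \<open>The sixteen types of summands\<close>

text \<open>Listed in the order in which the cases below split them off. The last six have rank one:
  k[[t]], the series without t^2, those without t, those without t and t^2, those without t and t^4,
  and K itself.\<close>

definition types :: "(nat \<times> 'k::field rel \<times> 'k rel) set"
  where "types = {
    (2, \<lambda>x y. x 1 = 0 \<and> y 1 = x 0, \<lambda>y z. z 1 = 0),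
    (3, \<lambda>x y. x 1 = 0 \<and> x 2 = 0 \<and> y 1 = x 0 \<and> y 2 = 0, \<lambda>y z. z 1 = 0 \<and> z 2 = y 0),
    (3, \<lambda>x y. x 2 = 0 \<and> y 1 = 0 \<and> y 2 = x 1, \<lambda>y z. z 2 = y 0),
    (2, \<lambda>x y. x 1 = 0 \<and> y 0 = 0 \<and> y 1 = x 0, \<lambda>y z. z 1 = 0),
    (2, \<lambda>x y. x 1 = 0 \<and> y 1 = x 0, \<lambda>y z. True),
    (3, \<lambda>x y. x 1 = 0 \<and> x 2 = 0 \<and> y 1 = x 0 \<and> y 2 = 0, \<lambda>y z. z 2 = y 0),
    (2, \<lambda>x y. x 1 = 0 \<and> y 0 = 0 \<and> y 1 = x 0, \<lambda>y z. True),
    (2, \<lambda>x y. x 1 = 0 \<and> y 1 = 0, \<lambda>y z. z 1 = y 0),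
    (2, \<lambda>x y. x 0 = 0 \<and> x 1 = 0 \<and> y 1 = 0, \<lambda>y z. z 1 = y 0),
    (2, \<lambda>x y. x 0 = 0 \<and> x 1 = 0 \<and> y 1 = 0, \<lambda>y z. z 0 = 0 \<and> z 1 = y 0),
    (1, \<lambda>x y. True, \<lambda>y z. True),
    (1, \<lambda>x y. y 0 = 0, \<lambda>y z. True),
    (1, \<lambda>x y. x 0 = 0, \<lambda>y z. True),
    (1, \<lambda>x y. x 0 = 0 \<and> y 0 = 0, \<lambda>y z. True),
    (1, \<lambda>x y. x 0 = 0, \<lambda>y z. z 0 = 0),
    (1, \<lambda>x y. x 0 = 0 \<and> y 0 = 0, \<lambda>y z. z 0 = 0)}"

text \<open>Multiplication by \<open>t^3\<close> maps \<open>(x, y, z)\<close> to \<open>(0, 0, x)\<close>, whence the last assumption.\<close>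

locale relation_pair =
  fixes U :: "(nat \<Rightarrow> 'k::field) set" and P Q :: "'k rel"
  assumes U: "sub (\<lambda>v. v \<in> U)"
    and Pl: "linrel sc sc P" and Ql: "linrel sc sc Q"
    and PU: "P x y \<Longrightarrow> x \<in> U \<and> y \<in> U" and QU: "Q y z \<Longrightarrow> y \<in> U \<and> z \<in> U"
    and P0: "P 0 y \<longleftrightarrow> (\<exists>z. Q y z)" and PQ: "P x y \<Longrightarrow> Q 0 x"
begin

text \<open>The spaces of leading coefficients at t, t^2 and t^4 are V1, the domain of
  \<open>P\<close>, V2, which is \<open>P 0\<close>, and V4, which is \<open>Q 0\<close>; by
  \<open>PQ\<close> the first lies in the third. Values of \<open>P\<close> are defined up to V2 and
  values of \<open>Q\<close> up to V4. This is V2 + V4.\<close>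

definition D where "D v \<longleftrightarrow> (\<exists>y z. P 0 y \<and> Q 0 z \<and> v = y + z)"

text \<open>The space V1 + V2, contained in \<open>D\<close>. An image under \<open>P\<close> that
  lies here can be changed by V2 so that \<open>P\<close> applies to it once more.\<close>

definition E where "E v \<longleftrightarrow> (\<exists>x w y. P x w \<and> P 0 y \<and> v = x + y)"

lemma sub_diff: "sub S \<Longrightarrow> S x \<Longrightarrow> S y \<Longrightarrow> S (x - y)"
  unfolding sub_def by (metis sc_simps(4) diff_conv_add_uminus)

lemma U_diff: "x \<in> U \<Longrightarrow> y \<in> U \<Longrightarrow> x - y \<in> U"
  by (rule sub_diff[OF U])

lemma sub_V2: "sub (P 0)"
  using linrelD(1)[OF Pl] linrelD(2)[OF Pl, of 0 _ 0] linrelD(3)[OF Pl, of 0]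
  by (auto simp: sub_def)

lemma sub_V4: "sub (Q 0)"
  using linrelD(1)[OF Ql] linrelD(2)[OF Ql, of 0 _ 0] linrelD(3)[OF Ql, of 0]
  by (auto simp: sub_def)

lemma sub_V1: "sub (\<lambda>x. \<exists>y. P x y)"
  using linrelD(1-3)[OF Pl] unfolding sub_def by blast

lemma sub_sum:
  assumes "sub S" "sub S'"
  shows "sub (\<lambda>v. \<exists>x y. S x \<and> S' y \<and> v = x + y)"
  unfolding sub_def
proof (intro conjI allI impI)
  show "\<exists>x y. S x \<and> S' y \<and> 0 = x + y" using assms unfolding sub_def by (metis add_0)
next
  fix v w assume "\<exists>x y. S x \<and> S' y \<and> v = x + y" "\<exists>x y. S x \<and> S' y \<and> w = x + y"
  then obtain x y x' y' where "S x" "S' y" "v = x + y" "S x'" "S' y'" "w = x' + y'" by blast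
  then show "\<exists>x y. S x \<and> S' y \<and> v + w = x + y"
    using assms by (intro exI[of _ "x + x'"] exI[of _ "y + y'"]) (auto simp: sub_def add_ac)
next
  fix c v assume "\<exists>x y. S x \<and> S' y \<and> v = x + y"
  then obtain x y where "S x" "S' y" "v = x + y" by blast
  then show "\<exists>x y. S x \<and> S' y \<and> sc c v = x + y"
    using assms by (intro exI[of _ "sc c x"] exI[of _ "sc c y"])
      (auto simp: sub_def fun_eq_iff algebra_simps)
qed

lemma sub_D: "sub D"
  using sub_sum[OF sub_V2 sub_V4] by (simp add: D_def[abs_def])

lemma sub_E: "sub E"
proof -
  have "E = (\<lambda>v. \<exists>x y. (\<exists>w. P x w) \<and> P 0 y \<and> v = x + y)" by (auto simp: E_def fun_eq_iff)
  then show ?thesis using sub_sum[OF sub_V1 sub_V2] by simp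
qed

lemma D_V2: "P 0 y \<Longrightarrow> D y"
  unfolding D_def using linrelD(1)[OF Ql] by (metis add.right_neutral)

lemma D_V4: "Q 0 z \<Longrightarrow> D z"
  unfolding D_def using linrelD(1)[OF Pl] by (metis add_0)

lemma D_V1: "P x y \<Longrightarrow> D x"
  using D_V4 PQ by blast

lemma D_dQ: "Q y z \<Longrightarrow> D y"
  using D_V2 P0 by blast

lemma E_V1: "P x y \<Longrightarrow> E x"
  unfolding E_def using linrelD(1)[OF Pl] by (metis add.right_neutral)

lemma E_V2: "P 0 y \<Longrightarrow> E y"
  unfolding E_def using linrelD(1)[OF Pl] by (metis add_0)

lemma Q_dP: "Q y z \<Longrightarrow> P 0 y"
  using P0 by blast

text \<open>Relates an image of \<open>a\<close> under \<open>P\<close> to an image of the same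
  \<open>a\<close> under \<open>Q\<close>; a functional that has to respect both relations at
  \<open>a\<close> must respect this one.\<close>

lemma linrel_W: "linrel sc sc (\<lambda>y z. \<exists>a. P a y \<and> Q a z)"
  unfolding linrel_def using linrelD(1-3)[OF Pl] linrelD(1-3)[OF Ql] by blast

lemma sub_ran: "sub (\<lambda>y. \<exists>x. P x y)"
  using linrelD(1-3)[OF Pl] unfolding sub_def by blast

text \<open>Along the relation of \<open>linrel_W\<close>, a functional vanishing on
  \<open>S\<close> forces its partner to vanish on these \<open>w\<close>.\<close>

lemma sub_K:
  assumes "sub S"
  shows "sub (\<lambda>w. \<exists>k y. P k y \<and> S y \<and> Q k w)"
  unfolding sub_def
proof (intro conjI allI impI)
  show "\<exists>k y. P k y \<and> S y \<and> Q k 0"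
    using linrelD(1)[OF Pl] linrelD(1)[OF Ql] assms unfolding sub_def by blast
next
  fix v w assume "\<exists>k y. P k y \<and> S y \<and> Q k v" "\<exists>k y. P k y \<and> S y \<and> Q k w"
  then obtain k y k' y' where "P k y" "S y" "Q k v" "P k' y'" "S y'" "Q k' w" by blast
  then have "P (k + k') (y + y')" "S (y + y')" "Q (k + k') (v + w)"
    using linrelD(2)[OF Pl] linrelD(2)[OF Ql] assms by (auto simp: sub_def)
  then show "\<exists>k y. P k y \<and> S y \<and> Q k (v + w)" by blast
next
  fix c v assume "\<exists>k y. P k y \<and> S y \<and> Q k v"
  then obtain k y where "P k y" "S y" "Q k v" by blast
  then have "P (sc c k) (sc c y)" "S (sc c y)" "Q (sc c k) (sc c v)"
    using linrelD(3)[OF Pl] linrelD(3)[OF Ql] assms by (auto simp: sub_def)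
  then show "\<exists>k y. P k y \<and> S y \<and> Q k (sc c v)" by blast
qed

lemmas splitI = splitsI[OF U Pl]

section \<open>Splitting off a summand, one type at a time\<close>

text \<open>Here \<open>a\<close> lies in V1 and in V2. The column a + t p + t^2 q is admissible
  because of \<open>P p q\<close>, and its product with t^2 because of \<open>Q a q\<close>.\<close>

lemma case1A:
  assumes "P 0 a" "P a y" "\<not> D y" "P p q" "Q a q"
  shows "splits U P Q (2, \<lambda>x y. x 1 = 0 \<and> y 1 = x 0, \<lambda>y z. z 1 = 0)"
proof -
  obtain \<beta> where \<beta>: "lin \<beta>" "\<And>d. D d \<Longrightarrow> \<beta> d = 0" "\<beta> (y) = 1" using sep[OF sub_D assms(3)] by metis
  obtain \<alpha> where \<alpha>: "lin \<alpha>" "\<And>v y. P v y \<Longrightarrow> \<alpha> v = \<beta> y + 0"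
    using ext1[OF Pl \<beta>(1) lin_zero] \<beta>(2) D_V2 by metis
  \<comment> \<open>The functional \<open>h\<close> compensates \<open>\<beta>\<close> along
    \<open>Q\<close>; it enters at t in the first row and at t^2 in the second.\<close>
  obtain h where h: "lin h" "\<And>v z. Q v z \<Longrightarrow> h v = - \<beta> z + 0"
    using ext1[OF Ql lin_uminus[OF \<beta>(1)] lin_zero] \<beta>(2) D_V4 by (metis neg_equal_0_iff_equal)
  show ?thesis
  \<comment> \<open>The second column is \<open>y - p\<close>, so that t e_0 + t^2 e_1 is sent to t
    a + t^2 y up to higher terms, as \<open>P a y\<close> allows.\<close>
  proof (rule splitI[where u = "\<lambda>i. [a, y - p] ! i" and p = "\<lambda>i. [p, 0] ! i"
        and q = "\<lambda>i. [q, 0] ! i" and a = "\<lambda>i. [\<alpha>, \<beta>] ! i"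
        and b = "\<lambda>i. [h, \<lambda>_. 0] ! i" and c = "\<lambda>i. [\<lambda>_. 0, h] ! i"], goal_cases)
    case (4 x y')
    then show ?case
      by (intro linrel_comb2[OF Pl assms(2) assms(1), where c = "x 0" and c' = "y' 0"])
        (auto simp: small_simps algebra_simps)
  next
    case (5 y' z')
    then show ?case
      by (intro linrel_comb2[OF Ql assms(5) PQ[OF assms(2)], where c = "y' 0" and c' = "z' 0"])
        (auto simp: small_simps algebra_simps)
  next
    case (7 x y)
    then show ?case
      using \<beta>(2)[OF D_V1[OF 7]] \<alpha>(2)[OF 7] by (auto simp: zero_fun_def)
  next
    case (8 y z)
    then show ?case
      using h(2)[OF 8] by auto
  next
    case 9
    then show ?case
      using \<alpha>(2)[OF assms(2)] \<beta>(3) \<beta>(2)[OF D_V1[OF assms(2)]] \<beta>(2)[OF D_V1[OF assms(4)]]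
      by (auto simp: small_simps linD[OF \<beta>(1)])
  qed (use lin_zero linrelD(1)[OF Pl] linrelD(1)[OF Ql] U_diff PU[OF assms(2)] PU[OF assms(4)] assms(4) \<alpha>(1) \<beta>(1) h(1) in \<open>auto simp: small_simps\<close>)
qed

text \<open>Without a \<open>q\<close> as in \<open>case1A\<close> the image \<open>z\<close> of
  \<open>a\<close> under \<open>Q\<close> has to become a third basis vector.\<close>

lemma case1B:
  assumes "P a y" "\<not> D y" "Q a z"
    and N: "\<And>a y p q. P 0 a \<Longrightarrow> P a y \<Longrightarrow> \<not> D y \<Longrightarrow> P p q \<Longrightarrow> \<not> Q a q"
  shows "splits U P Q (3, \<lambda>x y. x 1 = 0 \<and> x 2 = 0 \<and> y 1 = x 0 \<and> y 2 = 0, \<lambda>y z. z 1 = 0 \<and> z 2 = y 0)"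
proof -
  \<comment> \<open>Collects what the third functional has to annihilate. If \<open>z\<close> lay in
    it, subtracting a suitable \<open>k\<close> from \<open>a\<close> would produce the
    configuration of \<open>case1A\<close> that \<open>N\<close> excludes.\<close>
  define S where "S = (\<lambda>v. \<exists>x y. D x \<and> (\<exists>s t. (\<exists>u. P u s) \<and> (\<exists>k yk. P k yk \<and> D yk \<and> Q k t) \<and> y = s + t) \<and> v = x + y)"
  have subS: "sub S"
    unfolding S_def
  by (intro sub_sum sub_D sub_ran sub_K)
  have SI: "S (d + (s + t))" if "D d" "P u s" "P k yk" "D yk" "Q k t" for d s t u k yk
    using that unfolding S_def by blast
  have S_D: "S d" if "D d" for d
    using SI[OF that linrelD(1)[OF Pl] linrelD(1)[OF Pl] _ linrelD(1)[OF Ql]] sub_D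
    by (simp add: sub_def)
  have S_P: "S s" if "P u s" for u s
    using SI[OF _ that linrelD(1)[OF Pl] _ linrelD(1)[OF Ql], of 0] sub_D
    by (simp add: sub_def)
  have S_K: "S t" if "P k yk" "D yk" "Q k t" for t k yk
    using SI[OF _ linrelD(1)[OF Pl] that, of 0] sub_D by (simp add: sub_def)
  have a: "P 0 a" using Q_dP[OF assms(3)] .
  have "\<not> S z"
  proof
    assume "S z"
    then obtain d s t u k yk where *: "D d" "P u s" "P k yk" "D yk" "Q k t" "z = d + (s + t)"
      unfolding S_def by blast
    obtain d2 d4 where d: "P 0 d2" "Q 0 d4" "d = d2 + d4" using *(1) unfolding D_def by blast
    have "Q (a - k - 0) (z - t - d4)"
      by (intro linrelD(4)[OF Ql] assms(3) *(5) d(2))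
    then have "Q (a - k) (s + d2)" using *(6) d(3) by (simp add: algebra_simps)
    moreover have "P (u + 0) (s + d2)" by (intro linrelD(2)[OF Pl] *(2) d(1))
    moreover have "P 0 (a - k)" using sub_diff[OF sub_V2 a Q_dP[OF *(5)]] .
    moreover have "P (a - k) (y - yk)" using linrelD(4)[OF Pl assms(1) *(3)] .
    moreover have "\<not> D (y - yk)" using sub_D *(4) assms(2) unfolding sub_def by (metis diff_add_cancel)
    ultimately show False using N by auto
  qed
  then obtain \<gamma> where \<gamma>: "lin \<gamma>" "\<And>d. S d \<Longrightarrow> \<gamma> d = 0" "\<gamma> z = 1" using sep[OF subS] by metis
  obtain \<beta> where \<beta>: "lin \<beta>" "\<And>y z. \<exists>a. P a y \<and> Q a z \<Longrightarrow> \<beta> y = \<gamma> z + 0" "\<And>v. D v \<Longrightarrow> \<beta> v = 0"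
  proof (rule ext_sub[OF linrel_W \<gamma>(1) lin_zero sub_D])
    show "\<gamma> z + 0 = 0" if "\<exists>a. P a v \<and> Q a z" "D v" for v z
      using that \<gamma>(2) S_K by (metis add_0_right)
  qed auto
  obtain \<alpha> where \<alpha>: "lin \<alpha>" "\<And>v y. P v y \<Longrightarrow> \<alpha> v = \<beta> y + 0" "\<And>v z. Q v z \<Longrightarrow> \<alpha> v = \<gamma> z + 0"
    by (rule ext2[OF Pl \<beta>(1) lin_zero Ql \<gamma>(1) lin_zero]) (use \<beta>(2) in auto)
  obtain h where h: "lin h" "\<And>v z. Q v z \<Longrightarrow> h v = - \<beta> z + 0"
    using ext1[OF Ql lin_uminus[OF \<beta>(1)] lin_zero] \<beta>(3) D_V4 by (metis neg_equal_0_iff_equal)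
  show ?thesis
  proof (rule splitI[where u = "\<lambda>i. [a, y, z] ! i" and p = "\<lambda>i. [0, 0, 0] ! i"
        and q = "\<lambda>i. [0, 0, 0] ! i" and a = "\<lambda>i. [\<alpha>, \<beta>, \<gamma>] ! i"
        and b = "\<lambda>i. [h, \<lambda>_. 0, \<lambda>_. 0] ! i" and c = "\<lambda>i. [\<lambda>_. 0, h, \<lambda>_. 0] ! i"], goal_cases)
    case (4 x y')
    then show ?case
      by (intro linrel_comb2[OF Pl assms(1) a, where c = "x 0" and c' = "y' 0"])
        (auto simp: small_simps algebra_simps)
  next
    case (5 y' z')
    then show ?case
      by (intro linrel_comb2[OF Ql assms(3) PQ[OF assms(1)], where c = "y' 0" and c' = "z' 0"])
        (auto simp: small_simps algebra_simps)
  next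
    case (7 x y)
    then show ?case
      using \<beta>(3)[OF D_V1[OF 7]] \<gamma>(2)[OF S_D[OF D_V1[OF 7]]] \<gamma>(2)[OF S_P[OF 7]] \<alpha>(2)[OF 7] by (auto simp: zero_fun_def)
  next
    case (8 y z)
    then show ?case
      using h(2)[OF 8] \<alpha>(3)[OF 8] by auto
  next
    case 9
    then show ?case
      using \<alpha>(2)[OF assms(1)] \<alpha>(3)[OF assms(3)] \<beta>(3)[OF D_V1[OF assms(1)]] \<gamma>(2)[OF S_D[OF D_V1[OF assms(1)]]] \<gamma>(2)[OF S_P[OF assms(1)]] \<gamma>(3)
      by (auto simp: small_simps)
  qed (use lin_zero linrelD(1)[OF Pl] linrelD(1)[OF Ql] U_diff PU[OF assms(1)] QU[OF assms(3)] \<alpha>(1) \<beta>(1) \<gamma>(1) h(1) in \<open>auto simp: small_simps\<close>)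
qed

text \<open>The vector \<open>y\<close> is needed twice: it is reached from \<open>b\<close> at t^2
  and, after subtraction of \<open>q\<close>, from \<open>a\<close> at t^4. It becomes the third
  basis vector.\<close>

lemma case2A:
  assumes "P 0 a" "P a p" "P p q" "Q a (y + q)" "P b y" "\<not> D y"
    and N: "\<And>a y. P 0 a \<Longrightarrow> P a y \<Longrightarrow> D y"
  shows "splits U P Q (3, \<lambda>x y. x 2 = 0 \<and> y 1 = 0 \<and> y 2 = x 1, \<lambda>y z. z 2 = y 0)"
proof -
  obtain \<beta> where \<beta>: "lin \<beta>" "\<And>d. D d \<Longrightarrow> \<beta> d = 0" "\<beta> (y) = 1" using sep[OF sub_D assms(6)] by metis
  \<comment> \<open>By \<open>N\<close> the images of vectors of V2 lie in \<open>D\<close>, where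
    \<open>\<beta>\<close> vanishes; hence the two demands are compatible.\<close>
  obtain \<gamma> where \<gamma>: "lin \<gamma>" "\<And>v y. P v y \<Longrightarrow> \<gamma> v = \<beta> y + 0" "\<And>v. P 0 v \<Longrightarrow> \<gamma> v = 0"
    by (rule ext_sub[OF Pl \<beta>(1) lin_zero sub_V2]) (use \<beta>(2) N in auto)
  obtain h where h: "lin h" "\<And>v y. P v y \<Longrightarrow> h v = - \<gamma> y + 0"
    using ext1[OF Pl lin_uminus[OF \<gamma>(1)] lin_zero] \<gamma>(3) by (metis neg_equal_0_iff_equal)
  obtain \<alpha> where \<alpha>: "lin \<alpha>" "\<And>v z. Q v z \<Longrightarrow> \<alpha> v = \<beta> z + h v"
    using ext1[OF Ql \<beta>(1) h(1)] \<beta>(2) D_V4 by metis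
  show ?thesis
  proof (rule splitI[where u = "\<lambda>i. [a, b, y] ! i" and p = "\<lambda>i. [p, 0, 0] ! i"
        and q = "\<lambda>i. [q, 0, 0] ! i" and a = "\<lambda>i. [\<alpha>, \<gamma>, \<beta>] ! i"
        and b = "\<lambda>i. [\<lambda>_. 0, h, \<lambda>_. 0] ! i" and c = "\<lambda>i. [\<lambda>_. 0, \<lambda>_. 0, h] ! i"], goal_cases)
    case (4 x y')
    then show ?case
      by (intro linrel_comb3[OF Pl assms(2) assms(5) assms(1), where c = "x 0" and c' = "x 1" and c'' = "y' 0"])
        (auto simp: small_simps algebra_simps)
  next
    case (5 y' z')
    then show ?case
      by (intro linrel_comb3[OF Ql assms(4) PQ[OF assms(2)] PQ[OF assms(5)], where c = "y' 0" and c' = "z' 0" and c'' = "z' 1"])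
        (auto simp: small_simps algebra_simps)
  next
    case (7 x y)
    then show ?case
      using \<beta>(2)[OF D_V1[OF 7]] h(2)[OF 7] \<gamma>(2)[OF 7] by (auto simp: zero_fun_def)
  next
    case (8 y z)
    then show ?case
      using \<alpha>(2)[OF 8] by auto
  next
    case 9
    then show ?case
      using \<alpha>(2)[OF assms(4)] h(2)[OF assms(2)] \<gamma>(2)[OF assms(3)] \<gamma>(3)[OF assms(1)] \<beta>(2)[OF D_V1[OF assms(2)]] \<beta>(2)[OF D_V1[OF assms(5)]] \<gamma>(2)[OF assms(5)] \<beta>(3)
      by (auto simp: small_simps linD[OF \<beta>(1)])
  qed (use lin_zero linrelD(1)[OF Pl] linrelD(1)[OF Ql] U_diff PU[OF assms(2)] PU[OF assms(5)] assms(3) \<alpha>(1) \<beta>(1) \<gamma>(1) h(1) in \<open>auto simp: small_simps\<close>)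
qed

text \<open>As no \<open>y\<close> outside \<open>D\<close> occurs as in \<open>case2A\<close>, a
  functional with value 1 at \<open>y\<close> may vanish on everything that is reached there at t^4;
  this is what makes \<open>\<gamma>\<close> well defined.\<close>

lemma case2B:
  assumes "P b y" "\<not> D y"
    and N: "\<And>a y. P 0 a \<Longrightarrow> P a y \<Longrightarrow> D y"
    and N2: "\<And>a p q y b. P 0 a \<Longrightarrow> P a p \<Longrightarrow> P p q \<Longrightarrow> Q a (y + q) \<Longrightarrow> P b y \<Longrightarrow> D y"
  shows "splits U P Q (2, \<lambda>x y. x 1 = 0 \<and> y 0 = 0 \<and> y 1 = x 0, \<lambda>y z. z 1 = 0)"
proof -
  define S where "S = (\<lambda>v. \<exists>d w. D d \<and> (\<exists>a p q. P a p \<and> P p q \<and> Q a (w + q)) \<and> v = d + w)"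
  have K: "sub (\<lambda>w. \<exists>a p q. P a p \<and> P p q \<and> Q a (w + q))"
    unfolding sub_def
  proof (intro conjI allI impI)
    show "\<exists>a p q. P a p \<and> P p q \<and> Q a (0 + q)"
      using linrelD(1)[OF Pl] linrelD(1)[OF Ql] by (metis add_0)
  next
    fix v w assume "\<exists>a p q. P a p \<and> P p q \<and> Q a (v + q)" "\<exists>a p q. P a p \<and> P p q \<and> Q a (w + q)"
    then obtain a p q a' p' q' where "P a p" "P p q" "Q a (v + q)" "P a' p'" "P p' q'" "Q a' (w + q')"
      by blast
    then show "\<exists>a p q. P a p \<and> P p q \<and> Q a (v + w + q)"
      using linrelD(2)[OF Pl, of a p a' p'] linrelD(2)[OF Pl, of p q p' q'] linrelD(2)[OF Ql, of a "v + q" a' "w + q'"]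
      by (intro exI[of _ "a + a'"] exI[of _ "p + p'"] exI[of _ "q + q'"]) (simp add: add_ac)
  next
    fix c v assume "\<exists>a p q. P a p \<and> P p q \<and> Q a (v + q)"
    then obtain a p q where "P a p" "P p q" "Q a (v + q)" by blast
    then have "P (sc c a) (sc c p)" "P (sc c p) (sc c q)" "Q (sc c a) (sc c (v + q))"
      using linrelD(3)[OF Pl] linrelD(3)[OF Ql] by auto
    moreover have "sc c (v + q) = sc c v + sc c q" by (auto simp: fun_eq_iff algebra_simps)
    ultimately show "\<exists>a p q. P a p \<and> P p q \<and> Q a (sc c v + q)" by metis
  qed
  have subS: "sub S" unfolding S_def by (rule sub_sum[OF sub_D K])
  have S_D: "S d" if "D d" for d
    using that K unfolding S_def sub_def by (metis add_0_right)
  have S_K: "S w" if "P a p" "P p q" "Q a (w + q)" for a p q w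
    using that sub_D unfolding S_def sub_def by (metis add_0)
  have "\<not> S y"
  proof
    assume "S y"
    then obtain d w a p q where *: "D d" "P a p" "P p q" "Q a (w + q)" "y = d + w"
      unfolding S_def by blast
    obtain d2 d4 where d: "P 0 d2" "Q 0 d4" "d = d2 + d4" using *(1) unfolding D_def by blast
    have "Q (a + 0) (w + q + d4)" by (intro linrelD(2)[OF Ql] *(4) d(2))
    then have Qa: "Q a (y + (q - d2))" using *(5) d(3) by (simp add: algebra_simps)
    have "P (p - 0) (q - d2)" by (intro linrelD(4)[OF Pl] *(3) d(1))
    then show False using N2[OF Q_dP[OF *(4)] *(2) _ Qa assms(1)] assms(2) by simp
  qed
  then obtain \<beta> where \<beta>: "lin \<beta>" "\<And>d. S d \<Longrightarrow> \<beta> d = 0" "\<beta> y = 1" using sep[OF subS] by metis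
  \<comment> \<open>The value of \<open>\<gamma>\<close> must be that of \<open>\<beta>\<close> at
    the image both along \<open>P\<close> and along the relation of \<open>linrel_W\<close>; one
    extension along the sum of the two relations meets both demands.\<close>
  define R where "R = (\<lambda>v w. \<exists>v1 w1 v2 w2. P v1 w1 \<and> (\<exists>a. P a v2 \<and> Q a w2) \<and> v = v1 + v2 \<and> w = w1 + w2)"
  have RI: "R (v1 + v2) (w1 + w2)" if "P v1 w1" "P a v2" "Q a w2" for v1 w1 v2 w2 a
    using that unfolding R_def by blast
  have "linrel sc sc R"
    unfolding linrel_def
  proof (intro conjI allI impI)
    show "R 0 0" using RI[OF linrelD(1)[OF Pl] linrelD(1)[OF Pl] linrelD(1)[OF Ql]] by simp
  next
    fix x y x' y' assume "R x y" "R x' y'"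
    then obtain v1 w1 v2 w2 a v1' w1' v2' w2' a' where *: "P v1 w1" "P a v2" "Q a w2" "x = v1 + v2" "y = w1 + w2"
      "P v1' w1'" "P a' v2'" "Q a' w2'" "x' = v1' + v2'" "y' = w1' + w2'" unfolding R_def by blast
    have "R ((v1 + v1') + (v2 + v2')) ((w1 + w1') + (w2 + w2'))"
      using * by (intro RI[of _ _ "a + a'"] linrelD(2)[OF Pl] linrelD(2)[OF Ql])
    then show "R (x + x') (y + y')" using * by (simp add: add_ac)
  next
    fix c x y assume "R x y"
    then obtain v1 w1 v2 w2 a where *: "P v1 w1" "P a v2" "Q a w2" "x = v1 + v2" "y = w1 + w2"
      unfolding R_def by blast
    have "R (sc c v1 + sc c v2) (sc c w1 + sc c w2)"
      using * by (intro RI[of _ _ "sc c a"] linrelD(3)[OF Pl] linrelD(3)[OF Ql])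
    moreover have "sc c v1 + sc c v2 = sc c x" "sc c w1 + sc c w2 = sc c y"
      using * by (auto simp: fun_eq_iff algebra_simps)
    ultimately show "R (sc c x) (sc c y)" by simp
  qed
  then obtain \<gamma> where \<gamma>: "lin \<gamma>" "\<And>v w. R v w \<Longrightarrow> \<gamma> v = \<beta> w + 0" "\<And>v. P 0 v \<Longrightarrow> \<gamma> v = 0"
  \<comment> \<open>For \<open>v\<close> in V2 the relation \<open>P\<close> sends \<open>a\<close>
    to - v1 and this to - w1, so \<open>w\<close> is one of the vectors that \<open>\<beta>\<close>
    annihilates through \<open>S\<close>.\<close>
  proof (rule ext_sub[OF _ \<beta>(1) lin_zero sub_V2])
    fix v w assume "R v w" "P 0 v"
    then obtain v1 w1 v2 w2 a where *: "P v1 w1" "P a v2" "Q a w2" "v = v1 + v2" "w = w1 + w2"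
      unfolding R_def by blast
    have "P (a - 0) (v2 - v)" by (intro linrelD(4)[OF Pl] *(2) \<open>P 0 v\<close>)
    then have "P a (- v1)" using *(4) by simp
    moreover have "P (- v1) (- w1)" using linrelD(4)[OF Pl linrelD(1)[OF Pl] *(1)] by (simp only: diff_0)
    moreover have "Q a (w + - w1)" using *(3,5) by simp
    ultimately have "S w" by (rule S_K)
    then show "\<beta> w + 0 = 0" using \<beta>(2) by simp
  qed blast
  have \<gamma>1: "\<gamma> x = \<beta> y" if "P x y" for x y
    using \<gamma>(2) RI[OF that linrelD(1)[OF Pl] linrelD(1)[OF Ql]] by simp
  have \<gamma>2: "\<gamma> y = \<beta> z" if "P a y" "Q a z" for a y z
    using \<gamma>(2) RI[OF linrelD(1)[OF Pl] that] by simp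
  obtain h where h: "lin h" "\<And>v y. P v y \<Longrightarrow> h v = - \<gamma> y + 0" "\<And>v z. Q v z \<Longrightarrow> h v = - \<beta> z + 0"
    by (rule ext2[OF Pl lin_uminus[OF \<gamma>(1)] lin_zero Ql lin_uminus[OF \<beta>(1)] lin_zero]) (use \<gamma>2 in auto)
  show ?thesis
  proof (rule splitI[where u = "\<lambda>i. [b, y] ! i" and p = "\<lambda>i. [0, 0] ! i"
        and q = "\<lambda>i. [0, 0] ! i" and a = "\<lambda>i. [\<gamma>, \<beta>] ! i"
        and b = "\<lambda>i. [h, \<lambda>_. 0] ! i" and c = "\<lambda>i. [\<lambda>_. 0, h] ! i"], goal_cases)
    case (4 x y')
    then show ?case
      by (intro linrel_comb2[OF Pl assms(1) linrelD(1)[OF Pl], where c = "x 0" and c' = "0"])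
        (auto simp: small_simps algebra_simps)
  next
    case (5 y' z')
    then show ?case
      by (intro linrel_comb2[OF Ql PQ[OF assms(1)] linrelD(1)[OF Ql], where c = "z' 0" and c' = "0"])
        (auto simp: small_simps algebra_simps)
  next
    case (7 x y)
    then show ?case
      using \<beta>(2)[OF S_D[OF D_V1[OF 7]]] h(2)[OF 7] \<gamma>1[OF 7] by (auto simp: zero_fun_def)
  next
    case (8 y z)
    then show ?case
      using h(3)[OF 8] by auto
  next
    case 9
    then show ?case
      using \<gamma>1[OF assms(1)] \<beta>(2)[OF S_D[OF D_V1[OF assms(1)]]] \<beta>(3)
      by (auto simp: small_simps)
  qed (use lin_zero linrelD(1)[OF Pl] linrelD(1)[OF Ql] U_diff PU[OF assms(1)] \<beta>(1) \<gamma>(1) h(1) in \<open>auto simp: small_simps\<close>)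
qed

text \<open>The image \<open>d\<close> of \<open>a\<close> lies in V4 but outside V1 + V2: the chain
  ends in a basis vector whose coefficient at t^4 is free.\<close>

lemma case3A:
  assumes "P 0 a" "P a d" "Q 0 d" "\<not> E d" "P 0 q" "Q a q"
  shows "splits U P Q (2, \<lambda>x y. x 1 = 0 \<and> y 1 = x 0, \<lambda>y z. True)"
proof -
  obtain \<delta> where \<delta>: "lin \<delta>" "\<And>d. E d \<Longrightarrow> \<delta> d = 0" "\<delta> (d) = 1" using sep[OF sub_E assms(4)] by metis
  obtain \<alpha> where \<alpha>: "lin \<alpha>" "\<And>v y. P v y \<Longrightarrow> \<alpha> v = \<delta> y + 0"
    using ext1[OF Pl \<delta>(1) lin_zero] \<delta>(2) E_V2 by metis
  show ?thesis
  proof (rule splitI[where u = "\<lambda>i. [a, d] ! i" and p = "\<lambda>i. [0, 0] ! i"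
        and q = "\<lambda>i. [q, 0] ! i" and a = "\<lambda>i. [\<alpha>, \<delta>] ! i"
        and b = "\<lambda>i. [\<lambda>_. 0, \<lambda>_. 0] ! i" and c = "\<lambda>i. [\<lambda>_. 0, \<lambda>_. 0] ! i"], goal_cases)
    case (4 x y')
    then show ?case
      by (intro linrel_comb2[OF Pl assms(2) assms(1), where c = "x 0" and c' = "y' 0"])
        (auto simp: small_simps algebra_simps)
  next
    case (5 y' z')
    then show ?case
      by (intro linrel_comb3[OF Ql assms(6) PQ[OF assms(2)] assms(3), where c = "y' 0" and c' = "z' 0" and c'' = "z' 1"])
        (auto simp: small_simps algebra_simps)
  next
    case (7 x y)
    then show ?case
      using \<delta>(2)[OF E_V1[OF 7]] \<alpha>(2)[OF 7] by (auto simp: zero_fun_def)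
  next
    case 9
    then show ?case
      using \<alpha>(2)[OF assms(2)] \<delta>(2)[OF E_V1[OF assms(2)]] \<delta>(3)
      by (auto simp: small_simps)
  qed (use lin_zero linrelD(1)[OF Pl] linrelD(1)[OF Ql] U_diff PU[OF assms(2)] assms(5) \<alpha>(1) \<delta>(1) in \<open>auto simp: small_simps\<close>)
qed

text \<open>The analogue of \<open>case1B\<close> for \<open>E\<close> in place of \<open>D\<close>:
  no choice of \<open>a\<close> brings its \<open>Q\<close>-image into \<open>D\<close>, so
  \<open>z\<close> becomes a third basis vector.\<close>

lemma case3B:
  assumes "P a d" "Q 0 d" "\<not> E d" "Q a z"
    and N: "\<And>x y. P x y \<Longrightarrow> D y"
    and N2: "\<And>a y z. P 0 a \<Longrightarrow> P a y \<Longrightarrow> \<not> E y \<Longrightarrow> Q a z \<Longrightarrow> \<not> D z"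
  shows "splits U P Q (3, \<lambda>x y. x 1 = 0 \<and> x 2 = 0 \<and> y 1 = x 0 \<and> y 2 = 0, \<lambda>y z. z 2 = y 0)"
proof -
  define S where "S = (\<lambda>v. \<exists>d w. D d \<and> (\<exists>k y. P k y \<and> E y \<and> Q k w) \<and> v = d + w)"
  have K: "sub (\<lambda>w. \<exists>k y. P k y \<and> E y \<and> Q k w)"
    by (rule sub_K[OF sub_E])
  have subS: "sub S" unfolding S_def by (rule sub_sum[OF sub_D K])
  have S_D: "S d" if "D d" for d
    using that K unfolding S_def sub_def by (metis add_0_right)
  have S_K: "S w" if "P k y" "E y" "Q k w" for k y w
    using that sub_D unfolding S_def sub_def by (metis add_0)
  have "\<not> S z"
  proof
    assume "S z"
    then obtain d' w k y where *: "D d'" "P k y" "E y" "Q k w" "z = d' + w"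
      unfolding S_def by blast
    have "P (a - k) (d - y)" "Q (a - k) (z - w)"
      using linrelD(4)[OF Pl assms(1) *(2)] linrelD(4)[OF Ql assms(4) *(4)] .
    moreover have "\<not> E (d - y)" using sub_E *(3) assms(3) unfolding sub_def by (metis diff_add_cancel)
    ultimately show False using N2[OF Q_dP] *(1,5) by simp
  qed
  then obtain \<beta> where \<beta>: "lin \<beta>" "\<And>d. S d \<Longrightarrow> \<beta> d = 0" "\<beta> z = 1" using sep[OF subS] by metis
  obtain \<delta> where \<delta>: "lin \<delta>" "\<And>y z. \<exists>a. P a y \<and> Q a z \<Longrightarrow> \<delta> y = \<beta> z + 0" "\<And>v. E v \<Longrightarrow> \<delta> v = 0"
  proof (rule ext_sub[OF linrel_W \<beta>(1) lin_zero sub_E])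
    show "\<beta> z + 0 = 0" if "\<exists>a. P a v \<and> Q a z" "E v" for v z
      using that \<beta>(2) S_K by (metis add_0_right)
  qed auto
  obtain \<alpha> where \<alpha>: "lin \<alpha>" "\<And>v y. P v y \<Longrightarrow> \<alpha> v = \<delta> y + 0" "\<And>v z. Q v z \<Longrightarrow> \<alpha> v = \<beta> z + 0"
    by (rule ext2[OF Pl \<delta>(1) lin_zero Ql \<beta>(1) lin_zero]) (use \<delta>(2) in auto)
  have \<beta>D: "\<beta> v = 0" if "D v" for v using that \<beta>(2) S_D by blast
  show ?thesis
  proof (rule splitI[where u = "\<lambda>i. [a, d, z] ! i" and p = "\<lambda>i. [0, 0, 0] ! i"
        and q = "\<lambda>i. [0, 0, 0] ! i" and a = "\<lambda>i. [\<alpha>, \<delta>, \<beta>] ! i"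
        and b = "\<lambda>i. [\<lambda>_. 0, \<lambda>_. 0, \<lambda>_. 0] ! i" and c = "\<lambda>i. [\<lambda>_. 0, \<lambda>_. 0, \<lambda>_. 0] ! i"], goal_cases)
    case (4 x y')
    then show ?case
      by (intro linrel_comb2[OF Pl assms(1) Q_dP[OF assms(4)], where c = "x 0" and c' = "y' 0"])
        (auto simp: small_simps algebra_simps)
  next
    case (5 y' z')
    then show ?case
      by (intro linrel_comb3[OF Ql assms(4) PQ[OF assms(1)] assms(2), where c = "y' 0" and c' = "z' 0" and c'' = "z' 1"])
        (auto simp: small_simps algebra_simps)
  next
    case (7 x y)
    then show ?case
      using \<delta>(3)[OF E_V1[OF 7]] \<beta>D[OF D_V1[OF 7]] \<beta>D[OF N[OF 7]] \<alpha>(2)[OF 7] by (auto simp: zero_fun_def)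
  next
    case (8 y z)
    then show ?case
      using \<alpha>(3)[OF 8] by auto
  next
    case 9
    then show ?case
      using \<alpha>(3)[OF assms(4)] \<alpha>(2)[OF assms(1)] \<delta>(3)[OF E_V1[OF assms(1)]] \<beta>D[OF D_V1[OF assms(1)]] \<beta>D[OF D_V4[OF assms(2)]] \<beta>(3)
      by (auto simp: small_simps)
  qed (use lin_zero linrelD(1)[OF Pl] linrelD(1)[OF Ql] U_diff PU[OF assms(1)] QU[OF assms(4)] \<alpha>(1) \<beta>(1) \<delta>(1) in \<open>auto simp: small_simps\<close>)
qed

text \<open>By \<open>N\<close> the vector \<open>b\<close> lies outside V2, so its column has no
  multiple by t^2 in the summand.\<close>

lemma case4:
  assumes "P b d" "Q 0 d" "\<not> E d"
    and N: "\<And>a y. P 0 a \<Longrightarrow> P a y \<Longrightarrow> E y"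
  shows "splits U P Q (2, \<lambda>x y. x 1 = 0 \<and> y 0 = 0 \<and> y 1 = x 0, \<lambda>y z. True)"
proof -
  obtain \<delta> where \<delta>: "lin \<delta>" "\<And>d. E d \<Longrightarrow> \<delta> d = 0" "\<delta> (d) = 1" using sep[OF sub_E assms(3)] by metis
  obtain \<gamma> where \<gamma>: "lin \<gamma>" "\<And>v y. P v y \<Longrightarrow> \<gamma> v = \<delta> y + 0" "\<And>v. P 0 v \<Longrightarrow> \<gamma> v = 0"
    by (rule ext_sub[OF Pl \<delta>(1) lin_zero sub_V2]) (metis \<delta>(2) N add_0_right, blast)
  obtain h where h: "lin h" "\<And>v y. P v y \<Longrightarrow> h v = - \<gamma> y + 0"
    using ext1[OF Pl lin_uminus[OF \<gamma>(1)] lin_zero] \<gamma>(3) by (metis neg_equal_0_iff_equal)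
  show ?thesis
  proof (rule splitI[where u = "\<lambda>i. [b, d] ! i" and p = "\<lambda>i. [0, 0] ! i"
        and q = "\<lambda>i. [0, 0] ! i" and a = "\<lambda>i. [\<gamma>, \<delta>] ! i"
        and b = "\<lambda>i. [h, \<lambda>_. 0] ! i" and c = "\<lambda>i. [\<lambda>_. 0, h] ! i"], goal_cases)
    case (4 x y')
    then show ?case
      by (intro linrel_comb2[OF Pl assms(1) linrelD(1)[OF Pl], where c = "x 0" and c' = "0"])
        (auto simp: small_simps algebra_simps)
  next
    case (5 y' z')
    then show ?case
      by (intro linrel_comb2[OF Ql PQ[OF assms(1)] assms(2), where c = "z' 0" and c' = "z' 1"])
        (auto simp: small_simps algebra_simps)
  next
    case (7 x y)
    then show ?case
      using \<delta>(2)[OF E_V1[OF 7]] h(2)[OF 7] \<gamma>(2)[OF 7] by (auto simp: zero_fun_def)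
  next
    case 9
    then show ?case
      using \<gamma>(2)[OF assms(1)] \<delta>(2)[OF E_V1[OF assms(1)]] \<delta>(3)
      by (auto simp: small_simps)
  qed (use lin_zero linrelD(1)[OF Pl] linrelD(1)[OF Ql] U_diff PU[OF assms(1)] \<delta>(1) \<gamma>(1) h(1) in \<open>auto simp: small_simps\<close>)
qed

text \<open>Now only \<open>Q\<close> leads out of \<open>D\<close>. The cases 5 start at a vector
  of V2 that lies in V1, that lies in V4, or that is arbitrary. Subtracting \<open>q\<close> from
  \<open>z\<close> compensates the t^2 term of the first column.\<close>

lemma case5a:
  assumes "P a p" "P p q" "Q a z" "\<not> D z"
    and N: "\<And>x y. P x y \<Longrightarrow> D y"
  shows "splits U P Q (2, \<lambda>x y. x 1 = 0 \<and> y 1 = 0, \<lambda>y z. z 1 = y 0)"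
proof -
  obtain \<beta> where \<beta>: "lin \<beta>" "\<And>d. D d \<Longrightarrow> \<beta> d = 0" "\<beta> (z) = 1" using sep[OF sub_D assms(4)] by metis
  have K: "\<beta> x = 0" "\<beta> y = 0" if "P x y" for x y
    using that \<beta>(2) D_V1 N by blast+
  obtain \<alpha> where \<alpha>: "lin \<alpha>" "\<And>v z. Q v z \<Longrightarrow> \<alpha> v = \<beta> z + 0"
    using ext1[OF Ql \<beta>(1) lin_zero] \<beta>(2) D_V4 by metis
  show ?thesis
  proof (rule splitI[where u = "\<lambda>i. [a, z - q] ! i" and p = "\<lambda>i. [p, 0] ! i"
        and q = "\<lambda>i. [q, 0] ! i" and a = "\<lambda>i. [\<alpha>, \<beta>] ! i"
        and b = "\<lambda>i. [\<lambda>_. 0, \<lambda>_. 0] ! i" and c = "\<lambda>i. [\<lambda>_. 0, \<lambda>_. 0] ! i"], goal_cases)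
    case (4 x y')
    then show ?case
      by (intro linrel_comb2[OF Pl assms(1) Q_dP[OF assms(3)], where c = "x 0" and c' = "y' 0"])
        (auto simp: small_simps algebra_simps)
  next
    case (5 y' z')
    then show ?case
      by (intro linrel_comb2[OF Ql assms(3) PQ[OF assms(1)], where c = "y' 0" and c' = "z' 0"])
        (auto simp: small_simps algebra_simps)
  next
    case (7 x y)
    then show ?case
      using K[OF 7] by (auto simp: zero_fun_def)
  next
    case (8 y z)
    then show ?case
      using \<alpha>(2)[OF 8] by auto
  next
    case 9
    then show ?case
      using \<alpha>(2)[OF assms(3)] \<beta>(2)[OF D_V1[OF assms(1)]] K(2)[OF assms(2)] \<beta>(3)
      by (auto simp: small_simps linD[OF \<beta>(1)])
  qed (use lin_zero linrelD(1)[OF Pl] linrelD(1)[OF Ql] U_diff PU[OF assms(1)] PU[OF assms(2)] QU[OF assms(3)] assms(2) \<alpha>(1) \<beta>(1) in \<open>auto simp: small_simps\<close>)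
qed

lemma case5b:
  assumes "Q 0 c" "Q c z" "\<not> D z"
    and N: "\<And>x y. P x y \<Longrightarrow> D y" "\<And>a y z. P a y \<Longrightarrow> Q a z \<Longrightarrow> D z"
  shows "splits U P Q (2, \<lambda>x y. x 0 = 0 \<and> x 1 = 0 \<and> y 1 = 0, \<lambda>y z. z 1 = y 0)"
proof -
  obtain \<beta> where \<beta>: "lin \<beta>" "\<And>d. D d \<Longrightarrow> \<beta> d = 0" "\<beta> (z) = 1" using sep[OF sub_D assms(3)] by metis
  have K: "\<beta> x = 0" "\<beta> y = 0" if "P x y" for x y
    using that \<beta>(2) D_V1 N(1) by blast+
  obtain \<gamma> where \<gamma>: "lin \<gamma>" "\<And>v z. Q v z \<Longrightarrow> \<gamma> v = \<beta> z + 0" "\<And>v. \<exists>y. P v y \<Longrightarrow> \<gamma> v = 0"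
    by (rule ext_sub[OF Ql \<beta>(1) lin_zero sub_V1]) (metis \<beta>(2) N(2) add_0_right, blast)
  show ?thesis
  proof (rule splitI[where u = "\<lambda>i. [c, z] ! i" and p = "\<lambda>i. [0, 0] ! i"
        and q = "\<lambda>i. [0, 0] ! i" and a = "\<lambda>i. [\<gamma>, \<beta>] ! i"
        and b = "\<lambda>i. [\<lambda>_. 0, \<lambda>_. 0] ! i" and c = "\<lambda>i. [\<lambda>_. 0, \<lambda>_. 0] ! i"], goal_cases)
    case (4 x y')
    then show ?case
      by (intro linrel_comb2[OF Pl Q_dP[OF assms(2)] linrelD(1)[OF Pl], where c = "y' 0" and c' = "0"])
        (auto simp: small_simps algebra_simps)
  next
    case (5 y' z')
    then show ?case
      by (intro linrel_comb2[OF Ql assms(2) assms(1), where c = "y' 0" and c' = "z' 0"])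
        (auto simp: small_simps algebra_simps)
  next
    case (7 x y)
    then show ?case
      using K[OF 7] \<gamma>(3)[OF exI, OF 7] by (auto simp: zero_fun_def)
  next
    case (8 y z)
    then show ?case
      using \<gamma>(2)[OF 8] by auto
  next
    case 9
    then show ?case
      using \<gamma>(2)[OF assms(2)] \<beta>(2)[OF D_V4[OF assms(1)]] \<beta>(3)
      by (auto simp: small_simps)
  qed (use lin_zero linrelD(1)[OF Pl] linrelD(1)[OF Ql] U_diff QU[OF assms(1)] QU[OF assms(2)] \<beta>(1) \<gamma>(1) in \<open>auto simp: small_simps\<close>)
qed

lemma case5c:
  assumes "Q e z" "\<not> D z"
    and N: "\<And>x y. P x y \<Longrightarrow> D y" "\<And>c z. Q 0 c \<Longrightarrow> Q c z \<Longrightarrow> D z"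
  shows "splits U P Q (2, \<lambda>x y. x 0 = 0 \<and> x 1 = 0 \<and> y 1 = 0, \<lambda>y z. z 0 = 0 \<and> z 1 = y 0)"
proof -
  obtain \<beta> where \<beta>: "lin \<beta>" "\<And>d. D d \<Longrightarrow> \<beta> d = 0" "\<beta> (z) = 1" using sep[OF sub_D assms(2)] by metis
  have K: "\<beta> x = 0" "\<beta> y = 0" if "P x y" for x y
    using that \<beta>(2) D_V1 N(1) by blast+
  obtain \<epsilon> where \<epsilon>: "lin \<epsilon>" "\<And>v z. Q v z \<Longrightarrow> \<epsilon> v = \<beta> z + 0" "\<And>v. Q 0 v \<Longrightarrow> \<epsilon> v = 0"
    by (rule ext_sub[OF Ql \<beta>(1) lin_zero sub_V4]) (metis \<beta>(2) N(2) add_0_right, blast)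
  obtain h where h: "lin h" "\<And>v z. Q v z \<Longrightarrow> h v = - \<epsilon> z + 0"
    using ext1[OF Ql lin_uminus[OF \<epsilon>(1)] lin_zero] \<epsilon>(3) by (metis neg_equal_0_iff_equal)
  show ?thesis
  proof (rule splitI[where u = "\<lambda>i. [e, z] ! i" and p = "\<lambda>i. [0, 0] ! i"
        and q = "\<lambda>i. [0, 0] ! i" and a = "\<lambda>i. [\<epsilon>, \<beta>] ! i"
        and b = "\<lambda>i. [\<lambda>_. 0, \<lambda>_. 0] ! i" and c = "\<lambda>i. [h, \<lambda>_. 0] ! i"], goal_cases)
    case (4 x y')
    then show ?case
      by (intro linrel_comb2[OF Pl Q_dP[OF assms(1)] linrelD(1)[OF Pl], where c = "y' 0" and c' = "0"])
        (auto simp: small_simps algebra_simps)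
  next
    case (5 y' z')
    then show ?case
      by (intro linrel_comb2[OF Ql assms(1) linrelD(1)[OF Ql], where c = "y' 0" and c' = "0"])
        (auto simp: small_simps algebra_simps)
  next
    case (7 x y)
    then show ?case
      using K[OF 7] PQ[OF 7] \<epsilon>(3) by (auto simp: zero_fun_def)
  next
    case (8 y z)
    then show ?case
      using \<epsilon>(2)[OF 8] h(2)[OF 8] by auto
  next
    case 9
    then show ?case
      using \<epsilon>(2)[OF assms(1)] \<beta>(2)[OF D_dQ[OF assms(1)]] \<beta>(3)
      by (auto simp: small_simps)
  qed (use lin_zero linrelD(1)[OF Pl] linrelD(1)[OF Ql] U_diff QU[OF assms(1)] \<beta>(1) \<epsilon>(1) h(1) in \<open>auto simp: small_simps\<close>)
qed

text \<open>The cases 6 give the types of rank one: all images can be corrected to fit into a single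
  column, and the leading coefficient spaces that contain the vector decide the type.\<close>

lemma case6a:
  assumes "P a p" "P p q" "Q a q" "a \<noteq> 0"
  shows "splits U P Q (1, \<lambda>x y. True, \<lambda>y z. True)"
proof -
  have "sub (\<lambda>v. v = (0::nat \<Rightarrow> 'k))" by (auto simp: sub_def)
  from sep[OF this, of a] assms(4) obtain \<alpha> where \<alpha>: "lin \<alpha>" "\<alpha> a = 1" by blast
  show ?thesis
  proof (rule splitI[where u = "\<lambda>_. a" and p = "\<lambda>_. p"
        and q = "\<lambda>_. q" and a = "\<lambda>_. \<alpha>"
        and b = "\<lambda>_. \<lambda>_. 0" and c = "\<lambda>_. \<lambda>_. 0"], goal_cases)
    case (4 x y')
    then show ?case
      by (intro linrel_comb2[OF Pl assms(1) Q_dP[OF assms(3)], where c = "x 0" and c' = "y' 0"])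
        (auto simp: small_simps algebra_simps)
  next
    case (5 y' z')
    then show ?case
      by (intro linrel_comb2[OF Ql assms(3) PQ[OF assms(1)], where c = "y' 0" and c' = "z' 0"])
        (auto simp: small_simps algebra_simps)
  next
    case 9
    then show ?case
      using \<alpha>(2)
      by (auto simp: small_simps)
  qed (use lin_zero linrelD(1)[OF Pl] linrelD(1)[OF Ql] U_diff PU[OF assms(1)] assms(2) \<alpha>(1) in \<open>auto simp: small_simps\<close>)
qed

lemma case6b:
  assumes "P b p" "P p q" "\<not> P 0 b"
  shows "splits U P Q (1, \<lambda>x y. y 0 = 0, \<lambda>y z. True)"
proof -
  obtain \<beta> where \<beta>: "lin \<beta>" "\<And>d. P 0 d \<Longrightarrow> \<beta> d = 0" "\<beta> (b) = 1" using sep[OF sub_V2 assms(3)] by metis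
  obtain h where h: "lin h" "\<And>v y. P v y \<Longrightarrow> h v = - \<beta> y + 0"
    using ext1[OF Pl lin_uminus[OF \<beta>(1)] lin_zero] \<beta>(2) by (metis neg_equal_0_iff_equal)
  show ?thesis
  proof (rule splitI[where u = "\<lambda>_. b" and p = "\<lambda>_. p"
        and q = "\<lambda>_. q" and a = "\<lambda>_. \<beta>"
        and b = "\<lambda>_. h" and c = "\<lambda>_. \<lambda>_. 0"], goal_cases)
    case (4 x y')
    then show ?case
      by (intro linrel_comb2[OF Pl assms(1) linrelD(1)[OF Pl], where c = "x 0" and c' = "0"])
        (auto simp: small_simps algebra_simps)
  next
    case (5 y' z')
    then show ?case
      by (intro linrel_comb2[OF Ql PQ[OF assms(1)] linrelD(1)[OF Ql], where c = "z' 0" and c' = "0"])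
        (auto simp: small_simps algebra_simps)
  next
    case (7 x y)
    then show ?case
      using h(2)[OF 7] by (auto simp: zero_fun_def)
  next
    case 9
    then show ?case
      using \<beta>(3)
      by (auto simp: small_simps)
  qed (use lin_zero linrelD(1)[OF Pl] linrelD(1)[OF Ql] U_diff PU[OF assms(1)] assms(2) \<beta>(1) h(1) in \<open>auto simp: small_simps\<close>)
qed

lemma case6c:
  assumes "Q 0 c" "Q c q" "P 0 q" "c \<noteq> 0"
    and N: "\<And>x y. P x y \<Longrightarrow> x = 0"
  shows "splits U P Q (1, \<lambda>x y. x 0 = 0, \<lambda>y z. True)"
proof -
  have "sub (\<lambda>v. v = (0::nat \<Rightarrow> 'k))" by (auto simp: sub_def)
  from sep[OF this, of c] assms(4) obtain \<gamma> where \<gamma>: "lin \<gamma>" "\<gamma> c = 1" by blast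
  show ?thesis
  proof (rule splitI[where u = "\<lambda>_. c" and p = "\<lambda>_. 0"
        and q = "\<lambda>_. q" and a = "\<lambda>_. \<gamma>"
        and b = "\<lambda>_. \<lambda>_. 0" and c = "\<lambda>_. \<lambda>_. 0"], goal_cases)
    case (4 x y')
    then show ?case
      by (intro linrel_comb2[OF Pl Q_dP[OF assms(2)] linrelD(1)[OF Pl], where c = "y' 0" and c' = "0"])
        (auto simp: small_simps algebra_simps)
  next
    case (5 y' z')
    then show ?case
      by (intro linrel_comb2[OF Ql assms(2) assms(1), where c = "y' 0" and c' = "z' 0"])
        (auto simp: small_simps algebra_simps)
  next
    case (7 x y)
    then show ?case
      using N[OF 7] linD(3)[OF \<gamma>(1)] by (auto simp: zero_fun_def)
  next
    case 9
    then show ?case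
      using \<gamma>(2)
      by (auto simp: small_simps)
  qed (use lin_zero linrelD(1)[OF Pl] linrelD(1)[OF Ql] U_diff QU[OF assms(1)] assms(3) \<gamma>(1) in \<open>auto simp: small_simps\<close>)
qed

lemma case6d:
  assumes "Q 0 d" "\<not> P 0 d"
    and N: "\<And>x y. P x y \<Longrightarrow> x = 0"
  shows "splits U P Q (1, \<lambda>x y. x 0 = 0 \<and> y 0 = 0, \<lambda>y z. True)"
proof -
  obtain \<delta> where \<delta>: "lin \<delta>" "\<And>d. P 0 d \<Longrightarrow> \<delta> d = 0" "\<delta> (d) = 1" using sep[OF sub_V2 assms(2)] by metis
  show ?thesis
  proof (rule splitI[where u = "\<lambda>_. d" and p = "\<lambda>_. 0"
        and q = "\<lambda>_. 0" and a = "\<lambda>_. \<delta>"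
        and b = "\<lambda>_. \<lambda>_. 0" and c = "\<lambda>_. \<lambda>_. 0"], goal_cases)
    case (4 x y')
    then show ?case
      by (intro linrel_comb2[OF Pl linrelD(1)[OF Pl] linrelD(1)[OF Pl], where c = "0" and c' = "0"])
        (auto simp: small_simps algebra_simps)
  next
    case (5 y' z')
    then show ?case
      by (intro linrel_comb2[OF Ql assms(1) linrelD(1)[OF Ql], where c = "z' 0" and c' = "0"])
        (auto simp: small_simps algebra_simps)
  next
    case (7 x y)
    then show ?case
      using 7 N[OF 7] linD(3)[OF \<delta>(1)] \<delta>(2)[of y] by (auto simp: zero_fun_def)
  next
    case 9
    then show ?case
      using \<delta>(3)
      by (auto simp: small_simps)
  qed (use lin_zero linrelD(1)[OF Pl] linrelD(1)[OF Ql] U_diff QU[OF assms(1)] \<delta>(1) in \<open>auto simp: small_simps\<close>)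
qed

lemma case6e:
  assumes "Q e q" "P 0 q" "e \<noteq> 0"
    and N: "\<And>x y. P x y \<Longrightarrow> x = 0" "\<And>z. Q 0 z \<Longrightarrow> z = 0"
  shows "splits U P Q (1, \<lambda>x y. x 0 = 0, \<lambda>y z. z 0 = 0)"
proof -
  have "sub (\<lambda>v. v = (0::nat \<Rightarrow> 'k))" by (auto simp: sub_def)
  from sep[OF this, of e] assms(3) obtain \<epsilon> where \<epsilon>: "lin \<epsilon>" "\<epsilon> e = 1" by blast
  obtain h where h: "lin h" "\<And>v z. Q v z \<Longrightarrow> h v = - \<epsilon> z + 0"
    using ext1[OF Ql lin_uminus[OF \<epsilon>(1)] lin_zero] N(2) linD(3)[OF \<epsilon>(1)] by (metis neg_equal_0_iff_equal)
  show ?thesis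
  proof (rule splitI[where u = "\<lambda>_. e" and p = "\<lambda>_. 0"
        and q = "\<lambda>_. q" and a = "\<lambda>_. \<epsilon>"
        and b = "\<lambda>_. \<lambda>_. 0" and c = "\<lambda>_. h"], goal_cases)
    case (4 x y')
    then show ?case
      by (intro linrel_comb2[OF Pl Q_dP[OF assms(1)] linrelD(1)[OF Pl], where c = "y' 0" and c' = "0"])
        (auto simp: small_simps algebra_simps)
  next
    case (5 y' z')
    then show ?case
      by (intro linrel_comb2[OF Ql assms(1) linrelD(1)[OF Ql], where c = "y' 0" and c' = "0"])
        (auto simp: small_simps algebra_simps)
  next
    case (7 x y)
    then show ?case
      using N(1)[OF 7] linD(3)[OF \<epsilon>(1)] by (auto simp: zero_fun_def)
  next
    case (8 y z)
    then show ?case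
      using h(2)[OF 8] by auto
  next
    case 9
    then show ?case
      using \<epsilon>(2)
      by (auto simp: small_simps)
  qed (use lin_zero linrelD(1)[OF Pl] linrelD(1)[OF Ql] U_diff QU[OF assms(1)] assms(2) \<epsilon>(1) h(1) in \<open>auto simp: small_simps\<close>)
qed

lemma case6f:
  assumes "f \<in> U" "f \<noteq> 0"
    and N: "\<And>x y. P x y \<Longrightarrow> x = 0 \<and> y = 0" "\<And>y z. Q y z \<Longrightarrow> z = 0"
  shows "splits U P Q (1, \<lambda>x y. x 0 = 0 \<and> y 0 = 0, \<lambda>y z. z 0 = 0)"
proof -
  have "sub (\<lambda>v. v = (0::nat \<Rightarrow> 'k))" by (auto simp: sub_def)
  from sep[OF this, of f] assms(2) obtain \<alpha> where \<alpha>: "lin \<alpha>" "\<alpha> f = 1" by blast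
  show ?thesis
  proof (rule splitI[where u = "\<lambda>_. f" and p = "\<lambda>_. 0"
        and q = "\<lambda>_. 0" and a = "\<lambda>_. \<alpha>"
        and b = "\<lambda>_. \<lambda>_. 0" and c = "\<lambda>_. \<lambda>_. 0"], goal_cases)
    case (4 x y')
    then show ?case
      by (intro linrel_comb2[OF Pl linrelD(1)[OF Pl] linrelD(1)[OF Pl], where c = "0" and c' = "0"])
        (auto simp: small_simps algebra_simps)
  next
    case (5 y' z')
    then show ?case
      by (intro linrel_comb2[OF Ql linrelD(1)[OF Ql] linrelD(1)[OF Ql], where c = "0" and c' = "0"])
        (auto simp: small_simps algebra_simps)
  next
    case (7 x y)
    then show ?case
      using N(1)[OF 7] linD(3)[OF \<alpha>(1)] by (auto simp: zero_fun_def)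
  next
    case (8 y z)
    then show ?case
      using N(2)[OF 8] linD(3)[OF \<alpha>(1)] by auto
  next
    case 9
    then show ?case
      using \<alpha>(2)
      by (auto simp: small_simps)
  qed (use lin_zero linrelD(1)[OF Pl] linrelD(1)[OF Ql] U_diff assms(1) \<alpha>(1) in \<open>auto simp: small_simps\<close>)
qed

text \<open>Excluding a type confines the images, first to \<open>D\<close> and then to
  \<open>E\<close>; afterwards the spaces V1, V4 and V2 are forced to vanish one after the other.
  Then both relations are zero and any nonzero vector splits off a copy of K.\<close>

theorem splits_some_type:
  assumes "f \<in> U" "f \<noteq> 0"
  shows "\<exists>\<tau>\<in>types. splits U P Q \<tau>"
proof (rule ccontr)
  assume "\<not> ?thesis"
  then have no: False if "splits U P Q \<tau>" "\<tau> \<in> types" for \<tau> using that by blast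
  have Qex: "\<exists>z. Q a z" if "P 0 a" for a using that P0 by blast
  have H2: "D y" if h: "P 0 a" "P a y" for a y
  proof (rule ccontr)
    assume y: "\<not> D y"
    obtain z where z: "Q a z" using Qex h by blast
    have N: "\<not> Q a q" if h: "P 0 a" "P a y" "\<not> D y" "P p q" for a y p q
    proof
      assume "Q a q"
      then show False by (intro no[OF case1A[OF h(1-4)]]) (auto simp: types_def)
    qed
    show False by (rule no[OF case1B[OF h(2) y z N]]) (auto simp: types_def)
  qed
  have H3: "D y" if h: "P b y" for b y
  proof (rule ccontr)
    assume y: "\<not> D y"
    have N: "D y" if h: "P 0 a" "P a p" "P p q" "Q a (y + q)" "P b y" for a p q y b
      by (rule ccontr, rule no[OF case2A[OF h(1-5) _ H2]]) (auto simp: types_def)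
    show False by (rule no[OF case2B[OF h y H2 N]]) (auto simp: types_def)
  qed
  \<comment> \<open>Images under \<open>P\<close> may be changed by V2, so an image in
    \<open>D\<close> may be taken in V4.\<close>
  have split_D: "\<exists>d. Q 0 d \<and> P a d \<and> \<not> E d" if h: "P a y" "\<not> E y" for a y
  proof -
    obtain d2 d4 where d: "P 0 d2" "Q 0 d4" "y = d2 + d4" using H3[OF h(1)] unfolding D_def by blast
    have "P (a - 0) (y - d2)" by (intro linrelD(4)[OF Pl] h d)
    then have "P a d4" using d(3) by simp
    moreover have "\<not> E d4" using h(2) E_V2[OF d(1)] d(3) sub_E unfolding sub_def by blast
    ultimately show ?thesis using d by blast
  qed
  have split_Q: "\<exists>q. P 0 q \<and> Q a q" if h: "Q a z" "D z" for a z
  proof -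
    obtain d2 d4 where d: "P 0 d2" "Q 0 d4" "z = d2 + d4" using h(2) unfolding D_def by blast
    have "Q (a - 0) (z - d4)" by (intro linrelD(4)[OF Ql] h d)
    then show ?thesis using d by auto
  qed
  have H4: "E y" if h: "P 0 a" "P a y" for a y
  proof (rule ccontr)
    assume y: "\<not> E y"
    obtain d where d: "Q 0 d" "P a d" "\<not> E d" using split_D[OF h(2) y] by blast
    obtain z where z: "Q a z" using Qex h by blast
    have N: "\<not> D z" if a: "P 0 a" "P a y" "\<not> E y" "Q a z" for a y z
    proof
      assume "D z"
      then obtain q where q: "P 0 q" "Q a q" using split_Q a(4) by blast
      obtain d where d: "Q 0 d" "P a d" "\<not> E d" using split_D[OF a(2,3)] by blast
      show False by (rule no[OF case3A[OF a(1) d(2,1,3) q]]) (auto simp: types_def)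
    qed
    show False by (rule no[OF case3B[OF d(2,1,3) z H3 N]]) (auto simp: types_def)
  qed
  have H5: "E y" if h: "P b y" for b y
  proof (rule ccontr)
    assume y: "\<not> E y"
    obtain d where d: "Q 0 d" "P b d" "\<not> E d" using split_D[OF h(1) y] by blast
    show False by (rule no[OF case4[OF d(2,1,3) H4]]) (auto simp: types_def)
  qed
  \<comment> \<open>In the same way an image in \<open>E\<close> may be taken in V1, where
    \<open>P\<close> applies again.\<close>
  have split_P: "\<exists>p q. P a p \<and> P p q" if h: "P a y" for a y
  proof -
    obtain x w v where "P x w" "P 0 v" "y = x + v" using H5[OF h] unfolding E_def by blast
    moreover have "P (a - 0) (y - v)" by (intro linrelD(4)[OF Pl] h \<open>P 0 v\<close>)
    ultimately show ?thesis by auto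
  qed
  have H5a: "D z" if h: "P a y" "Q a z" for a y z
  proof (rule ccontr)
    assume z: "\<not> D z"
    obtain p q where "P a p" "P p q" using split_P[OF h(1)] by blast
    from no[OF case5a[OF this h(2) z H3]] show False by (auto simp: types_def)
  qed
  have H5b: "D z" if h: "Q 0 c" "Q c z" for c z
    by (rule ccontr, rule no[OF case5b[OF h _ H3 H5a]]) (auto simp: types_def)
  have H6: "D z" if h: "Q e z" for e z
    by (rule ccontr, rule no[OF case5c[OF h _ H3 H5b]]) (auto simp: types_def)
  have Ha: "a = 0" if h: "P 0 a" "P a y" for a y
  proof (rule ccontr)
    assume a: "a \<noteq> 0"
    obtain p q1 where p: "P a p" "P p q1" using split_P[OF h(2)] by blast
    obtain z where "Q a z" using Qex h by blast
    then obtain q0 where q0: "P 0 q0" "Q a q0" using split_Q H6 by blast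
    \<comment> \<open>One and the same vector must be an image of \<open>p\<close> under
      \<open>P\<close> and of \<open>a\<close> under \<open>Q\<close>. The part \<open>v\<close> of
      \<open>q1\<close> lies in V1, hence in V4, and \<open>q0\<close> lies in V2; so v + q0 serves
      for both.\<close>
    obtain v w v2 where v: "P v w" "P 0 v2" "q1 = v + v2" using H5[OF p(2)] unfolding E_def by blast
    have "P (p + 0) (q1 + (q0 - v2))"
      by (intro linrelD(2)[OF Pl] p(2) sub_diff[OF sub_V2] q0(1) v(2))
    then have "P p (v + q0)" using v(3) by (simp add: algebra_simps)
    moreover have "Q (0 + a) (v + q0)" by (intro linrelD(2)[OF Ql] PQ[OF v(1)] q0(2))
    then have "Q a (v + q0)" by simp
    ultimately show False by (intro no[OF case6a[OF p(1) _ _ a]]) (auto simp: types_def)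
  qed
  have Hb: "b = 0" if h: "P b y" for b y
  proof (rule ccontr)
    assume b: "b \<noteq> 0"
    obtain p q where p: "P b p" "P p q" using split_P[OF h] by blast
    have "\<not> P 0 b" using Ha h b by blast
    from no[OF case6b[OF p this]] show False by (auto simp: types_def)
  qed
  have Hc: "c = 0" if h: "Q 0 c" "P 0 c" for c
  proof (rule ccontr)
    assume c: "c \<noteq> 0"
    obtain z where "Q c z" using Qex h by blast
    then obtain q where q: "P 0 q" "Q c q" using split_Q H6 by blast
    show False by (rule no[OF case6c[OF h(1) q(2,1) c Hb]]) (auto simp: types_def)
  qed
  have Hd: "d = 0" if h: "Q 0 d" for d
  proof (rule ccontr)
    assume d: "d \<noteq> 0"
    then have "\<not> P 0 d" using Hc h by blast
    from no[OF case6d[OF h this Hb]] show False by (auto simp: types_def)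
  qed
  have He: "e = 0" if h: "Q e z" for e z
  proof (rule ccontr)
    assume e: "e \<noteq> 0"
    obtain q where q: "P 0 q" "Q e q" using split_Q H6 h by blast
    show False by (rule no[OF case6e[OF q(2,1) e Hb Hd]]) (auto simp: types_def)
  qed
  have N1: "x = 0 \<and> y = 0" if h: "P x y" for x y
    using h Hb[OF h] P0 He by blast
  have N2: "z = 0" if h: "Q y z" for y z
    using He[OF h] h Hd by blast
  show False by (rule no[OF case6f[OF assms N1 N2]]) (auto simp: types_def)
qed

end

section \<open>Laurent series with restricted support\<close>

notation fls_nth (infixl "$$" 75)

definition supp_in :: "int set \<Rightarrow> 'k::field fls set"
  where "supp_in A = {f. \<forall>i. f $$ i \<noteq> 0 \<longrightarrow> i \<in> A}"

abbreviation tail :: "nat \<Rightarrow> 'k::field fls set"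
  where "tail c \<equiv> supp_in {int c..}"

text \<open>The monomial t^i for an arbitrary integer \<open>i\<close>.\<close>

definition tp :: "int \<Rightarrow> 'k::field fls" where "tp i = fls_shift (- i) 1"

lemma tp_nth [simp]: "tp i $$ n = (if n = i then 1 else 0)"
  by (auto simp: tp_def)

lemma tp_times_nth [simp]: "(tp i * f) $$ n = f $$ (n - i)" "(f * tp i) $$ n = f $$ (n - i)"
  unfolding tp_def by (simp_all add: fls_X_intpow_times_conv_shift)

lemma tp_power: "fls_X ^ n = tp (int n)"
  by (intro fls_eqI) simp

lemma tp_nonzero [simp]: "tp i \<noteq> 0"
  by (rule fls_nonzeroI[of _ i]) simp

lemma tp_mult: "tp i * tp j = tp (i + j)"
  by (intro fls_eqI) auto

lemma tp_0: "tp 0 = 1"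
  by (intro fls_eqI) auto

lemma supp_inI: "(\<And>i. f $$ i \<noteq> 0 \<Longrightarrow> i \<in> A) \<Longrightarrow> f \<in> supp_in A"
  by (simp add: supp_in_def)

lemma supp_inD: "f \<in> supp_in A \<Longrightarrow> i \<notin> A \<Longrightarrow> f $$ i = 0"
  by (auto simp: supp_in_def)

lemma supp_in_mono: "f \<in> supp_in A \<Longrightarrow> A \<subseteq> B \<Longrightarrow> f \<in> supp_in B"
  by (auto simp: supp_in_def)

lemma times_nth_nonzero:
  fixes f g :: "'k::field fls"
  assumes "(f * g) $$ n \<noteq> 0"
  obtains i where "f $$ i \<noteq> 0" "g $$ (n - i) \<noteq> 0"
proof -
  have "(\<Sum>i=fls_subdegree f..n - fls_subdegree g. f $$ i * g $$ (n - i)) \<noteq> 0"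
    using assms fls_times_nth(2)[of f g n] by simp
  then obtain i where "f $$ i * g $$ (n - i) \<noteq> 0" by (meson sum.neutral)
  then show ?thesis using that by auto
qed

lemma supp_in_closed [simp, intro]:
  "0 \<in> supp_in A"
  "f \<in> supp_in A \<Longrightarrow> g \<in> supp_in A \<Longrightarrow> f + g \<in> supp_in A"
  "f \<in> supp_in A \<Longrightarrow> - f \<in> supp_in A"
  "f \<in> supp_in A \<Longrightarrow> g \<in> supp_in A \<Longrightarrow> f - g \<in> supp_in A"
  "f \<in> supp_in A \<Longrightarrow> fls_const c * f \<in> supp_in A"
  "0 \<in> A \<Longrightarrow> fls_const c \<in> supp_in A"
  "0 \<in> A \<Longrightarrow> 1 \<in> supp_in A"
  "i \<in> A \<Longrightarrow> tp i \<in> supp_in A"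
  unfolding supp_in_def by (auto split: if_splits) (metis add.right_neutral, metis diff_zero)

lemma supp_in_sum: "(\<And>x. x \<in> X \<Longrightarrow> f x \<in> supp_in A) \<Longrightarrow> sum f X \<in> supp_in A"
  by (induction X rule: infinite_finite_induct) auto

lemma supp_in_mult:
  assumes "f \<in> supp_in A" "g \<in> supp_in B" "\<And>i j. i \<in> A \<Longrightarrow> j \<in> B \<Longrightarrow> i + j \<in> C"
  shows "f * g \<in> supp_in C"
proof (rule supp_inI)
  fix n assume "(f * g) $$ n \<noteq> 0"
  then obtain i where "f $$ i \<noteq> 0" "g $$ (n - i) \<noteq> 0" by (rule times_nth_nonzero)
  then have "i \<in> A" "n - i \<in> B" using assms(1,2) by (auto simp: supp_in_def)
  then show "n \<in> C" using assms(3)[of i "n - i"] by simp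
qed

lemma subdegree_supp: "f \<noteq> 0 \<Longrightarrow> f \<in> supp_in {i..} \<longleftrightarrow> i \<le> fls_subdegree f"
proof
  assume "f \<noteq> 0" "f \<in> supp_in {i..}"
  then show "i \<le> fls_subdegree f"
    using nth_fls_subdegree_nonzero[of f] by (auto simp: supp_in_def)
next
  assume "i \<le> fls_subdegree f"
  then show "f \<in> supp_in {i..}"
    by (intro supp_inI) (meson atLeast_iff fls_subdegree_leI order_trans)
qed

lemma integral_times_nth:
  assumes "f \<in> supp_in {0..}" "g \<in> supp_in {0..}"
  shows "(f * g) $$ n = (\<Sum>i=0..n. f $$ i * g $$ (n - i))"
proof (cases "f = 0 \<or> g = 0")
  case False
  then have d: "0 \<le> fls_subdegree f" "0 \<le> fls_subdegree g" using assms subdegree_supp by blast+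
  have "(f * g) $$ n = (\<Sum>i=fls_subdegree f..n - fls_subdegree g. f $$ i * g $$ (n - i))"
    by (rule fls_times_nth(2))
  also have "\<dots> = (\<Sum>i=0..n. f $$ i * g $$ (n - i))"
    using d by (intro sum.mono_neutral_left) auto
  finally show ?thesis .
qed auto

lemma times_nth_0:
  assumes "f \<in> supp_in {0..}" "g \<in> supp_in {0..}"
  shows "(f * g) $$ 0 = f $$ 0 * g $$ 0"
  using integral_times_nth[OF assms, of 0] by simp

lemma tail_shift: "f \<in> supp_in {i..} \<longleftrightarrow> (\<exists>g\<in>supp_in {0..}. f = tp i * g)"
proof
  assume "f \<in> supp_in {i..}"
  then have "tp (- i) * f \<in> supp_in {0..}" by (auto simp: supp_in_def)
  moreover have "f = tp i * (tp (- i) * f)" by (simp add: mult.assoc[symmetric] tp_mult tp_0)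
  ultimately show "\<exists>g\<in>supp_in {0..}. f = tp i * g" by blast
qed (auto simp: supp_in_def)

lemma exists_tail: "\<exists>n. tp (int n) * (f::'k::field fls) \<in> tail c"
proof (cases "f = 0")
  case False
  define n where "n = nat (int c - fls_subdegree f)"
  have "tp (int n) * f \<in> tail c"
    unfolding n_def by (intro supp_inI) (smt (verit) atLeast_iff fls_eq0_below_subdegree nat_0_le tp_times_nth(1) int_nat_eq)
  then show ?thesis by blast
qed auto

section \<open>Numerical semigroup rings\<close>

locale numsg =
  fixes H :: "nat set"
  assumes numerical: "numerical_semigroup H"
begin

lemma H0: "0 \<in> H" and Hadd: "x \<in> H \<Longrightarrow> y \<in> H \<Longrightarrow> x + y \<in> H" and Hfin: "finite (- H)"
  using numerical by (auto simp: numerical_semigroup_def)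

lemma exists_conductor: "\<exists>c. \<forall>n\<ge>c. n \<in> H"
proof -
  obtain c where "\<forall>n\<in>- H. n < c" using finite_nat_set_iff_bounded[of "- H"] Hfin by auto
  then show ?thesis by (metis ComplI not_less)
qed

definition cnd :: nat where "cnd = (LEAST c. \<forall>n\<ge>c. n \<in> H)"

lemma cnd: "n \<ge> cnd \<Longrightarrow> n \<in> H"
  using LeastI_ex[OF exists_conductor] unfolding cnd_def by blast

lemma cnd_least: "(\<And>n. n \<ge> c \<Longrightarrow> n \<in> H) \<Longrightarrow> cnd \<le> c"
  unfolding cnd_def by (rule Least_le) blast

lemma cnd_pred: "cnd \<noteq> 0 \<Longrightarrow> cnd - 1 \<notin> H"
proof
  assume "cnd \<noteq> 0" "cnd - 1 \<in> H"
  then have "n \<in> H" if "n \<ge> cnd - 1" for n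
    using that cnd[of n] by (cases "n = cnd - 1") auto
  then have "cnd \<le> cnd - 1" by (rule cnd_least)
  then show False using \<open>cnd \<noteq> 0\<close> by auto
qed

definition S :: "'k::field fls set" where "S = supp_in (int ` H)"

lemma S_closed [simp, intro]:
  "0 \<in> S" "1 \<in> S" "f \<in> S \<Longrightarrow> g \<in> S \<Longrightarrow> f + g \<in> S" "f \<in> S \<Longrightarrow> - f \<in> S"
  "f \<in> S \<Longrightarrow> g \<in> S \<Longrightarrow> f - g \<in> S" "fls_const c \<in> S"
  using H0 unfolding S_def by (auto intro!: supp_in_closed)

lemma S_mult [simp, intro]: "f \<in> S \<Longrightarrow> g \<in> S \<Longrightarrow> f * g \<in> S"
  unfolding S_def by (erule supp_in_mult) (use Hadd in \<open>auto simp flip: of_nat_add\<close>)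

lemma S_integral: "f \<in> S \<Longrightarrow> f \<in> supp_in {0..}"
  unfolding S_def by (erule supp_in_mono) auto

lemma tail_S: "f \<in> tail cnd \<Longrightarrow> f \<in> S"
  unfolding S_def
proof (erule supp_in_mono)
  show "{int cnd..} \<subseteq> int ` H"
  proof
    fix i assume "i \<in> {int cnd..}"
    then have "nat i \<in> H" "i = int (nat i)" using cnd[of "nat i"] by auto
    then show "i \<in> int ` H" by blast
  qed
qed

lemma tp_S: "tp (int n) \<in> S \<longleftrightarrow> n \<in> H"
  by (auto simp: S_def supp_in_def)

lemma semigroup_ring_eq: "semigroup_ring H = fls_subring S"
  by (simp add: semigroup_ring_def S_def supp_in_def)

lemma carrier_ring [simp]: "carrier (semigroup_ring H) = S"
  by (simp add: semigroup_ring_eq fls_subring_def)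

lemma ring_simps [simp]:
  "mult (semigroup_ring H) = (*)" "one (semigroup_ring H) = 1" "zero (semigroup_ring H) = 0"
  "add (semigroup_ring H) = (+)"
  by (simp_all add: semigroup_ring_def fls_subring_def)

lemma cring_R: "cring (semigroup_ring H :: 'k::field fls ring)"
proof (rule cringI)
  show "abelian_group (semigroup_ring H :: 'k fls ring)"
  proof (rule abelian_groupI)
    fix x :: "'k fls" assume "x \<in> carrier (semigroup_ring H)"
    then show "\<exists>y\<in>carrier (semigroup_ring H). y \<oplus>\<^bsub>semigroup_ring H\<^esub> x = \<zero>\<^bsub>semigroup_ring H\<^esub>"
      by (intro bexI[of _ "- x"]) auto
  qed (auto simp: algebra_simps)
  show "Group.comm_monoid (semigroup_ring H :: 'k fls ring)"
    by (rule comm_monoidI) (auto simp: algebra_simps)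
qed (auto simp: algebra_simps)

text \<open>If \<open>n\<close> is a gap and i lies in \<open>H\<close>, then n - i is no element of
  \<open>H\<close>; the recursion for the coefficients of the inverse therefore stays among the
  gaps.\<close>

lemma inverse_S:
  assumes "f \<in> S" "f $$ 0 \<noteq> 0"
  shows "inverse f \<in> S"
proof -
  have f0: "f \<noteq> 0" using assms by auto
  have "fls_subdegree f = 0"
    using S_integral[OF assms(1)] f0 subdegree_supp[of f 0] fls_subdegree_leI[OF assms(2)] by force
  then have sd: "fls_subdegree (inverse f) = 0" by (simp add: fls_inverse_subdegree)
  then have io: "inverse f \<in> supp_in {0..}"
    using f0 by (subst subdegree_supp) auto
  have "inverse f $$ int n = 0" if "n \<notin> H" for n
    using that
  proof (induction n rule: less_induct)
    case (less n)
    then have "n \<noteq> 0" using H0 by metis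
    then have "0 = (f * inverse f) $$ int n" using f0 by simp
    also have "\<dots> = (\<Sum>i=0..int n. f $$ i * inverse f $$ (int n - i))"
      by (rule integral_times_nth[OF S_integral[OF assms(1)] io])
    also have "\<dots> = (\<Sum>i\<in>{0}. f $$ i * inverse f $$ (int n - i))"
    proof (intro sum.mono_neutral_right ballI)
      fix i assume i: "i \<in> {0..int n} - {0}"
      show "f $$ i * inverse f $$ (int n - i) = 0"
      proof (cases "nat i \<in> H")
        case True
        have "nat (int n - i) \<notin> H" using Hadd[OF True, of "nat (int n - i)"] less.prems i
          by (auto simp: nat_add_distrib[symmetric])
        moreover have "nat (int n - i) < n" using i by auto
        ultimately have "inverse f $$ int (nat (int n - i)) = 0" by (intro less.IH)
        then show ?thesis using i by auto
      next
        case False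
        then have "i \<notin> int ` H" by auto
        then have "f $$ i = 0" using assms(1) unfolding S_def by (intro supp_inD)
        then show ?thesis by simp
      qed
    qed auto
    finally show ?case using assms(2) by simp
  qed
  then have "i \<in> int ` H" if "inverse f $$ i \<noteq> 0" for i
    using that io supp_inD[OF io, of i] by (cases i) auto
  then show ?thesis unfolding S_def by (rule supp_inI)
qed

end

section \<open>Isomorphisms and direct summands\<close>

lemma mod_isomorphic_trans:
  assumes "module R M" "mod_isomorphic R M N" "mod_isomorphic R N K"
  shows "mod_isomorphic R M K"
proof -
  interpret module R M by fact
  obtain f where f: "f \<in> mod_hom R M N" "bij_betw f (carrier M) (carrier N)"
    using assms(2) by (auto simp: mod_isomorphic_def)
  obtain g where g: "g \<in> mod_hom R N K" "bij_betw g (carrier N) (carrier K)"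
    using assms(3) by (auto simp: mod_isomorphic_def)
  have fc: "f x \<in> carrier N" if "x \<in> carrier M" for x using f(1) that by (auto simp: mod_hom_def)
  have gc: "g x \<in> carrier K" if "x \<in> carrier N" for x using g(1) that by (auto simp: mod_hom_def)
  let ?h = "\<lambda>x\<in>carrier M. g (f x)"
  have "?h \<in> mod_hom R M K"
    using f(1) g(1) fc gc by (auto simp: mod_hom_def)
  moreover have "bij_betw (g \<circ> f) (carrier M) (carrier K)"
    using bij_betw_trans[OF f(2) g(2)] .
  then have "bij_betw ?h (carrier M) (carrier K)"
    by (rule bij_betw_cong[THEN iffD1, rotated]) auto
  ultimately show ?thesis unfolding mod_isomorphic_def by blast
qed

lemma indecomposable_transfer:
  assumes "indecomposable_module R M" "module R N" and f: "f \<in> mod_hom R M N"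
    and bij: "bij_betw f (carrier M) (carrier N)"
  shows "indecomposable_module R N"
proof -
  interpret M: module R M using assms(1) by (simp add: indecomposable_module_def)
  interpret N: module R N by fact
  have fc: "f x \<in> carrier N" if "x \<in> carrier M" for x using f that by (auto simp: mod_hom_def)
  have fadd: "f (x \<oplus>\<^bsub>M\<^esub> y) = f x \<oplus>\<^bsub>N\<^esub> f y" if "x \<in> carrier M" "y \<in> carrier M" for x y
    using f that by (auto simp: mod_hom_def)
  have fsm: "f (r \<odot>\<^bsub>M\<^esub> x) = r \<odot>\<^bsub>N\<^esub> f x" if "r \<in> carrier R" "x \<in> carrier M" for r x
    using f that by (auto simp: mod_hom_def)
  have f0: "f \<zero>\<^bsub>M\<^esub> = \<zero>\<^bsub>N\<^esub>"
    using fsm[of "\<zero>\<^bsub>R\<^esub>" "\<zero>\<^bsub>M\<^esub>"] fc by simp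
  have inj: "inj_on f (carrier M)" and img: "f ` carrier M = carrier N"
    using bij by (auto simp: bij_betw_def)
  have f0': "x = \<zero>\<^bsub>M\<^esub>" if "x \<in> carrier M" "f x = \<zero>\<^bsub>N\<^esub>" for x
    using inj_onD[OF inj, of x "\<zero>\<^bsub>M\<^esub>"] that f0 by simp
  have fneg: "f (\<ominus>\<^bsub>M\<^esub> x) = \<ominus>\<^bsub>N\<^esub> f x" if "x \<in> carrier M" for x
  proof -
    have "f (\<ominus>\<^bsub>M\<^esub> x) \<oplus>\<^bsub>N\<^esub> f x = \<zero>\<^bsub>N\<^esub>"
      using fadd[of "\<ominus>\<^bsub>M\<^esub> x" x] that f0 by (simp add: M.M.l_neg)
    then show ?thesis using fc that by (intro N.M.minus_equality[symmetric]) auto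
  qed
  define pre where "pre A = {x \<in> carrier M. f x \<in> A}" for A
  have pre: "submodule (pre A) R M" if "submodule A R N" for A
  proof -
    note A = N.submoduleE[OF that]
    have "\<zero>\<^bsub>N\<^esub> \<in> A"
      using A(1-5) by (metis N.M.r_neg all_not_in_conv subsetD)
    then show ?thesis
      using A f0 fneg fadd fsm by (intro M.submoduleI) (auto simp: pre_def)
  qed
  have surj_pre: "f ` pre A = A" if "submodule A R N" for A
    using N.submoduleE(1)[OF that] img by (auto simp: pre_def)
  show ?thesis
    unfolding indecomposable_module_def
  proof (intro conjI allI impI)
    show "module R N" by fact
    show "carrier N \<noteq> {\<zero>\<^bsub>N\<^esub>}"
    proof
      assume "carrier N = {\<zero>\<^bsub>N\<^esub>}"
      then have "carrier M = {\<zero>\<^bsub>M\<^esub>}" using f0' fc by auto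
      then show False using assms(1) by (simp add: indecomposable_module_def)
    qed
  next
    fix A B
    assume AB: "submodule A R N \<and> submodule B R N \<and> A \<inter> B = {\<zero>\<^bsub>N\<^esub>} \<and> A <+>\<^bsub>N\<^esub> B = carrier N"
    then have zA: "\<zero>\<^bsub>N\<^esub> \<in> A" "\<zero>\<^bsub>N\<^esub> \<in> B" by auto
    have sA: "A \<subseteq> carrier N" "B \<subseteq> carrier N" using AB N.submoduleE(1) by auto
    have "pre A \<inter> pre B = {\<zero>\<^bsub>M\<^esub>}"
      using AB f0' f0 zA by (auto simp: pre_def)
    moreover have "pre A <+>\<^bsub>M\<^esub> pre B = carrier M"
    proof (intro equalityI subsetI)
      fix x assume "x \<in> pre A <+>\<^bsub>M\<^esub> pre B"
      then show "x \<in> carrier M" by (auto simp: set_add_def' pre_def)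
    next
      fix x assume x: "x \<in> carrier M"
      then have "f x \<in> A <+>\<^bsub>N\<^esub> B" using AB fc by auto
      then obtain a b where ab: "a \<in> A" "b \<in> B" "f x = a \<oplus>\<^bsub>N\<^esub> b" by (auto simp: set_add_def')
      then have "a \<in> f ` carrier M" "b \<in> f ` carrier M" using sA img by auto
      then obtain a' b' where a': "a' \<in> carrier M" "f a' = a" "b' \<in> carrier M" "f b' = b" by blast
      have "f x = f (a' \<oplus>\<^bsub>M\<^esub> b')" using fadd[OF a'(1,3)] a'(2,4) ab(3) by simp
      then have "x = a' \<oplus>\<^bsub>M\<^esub> b'" using inj_onD[OF inj _ x M.M.a_closed[OF a'(1,3)]] by simp
      then show "x \<in> pre A <+>\<^bsub>M\<^esub> pre B" using a' ab by (auto simp: set_add_def' pre_def)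
    qed
    ultimately have "pre A = {\<zero>\<^bsub>M\<^esub>} \<or> pre B = {\<zero>\<^bsub>M\<^esub>}"
      using assms(1) pre[of A] pre[of B] AB unfolding indecomposable_module_def by blast
    then have "f ` pre A = {\<zero>\<^bsub>N\<^esub>} \<or> f ` pre B = {\<zero>\<^bsub>N\<^esub>}"
      using f0 by (elim disjE) (simp_all only: image_insert image_empty simp_thms)
    then show "A = {\<zero>\<^bsub>N\<^esub>} \<or> B = {\<zero>\<^bsub>N\<^esub>}"
      using surj_pre[of A] surj_pre[of B] AB by simp
  qed
qed

section \<open>Submodules of powers of the Laurent series field\<close>

definition sm :: "'k::field fls \<Rightarrow> (nat \<Rightarrow> 'k fls) \<Rightarrow> nat \<Rightarrow> 'k fls"
  where "sm r f = (\<lambda>i. r * f i)"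

lemma sm_apply [simp]: "sm r f i = r * f i"
  by (simp add: sm_def)

lemma sm_simps [simp]: "sm r 0 = 0" "sm 0 f = 0" "sm 1 f = f" "sm (- 1) f = - f"
  "sm r (sm s f) = sm (r * s) f"
  by (auto simp: fun_eq_iff mult.assoc)

lemma sm_distrib: "sm r (f + g) = sm r f + sm r g" "sm (r + s) f = sm r f + sm s f"
  "sm r (f - g) = sm r f - sm r g" "sm (r - s) f = sm r f - sm s f"
  by (auto simp: fun_eq_iff algebra_simps)

lemma sm_eq_0: "sm r f = 0 \<longleftrightarrow> r = 0 \<or> f = 0"
  by (auto simp: fun_eq_iff)

definition cm :: "(nat \<Rightarrow> 'k::field fls) set \<Rightarrow> 'k lmodule"
  where "cm N = \<lparr>carrier = N, mult = undefined, one = undefined, zero = 0, add = (+), smult = sm\<rparr>"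

lemma cm_simps [simp]: "carrier (cm N) = N" "zero (cm N) = 0" "add (cm N) = (+)" "smult (cm N) = sm"
  by (simp_all add: cm_def)

text \<open>The scalars form an arbitrary set, so that the same \<open>N\<close> can be tested
  against R, B, K or the series of high order.\<close>

definition stable :: "'k::field fls set \<Rightarrow> (nat \<Rightarrow> 'k fls) set \<Rightarrow> bool"
  where "stable T N \<longleftrightarrow> 0 \<in> N \<and> (\<forall>x\<in>N. \<forall>y\<in>N. x + y \<in> N \<and> x - y \<in> N) \<and> (\<forall>r\<in>T. \<forall>x\<in>N. sm r x \<in> N)"

lemma stableD:
  assumes "stable T N"
  shows "0 \<in> N" "x \<in> N \<Longrightarrow> y \<in> N \<Longrightarrow> x + y \<in> N" "x \<in> N \<Longrightarrow> y \<in> N \<Longrightarrow> x - y \<in> N"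
    "r \<in> T \<Longrightarrow> x \<in> N \<Longrightarrow> sm r x \<in> N" "x \<in> N \<Longrightarrow> - x \<in> N"
proof -
  show "x \<in> N \<Longrightarrow> - x \<in> N"
    using assms unfolding stable_def by (metis diff_0)
qed (use assms in \<open>auto simp: stable_def\<close>)

lemma stable_subset: "stable T N \<Longrightarrow> T' \<subseteq> T \<Longrightarrow> stable T' N"
  by (auto simp: stable_def)

lemma stable_sum: "stable T N \<Longrightarrow> (\<And>x. x \<in> X \<Longrightarrow> f x \<in> N) \<Longrightarrow> sum f X \<in> N"
  by (induction X rule: infinite_finite_induct) (auto simp: stableD)

definition On :: "nat \<Rightarrow> (nat \<Rightarrow> 'k::field fls) set"
  where "On n = {f. \<forall>i. (i < n \<longrightarrow> f i \<in> supp_in {0..}) \<and> (i \<ge> n \<longrightarrow> f i = 0)}"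

definition unit :: "nat \<Rightarrow> nat \<Rightarrow> 'k::field fls"
  where "unit i = (\<lambda>j. if j = i then 1 else 0)"

text \<open>A lattice in normal position: its k[[t]]-span is k[[t]]^n, and the standard basis is
  taken from \<open>N\<close> itself.\<close>

definition frame :: "nat \<Rightarrow> (nat \<Rightarrow> 'k::field fls) set \<Rightarrow> bool"
  where "frame n N \<longleftrightarrow> N \<subseteq> On n \<and> (\<forall>i<n. unit i \<in> N)"

context numsg
begin

lemma module_cm:
  fixes N :: "(nat \<Rightarrow> 'k::field fls) set"
  assumes "stable S N"
  shows "module (semigroup_ring H) (cm N)"
proof (rule moduleI)
  show "cring (semigroup_ring H :: 'k fls ring)" by (rule cring_R)
  show "abelian_group (cm N)"
  proof (rule abelian_groupI)
    fix x assume "x \<in> carrier (cm N)"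
    then show "\<exists>y\<in>carrier (cm N). y \<oplus>\<^bsub>cm N\<^esub> x = \<zero>\<^bsub>cm N\<^esub>"
      using stableD[OF assms] by (intro bexI[of _ "- x"]) auto
  qed (use stableD[OF assms] in \<open>auto simp: add_ac\<close>)
qed (use stableD[OF assms] in \<open>auto simp: sm_distrib\<close>)

lemma submodule_cm:
  fixes N :: "(nat \<Rightarrow> 'k::field fls) set"
  assumes "stable S N" "stable S A" "A \<subseteq> N"
  shows "submodule A (semigroup_ring H) (cm N)"
proof -
  interpret module "semigroup_ring H" "cm N" by (rule module_cm[OF assms(1)])
  show ?thesis
  proof (rule submoduleI)
    fix a assume a: "a \<in> A"
    have "\<ominus>\<^bsub>cm N\<^esub> a = - a"
      using a assms(3) stableD(5)[OF assms(2)] by (intro M.minus_equality) auto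
    then show "\<ominus>\<^bsub>cm N\<^esub> a \<in> A" using stableD(5)[OF assms(2) a] by simp
  qed (use assms(3) stableD[OF assms(2)] in auto)
qed

lemma iso_cm:
  assumes "stable S N" "bij_betw \<phi> N N'"
    and "\<And>x y. x \<in> N \<Longrightarrow> y \<in> N \<Longrightarrow> \<phi> (x + y) = \<phi> x + \<phi> y"
    and "\<And>r x. r \<in> S \<Longrightarrow> x \<in> N \<Longrightarrow> \<phi> (sm r x) = sm r (\<phi> x)"
  shows "mod_isomorphic (semigroup_ring H) (cm N) (cm N')"
proof -
  have "restrict \<phi> N \<in> mod_hom (semigroup_ring H) (cm N) (cm N')"
    using assms stableD[OF assms(1)] bij_betwE[OF assms(2)] by (auto simp: mod_hom_def)
  moreover have "bij_betw (restrict \<phi> N) N N'"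
    using assms(2) by (rule bij_betw_cong[THEN iffD1, rotated]) auto
  ultimately show ?thesis
    unfolding mod_isomorphic_def by (intro bexI[of _ "restrict \<phi> N"]) simp_all
qed

text \<open>If r x = a + b with \<open>x\<close> in \<open>A\<close>, multiply by t^c: both t^c and
  t^c r are scalars for \<open>A\<close>, so t^c b lies in both summands and is 0.\<close>

lemma tail_complement_stable:
  fixes N :: "(nat \<Rightarrow> 'k::field fls) set"
  assumes N: "stable S N" and A: "stable (tail c) A" "A \<subseteq> N" and B: "stable (tail c) B" "B \<subseteq> N"
    and AB: "A \<inter> B = {0}" "\<And>x. x \<in> N \<Longrightarrow> \<exists>a\<in>A. \<exists>b\<in>B. x = a + b"
  shows "stable S A"
  unfolding stable_def
proof (intro conjI ballI)
  fix r x assume r: "(r::'k fls) \<in> S" and x: "x \<in> A"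
  obtain a b where ab: "a \<in> A" "b \<in> B" "sm r x = a + b"
    using AB(2) stableD(4)[OF N r] x A(2) by blast
  let ?t = "tp (int c) :: 'k fls"
  have t: "?t \<in> tail c" "?t * r \<in> tail c"
    using S_integral[OF r] tail_shift[of "?t * r" "int c"] by auto
  have "sm ?t b = sm (?t * r) x - sm ?t a"
    using arg_cong[OF ab(3), of "sm ?t"] by (simp add: sm_distrib)
  then have "sm ?t b \<in> A" using stableD(3,4)[OF A(1)] t x ab(1) by auto
  moreover have "sm ?t b \<in> B" using stableD(4)[OF B(1) t(1) ab(2)] .
  ultimately have "sm ?t b = 0" using AB(1) by auto
  then have "b = 0" by (simp add: sm_eq_0)
  then show "sm r x \<in> A" using ab by simp
qed (use stableD[OF A(1)] in auto)

text \<open>Indecomposability over R thus refutes decompositions over any ring that contains the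
  series of high order.\<close>

lemma indecomposable_split:
  fixes N :: "(nat \<Rightarrow> 'k::field fls) set"
  assumes ind: "indecomposable_module (semigroup_ring H) (cm N)"
    and N: "stable S N" and A: "stable (tail c) A" "A \<subseteq> N" and B: "stable (tail c) B" "B \<subseteq> N"
    and AB: "A \<inter> B = {0}" "\<And>x. x \<in> N \<Longrightarrow> \<exists>a\<in>A. \<exists>b\<in>B. x = a + b"
  shows "A = {0} \<or> B = {0}"
proof -
  have SA: "stable S A" by (rule tail_complement_stable[OF assms(2-)])
  have SB: "stable S B"
  proof (rule tail_complement_stable[OF N B A])
    show "B \<inter> A = {0}" using AB(1) by auto
    show "\<exists>a\<in>B. \<exists>b\<in>A. x = a + b" if "x \<in> N" for x
      using AB(2)[OF that] by (metis add.commute)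
  qed
  have "A <+>\<^bsub>cm N\<^esub> B = carrier (cm N)"
    using AB(2) A(2) B(2) stableD(2)[OF N] unfolding set_add_def' cm_simps by blast
  moreover have "A \<inter> B = {\<zero>\<^bsub>cm N\<^esub>}" using AB(1) by simp
  ultimately have "A = {\<zero>\<^bsub>cm N\<^esub>} \<or> B = {\<zero>\<^bsub>cm N\<^esub>}"
    using ind submodule_cm[OF N SA A(2)] submodule_cm[OF N SB B(2)]
    unfolding indecomposable_module_def by blast
  then show ?thesis by simp
qed

end

text \<open>Fractional ideals are put into coordinate 0 in order to have the type of the common
  universe.\<close>

definition rank1 :: "'k::field fls set \<Rightarrow> (nat \<Rightarrow> 'k fls) set"
  where "rank1 I = {f. f 0 \<in> I \<and> (\<forall>i>0. f i = 0)}"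

text \<open>A linear form on an indecomposable module that takes a unit value is an isomorphism onto
  the ring; the ring \<open>k[[H0]]\<close> of the form need not be the ring \<open>k[[H]]\<close> of the module.\<close>

lemma (in numsg) unit_valued_form:
  fixes N :: "(nat \<Rightarrow> 'k::field fls) set"
  assumes ind: "indecomposable_module (semigroup_ring H) (cm N)" and N: "stable S N"
    and H0: "numsg H0" and N0: "stable (numsg.S H0) N"
    and \<phi>: "\<And>x. x \<in> N \<Longrightarrow> \<phi> x \<in> numsg.S H0"
    and add: "\<And>x y. x \<in> N \<Longrightarrow> y \<in> N \<Longrightarrow> \<phi> (x + y) = \<phi> x + \<phi> y"
    and lin: "\<And>r x. r \<in> S \<union> numsg.S H0 \<Longrightarrow> x \<in> N \<Longrightarrow> \<phi> (sm r x) = r * \<phi> x"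
    and x0: "x0 \<in> N" "\<phi> x0 $$ 0 \<noteq> 0"
  shows "mod_isomorphic (semigroup_ring H) (cm N) (cm (rank1 (numsg.S H0)))"
proof -
  interpret R0: numsg H0 by fact
  define u where "u = \<phi> x0"
  have u: "u \<in> R0.S" "u \<noteq> 0" "inverse u \<in> R0.S"
    using \<phi>[OF x0(1)] x0(2) R0.inverse_S[of u] by (auto simp: u_def)
  have neg: "- x \<in> N" if "x \<in> N" for x using stableD(5)[OF N that] .
  have \<phi>diff: "\<phi> (x - y) = \<phi> x - \<phi> y" if "x \<in> N" "y \<in> N" for x y
    using add[OF stableD(3)[OF N that] that(2)] by simp
  have \<phi>0: "\<phi> 0 = 0" using \<phi>diff[OF x0(1) x0(1)] by simp
  \<comment> \<open>The submodule \<open>A\<close> is free on \<open>x0\<close> and \<open>B\<close>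
    is the kernel of the form; the form splits because its value at \<open>x0\<close> is invertible
    in k[[H0]].\<close>
  define A where "A = (\<lambda>s. sm s x0) ` R0.S"
  define B where "B = {x \<in> N. \<phi> x = 0}"
  have tR0: "r \<in> R0.S" if "(r::'k fls) \<in> tail (R0.cnd)" for r using R0.tail_S that .
  have "stable R0.S A"
    unfolding stable_def
  proof (intro conjI ballI)
    show "0 \<in> A" unfolding A_def by (rule image_eqI[of _ _ 0]) auto
    fix x y assume "x \<in> A" "y \<in> A"
    then obtain s t where "x = sm s x0" "y = sm t x0" "s \<in> R0.S" "t \<in> R0.S" by (auto simp: A_def)
    then show "x + y \<in> A" "x - y \<in> A"
      unfolding A_def by (auto simp: sm_distrib[symmetric])
  qed (auto simp: A_def)
  then have A: "stable (tail R0.cnd) A" by (rule stable_subset) (use tR0 in auto)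
  have "stable R0.S B"
    using stableD[OF N0] add \<phi>diff \<phi>0 lin by (auto simp: stable_def B_def)
  then have B: "stable (tail R0.cnd) B" by (rule stable_subset) (use tR0 in auto)
  have AN: "A \<subseteq> N" using stableD(4)[OF N0 _ x0(1)] by (auto simp: A_def)
  have BN: "B \<subseteq> N" by (auto simp: B_def)
  have AB0: "A \<inter> B = {0}"
  proof
    show "A \<inter> B \<subseteq> {0}"
      using lin x0 u(2) by (auto simp: A_def B_def u_def)
    show "{0} \<subseteq> A \<inter> B" using stableD(1)[OF A] stableD(1)[OF B] by auto
  qed
  have dec: "\<exists>a\<in>A. \<exists>b\<in>B. x = a + b" if x: "x \<in> N" for x
  proof (intro bexI)
    let ?s = "\<phi> x * inverse u"
    have s: "?s \<in> R0.S" using \<phi>[OF x] u by auto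
    show "x = sm ?s x0 + (x - sm ?s x0)" by simp
    show "sm ?s x0 \<in> A" using s by (auto simp: A_def)
    have "sm ?s x0 \<in> N" using stableD(4)[OF N0 s x0(1)] .
    then show "x - sm ?s x0 \<in> B"
      using x stableD(3)[OF N x] \<phi>diff lin s x0(1) u(2) by (auto simp: B_def u_def[symmetric])
  qed
  have "A \<noteq> {0}"
  proof
    assume "A = {0}"
    moreover have "x0 \<in> A" unfolding A_def by (rule image_eqI[of _ _ 1]) auto
    ultimately show False using \<phi>0 u(2) by (auto simp: u_def)
  qed
  then have B0: "B = {0}"
    using indecomposable_split[OF ind N A AN B BN AB0 dec] by blast
  show ?thesis
  proof (rule iso_cm[OF N, where \<phi> = "\<lambda>x i. if i = 0 then \<phi> x else 0"])
    show "bij_betw (\<lambda>x i. if i = 0 then \<phi> x else 0) N (rank1 R0.S)"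
      unfolding bij_betw_def
    proof
      show "inj_on (\<lambda>x i. if i = (0::nat) then \<phi> x else 0) N"
      proof (rule inj_onI)
        fix x y assume xy: "x \<in> N" "y \<in> N"
          "(\<lambda>i. if i = (0::nat) then \<phi> x else 0) = (\<lambda>i. if i = 0 then \<phi> y else 0)"
        then have "\<phi> x = \<phi> y" by (metis (mono_tags))
        then have "x - y \<in> B" using xy \<phi>diff stableD(3)[OF N] by (auto simp: B_def)
        then show "x = y" using B0 by auto
      qed
      show "(\<lambda>x i. if i = (0::nat) then \<phi> x else 0) ` N = rank1 R0.S"
      proof (intro equalityI subsetI)
        fix f :: "nat \<Rightarrow> 'k fls" assume "f \<in> rank1 R0.S"
        then have f: "f 0 \<in> R0.S" "\<And>i. i > 0 \<Longrightarrow> f i = 0" by (auto simp: rank1_def)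
        let ?s = "f 0 * inverse u"
        have s: "?s \<in> R0.S" using f u by auto
        have "\<phi> (sm ?s x0) = f 0" using lin s x0(1) u(2) by (auto simp: u_def[symmetric])
        then have "f = (\<lambda>i. if i = 0 then \<phi> (sm ?s x0) else 0)" using f by (auto simp: fun_eq_iff)
        then show "f \<in> (\<lambda>x i. if i = (0::nat) then \<phi> x else 0) ` N"
          using stableD(4)[OF N0 s x0(1)] by blast
      qed (use \<phi> in \<open>auto simp: rank1_def\<close>)
    qed
  qed (use add lin in \<open>auto simp: fun_eq_iff\<close>)
qed

section \<open>Coefficient vectors\<close>

definition cv :: "(nat \<Rightarrow> 'k::field fls) \<Rightarrow> int \<Rightarrow> nat \<Rightarrow> 'k"
  where "cv f j = (\<lambda>i. f i $$ j)"

lemma cv_apply [simp]: "cv f j i = f i $$ j"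
  by (simp add: cv_def)

lemma cv_simps [simp]: "cv 0 j = 0" "cv (f + g) j = cv f j + cv g j" "cv (f - g) j = cv f j - cv g j"
  "cv (- f) j = - cv f j"
  by (auto simp: fun_eq_iff)

lemma cv_eqI: "(\<And>j. cv f j = cv g j) \<Longrightarrow> f = g"
  by (auto simp: fun_eq_iff fls_eq_iff)

lemma OnD: "f \<in> On n \<Longrightarrow> j < 0 \<Longrightarrow> cv f j = 0" "f \<in> On n \<Longrightarrow> cv f j \<in> Usp n"
  unfolding On_def Usp_def by (auto simp: fun_eq_iff) (metis atLeast_iff linorder_not_less supp_inD fls_zero_nth)

lemma On_iff: "f \<in> On n \<longleftrightarrow> (\<forall>j<0. cv f j = 0) \<and> (\<forall>j. cv f j \<in> Usp n)"
proof
  assume "(\<forall>j<0. cv f j = 0) \<and> (\<forall>j. cv f j \<in> Usp n)"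
  then have 1: "\<And>i j. j < 0 \<Longrightarrow> f i $$ j = 0" and 2: "\<And>i j. n \<le> i \<Longrightarrow> f i $$ j = 0"
    by (auto simp: fun_eq_iff Usp_def)
  then show "f \<in> On n"
    unfolding On_def by (auto intro!: supp_inI fls_eqI) (meson linorder_not_less)
qed (use OnD in blast)

lemma stable_On: "stable (supp_in {0..}) (On n)"
  by (auto simp: stable_def On_def intro: supp_in_mult)

lemma fun_sum_apply: "(\<Sum>x\<in>X. f x) i = (\<Sum>x\<in>X. f x i)"
  by (induction X rule: infinite_finite_induct) auto

lemma On_expand: "f \<in> On n \<Longrightarrow> f = (\<Sum>q<n. sm (f q) (unit q))"
  by (auto simp: fun_eq_iff fun_sum_apply unit_def On_def if_distrib cong: if_cong)

text \<open>Over a complete ring \<open>1 - E\<close> is invertible if \<open>E\<close> raises the order of vanishing.\<close>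

lemma geometric_series:
  fixes N :: "(nat \<Rightarrow> 'k::field fls) set"
  assumes E: "\<And>f g. f \<in> On m \<Longrightarrow> g \<in> On m \<Longrightarrow> E (f - g) = E f - E g"
    and EO: "\<And>f. f \<in> On m \<Longrightarrow> E f \<in> On m"
    and order: "\<And>f k. f \<in> On m \<Longrightarrow> (\<And>j. j < k \<Longrightarrow> cv f j = 0) \<Longrightarrow> cv (E f) k = 0"
    and N: "N \<subseteq> On m" "\<And>f g. f \<in> N \<Longrightarrow> g \<in> N \<Longrightarrow> f + g \<in> N" "\<And>f. f \<in> N \<Longrightarrow> E f \<in> N"
      "\<And>f. f \<in> On m \<Longrightarrow> (\<And>j. j < 5 \<Longrightarrow> cv f j = 0) \<Longrightarrow> f \<in> N"
    and h: "h \<in> N"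
  shows "\<exists>y\<in>N. y - E y = h"
proof -
  define a where "a l = (E ^^ l) h" for l
  have a: "a l \<in> N" "a l \<in> On m" for l
  proof -
    show "a l \<in> N" using h N(3) by (induction l) (auto simp: a_def)
    then show "a l \<in> On m" using N(1) by auto
  qed
  have order': "cv (E f) j = 0" if "f \<in> On m" "\<And>i. i < k \<Longrightarrow> cv f i = 0" "j \<le> k" for f j k
    using that by (intro order) auto
  have ao: "cv (a l) j = 0" if "j < int l" for l j
    using that
  proof (induction l arbitrary: j)
    case 0
    then show ?case using OnD(1)[OF a(2)] by simp
  next
    case (Suc l)
    have "cv (E (a l)) j = 0"
    proof (rule order'[OF a(2)])
      show "cv (a l) i = 0" if "i < int l" for i using Suc.IH[OF that] .
      show "j \<le> int l" using Suc.prems by simp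
    qed
    then show ?case by (simp add: a_def)
  qed
  define s where "s k = (\<Sum>l<k. a l)" for k
  have sO: "s k \<in> On m" for k
    unfolding s_def by (rule stable_sum[OF stable_On]) (use a in auto)
  have E0: "E 0 = 0" using E[of 0 0] stableD(1)[OF stable_On] by auto
  have Eadd: "E (f + g) = E f + E g" if "f \<in> On m" "g \<in> On m" for f g
    using E[OF stableD(2)[OF stable_On that] that(2)] by (simp add: algebra_simps)
  have sE: "E (s k) = s (Suc k) - h" for k
  proof (induction k)
    case 0
    have "s 0 = 0" "s (Suc 0) = h" by (simp_all add: s_def a_def)
    then show ?case using E0 by (metis diff_self)
  next
    case (Suc k)
    have "E (s (Suc k)) = E (s k) + E (a k)"
      using Eadd[OF sO a(2)] by (simp add: s_def)
    also have "E (a k) = a (Suc k)" by (simp add: a_def)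
    finally have "E (s (Suc k)) = s (Suc k) - h + a (Suc k)" unfolding Suc .
    then show ?case by (simp only: s_def sum.lessThan_Suc) (simp add: algebra_simps)
  qed
  have sN: "s (Suc k) \<in> N" for k
    using a N(2) by (induction k) (auto simp: s_def)
  \<comment> \<open>The limit, taken coefficientwise: the coefficient at j is already that of the
    partial sum with j + 1 terms.\<close>
  define y where "y i = fps_to_fls (Abs_fps (\<lambda>j. s (Suc j) i $$ int j))" for i
  have stab: "cv (s k) j = cv (s l) j" if "l \<le> k" "j < int l" for k l j
    using that(1)
  proof (induction k rule: dec_induct)
    case (step k)
    have "cv (s (Suc k)) j = cv (s k) j + cv (a k) j"
      by (simp only: s_def sum.lessThan_Suc cv_simps)
    moreover have "cv (a k) j = 0" using ao[of j k] that(2) step(1) by simp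
    ultimately show ?case using step by (simp only: add_0_right)
  qed simp
  have yj: "cv y j = cv (s k) j" if "j < int k" for j k
  proof (cases "j < 0")
    case True
    then show ?thesis using OnD(1)[OF sO] by (simp add: y_def cv_def fun_eq_iff)
  next
    case False
    then have "cv y j = cv (s (Suc (nat j))) j" by (simp add: y_def cv_def fun_eq_iff)
    also have "\<dots> = cv (s k) j" using stab[of "Suc (nat j)" k j] that False by auto
    finally show ?thesis .
  qed
  have yO: "y \<in> On m"
    unfolding On_iff
  proof (intro conjI allI impI)
    show "cv y j = 0" if "j < 0" for j using yj[of j 0] that OnD(1)[OF sO that] by simp
    show "cv y j \<in> Usp m" for j
    proof -
      have "cv y j = cv (s (nat (j + 1))) j" by (rule yj) simp
      then show ?thesis using OnD(2)[OF sO] by metis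
    qed
  qed
  have dO: "y - s k \<in> On m" for k using stableD(3)[OF stable_On yO sO] .
  \<comment> \<open>Membership of the limit does not come from a closedness assumption:
    \<open>N\<close> contains all series of order at least 5, and the remainder after finitely many
    terms is one.\<close>
  have "y - s (Suc 5) \<in> N"
  proof (rule N(4)[OF dO])
    fix j :: int assume "j < 5"
    then have "cv y j = cv (s (Suc 5)) j" by (intro yj) simp
    then show "cv (y - s (Suc 5)) j = 0" by (metis cv_simps(3) diff_self)
  qed
  then have "(y - s (Suc 5)) + s (Suc 5) \<in> N" using N(2) sN by blast
  then have yN: "y \<in> N" by (metis diff_add_cancel)
  have "cv (y - E y) j = cv h j" for j
  proof -
    define k where "k = Suc (nat j)"
    have jk: "j < int k" by (auto simp: k_def)
    have "cv (E (y - s k)) j = 0"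
    proof (rule order'[OF dO])
      show "j \<le> int k" using jk by simp
      show "cv (y - s k) i = 0" if "i < int k" for i
        using yj[OF that] by (metis cv_simps(3) diff_self)
    qed
    then have "cv (E y) j = cv (E (s k)) j" using E[OF yO sO] by (metis cv_simps(3) right_minus_eq)
    also have "\<dots> = cv (s (Suc k)) j - cv h j" by (simp only: sE cv_simps)
    also have "cv (s (Suc k)) j = cv y j" using yj[of j "Suc k"] jk by (metis less_Suc_eq of_nat_less_iff order_less_trans)
    finally have "cv (E y) j = cv y j - cv h j" .
    then show ?thesis by (simp only: cv_simps) (simp only: diff_diff_eq2 add_diff_cancel_left')
  qed
  then have "y - E y = h" by (rule cv_eqI)
  then show ?thesis using yN by blast
qed

section \<open>Linear maps given by polynomial matrices\<close>

definition ev :: "nat \<Rightarrow> nat \<Rightarrow> 'k::field" where "ev q = (\<lambda>j. if j = q then 1 else 0)"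

text \<open>Only the values of \<open>g l\<close> at unit vectors enter. Degrees below 5 are enough,
  since the modules to be compared contain all series of order at least 5.\<close>

definition polymap :: "nat \<Rightarrow> (nat \<Rightarrow> (nat \<Rightarrow> 'k::field) \<Rightarrow> nat \<Rightarrow> 'k) \<Rightarrow> (nat \<Rightarrow> 'k fls) \<Rightarrow> nat \<Rightarrow> 'k fls"
  where "polymap m g f = (\<lambda>r. \<Sum>q<m. (\<Sum>l<5. fls_const (g l (ev q) r) * tp (int l)) * f q)"

lemma polymap_linear: "polymap m g (x + y) = polymap m g x + polymap m g y"
  "polymap m g (x - y) = polymap m g x - polymap m g y"
  "polymap m g (sm r x) = sm r (polymap m g x)"
  by (auto simp: polymap_def fun_eq_iff algebra_simps sum.distrib sum_subtractf sum_distrib_left)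

lemma lmapD:
  assumes "lmap f"
  shows "f (x + y) = f x + f y" "f (sc c x) = sc c (f x)" "f 0 = 0" "f (x - y) = f x - f y"
proof -
  show a: "f (x + y) = f x + f y" for x y using assms by (simp add: lmap_def)
  show s: "f (sc c x) = sc c (f x)" for c x using assms by (simp add: lmap_def)
  show "f 0 = 0" using s[of 0 0] by simp
  show "f (x - y) = f x - f y" using a[of x "sc (- 1) y"] s[of "- 1" y] by simp
qed

lemma Usp_expand: "v \<in> Usp m \<Longrightarrow> v = (\<Sum>q<m. sc (v q) (ev q))"
  by (auto simp: fun_eq_iff fun_sum_apply ev_def Usp_def if_distrib cong: if_cong)

lemma lmap_Usp:
  assumes "lmap g" "v \<in> Usp m"
  shows "g v r = (\<Sum>q<m. v q * g (ev q) r)"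
proof -
  have "g (\<Sum>q<l. sc (v q) (ev q)) r = (\<Sum>q<l. v q * g (ev q) r)" for l
  proof (induction l)
    case 0
    then show ?case unfolding lessThan_0 sum.empty lmapD(3)[OF assms(1)] by simp
  next
    case (Suc l)
    have "g (\<Sum>q<Suc l. sc (v q) (ev q)) = g (\<Sum>q<l. sc (v q) (ev q)) + sc (v l) (g (ev l))"
      unfolding sum.lessThan_Suc lmapD(1,2)[OF assms(1)] by (rule refl)
    from fun_cong[OF this, of r]
    have "g (\<Sum>q<Suc l. sc (v q) (ev q)) r = (g (\<Sum>q<l. sc (v q) (ev q)) + sc (v l) (g (ev l))) r" .
    also have "\<dots> = g (\<Sum>q<l. sc (v q) (ev q)) r + v l * g (ev l) r"
      by simp
    also have "\<dots> = (\<Sum>q<Suc l. v q * g (ev q) r)"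
      unfolding Suc sum.lessThan_Suc by (rule refl)
    finally show ?case .
  qed
  from this[of m] show ?thesis by (simp only: Usp_expand[OF assms(2), symmetric])
qed

lemma cv_polymap:
  assumes "\<And>l. l < 5 \<Longrightarrow> lmap (g l)" "f \<in> On m"
  shows "cv (polymap m g f) j = (\<Sum>l<5. g l (cv f (j - int l)))"
proof
  fix r
  have "cv (polymap m g f) j r = (\<Sum>q<m. \<Sum>l<5. g l (ev q) r * f q $$ (j - int l))"
    by (simp add: polymap_def fls_nth_sum sum_distrib_right mult.assoc)
  also have "\<dots> = (\<Sum>l<5. \<Sum>q<m. f q $$ (j - int l) * g l (ev q) r)"
    by (subst sum.swap) (simp add: mult.commute)
  also have "\<dots> = (\<Sum>l<5. g l (cv f (j - int l)) r)"
    using lmap_Usp[OF assms(1) OnD(2)[OF assms(2)]] by (intro sum.cong) auto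
  finally show "cv (polymap m g f) j r = (\<Sum>l<5. g l (cv f (j - int l))) r"
    by (simp add: fun_sum_apply)
qed

lemma sum_less_5: "(\<Sum>i<(5::nat). f i) = f 0 + f 1 + f 2 + f 3 + f 4" for f :: "nat \<Rightarrow> 'a::comm_monoid_add"
  by (simp add: eval_nat_numeral)

lemma polymap_On:
  assumes "\<And>l. l < 5 \<Longrightarrow> lmap (g l)" "\<And>l u. l < 5 \<Longrightarrow> u \<in> Usp m \<Longrightarrow> g l u \<in> Usp n" "f \<in> On m"
  shows "polymap m g f \<in> On n"
  unfolding On_iff
proof (intro conjI allI impI)
  have c: "cv (polymap m g f) j = (\<Sum>l<5. g l (cv f (j - int l)))" for j
    by (rule cv_polymap) (use assms in auto)
  show "cv (polymap m g f) j = 0" if "j < 0" for j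
    unfolding c
  proof (intro sum.neutral ballI)
    fix l :: nat assume "l \<in> {..<5}"
    then have "lmap (g l)" using assms(1) by simp
    moreover have "cv f (j - int l) = 0" using that by (intro OnD(1)[OF assms(3)]) simp
    ultimately show "g l (cv f (j - int l)) = 0" by (simp only: lmapD(3))
  qed
  show "cv (polymap m g f) j \<in> Usp n" for j
  proof -
    have "g l (cv f (j - int l)) \<in> Usp n" if "l < 5" for l
      using assms(2)[OF that OnD(2)[OF assms(3)]] .
    then have "(\<Sum>l<5. g l (cv f (j - int l)) i) = 0" if "n \<le> i" for i
      using that by (intro sum.neutral) (auto simp: Usp_def)
    then show ?thesis unfolding c Usp_def fun_sum_apply by blast
  qed
qed

section \<open>Modules over the ring of 3, 5, 7\<close>

type_synonym 'k rel3 = "(nat \<Rightarrow> 'k) \<Rightarrow> (nat \<Rightarrow> 'k) \<Rightarrow> (nat \<Rightarrow> 'k) \<Rightarrow> bool"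

definition rel_module :: "nat \<Rightarrow> 'k::field rel3 \<Rightarrow> (nat \<Rightarrow> 'k fls) set"
  where "rel_module m T = {f \<in> On m. T (cv f 1) (cv f 2) (cv f 4)}"

definition admissible :: "nat \<Rightarrow> 'k::field rel3 \<Rightarrow> bool"
  where "admissible m T \<longleftrightarrow> T 0 0 0 \<and>
    (\<forall>x y z x' y' z'. T x y z \<longrightarrow> T x' y' z' \<longrightarrow> T (x + x') (y + y') (z + z')) \<and>
    (\<forall>c x y z. T x y z \<longrightarrow> T (sc c x) (sc c y) (sc c z)) \<and>
    (\<forall>x y z. T x y z \<longrightarrow> x \<in> Usp m \<and> y \<in> Usp m \<and> z \<in> Usp m \<and> T 0 0 x)"

lemma admissibleD:
  assumes "admissible m T"
  shows "T 0 0 0" "T x y z \<Longrightarrow> T x' y' z' \<Longrightarrow> T (x + x') (y + y') (z + z')"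
    "T x y z \<Longrightarrow> T (sc c x) (sc c y) (sc c z)"
    "T x y z \<Longrightarrow> x \<in> Usp m" "T x y z \<Longrightarrow> y \<in> Usp m" "T x y z \<Longrightarrow> z \<in> Usp m" "T x y z \<Longrightarrow> T 0 0 x"
    "T x y z \<Longrightarrow> T x' y' z' \<Longrightarrow> T (x - x') (y - y') (z - z')"
proof -
  show a: "T x y z \<Longrightarrow> T x' y' z' \<Longrightarrow> T (x + x') (y + y') (z + z')" for x y z x' y' z'
    using assms unfolding admissible_def by blast
  show s: "T x y z \<Longrightarrow> T (sc c x) (sc c y) (sc c z)" for x y z c
    using assms unfolding admissible_def by blast
  show "T (x - x') (y - y') (z - z')" if "T x y z" "T x' y' z'"
    using a[OF that(1) s[OF that(2), of "- 1"]] by (simp only: sc_simps add_uminus_conv_diff)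
qed (use assms in \<open>unfold admissible_def, blast+\<close>)

lemma Usp_closed: "0 \<in> Usp m" "x \<in> Usp m \<Longrightarrow> y \<in> Usp m \<Longrightarrow> x + y \<in> Usp m"
  "x \<in> Usp m \<Longrightarrow> y \<in> Usp m \<Longrightarrow> x - y \<in> Usp m" "x \<in> Usp m \<Longrightarrow> sc c x \<in> Usp m"
  for x y :: "nat \<Rightarrow> 'k::field"
  by (auto simp: Usp_def)

lemma linear_lmap: "Vector_Spaces.linear sc sc g \<Longrightarrow> lmap g"
proof -
  assume "Vector_Spaces.linear sc sc g"
  then interpret Vector_Spaces.linear sc sc g .
  show "lmap g" unfolding lmap_def using add scale by blast
qed

lemma polymap_cv5:
  assumes "\<And>l. l < 5 \<Longrightarrow> lmap (g l)" "f \<in> On m"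
  shows "cv (polymap m g f) j = g 0 (cv f j) + g 1 (cv f (j - 1)) + g 2 (cv f (j - 2))
    + g 3 (cv f (j - 3)) + g 4 (cv f (j - 4))"
proof -
  have "cv (polymap m g f) j = (\<Sum>l<5. g l (cv f (j - int l)))"
    by (rule cv_polymap) (use assms in auto)
  then show ?thesis unfolding sum_less_5 by simp
qed

text \<open>For a series with coefficients x, y, z at t, t^2, t^4 the image has there the
  coefficients i0 x + i1 f_0, i0 y + i1 x + i2 f_0 and i0 z + i1 f_3 + i2 y + i3 x + i4 f_0. This is
  the sum of a triple depending on (x, y, z), of (i1 f_0, i2 f_0, i4 f_0) and of (0, 0, i1 f_3). The
  last lies in \<open>T2\<close> by admissibility; \<open>i3\<close> and \<open>i4\<close> are
  linear selections that put the other two there.\<close>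

lemma hom_polymap:
  fixes T1 T2 :: "'k::field rel3"
  assumes T1: "admissible m T1" and T2: "admissible n T2"
    and lm: "lmap i0" "lmap i1" "lmap i2"
    and i0: "\<And>u. u \<in> Usp m \<Longrightarrow> i0 u \<in> Usp n"
    and a: "\<And>u. u \<in> Usp m \<Longrightarrow> \<exists>z. T2 (i1 u) (i2 u) z"
    and b: "\<And>x y z. T1 x y z \<Longrightarrow> \<exists>z'. T2 (i0 x) (i0 y + i1 x) z'"
    and c: "\<And>y z. T1 0 y z \<Longrightarrow> T2 0 (i0 y) (i0 z + i2 y)"
  shows "\<exists>g. g 0 = i0 \<and> (\<forall>l<5. lmap (g l) \<and> (\<forall>u\<in>Usp m. g l u \<in> Usp n)) \<and>
    (\<forall>f\<in>rel_module m T1. polymap m g f \<in> rel_module n T2)"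
proof -
  note T1D = admissibleD[OF T1] and T2D = admissibleD[OF T2]
  note lmD = lmapD[OF lm(1)] lmapD[OF lm(2)] lmapD[OF lm(3)]
  have i12: "i1 u \<in> Usp n" "i2 u \<in> Usp n" if "u \<in> Usp m" for u
    using a[OF that] T2D by blast+
  have "linrel sc sc (\<lambda>u w. T2 (i1 u) (i2 u) w)"
    unfolding linrel_def lmD using T2D(1-3) by blast
  from linear_selection[OF vector_space_sc vector_space_sc this]
  obtain i4 where i4: "lmap i4" "\<And>u w. T2 (i1 u) (i2 u) w \<Longrightarrow> T2 (i1 u) (i2 u) (i4 u)"
    using linear_lmap by blast
  have i4': "T2 (i1 u) (i2 u) (i4 u)" if "u \<in> Usp m" for u
    using a[OF that] i4(2) by blast
  \<comment> \<open>Says that \<open>w\<close> may serve as the t^3 term at \<open>x\<close>. By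
    assumption \<open>c\<close> it does not matter which \<open>y\<close> and \<open>z\<close>
    accompany \<open>x\<close>.\<close>
  define G where "G x w \<longleftrightarrow> (\<exists>y z. T1 x y z \<and> T2 (i0 x) (i0 y + i1 x) (i0 z + i2 y + w))" for x w
  have GI: "G x w" if "T1 x y z" "T2 (i0 x) (i0 y + i1 x) (i0 z + i2 y + w)" for x y z w
    using that unfolding G_def by blast
  have "linrel sc sc G"
    unfolding linrel_def
  proof (intro conjI allI impI)
    show "G 0 0" by (rule GI[OF T1D(1)]) (use T2D(1) in \<open>simp only: lmD add_0_right\<close>)
  next
    fix x w x' w' assume "G x w" "G x' w'"
    then obtain y z y' z' where *: "T1 x y z" "T2 (i0 x) (i0 y + i1 x) (i0 z + i2 y + w)"
      "T1 x' y' z'" "T2 (i0 x') (i0 y' + i1 x') (i0 z' + i2 y' + w')" unfolding G_def by blast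
    show "G (x + x') (w + w')"
      using T2D(2)[OF *(2,4)] by (intro GI[OF T1D(2)[OF *(1,3)]]) (simp only: lmD add_ac)
  next
    fix d x w assume "G x w"
    then obtain y z where *: "T1 x y z" "T2 (i0 x) (i0 y + i1 x) (i0 z + i2 y + w)" unfolding G_def by blast
    have sca: "sc d (p + q) = sc d p + sc d q" for p q :: "nat \<Rightarrow> 'k" by (auto simp: fun_eq_iff algebra_simps)
    show "G (sc d x) (sc d w)"
      using T2D(3)[OF *(2), of d] by (intro GI[OF T1D(3)[OF *(1)]]) (simp only: lmD sca)
  qed
  from linear_selection[OF vector_space_sc vector_space_sc this]
  obtain j3 where j3: "lmap j3" "\<And>x w. G x w \<Longrightarrow> G x (j3 x)" using linear_lmap by blast
  \<comment> \<open>Outside its domain the selection may leave k^n; cutting it down to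
    \<open>n\<close> coordinates changes nothing on the domain.\<close>
  define i3 where "i3 v = (\<lambda>i. if i < n then j3 v i else 0)" for v
  have li3: "lmap i3" using lmapD[OF j3(1)] by (auto simp: lmap_def i3_def fun_eq_iff)
  have i3U: "i3 v \<in> Usp n" for v by (auto simp: i3_def Usp_def)
  have i3: "T2 (i0 x) (i0 y + i1 x) (i0 z + i2 y + i3 x)" if T: "T1 x y z" for x y z
  proof -
    obtain z' where "T2 (i0 x) (i0 y + i1 x) z'" using b[OF T] by blast
    then have "G x (z' - (i0 z + i2 y))"
      by (intro GI[OF T]) (simp only: add_diff_cancel diff_add_cancel add.commute[of "i0 z + i2 y"])
    from j3(2)[OF this] obtain y' z' where *: "T1 x y' z'"
      "T2 (i0 x) (i0 y' + i1 x) (i0 z' + i2 y' + j3 x)" unfolding G_def by blast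
    have U: "i0 z' + i2 y' \<in> Usp n" "i0 z' + i2 y' + j3 x \<in> Usp n"
      using T1D(4-6)[OF *(1)] T2D(4-6)[OF *(2)] i0 i12 Usp_closed(2) by blast+
    have "j3 x = (i0 z' + i2 y' + j3 x) - (i0 z' + i2 y')" by (simp only: add_diff_cancel_left')
    then have "j3 x \<in> Usp n" using Usp_closed(3)[OF U(2,1)] by metis
    then have e: "i3 x = j3 x" by (auto simp: i3_def Usp_def fun_eq_iff)
    have "T1 (x - x) (y - y') (z - z')" by (rule T1D(8)[OF T *(1)])
    then have "T1 0 (y - y') (z - z')" by (simp only: diff_self)
    from T2D(2)[OF c[OF this] *(2)]
    have "T2 (0 + i0 x) (i0 (y - y') + (i0 y' + i1 x))
      (i0 (z - z') + i2 (y - y') + (i0 z' + i2 y' + j3 x))" .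
    moreover have "i0 (y - y') + (i0 y' + i1 x) = i0 y + i1 x"
      by (simp only: lmD) (simp add: algebra_simps)
    moreover have "i0 (z - z') + i2 (y - y') + (i0 z' + i2 y' + j3 x) = i0 z + i2 y + j3 x"
      by (simp only: lmD) (simp add: algebra_simps)
    ultimately show ?thesis by (simp only: add_0 e)
  qed
  define g where "g = (\<lambda>l::nat. [i0, i1, i2, i3, i4] ! l)"
  have gs: "g 0 = i0" "g 1 = i1" "g 2 = i2" "g 3 = i3" "g 4 = i4" by (simp_all add: g_def)
  have l5: "l = 0 \<or> l = 1 \<or> l = 2 \<or> l = 3 \<or> l = 4" if "l < 5" for l :: nat using that by linarith
  have gl: "lmap (g l)" if "l < 5" for l
    using l5[OF that] gs lm li3 i4(1) by auto
  have gU: "g l u \<in> Usp n" if "l < 5" "u \<in> Usp m" for l u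
    using l5[OF that(1)] gs i0 i12 i3U T2D(6)[OF i4'[OF that(2)]] that(2) by auto
  have "polymap m g f \<in> rel_module n T2" if f: "f \<in> rel_module m T1" for f
  proof -
    have fO: "f \<in> On m" and fT: "T1 (cv f 1) (cv f 2) (cv f 4)" using f by (auto simp: rel_module_def)
    have neg: "g l (cv f (- int j)) = 0" if "l < 5" "j > 0" for l j
      using OnD(1)[OF fO, of "- int j"] that lmapD(3)[OF gl[OF that(1)]] by simp
    have cvs: "cv (polymap m g f) j = g 0 (cv f j) + g 1 (cv f (j - 1)) + g 2 (cv f (j - 2))
      + g 3 (cv f (j - 3)) + g 4 (cv f (j - 4))" for j
      by (rule polymap_cv5[OF gl fO])
    have n: "g 2 (cv f (- 1)) = 0" "g 3 (cv f (- 2)) = 0" "g 4 (cv f (- 3)) = 0"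
      "g 3 (cv f (- 1)) = 0" "g 4 (cv f (- 2)) = 0"
      using neg[of 2 1] neg[of 3 2] neg[of 4 3] neg[of 3 1] neg[of 4 2] by simp_all
    have c1: "cv (polymap m g f) 1 = i0 (cv f 1) + i1 (cv f 0)"
      using cvs[of 1] n by (simp only: gs) simp
    have c2: "cv (polymap m g f) 2 = i0 (cv f 2) + i1 (cv f 1) + i2 (cv f 0)"
      using cvs[of 2] n by (simp only: gs) simp
    have c4: "cv (polymap m g f) 4 = i0 (cv f 4) + i1 (cv f 3) + i2 (cv f 2) + i3 (cv f 1) + i4 (cv f 0)"
      using cvs[of 4] by (simp only: gs) simp
    have A: "T2 (i1 (cv f 0)) (i2 (cv f 0)) (i4 (cv f 0))" using i4' OnD(2)[OF fO] .
    obtain z where "T2 (i1 (cv f 3)) (i2 (cv f 3)) z" using a OnD(2)[OF fO] by blast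
    then have C: "T2 0 0 (i1 (cv f 3))" by (rule T2D(7))
    from T2D(2)[OF T2D(2)[OF i3[OF fT] A] C]
    have "T2 (cv (polymap m g f) 1) (cv (polymap m g f) 2) (cv (polymap m g f) 4)"
      unfolding c1 c2 c4 by (simp only: add_0_right add_0 add_ac)
    moreover have "polymap m g f \<in> On n" by (rule polymap_On) (use gl gU fO in auto)
    ultimately show ?thesis by (simp add: rel_module_def)
  qed
  then show ?thesis using gs gl gU by (intro exI[of _ g]) auto
qed

definition type_rel :: "nat \<times> 'k::field rel \<times> 'k rel \<Rightarrow> 'k rel3"
  where "type_rel = (\<lambda>(m, P, C) x y z. x \<in> Usp m \<and> y \<in> Usp m \<and> z \<in> Usp m \<and> P x y \<and> C y z)"

definition type_module :: "nat \<times> 'k::field rel \<times> 'k rel \<Rightarrow> (nat \<Rightarrow> 'k fls) set"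
  where "type_module \<tau> = rel_module (fst \<tau>) (type_rel \<tau>)"

lemma types_admissible:
  assumes "\<tau> \<in> types"
  shows "admissible (fst \<tau>) (type_rel \<tau>)"
  using assms unfolding types_def
  by (auto simp: admissible_def type_rel_def Usp_def algebra_simps)

text \<open>Ensures that \<open>P\<close> is the whole projection of the triples to the first two
  entries, as the encoding by \<open>P\<close> and \<open>Q\<close> presupposes.\<close>

lemma types_total:
  assumes "(m, P, C) \<in> types" "P x y" "x \<in> Usp m" "y \<in> Usp m"
  shows "\<exists>z\<in>Usp m. C y z"
proof -
  have w: "0 \<in> Usp m" "(\<lambda>i. if i = 1 then c else 0) \<in> Usp 2" "(\<lambda>i. if i = 2 then c else 0) \<in> Usp 3" for c :: 'a
    by (auto simp: Usp_def)
  have e: "\<exists>z\<in>Usp 3. z 2 = y 0 \<and> z 1 = 0" "\<exists>z\<in>Usp 2. z 1 = y 0 \<and> z 0 = 0" "\<exists>z\<in>Usp m. z 0 = 0 \<and> z 1 = 0"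
    using w by (auto intro!: bexI[OF _ w(1)] bexI[OF _ w(2)[of "y 0"]] bexI[OF _ w(3)[of "y 0"]])
  show ?thesis using assms(1) e unfolding types_def by (auto; blast)
qed

lemma types_rank: "\<tau> \<in> types \<Longrightarrow> 1 \<le> fst \<tau> \<and> fst \<tau> \<le> 3"
  by (auto simp: types_def)

lemma rel_module_closed:
  assumes "admissible m T"
  shows "f \<in> rel_module m T \<Longrightarrow> g \<in> rel_module m T \<Longrightarrow> f + g \<in> rel_module m T"
    "f \<in> rel_module m T \<Longrightarrow> g \<in> rel_module m T \<Longrightarrow> f - g \<in> rel_module m T"
    "f \<in> On m \<Longrightarrow> (\<And>j. j < 5 \<Longrightarrow> cv f j = 0) \<Longrightarrow> f \<in> rel_module m T"
proof -
  show "f \<in> rel_module m T \<Longrightarrow> g \<in> rel_module m T \<Longrightarrow> f + g \<in> rel_module m T"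
    unfolding rel_module_def cv_simps mem_Collect_eq
    using admissibleD(2)[OF assms] stableD(2)[OF stable_On] by blast
  show "f \<in> rel_module m T \<Longrightarrow> g \<in> rel_module m T \<Longrightarrow> f - g \<in> rel_module m T"
    unfolding rel_module_def cv_simps mem_Collect_eq
    using admissibleD(8)[OF assms] stableD(3)[OF stable_On] by blast
  assume "f \<in> On m" and z: "\<And>j. j < 5 \<Longrightarrow> cv f j = 0"
  moreover have "cv f 1 = 0" "cv f 2 = 0" "cv f 4 = 0" by (rule z, simp)+
  ultimately show "f \<in> rel_module m T"
    unfolding rel_module_def using admissibleD(1)[OF assms] by (simp only: mem_Collect_eq)
qed

text \<open>Each application shortens the support by one place. Types have rank at most 3, whence
  the third power here and in the next proof.\<close>

lemma strictly_triangular_cube: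
  fixes d :: "(nat \<Rightarrow> 'k::field) \<Rightarrow> nat \<Rightarrow> 'k"
  assumes "\<And>u. u \<in> Usp m \<Longrightarrow> d u \<in> Usp m" "m \<le> 3"
    and "\<And>u i. u \<in> Usp m \<Longrightarrow> i < m \<Longrightarrow> \<forall>j>i. u j = 0 \<Longrightarrow> d u i = 0"
    and "u \<in> Usp m"
  shows "d (d (d u)) = 0"
proof -
  have step: "\<forall>j\<ge>i. d v j = 0" if "v \<in> Usp m" "\<forall>j\<ge>Suc i. v j = 0" for v i
  proof (intro allI impI)
    fix j assume "i \<le> j"
    show "d v j = 0"
    proof (cases "j < m")
      case True
      then show ?thesis using assms(3)[OF that(1) True] that(2) \<open>i \<le> j\<close> by auto
    next
      case False
      then show ?thesis using assms(1)[OF that(1)] by (auto simp: Usp_def)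
    qed
  qed
  have "\<forall>j\<ge>3. u j = 0" using assms(2,4) by (auto simp: Usp_def)
  then have "\<forall>j\<ge>2. d u j = 0" using step[of u 2] assms(4) by (simp add: eval_nat_numeral)
  then have "\<forall>j\<ge>1. d (d u) j = 0" using step[of "d u" 1] assms(1,4) by (simp add: eval_nat_numeral)
  then have "\<forall>j\<ge>0. d (d (d u)) j = 0" using step[of "d (d u)" 0] assms(1,4) by simp
  then show ?thesis by (auto simp: fun_eq_iff)
qed

text \<open>The map D = 1 - \<pi> \<iota> is strictly triangular on lowest coefficients, so E = D^3
  raises the order and 1 - E is invertible. Since 1 - E = \<pi> \<iota> (1 + D + D^2), the composite
  \<pi> \<iota> is bijective, and \<open>N\<close> is the direct sum of the image of \<iota> and the
  kernel of \<pi>.\<close>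

lemma (in numsg) type_summand:
  fixes N :: "(nat \<Rightarrow> 'k::field fls) set"
  assumes ind: "indecomposable_module (semigroup_ring H) (cm N)" and N: "stable S N"
    and T: "admissible n T" and NT: "N = rel_module n T"
    and \<tau>: "\<tau> \<in> types"
    and spl: "splits (Usp n) (\<lambda>x y. \<exists>z. T x y z) (\<lambda>y z. T 0 y z) \<tau>"
  shows "mod_isomorphic (semigroup_ring H) (cm N) (cm (type_module \<tau>))"
proof -
  obtain m P C where mPC: "\<tau> = (m, P, C)" by (cases \<tau>)
  have T': "admissible m (type_rel \<tau>)" using types_admissible[OF \<tau>] mPC by simp
  have m13: "1 \<le> m" "m \<le> 3" using types_rank[OF \<tau>] mPC by auto
  define N' :: "(nat \<Rightarrow> 'k fls) set" where "N' = rel_module m (type_rel \<tau>)"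
  have tr: "type_rel \<tau> x y z \<longleftrightarrow> x \<in> Usp m \<and> y \<in> Usp m \<and> z \<in> Usp m \<and> P x y \<and> C y z" for x y z
    by (simp add: type_rel_def mPC)
  have tot: "\<exists>z. type_rel \<tau> x y z" if "P x y" "x \<in> Usp m" "y \<in> Usp m" for x y
    using types_total[of m P C x y] \<tau> mPC that tr by blast
  note TD = admissibleD[OF T] and T'D = admissibleD[OF T']
  obtain ii pp where sd: "split_data (Usp n) (\<lambda>x y. \<exists>z. T x y z) (\<lambda>y z. T 0 y z) m P C ii pp"
    using spl unfolding splits_def mPC prod.case by blast
  define i0 i1 i2 p0 p1 p2 where ip: "i0 = ii ! 0" "i1 = ii ! 1" "i2 = ii ! 2"
    "p0 = pp ! 0" "p1 = pp ! 1" "p2 = pp ! 2"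
  note sd = sd[unfolded split_data_def, folded ip]
  have lm: "lmap i0" "lmap i1" "lmap i2" "lmap p0" "lmap p1" "lmap p2"
    using conjunct1[OF sd] by (auto simp: ip)
  note s = conjunct2[OF sd]
  note s1 = conjunct1[OF s] and s = conjunct2[OF s]
  note s2 = conjunct1[OF s] and s = conjunct2[OF s]
  note s3 = conjunct1[OF s] and s = conjunct2[OF s]
  note s4 = conjunct1[OF s] and s = conjunct2[OF s]
  note s5 = conjunct1[OF s] and s = conjunct2[OF s]
  note s6 = conjunct1[OF s] and s = conjunct2[OF s]
  note s7 = conjunct1[OF s] and s8 = conjunct2[OF s]
  have i: "i0 u \<in> Usp n" "\<exists>z. T (i1 u) (i2 u) z" if "u \<in> Usp m" for u using s1 that by blast+
  have pU: "p0 v \<in> Usp m" "p1 v \<in> Usp m" "p2 v \<in> Usp m" for v using s2 by blast+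
  have iP: "\<exists>z. T (i0 x) (i0 y + i1 x) z" if "x \<in> Usp m" "y \<in> Usp m" "P x y" for x y
    using s3 that by blast
  have iQ: "T 0 (i0 y) (i0 z + i2 y)" if "y \<in> Usp m" "z \<in> Usp m" "P 0 y" "C y z" for y z
    using s4 that by blast
  have pP: "P (p1 v) (p2 v)" if "v \<in> Usp n" for v using s5 that by blast
  have pP2: "P (p0 x) (p0 y + p1 x)" if "T x y z" for x y z using s6 that by blast
  have pQ: "C (p0 y) (p0 z + p2 y)" if "T 0 y z" for y z using s7 that by blast
  have tri: "p0 (i0 u) i = u i" if "u \<in> Usp m" "i < m" "\<forall>j>i. u j = 0" for u i using s8 that by blast
  obtain g where g: "g 0 = i0" "\<And>l. l < 5 \<Longrightarrow> lmap (g l)" "\<And>l u. l < 5 \<Longrightarrow> u \<in> Usp m \<Longrightarrow> g l u \<in> Usp n"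
    and gN: "\<And>f. f \<in> N' \<Longrightarrow> polymap m g f \<in> N"
  proof -
    have "\<exists>g. g 0 = i0 \<and> (\<forall>l<5. lmap (g l) \<and> (\<forall>u\<in>Usp m. g l u \<in> Usp n)) \<and>
      (\<forall>f\<in>rel_module m (type_rel \<tau>). polymap m g f \<in> rel_module n T)"
    proof (rule hom_polymap[OF T' T lm(1-3) i])
      show "\<exists>z'. T (i0 x) (i0 y + i1 x) z'" if "type_rel \<tau> x y z" for x y z
        using iP that unfolding tr by blast
      show "T 0 (i0 y) (i0 z + i2 y)" if "type_rel \<tau> 0 y z" for y z
        using iQ that unfolding tr by blast
    qed
    then show thesis using that unfolding NT N'_def by blast
  qed
  obtain h where h: "h 0 = p0" "\<And>l. l < 5 \<Longrightarrow> lmap (h l)" "\<And>l u. l < 5 \<Longrightarrow> u \<in> Usp n \<Longrightarrow> h l u \<in> Usp m"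
    and hN: "\<And>f. f \<in> N \<Longrightarrow> polymap n h f \<in> N'"
  proof -
    have "\<exists>g. g 0 = p0 \<and> (\<forall>l<5. lmap (g l) \<and> (\<forall>u\<in>Usp n. g l u \<in> Usp m)) \<and>
      (\<forall>f\<in>rel_module n T. polymap n g f \<in> rel_module m (type_rel \<tau>))"
    proof (rule hom_polymap[OF T T' lm(4-6)])
      show "p0 u \<in> Usp m" for u by (rule pU)
      show "\<exists>z. type_rel \<tau> (p1 u) (p2 u) z" if "u \<in> Usp n" for u
        by (rule tot[OF pP[OF that] pU(2,3)])
      show "\<exists>z'. type_rel \<tau> (p0 x) (p0 y + p1 x) z'" if "T x y z" for x y z
        by (rule tot[OF pP2[OF that] pU(1) Usp_closed(2)[OF pU(1,2)]])
      show "type_rel \<tau> 0 (p0 y) (p0 z + p2 y)" if "T 0 y z" for y z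
      proof -
        have "P (p0 0) (p0 y + p1 0)" by (rule pP2[OF that])
        then have "P 0 (p0 y)" by (simp only: lmapD(3)[OF lm(4)] lmapD(3)[OF lm(5)] add_0_right)
        then show ?thesis unfolding tr using pQ[OF that] pU Usp_closed by blast
      qed
    qed
    then show thesis using that unfolding NT N'_def by blast
  qed
  define \<iota> where "\<iota> = polymap m g"
  define \<pi> where "\<pi> = polymap n h"
  define D where "D f = f - \<pi> (\<iota> f)" for f
  have NO: "N \<subseteq> On n" "N' \<subseteq> On m" by (auto simp: NT N'_def rel_module_def)
  have \<iota>N: "\<iota> f \<in> N" if "f \<in> N'" for f using gN[OF that] by (simp add: \<iota>_def)
  have \<pi>N: "\<pi> f \<in> N'" if "f \<in> N" for f using hN[OF that] by (simp add: \<pi>_def)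
  have \<iota>O: "\<iota> f \<in> On n" if "f \<in> On m" for f
    unfolding \<iota>_def by (rule polymap_On) (use g that in auto)
  have \<pi>O: "\<pi> f \<in> On m" if "f \<in> On n" for f
    unfolding \<pi>_def by (rule polymap_On) (use h that in auto)
  have \<iota>lin: "\<iota> (x + y) = \<iota> x + \<iota> y" "\<iota> (x - y) = \<iota> x - \<iota> y" "\<iota> (sm r x) = sm r (\<iota> x)" for x y r
    unfolding \<iota>_def by (rule polymap_linear)+
  have \<pi>lin: "\<pi> (x + y) = \<pi> x + \<pi> y" "\<pi> (x - y) = \<pi> x - \<pi> y" "\<pi> (sm r x) = sm r (\<pi> x)" for x y r
    unfolding \<pi>_def by (rule polymap_linear)+
  have \<iota>0: "\<iota> 0 = 0" "\<pi> 0 = 0" using \<iota>lin(2)[of 0 0] \<pi>lin(2)[of 0 0] by simp_all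
  have N'c: "f + g \<in> N'" "f - g \<in> N'" if "f \<in> N'" "g \<in> N'" for f g
    using rel_module_closed[OF T'] that unfolding N'_def by blast+
  have N'5: "f \<in> N'" if "f \<in> On m" "\<And>j. j < 5 \<Longrightarrow> cv f j = 0" for f
    using rel_module_closed(3)[OF T'] that unfolding N'_def by blast
  have Dlin: "D (x - y) = D x - D y" for x y by (simp add: D_def \<iota>lin \<pi>lin)
  have DO: "D f \<in> On m" if "f \<in> On m" for f
    unfolding D_def by (rule stableD(3)[OF stable_On that \<pi>O[OF \<iota>O[OF that]]])
  have DN: "D f \<in> N'" if "f \<in> N'" for f
    unfolding D_def by (rule N'c(2)[OF that \<pi>N[OF \<iota>N[OF that]]])
  \<comment> \<open>On the lowest coefficient only the constant term of the matrix acts.\<close>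
  have low: "cv (polymap m' g' f) k = g' 0 (cv f k)"
    if "\<And>l. l < 5 \<Longrightarrow> lmap (g' l)" "f \<in> On m'" "\<And>j. j < k \<Longrightarrow> cv f j = 0"
    for m' g' k and f :: "nat \<Rightarrow> 'k fls"
  proof -
    have z: "g' l (cv f (k - int l)) = 0" if "l < 5" "l > 0" for l
    proof -
      have "cv f (k - int l) = 0" using that by (intro \<open>\<And>j. j < k \<Longrightarrow> cv f j = 0\<close>) simp
      then show ?thesis using lmapD(3)[OF \<open>\<And>l. l < 5 \<Longrightarrow> lmap (g' l)\<close>[OF that(1)]] by simp
    qed
    have "cv (polymap m' g' f) k = g' 0 (cv f k) + g' 1 (cv f (k - 1)) + g' 2 (cv f (k - 2))
      + g' 3 (cv f (k - 3)) + g' 4 (cv f (k - 4))"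
      by (rule polymap_cv5[OF that(1,2)])
    then show ?thesis using z[of 1] z[of 2] z[of 3] z[of 4] by simp
  qed
  have Dlow: "cv (D f) k = cv f k - p0 (i0 (cv f k))" if "f \<in> On m" "\<And>j. j < k \<Longrightarrow> cv f j = 0" for f k
  proof -
    have l1: "cv (\<iota> f) k' = i0 (cv f k')" if "k' \<le> k" for k'
      unfolding \<iota>_def g(1)[symmetric]
      by (rule low[OF g(2) \<open>f \<in> On m\<close>]) (use that \<open>\<And>j. j < k \<Longrightarrow> cv f j = 0\<close> in auto)
    have "cv (\<pi> (\<iota> f)) k = p0 (cv (\<iota> f) k)"
      unfolding \<pi>_def h(1)[symmetric]
    proof (rule low[OF h(2) \<iota>O[OF that(1)]])
      show "cv (\<iota> f) j = 0" if "j < k" for j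
        using l1[of j] that \<open>\<And>j. j < k \<Longrightarrow> cv f j = 0\<close>[OF that] lmapD(3)[OF lm(1)] by simp
    qed
    then show ?thesis unfolding D_def using l1[of k] by simp
  qed
  define d where "d u = u - p0 (i0 u)" for u
  have d3: "d (d (d u)) = 0" if "u \<in> Usp m" for u
  proof (rule strictly_triangular_cube[OF _ m13(2) _ that])
    show "d u \<in> Usp m" if "u \<in> Usp m" for u
      unfolding d_def by (rule Usp_closed(3)[OF that pU(1)])
    show "d u i = 0" if "u \<in> Usp m" "i < m" "\<forall>j>i. u j = 0" for u i
      unfolding d_def using tri[OF that] by simp
  qed
  have d0: "d 0 = 0" unfolding d_def by (simp only: lmapD(3)[OF lm(1)] lmapD(3)[OF lm(4)] diff_0_right)
  have D0: "cv (D f) j = 0" if "f \<in> On m" "\<And>i. i < k \<Longrightarrow> cv f i = 0" "j < k" for f k j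
    using Dlow[OF that(1), of j] that(2,3) d0 unfolding d_def by simp
  define E where "E f = D (D (D f))" for f
  have Eorder: "cv (E f) k = 0" if f: "f \<in> On m" "\<And>j. j < k \<Longrightarrow> cv f j = 0" for f k
  proof -
    have 1: "\<And>j. j < k \<Longrightarrow> cv (D f) j = 0" by (rule D0[OF f])
    have 2: "\<And>j. j < k \<Longrightarrow> cv (D (D f)) j = 0" by (rule D0[OF DO[OF f(1)] 1])
    have "cv (D f) k = d (cv f k)" unfolding d_def by (rule Dlow[OF f])
    moreover have "cv (D (D f)) k = d (cv (D f) k)" unfolding d_def by (rule Dlow[OF DO[OF f(1)] 1])
    moreover have "cv (D (D (D f))) k = d (cv (D (D f)) k)"
      unfolding d_def by (rule Dlow[OF DO[OF DO[OF f(1)]] 2])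
    ultimately have "cv (E f) k = d (d (d (cv f k)))" unfolding E_def by (simp only:)
    then show ?thesis using d3[OF OnD(2)[OF f(1)]] by simp
  qed
  have surj: "\<exists>y\<in>N'. \<pi> (\<iota> y) = z" if z: "z \<in> N'" for z
  proof -
    have "\<exists>y\<in>N'. y - E y = z"
    proof (rule geometric_series[OF _ _ Eorder NO(2) N'c(1) _ N'5 z])
      show "E (f - g) = E f - E g" for f g by (simp add: E_def Dlin)
      show "E f \<in> On m" if "f \<in> On m" for f unfolding E_def by (intro DO that)
      show "E f \<in> N'" if "f \<in> N'" for f unfolding E_def by (intro DN that)
    qed
    then obtain y where y: "y \<in> N'" "y - E y = z" by blast
    let ?w = "y + D y + D (D y)"
    have Dadd: "D (f + g) = D f + D g" for f g by (simp add: D_def \<iota>lin \<pi>lin)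
    have "\<pi> (\<iota> ?w) = ?w - D ?w" unfolding D_def[of ?w] by simp
    also have "\<dots> = y - E y" unfolding Dadd E_def by simp
    finally have "\<pi> (\<iota> ?w) = z" using y(2) by simp
    moreover have "?w \<in> N'" by (intro N'c(1) y(1) DN)
    ultimately show ?thesis by blast
  qed
  \<comment> \<open>An element of the kernel is fixed by \<open>D\<close>, hence by
    \<open>E\<close>, and so vanishes to every order.\<close>
  have inj0: "f = 0" if f: "f \<in> On m" "\<pi> (\<iota> f) = 0" for f
  proof -
    have "D f = f" using f(2) by (simp add: D_def)
    then have Ef: "E f = f" by (simp add: E_def)
    have low0: "cv f j = 0" if "j < int k" for j k
      using that
    proof (induction k arbitrary: j)
      case 0
      then show ?case using OnD(1)[OF f(1)] by simp
    next
      case (Suc k)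
      have "cv (E f) (int k) = 0" by (rule Eorder[OF f(1) Suc.IH])
      then show ?case using Suc.IH[of j] Suc.prems Ef by (cases "j = int k") simp_all
    qed
    have "cv f j = cv 0 j" for j using low0[of j "nat (j + 1)"] by simp
    then show ?thesis by (rule cv_eqI)
  qed
  define A where "A = \<iota> ` N'"
  define B where "B = {x \<in> N. \<pi> x = 0}"
  have tO: "r \<in> supp_in {0..}" if "(r::'k fls) \<in> tail c" for r c
    using that by (rule supp_in_mono) auto
  have N'tail: "sm r f \<in> N'" if "r \<in> tail 5" "f \<in> N'" for r f
  proof (rule N'5)
    show "sm r f \<in> On m" by (rule stableD(4)[OF stable_On tO[OF that(1)]]) (use that NO in auto)
    show "cv (sm r f) j = 0" if "j < 5" for j
    proof -
      have "f i \<in> supp_in {0..}" for i using \<open>f \<in> N'\<close> NO(2) by (cases "i < m") (auto simp: On_def)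
      then have "r * f i \<in> supp_in {5..}" for i using \<open>r \<in> tail 5\<close> by (intro supp_in_mult) auto
      then have "(r * f i) $$ j = 0" for i using that by (intro supp_inD) auto
      then show ?thesis by (simp add: cv_def fun_eq_iff)
    qed
  qed
  have N'0: "0 \<in> N'" by (rule N'5[OF stableD(1)[OF stable_On]]) (rule cv_simps)
  have A: "stable (tail 5) A" "A \<subseteq> N"
  proof -
    show "A \<subseteq> N" using \<iota>N by (auto simp: A_def)
    show "stable (tail 5) A"
      unfolding stable_def
    proof (intro conjI ballI)
      show "0 \<in> A" unfolding A_def using imageI[OF N'0, of \<iota>] \<iota>0(1) by simp
      fix x y assume "x \<in> A" "y \<in> A"
      then obtain x' y' where "x' \<in> N'" "y' \<in> N'" "x = \<iota> x'" "y = \<iota> y'" by (auto simp: A_def)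
      then show "x + y \<in> A" "x - y \<in> A"
        using imageI[OF N'c(1), of x' y' \<iota>] imageI[OF N'c(2), of x' y' \<iota>] \<iota>lin(1,2)
        unfolding A_def by simp_all
    next
      fix r :: "'k fls" and x assume r: "r \<in> tail 5" and "x \<in> A"
      then obtain x' where "x' \<in> N'" "x = \<iota> x'" by (auto simp: A_def)
      then show "sm r x \<in> A" using imageI[OF N'tail[OF r], of x' \<iota>] \<iota>lin(3) unfolding A_def by simp
    qed
  qed
  have "stable S B"
    unfolding stable_def B_def using stableD[OF N] \<iota>0 \<pi>lin by auto
  \<comment> \<open>The kernel is stable under R, the image under series of order at least 5; the
    maximum is a common order for both.\<close>
  then have B: "stable (tail (max 5 cnd)) B"
    by (rule stable_subset) (auto intro!: tail_S elim: supp_in_mono)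
  have A': "stable (tail (max 5 cnd)) A"
    by (rule stable_subset[OF A(1)]) (auto elim: supp_in_mono)
  have BN: "B \<subseteq> N" by (auto simp: B_def)
  have AB0: "A \<inter> B = {0}"
    using inj0 NO(2) \<iota>0 A(1) B stableD(1) by (auto simp: A_def B_def)
  have dec: "\<exists>a\<in>A. \<exists>b\<in>B. x = a + b" if x: "x \<in> N" for x
  proof -
    obtain y where y: "y \<in> N'" "\<pi> (\<iota> y) = \<pi> x" using surj[OF \<pi>N[OF x]] by blast
    have "x - \<iota> y \<in> B"
      unfolding B_def using stableD(3)[OF N x \<iota>N[OF y(1)]] y(2) \<pi>lin(2) by simp
    moreover have "\<iota> y \<in> A" using y(1) by (simp add: A_def)
    moreover have "x = \<iota> y + (x - \<iota> y)" by simp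
    ultimately show ?thesis by blast
  qed
  have "A \<noteq> {0}"
  proof
    assume A0: "A = {0}"
    \<comment> \<open>As the rank is at least 1, this is a nonzero element present in every
      type.\<close>
    let ?f = "sm (tp 5) (unit 0) :: nat \<Rightarrow> 'k fls"
    have "?f \<in> N'"
    proof (rule N'5)
      show "?f \<in> On m" using m13(1) by (auto simp: On_def unit_def)
      show "cv ?f j = 0" if "j < 5" for j using that by (simp add: cv_def unit_def fun_eq_iff)
    qed
    then have "\<iota> ?f = 0" using A0 by (auto simp: A_def)
    then have "?f = 0" using inj0[of ?f] \<open>?f \<in> N'\<close> NO(2) \<iota>0(2) by auto
    then have "?f 0 = 0" by (metis zero_fun_apply)
    then show False by (simp add: unit_def)
  qed
  then have B0: "B = {0}"
    using indecomposable_split[OF ind N A' A(2) B BN AB0 dec] by blast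
  have "bij_betw \<pi> N N'"
    unfolding bij_betw_def
  proof
    show "inj_on \<pi> N"
    proof (rule inj_onI)
      fix x y assume xy: "x \<in> N" "y \<in> N" "\<pi> x = \<pi> y"
      then have "x - y \<in> B" unfolding B_def using stableD(3)[OF N xy(1,2)] \<pi>lin(2) by simp
      then have "x - y = 0" using B0 by blast
      then show "x = y" by (rule eq_iff_diff_eq_0[THEN iffD2])
    qed
    show "\<pi> ` N = N'"
      using \<pi>N surj \<iota>N by (intro equalityI subsetI) (auto, metis imageI)
  qed
  then have "mod_isomorphic (semigroup_ring H) (cm N) (cm N')"
    by (rule iso_cm[OF N]) (use \<pi>lin in auto)
  then show ?thesis by (simp add: type_module_def N'_def mPC)
qed

section \<open>Frames over K and triples of coefficient vectors\<close>

definition K357 :: "'k::field fls set"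
  where "K357 = supp_in ({0, 3} \<union> {5..})"

text \<open>The gaps of K are 1, 2 and 4: modulo K^n every vector of power series has this
  form.\<close>

definition mk :: "(nat \<Rightarrow> 'k::field) \<Rightarrow> (nat \<Rightarrow> 'k) \<Rightarrow> (nat \<Rightarrow> 'k) \<Rightarrow> nat \<Rightarrow> 'k fls"
  where "mk x y z = (\<lambda>i. fls_const (x i) * tp 1 + fls_const (y i) * tp 2 + fls_const (z i) * tp 4)"

lemma mk_On: "x \<in> Usp n \<Longrightarrow> y \<in> Usp n \<Longrightarrow> z \<in> Usp n \<Longrightarrow> mk x y z \<in> On n"
  by (auto simp: mk_def On_def Usp_def)

lemma mk_linear: "mk (x + x') (y + y') (z + z') = mk x y z + mk x' y' z'"
  "mk (sc c x) (sc c y) (sc c z) = sm (fls_const c) (mk x y z)" "mk 0 0 0 = 0"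
  by (auto simp: mk_def fun_eq_iff fls_eq_iff algebra_simps)

text \<open>The unit vectors span K^n inside \<open>N\<close>, so membership depends only on the
  coefficients at the gaps of K.\<close>

lemma (in numsg) frame_rel_module:
  fixes N :: "(nat \<Rightarrow> 'k::field fls) set"
  assumes fr: "frame n N" and N: "stable K357 N"
  shows "\<exists>T. admissible n T \<and> N = rel_module n T"
proof -
  have NO: "N \<subseteq> On n" and un: "\<And>i. i < n \<Longrightarrow> unit i \<in> N" using fr by (auto simp: frame_def)
  note ND = stableD[OF N]
  have K: "g \<in> N" if "g \<in> On n" "\<And>q. g q \<in> K357" for g
  proof -
    have "(\<Sum>q<n. sm (g q) (unit q)) \<in> N"
      by (rule stable_sum[OF N]) (use un ND(4) that(2) in auto)
    then show ?thesis using On_expand[OF that(1)] by simp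
  qed
  have K': "f \<in> N \<longleftrightarrow> g \<in> N" if "f \<in> On n" "g \<in> On n" "\<And>q. f q - g q \<in> K357" for f g
  proof -
    have "f - g \<in> N" by (rule K[OF stableD(3)[OF stable_On that(1,2)]]) (use that(3) in simp)
    then show ?thesis using ND(2)[of "f - g" g] ND(3)[of f "f - g"] by force
  qed
  define T where "T x y z \<longleftrightarrow> x \<in> Usp n \<and> y \<in> Usp n \<and> z \<in> Usp n \<and> mk x y z \<in> N" for x y z
  have "f \<in> N \<longleftrightarrow> T (cv f 1) (cv f 2) (cv f 4)" if f: "f \<in> On n" for f
  proof -
    have "f q - mk (cv f 1) (cv f 2) (cv f 4) q \<in> K357" for q
    proof -
      have "f q $$ j = 0" if "j < 0" for j using OnD(1)[OF f that] by (auto simp: fun_eq_iff)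
      then show ?thesis
        unfolding K357_def supp_in_def mk_def by (auto split: if_splits) (smt (verit))
    qed
    then have "f \<in> N \<longleftrightarrow> mk (cv f 1) (cv f 2) (cv f 4) \<in> N"
      by (intro K' f mk_On OnD(2)[OF f])
    then show ?thesis using OnD(2)[OF f] by (simp add: T_def)
  qed
  then have "N = rel_module n T" using NO by (auto simp: rel_module_def)
  moreover have "admissible n T"
    unfolding admissible_def
  proof (intro conjI allI impI)
    show "T 0 0 0" using ND(1) by (simp add: T_def mk_linear Usp_closed)
    show "T (x + x') (y + y') (z + z')" if "T x y z" "T x' y' z'" for x y z x' y' z'
      using that ND(2) Usp_closed(2) unfolding T_def mk_linear by blast
    show "T (sc c x) (sc c y) (sc c z)" if "T x y z" for c x y z
    proof -
      have "fls_const c \<in> K357" unfolding K357_def by (rule supp_in_closed) simp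
      then show ?thesis using that ND(4) Usp_closed(4) unfolding T_def mk_linear by blast
    qed
    fix x y z assume T: "T x y z"
    then show "x \<in> Usp n" "y \<in> Usp n" "z \<in> Usp n" by (auto simp: T_def)
    \<comment> \<open>Multiplication by t^3 moves t to t^4, while t^2 and t^4 go to t^5 and t^7,
      which are in K.\<close>
    have "sm (tp 3) (mk x y z) \<in> N"
      by (rule ND(4)) (use T in \<open>auto simp: T_def K357_def\<close>)
    moreover have "sm (tp 3) (mk x y z) \<in> On n" using calculation NO by auto
    moreover have "sm (tp 3) (mk x y z) q - mk 0 0 x q \<in> K357" for q
      unfolding K357_def supp_in_def mk_def by (auto split: if_splits)
    moreover have "mk 0 0 x \<in> On n" using T by (intro mk_On) (auto simp: T_def Usp_closed)
    ultimately have "mk 0 0 x \<in> N" using K' by blast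
    then show "T 0 0 x" using T by (simp add: T_def Usp_closed)
  qed
  ultimately show ?thesis by blast
qed

theorem (in numsg) finite_357:
  fixes N :: "(nat \<Rightarrow> 'k::field fls) set"
  assumes ind: "indecomposable_module (semigroup_ring H) (cm N)"
    and fr: "frame n N" and N: "stable S N" "stable K357 N"
  shows "\<exists>\<tau>\<in>types. mod_isomorphic (semigroup_ring H) (cm N) (cm (type_module \<tau>))"
proof -
  obtain T where T: "admissible n T" and NT: "N = rel_module n T"
    using frame_rel_module[OF fr N(2)] by blast
  note TD = admissibleD[OF T]
  interpret relation_pair "Usp n" "\<lambda>x y. \<exists>z. T x y z" "\<lambda>y z. T 0 y z"
  proof
    show "sub (\<lambda>v. v \<in> (Usp n :: (nat \<Rightarrow> 'k) set))"
      using Usp_closed unfolding sub_def by blast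
    show "linrel sc sc (\<lambda>x y. \<exists>z. T x y z)"
      unfolding linrel_def using TD(1-3) by blast
    show "linrel sc sc (\<lambda>y z. T 0 y z)"
      unfolding linrel_def
    proof (intro conjI allI impI)
      show "T 0 0 0" by (rule TD(1))
      show "T 0 (y + y') (z + z')" if "T 0 y z" "T 0 y' z'" for y z y' z'
        using TD(2)[OF that] by (simp only: add_0)
      show "T 0 (sc c y) (sc c z)" if "T 0 y z" for c y z
        using TD(3)[OF that, of c] by (simp only: sc_simps)
    qed
    show "(\<exists>z. T 0 y z) \<longleftrightarrow> (\<exists>z. T 0 y z)" for y by (rule refl)
    show "x \<in> Usp n \<and> y \<in> Usp n" if "\<exists>z. T x y z" for x y using that TD(4,5) by blast
    show "y \<in> Usp n \<and> z \<in> Usp n" if "T 0 y z" for y z using that TD(5,6) by blast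
    show "T 0 0 x" if "\<exists>z. T x y z" for x y using that TD(7) by blast
  qed
  have "n \<noteq> 0"
  proof
    assume "n = 0"
    then have "N \<subseteq> {0}" using fr by (auto simp: frame_def On_def fun_eq_iff)
    then have "carrier (cm N) = {\<zero>\<^bsub>cm N\<^esub>}" using stableD(1)[OF N(1)] by auto
    then show False using ind by (simp add: indecomposable_module_def)
  qed
  then have "ev 0 \<in> (Usp n :: (nat \<Rightarrow> 'k) set)" by (auto simp: ev_def Usp_def)
  moreover have "(ev 0 :: nat \<Rightarrow> 'k) \<noteq> 0"
    unfolding ev_def by (metis (mono_tags) zero_fun_apply zero_neq_one)
  ultimately obtain \<tau> where \<tau>: "\<tau> \<in> types"
    and spl: "splits (Usp n) (\<lambda>x y. \<exists>z. T x y z) (\<lambda>y z. T 0 y z) \<tau>"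
    using splits_some_type by blast
  show ?thesis
    using type_summand[OF ind N(1) T NT \<tau> spl] \<tau> by blast
qed

text \<open>If \<open>H0\<close> is symmetric, then \<open>f \<mapsto> f $$ F0\<close> identifies linear functionals vanishing on \<open>N\<close> with
  \<open>k[[H0]]\<close>-linear forms on \<open>N\<close>. So a module without a unit valued form admits multiplication by
  \<open>t\<^sup>F\<^sup>0\<close>.\<close>

lemma (in numsg) symmetric_dichotomy:
  fixes N :: "(nat \<Rightarrow> 'k::field fls) set"
  assumes ind: "indecomposable_module (semigroup_ring H) (cm N)"
    and fr: "frame n N" and N: "stable S N" and H0: "numsg H0" and N0: "stable (numsg.S H0) N"
    and F0: "0 \<le> F0" "\<And>i. i \<in> int ` H0 \<longleftrightarrow> F0 - i \<notin> int ` H0"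
  shows "mod_isomorphic (semigroup_ring H) (cm N) (cm (rank1 (numsg.S H0)))
    \<or> (\<forall>x\<in>N. sm (tp F0) x \<in> N)"
proof (rule disjCI)
  interpret R0: numsg H0 by fact
  note ND = stableD[OF N0]
  have NO: "N \<subseteq> On n" and un: "\<And>i. i < n \<Longrightarrow> unit i \<in> N" using fr by (auto simp: frame_def)
  assume "\<not> (\<forall>x\<in>N. sm (tp F0) x \<in> N)"
  then obtain x where x: "x \<in> N" and y: "sm (tp F0) x \<notin> N" by blast
  define y where "y = sm (tp F0) x"
  define s1 where "s1 c = sm (fls_const c :: 'k fls)" for c
  have s1: "vector_space s1"
    by unfold_locales (auto simp: s1_def fun_eq_iff fls_eq_iff algebra_simps)
  have s1N: "s1 c w \<in> N" if "w \<in> N" for c w using ND(4)[OF _ that] by (simp add: s1_def)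
  define G where "G v c \<longleftrightarrow> (\<exists>w\<in>N. v = w + s1 c y)" for v c
  have s1D: "s1 (c + d) v = s1 c v + s1 d v" "s1 c (v + w) = s1 c v + s1 c w" "s1 0 v = 0"
    "s1 c (s1 d v) = s1 (c * d) v" "s1 1 v = v" for c d v w
    by (auto simp: s1_def fun_eq_iff fls_eq_iff algebra_simps)
  have GI: "G v c" if "w \<in> N" "v = w + s1 c y" for v c w using that unfolding G_def by blast
  have "linrel s1 (*) G"
    unfolding linrel_def
  proof (intro conjI allI impI)
    show "G 0 0" by (rule GI[OF ND(1)]) (simp only: s1D add_0)
  next
    fix v c v' c' assume "G v c" "G v' c'"
    then obtain w w' where *: "w \<in> N" "w' \<in> N" "v = w + s1 c y" "v' = w' + s1 c' y"
      unfolding G_def by blast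
    show "G (v + v') (c + c')"
      by (rule GI[OF ND(2)[OF *(1,2)]]) (simp only: s1D *(3,4) add_ac)
  next
    fix d v c assume "G v c"
    then obtain w where *: "w \<in> N" "v = w + s1 c y" unfolding G_def by blast
    show "G (s1 d v) (d * c)" by (rule GI[OF s1N[OF *(1)]]) (simp only: s1D *(2))
  qed
  \<comment> \<open>This yields a k-linear functional that vanishes on \<open>N\<close> and is 1 at
    \<open>y\<close>. Its continuity is not part of the construction; it follows from the vanishing
    on \<open>N\<close>.\<close>
  from linear_selection[OF s1 vector_space_mult this]
  obtain g where g: "Vector_Spaces.linear s1 (*) g" "\<And>v w. G v w \<Longrightarrow> G v (g v)" by blast
  interpret g: Vector_Spaces.linear s1 "(*)" g by fact
  have G0: "c = 0" if "w \<in> N" "s1 c y \<in> N" for c w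
  proof (rule ccontr)
    assume "c \<noteq> 0"
    then have "s1 (1 / c) (s1 c y) = y" unfolding s1D by (simp add: s1D)
    then show False using s1N[OF that(2), of "1 / c"] \<open>sm (tp F0) x \<notin> N\<close> by (simp add: y_def)
  qed
  have gN: "g v = 0" if v: "v \<in> N" for v
  proof -
    have "G v 0" by (rule GI[OF v]) (simp only: s1D add_0_right)
    then obtain w where w: "w \<in> N" "v = w + s1 (g v) y" using g(2) unfolding G_def by blast
    have "s1 (g v) y = v - w" unfolding eq_diff_eq by (subst add.commute) (rule w(2)[symmetric])
    then show ?thesis using G0 ND(3)[OF v \<open>w \<in> N\<close>] \<open>w \<in> N\<close> by simp
  qed
  have gy: "g y = 1"
  proof -
    have "G y 1" by (rule GI[OF ND(1)]) (simp only: s1D add_0)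
    then obtain w where w: "w \<in> N" "y = w + s1 (g y) y" using g(2) unfolding G_def by blast
    have "s1 1 y = s1 (1 - g y) y + s1 (g y) y" unfolding s1D(1)[symmetric] by simp
    then have "s1 (1 - g y) y = w" using w(2) unfolding s1D(5) by (metis add_right_cancel)
    then show ?thesis using G0[OF w(1), of "1 - g y"] w(1) by simp
  qed
  define c where "c = R0.cnd"
  define \<mu> where "\<mu> q j = g (sm (tp (int j)) (unit q))" for q and j :: nat
  \<comment> \<open>Vectors of series of order at least \<open>c\<close> belong to \<open>N\<close>,
    so \<open>g\<close> depends on finitely many coefficients.\<close>
  have gO: "g v = (\<Sum>q<n. \<Sum>j<c. v q $$ int j * \<mu> q j)" if v: "v \<in> On n" for v
  proof -
    let ?v = "\<Sum>q<n. \<Sum>j<c. s1 (v q $$ int j) (sm (tp (int j)) (unit q))"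
    have vq: "?v r = (if r < n then (\<Sum>j<c. fls_const (v r $$ int j) * tp (int j)) else 0)" for r
      by (simp add: fun_sum_apply s1_def unit_def if_distrib cong: if_cong)
        (subst sum.swap, simp)
    have "(v - ?v) r \<in> R0.S" if r: "r < n" for r
    proof (rule R0.tail_S, rule supp_inI)
      fix i assume i: "(v - ?v) r $$ i \<noteq> 0"
      have vr: "v r \<in> supp_in {0..}" using v r by (auto simp: On_def)
      show "i \<in> {int R0.cnd..}"
      proof (rule ccontr)
        assume ni: "i \<notin> {int R0.cnd..}"
        show False
        proof (cases "i < 0")
          case True
          then show ?thesis using i vq[of r] r supp_inD[OF vr, of i] by (auto simp: fls_nth_sum)
        next
          case False
          then obtain j where j: "i = int j" "j < c" using ni by (auto simp: c_def) (metis nat_eq_iff2 nat_int_comparison(2) not_le int_nat_eq)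
          have "(\<Sum>j'<c. (fls_const (v r $$ int j') * tp (int j')) $$ i) = (\<Sum>j'<c. if j' = j then v r $$ i else 0)"
            using j(1) by (intro sum.cong) auto
          then show ?thesis using i vq[of r] r j(2) by (simp add: fls_nth_sum)
        qed
      qed
    qed
    then have "(\<Sum>r<n. sm ((v - ?v) r) (unit r)) \<in> N"
      by (intro stable_sum[OF N0] ND(4) un) auto
    moreover have "v - ?v \<in> On n"
    proof (intro stableD(3)[OF stable_On] v stable_sum[OF stable_On])
      fix q j assume "q \<in> {..<n}"
      then show "s1 (v q $$ int j) (sm (tp (int j)) (unit q)) \<in> On n"
        by (auto simp: On_def s1_def unit_def)
    qed
    ultimately have "v - ?v \<in> N" by (simp only: On_expand[symmetric])
    then have "g v = g ?v" using gN[of "v - ?v"] by (simp only: g.diff right_minus_eq)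
    also have "\<dots> = (\<Sum>q<n. \<Sum>j<c. v q $$ int j * \<mu> q j)"
      by (simp only: g.sum g.scale \<mu>_def)
    finally show ?thesis .
  qed
  \<comment> \<open>Chosen so that the coefficient of Q_q v_q at t^F0 is the contribution of v_q to
    g(v).\<close>
  define Q where "Q q = (\<Sum>j<c. fls_const (\<mu> q j) * tp (F0 - int j))" for q
  define \<phi> where "\<phi> v = (\<Sum>q<n. Q q * v q)" for v
  have "(Q q * w) $$ F0 = (\<Sum>j<c. w $$ int j * \<mu> q j)" for q w
    unfolding Q_def sum_distrib_right fls_nth_sum mult.assoc by (simp add: mult.commute)
  then have \<phi>g: "\<phi> v $$ F0 = g v" if "v \<in> On n" for v
    unfolding gO[OF that] \<phi>_def fls_nth_sum by simp
  have \<phi>sm: "\<phi> (sm r v) = r * \<phi> v" for r v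
    by (simp add: \<phi>_def sum_distrib_left mult_ac)
  have \<phi>add: "\<phi> (v + w) = \<phi> v + \<phi> w" for v w
    by (simp add: \<phi>_def sum.distrib algebra_simps)
  \<comment> \<open>If the coefficient at some i outside \<open>H0\<close> were nonzero, then F0 - i
    would lie in \<open>H0\<close>, and \<open>g\<close> would not vanish on t^(F0 - i) v, an
    element of \<open>N\<close>.\<close>
  have \<phi>S: "\<phi> v \<in> R0.S" if v: "v \<in> N" for v
    unfolding R0.S_def
  proof (rule supp_inI, rule ccontr)
    fix i assume i: "\<phi> v $$ i \<noteq> 0" and "i \<notin> int ` H0"
    then obtain h where h: "h \<in> H0" "F0 - i = int h" using F0(2)[of i] by auto
    then have s: "sm (tp (F0 - i)) v \<in> N" using ND(4)[OF _ v] R0.tp_S by auto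
    have "\<phi> (sm (tp (F0 - i)) v) $$ F0 = 0" using \<phi>g[of "sm (tp (F0 - i)) v"] s NO gN by auto
    then show False using i unfolding \<phi>sm by simp
  qed
  have yO: "y \<in> On n"
    unfolding y_def by (rule stableD(4)[OF stable_On]) (use F0 x NO in auto)
  have "\<phi> x $$ 0 = \<phi> y $$ F0" unfolding y_def \<phi>sm by simp
  then have "\<phi> x $$ 0 \<noteq> 0" using \<phi>g[OF yO] gy by simp
  then show "mod_isomorphic (semigroup_ring H) (cm N) (cm (rank1 R0.S))"
    by (intro unit_valued_form[OF ind N H0 N0 \<phi>S \<phi>add \<phi>sm x])
qed

text \<open>For the semigroups of interest, generated by 3, 4 and by 3, 5, the exponent
  \<open>F0\<close> is 5 and 7; adjoining t^F0 makes K act on the module.\<close>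

lemma (in numsg) finite_symmetric:
  fixes N :: "(nat \<Rightarrow> 'k::field fls) set"
  assumes ind: "indecomposable_module (semigroup_ring H) (cm N)"
    and fr: "frame n N" and N: "stable S N" and H0: "numsg H0" and N0: "stable (numsg.S H0) N"
    and F0: "0 \<le> F0" "\<And>i. i \<in> int ` H0 \<longleftrightarrow> F0 - i \<notin> int ` H0"
    and sup: "{0, 3} \<union> {5..} \<subseteq> int ` H0 \<union> {F0}"
  shows "mod_isomorphic (semigroup_ring H) (cm N) (cm (rank1 (numsg.S H0)))
    \<or> (\<exists>\<tau>\<in>types. mod_isomorphic (semigroup_ring H) (cm N) (cm (type_module \<tau>)))"
  using symmetric_dichotomy[OF ind fr N H0 N0 F0]
proof
  interpret R0: numsg H0 by fact
  assume F: "\<forall>x\<in>N. sm (tp F0) x \<in> N"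
  have "stable K357 N"
    unfolding stable_def
  proof (intro conjI ballI)
    fix r :: "'k fls" and x assume r: "r \<in> K357" and x: "x \<in> N"
    let ?r = "r - fls_const (r $$ F0) * tp F0"
    have "?r \<in> R0.S"
      unfolding R0.S_def
    proof (rule supp_inI)
      fix i assume "?r $$ i \<noteq> 0"
      then have "i \<noteq> F0" "r $$ i \<noteq> 0" by (auto split: if_splits)
      then show "i \<in> int ` H0" using r sup unfolding K357_def supp_in_def by blast
    qed
    then have "sm ?r x \<in> N" using stableD(4)[OF N0 _ x] by blast
    moreover have "sm (fls_const (r $$ F0)) (sm (tp F0) x) \<in> N"
      by (rule stableD(4)[OF N0]) (use F x in auto)
    ultimately have "sm ?r x + sm (fls_const (r $$ F0)) (sm (tp F0) x) \<in> N"
      by (rule stableD(2)[OF N0])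
    moreover have "sm ?r x + sm (fls_const (r $$ F0)) (sm (tp F0) x) = sm r x"
      by (simp add: fun_eq_iff algebra_simps)
    ultimately show "sm r x \<in> N" by simp
  qed (use stableD[OF N] in auto)
  then show ?thesis using finite_357[OF ind fr N] by blast
qed blast

section \<open>Embedding torsion-free modules\<close>

definition span_int :: "(nat \<Rightarrow> 'k::field fls) set \<Rightarrow> (nat \<Rightarrow> 'k fls) set"
  where "span_int Y = {\<Sum>y\<in>Y. sm (c y) y | c. \<forall>y\<in>Y. c y \<in> supp_in {0..}}"

lemma span_intI: "(\<And>y. y \<in> Y \<Longrightarrow> c y \<in> supp_in {0..}) \<Longrightarrow> (\<Sum>y\<in>Y. sm (c y) y) \<in> span_int Y"
  unfolding span_int_def by blast

lemma stable_span_int: "stable (supp_in {0..}) (span_int Y)"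
  unfolding stable_def
proof (intro conjI ballI)
  have "(\<Sum>y\<in>Y. sm 0 y) \<in> span_int Y" by (rule span_intI) auto
  then show "0 \<in> span_int Y" by simp
next
  fix x y assume "x \<in> span_int Y" "y \<in> span_int Y"
  then obtain c d where c: "\<forall>y\<in>Y. c y \<in> supp_in {0..}" "x = (\<Sum>y\<in>Y. sm (c y) y)"
    and d: "\<forall>y\<in>Y. d y \<in> supp_in {0..}" "y = (\<Sum>y\<in>Y. sm (d y) y)" unfolding span_int_def by blast
  have "x + y = (\<Sum>y\<in>Y. sm (c y + d y) y)" "x - y = (\<Sum>y\<in>Y. sm (c y - d y) y)"
    unfolding c(2) d(2) sm_distrib by (simp_all only: sum.distrib sum_subtractf)
  moreover have "(\<Sum>y\<in>Y. sm (c y + d y) y) \<in> span_int Y" "(\<Sum>y\<in>Y. sm (c y - d y) y) \<in> span_int Y"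
    by (rule span_intI; use c(1) d(1) in simp)+
  ultimately show "x + y \<in> span_int Y" "x - y \<in> span_int Y" by simp_all
next
  fix r x assume r: "(r::'a fls) \<in> supp_in {0..}" and "x \<in> span_int Y"
  then obtain c where c: "\<forall>y\<in>Y. c y \<in> supp_in {0..}" "x = (\<Sum>y\<in>Y. sm (c y) y)"
    unfolding span_int_def by blast
  have "sm r x = (\<Sum>y\<in>Y. sm (r * c y) y)"
    unfolding c(2) by (simp add: fun_eq_iff fun_sum_apply sum_distrib_left mult.assoc)
  moreover have "(\<Sum>y\<in>Y. sm (r * c y) y) \<in> span_int Y"
    by (rule span_intI) (use r c(1) in \<open>auto intro: supp_in_mult\<close>)
  ultimately show "sm r x \<in> span_int Y" by simp
qed

lemma span_int_superset: "finite Y \<Longrightarrow> y \<in> Y \<Longrightarrow> y \<in> span_int Y"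
proof -
  assume Y: "finite Y" "y \<in> Y"
  have "(\<Sum>z\<in>Y. sm (if z = y then 1 else 0) z) = (\<Sum>z\<in>Y. if z = y then y else 0)"
    by (rule sum.cong) auto
  also have "\<dots> = y" using Y by simp
  finally show ?thesis using span_intI[of Y "\<lambda>z. if z = y then 1 else 0"] by force
qed

text \<open>Dividing a linear relation by a coefficient of least order makes one of the generators
  redundant.\<close>

lemma minimal_span_independent:
  fixes Y :: "(nat \<Rightarrow> 'k::field fls) set"
  assumes Y: "finite Y" "N0 \<subseteq> span_int Y"
    and min: "\<And>y. y \<in> Y \<Longrightarrow> \<not> N0 \<subseteq> span_int (Y - {y})"
    and rel: "(\<Sum>y\<in>Y. sm (c y) y) = 0" and y: "y \<in> Y"
  shows "c y = 0"
proof (rule ccontr)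
  assume "c y \<noteq> 0"
  define Z where "Z = {y \<in> Y. c y \<noteq> 0}"
  have "finite Z" "Z \<noteq> {}" using Y y \<open>c y \<noteq> 0\<close> by (auto simp: Z_def)
  then obtain z where z: "z \<in> Z" "\<And>y. y \<in> Z \<Longrightarrow> fls_subdegree (c z) \<le> fls_subdegree (c y)"
    using arg_min_if_finite[of Z "\<lambda>y. fls_subdegree (c y)"] not_less by blast
  then have zY: "z \<in> Y" "c z \<noteq> 0" by (auto simp: Z_def)
  define d where "d y = c y / c z" for y
  have dO: "d y \<in> supp_in {0..}" if "y \<in> Y" for y
  proof (cases "c y = 0")
    case False
    then have "fls_subdegree (d y) = fls_subdegree (c y) - fls_subdegree (c z)"
      using zY(2) by (simp add: d_def fls_divide_subdegree)
    moreover have "d y \<noteq> 0" using False zY(2) by (simp add: d_def)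
    ultimately show ?thesis using z(2)[of y] that False subdegree_supp[of "d y" 0] by (simp add: Z_def)
  qed (simp add: d_def)
  have dz: "d z = 1" using zY(2) by (simp add: d_def)
  have "(\<Sum>y\<in>Y. sm (d y) y) = sm (inverse (c z)) (\<Sum>y\<in>Y. sm (c y) y)"
    by (simp add: d_def fun_eq_iff fun_sum_apply sum_distrib_left divide_inverse mult_ac)
  then have d0: "(\<Sum>y\<in>Y. sm (d y) y) = 0" using rel by simp
  have "N0 \<subseteq> span_int (Y - {z})"
  proof
    fix v assume "v \<in> N0"
    then obtain e where e: "\<forall>y\<in>Y. e y \<in> supp_in {0..}" "v = (\<Sum>y\<in>Y. sm (e y) y)"
      using Y(2) unfolding span_int_def by blast
    have "v = (\<Sum>y\<in>Y. sm (e y - e z * d y) y)"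
    proof -
      have "(\<Sum>y\<in>Y. sm (e y - e z * d y) y) = v - sm (e z) (\<Sum>y\<in>Y. sm (d y) y)"
        unfolding e(2) by (simp add: fun_eq_iff fun_sum_apply sum_distrib_left sum_subtractf algebra_simps)
      then show ?thesis using d0 by simp
    qed
    also have "\<dots> = (\<Sum>y\<in>Y - {z}. sm (e y - e z * d y) y)"
      using Y(1) zY(1) dz by (subst sum.remove[of Y z]) auto
    also have "\<dots> \<in> span_int (Y - {z})"
    proof (rule span_intI)
      fix y assume y: "y \<in> Y - {z}"
      have "e z * d y \<in> supp_in {0..}"
        by (rule supp_in_mult[of _ "{0..}" _ "{0..}"]) (use e(1) dO zY y in auto)
      then show "e y - e z * d y \<in> supp_in {0..}" using e(1) y by auto
    qed
    finally show "v \<in> span_int (Y - {z})" .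
  qed
  then show False using min zY(1) by blast
qed

context numsg
begin

definition torsion_free :: "('k::field fls, 'b, 'y) module_scheme \<Rightarrow> bool"
  where "torsion_free M \<longleftrightarrow> (\<forall>r\<in>S. \<forall>x\<in>carrier M. r \<odot>\<^bsub>M\<^esub> x = \<zero>\<^bsub>M\<^esub> \<longrightarrow> r = 0 \<or> x = \<zero>\<^bsub>M\<^esub>)"

definition embeds :: "('k::field fls, 'b, 'y) module_scheme \<Rightarrow> 'b set \<Rightarrow> nat \<Rightarrow> ('b \<Rightarrow> nat \<Rightarrow> 'k fls) \<Rightarrow> bool"
  where "embeds M N p \<iota> \<longleftrightarrow> (\<forall>x\<in>N. \<iota> x \<in> On p \<and> (\<iota> x = 0 \<longrightarrow> x = \<zero>\<^bsub>M\<^esub>)) \<and>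
    (\<forall>x\<in>N. \<forall>y\<in>N. \<iota> (x \<oplus>\<^bsub>M\<^esub> y) = \<iota> x + \<iota> y) \<and> (\<forall>r\<in>S. \<forall>x\<in>N. \<iota> (r \<odot>\<^bsub>M\<^esub> x) = sm r (\<iota> x))"

text \<open>Adjoin a generator \<open>x\<close>. Either a nonzero multiple r x already lies in
  \<open>N\<close>, and then multiplication by \<open>r\<close> maps R x + N injectively into
  \<open>N\<close>, as there is no torsion; or R x meets \<open>N\<close> only in 0, and
  \<open>x\<close> receives a coordinate of its own.\<close>

lemma embeds_fg:
  fixes M :: "('k::field fls, 'b, 'y) module_scheme"
  assumes "module (semigroup_ring H) M" and tf: "torsion_free M"
    and "finite X" "X \<subseteq> carrier M"
  shows "\<exists>N p \<iota>. submodule N (semigroup_ring H) M \<and> X \<subseteq> N \<and> embeds M N p \<iota>"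
  using assms(3,4)
proof (induction X rule: finite_induct)
  case empty
  interpret M: module "semigroup_ring H" M by fact
  have "submodule {\<zero>\<^bsub>M\<^esub>} (semigroup_ring H) M"
    by (rule M.submoduleI) auto
  moreover have "embeds M {\<zero>\<^bsub>M\<^esub>} 0 (\<lambda>_. 0)"
    by (auto simp: embeds_def On_def)
  ultimately show ?case by blast
next
  case (insert x X)
  interpret M: module "semigroup_ring H" M by fact
  obtain N p \<iota> where N: "submodule N (semigroup_ring H) M" "X \<subseteq> N" and \<iota>: "embeds M N p \<iota>"
    using insert by auto
  have x: "x \<in> carrier M" using insert by auto
  note sN = M.submoduleE[OF N(1)]
  have NM: "y \<in> carrier M" if "y \<in> N" for y using sN(1) that by auto
  have zN: "\<zero>\<^bsub>M\<^esub> \<in> N"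
    using sN(2-5) NM M.M.r_neg by (metis all_not_in_conv)
  have dN: "y \<ominus>\<^bsub>M\<^esub> z \<in> N" if "y \<in> N" "z \<in> N" for y z
    using that sN by (simp add: a_minus_def)
  define N' where "N' = {r \<odot>\<^bsub>M\<^esub> x \<oplus>\<^bsub>M\<^esub> y | r y. r \<in> S \<and> y \<in> N}"
  have N'I: "r \<odot>\<^bsub>M\<^esub> x \<oplus>\<^bsub>M\<^esub> y \<in> N'" if "r \<in> S" "y \<in> N" for r y
    using that by (auto simp: N'_def)
  have addN': "(r \<odot>\<^bsub>M\<^esub> x \<oplus>\<^bsub>M\<^esub> y) \<oplus>\<^bsub>M\<^esub> (s \<odot>\<^bsub>M\<^esub> x \<oplus>\<^bsub>M\<^esub> z) = (r + s) \<odot>\<^bsub>M\<^esub> x \<oplus>\<^bsub>M\<^esub> (y \<oplus>\<^bsub>M\<^esub> z)"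
    if "r \<in> S" "s \<in> S" "y \<in> N" "z \<in> N" for r s y z
    using that x NM M.smult_l_distr[of r s x] by (simp add: M.M.a_ac)
  have smN': "s \<odot>\<^bsub>M\<^esub> (r \<odot>\<^bsub>M\<^esub> x \<oplus>\<^bsub>M\<^esub> y) = (s * r) \<odot>\<^bsub>M\<^esub> x \<oplus>\<^bsub>M\<^esub> s \<odot>\<^bsub>M\<^esub> y"
    if "r \<in> S" "s \<in> S" "y \<in> N" for r s y
    using that x NM M.smult_assoc1[of s r x] by (simp add: M.smult_r_distr)
  have sub: "submodule N' (semigroup_ring H) M"
  proof (rule M.submoduleI)
    show "N' \<subseteq> carrier M" using x NM by (auto simp: N'_def)
    show "\<zero>\<^bsub>M\<^esub> \<in> N'" using N'I[OF _ zN, of 0] x M.smult_l_null[OF x] by simp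
  next
    fix a assume "a \<in> N'"
    then obtain r y where a: "a = r \<odot>\<^bsub>M\<^esub> x \<oplus>\<^bsub>M\<^esub> y" "r \<in> S" "y \<in> N" by (auto simp: N'_def)
    have "\<ominus>\<^bsub>M\<^esub> a = (- 1) \<odot>\<^bsub>M\<^esub> a"
    proof -
      have am: "a \<in> carrier M" using a x NM by simp
      have "(- 1) \<odot>\<^bsub>M\<^esub> a \<oplus>\<^bsub>M\<^esub> a = (- 1 + 1) \<odot>\<^bsub>M\<^esub> a"
        using M.smult_l_distr[of "- 1" 1 a] M.smult_one[OF am] am by simp
      then have "(- 1) \<odot>\<^bsub>M\<^esub> a \<oplus>\<^bsub>M\<^esub> a = \<zero>\<^bsub>M\<^esub>" using M.smult_l_null[OF am] by simp
      then show ?thesis using am by (intro M.M.minus_equality) auto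
    qed
    also have "\<dots> = (- 1 * r) \<odot>\<^bsub>M\<^esub> x \<oplus>\<^bsub>M\<^esub> (- 1) \<odot>\<^bsub>M\<^esub> y"
      unfolding a(1) by (rule smN') (use a in auto)
    also have "\<dots> \<in> N'" by (rule N'I) (use a sN(4)[of "- 1" y] in auto)
    finally show "\<ominus>\<^bsub>M\<^esub> a \<in> N'" .
  next
    fix a b assume "a \<in> N'" "b \<in> N'"
    then obtain r y s z where a: "a = r \<odot>\<^bsub>M\<^esub> x \<oplus>\<^bsub>M\<^esub> y" "r \<in> S" "y \<in> N"
      and b: "b = s \<odot>\<^bsub>M\<^esub> x \<oplus>\<^bsub>M\<^esub> z" "s \<in> S" "z \<in> N" by (auto simp: N'_def)
    show "a \<oplus>\<^bsub>M\<^esub> b \<in> N'" unfolding a(1) b(1) addN'[OF a(2) b(2) a(3) b(3)]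
      using a b sN(5) by (intro N'I) auto
  next
    fix s :: "'k fls" and a assume s: "s \<in> carrier (semigroup_ring H)" and "a \<in> N'"
    then obtain r y where a: "a = r \<odot>\<^bsub>M\<^esub> x \<oplus>\<^bsub>M\<^esub> y" "r \<in> S" "y \<in> N" by (auto simp: N'_def)
    show "s \<odot>\<^bsub>M\<^esub> a \<in> N'" unfolding a(1) using smN'[OF a(2) _ a(3)] s a sN(4) N'I by auto
  qed
  have xX: "insert x X \<subseteq> N'"
  proof -
    have "1 \<odot>\<^bsub>M\<^esub> x \<oplus>\<^bsub>M\<^esub> \<zero>\<^bsub>M\<^esub> \<in> N'" by (rule N'I[OF _ zN]) simp
    moreover have "0 \<odot>\<^bsub>M\<^esub> x \<oplus>\<^bsub>M\<^esub> y \<in> N'" if "y \<in> N" for y by (rule N'I[OF _ that]) simp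
    ultimately show ?thesis
      using M.smult_one[OF x] M.smult_l_null[OF x] x N(2) NM by auto
  qed
  have \<iota>D: "\<iota> y \<in> On p" "\<iota> y = 0 \<Longrightarrow> y = \<zero>\<^bsub>M\<^esub>" "\<iota> (y \<oplus>\<^bsub>M\<^esub> z) = \<iota> y + \<iota> z"
    "r \<in> S \<Longrightarrow> \<iota> (r \<odot>\<^bsub>M\<^esub> y) = sm r (\<iota> y)"
    if "y \<in> N" "z \<in> N" for y z r using \<iota> that unfolding embeds_def by blast+
  show ?case
  proof (cases "\<exists>r\<in>S. r \<noteq> 0 \<and> r \<odot>\<^bsub>M\<^esub> x \<in> N")
    case True
    then obtain r where r: "r \<in> S" "r \<noteq> 0" "r \<odot>\<^bsub>M\<^esub> x \<in> N" by blast
    have rN: "r \<odot>\<^bsub>M\<^esub> y \<in> N" if y: "y \<in> N'" for y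
    proof -
      obtain s z where s: "y = s \<odot>\<^bsub>M\<^esub> x \<oplus>\<^bsub>M\<^esub> z" "s \<in> S" "z \<in> N" using y by (auto simp: N'_def)
      have "r \<odot>\<^bsub>M\<^esub> y = s \<odot>\<^bsub>M\<^esub> (r \<odot>\<^bsub>M\<^esub> x) \<oplus>\<^bsub>M\<^esub> r \<odot>\<^bsub>M\<^esub> z"
        unfolding s(1) smN'[OF s(2) r(1) s(3)] using M.smult_assoc1[of s r x] s r x by (simp add: mult.commute)
      then show ?thesis using sN(4,5) r s by auto
    qed
    have N'M: "y \<in> carrier M" if "y \<in> N'" for y using M.submoduleE(1)[OF sub] that by auto
    have "embeds M N' p (\<lambda>y. \<iota> (r \<odot>\<^bsub>M\<^esub> y))"
      unfolding embeds_def
    proof (intro conjI ballI impI)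
      fix y assume y: "y \<in> N'"
      show "\<iota> (r \<odot>\<^bsub>M\<^esub> y) \<in> On p" using \<iota>D(1)[OF rN[OF y] zN] .
      show "y = \<zero>\<^bsub>M\<^esub>" if "\<iota> (r \<odot>\<^bsub>M\<^esub> y) = 0"
        using \<iota>D(2)[OF rN[OF y] zN that] tf r(1,2) N'M[OF y] unfolding torsion_free_def by blast
      fix z assume z: "z \<in> N'"
      show "\<iota> (r \<odot>\<^bsub>M\<^esub> (y \<oplus>\<^bsub>M\<^esub> z)) = \<iota> (r \<odot>\<^bsub>M\<^esub> y) + \<iota> (r \<odot>\<^bsub>M\<^esub> z)"
        using \<iota>D(3)[OF rN[OF y] rN[OF z]] M.smult_r_distr[of r y z] r(1) N'M y z by simp
    next
      fix s :: "'k fls" and y assume s: "s \<in> S" and y: "y \<in> N'"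
      have "r \<odot>\<^bsub>M\<^esub> (s \<odot>\<^bsub>M\<^esub> y) = s \<odot>\<^bsub>M\<^esub> (r \<odot>\<^bsub>M\<^esub> y)"
        using M.smult_assoc1[of r s y] M.smult_assoc1[of s r y] s r N'M[OF y] by (simp add: mult.commute)
      then show "\<iota> (r \<odot>\<^bsub>M\<^esub> (s \<odot>\<^bsub>M\<^esub> y)) = sm s (\<iota> (r \<odot>\<^bsub>M\<^esub> y))"
        using \<iota>D(4)[OF rN[OF y] zN s] by simp
    qed
    then show ?thesis using sub xX by blast
  next
    case False
    then have free: "r = 0" if "r \<in> S" "r \<odot>\<^bsub>M\<^esub> x \<in> N" for r using that by blast
    have uniq: "r = s \<and> y = z"
      if "r \<in> S" "s \<in> S" "y \<in> N" "z \<in> N" "r \<odot>\<^bsub>M\<^esub> x \<oplus>\<^bsub>M\<^esub> y = s \<odot>\<^bsub>M\<^esub> x \<oplus>\<^bsub>M\<^esub> z" for r s y z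
    proof -
      have c: "r \<odot>\<^bsub>M\<^esub> x \<in> carrier M" "s \<odot>\<^bsub>M\<^esub> x \<in> carrier M" "y \<in> carrier M" "z \<in> carrier M"
        using that x NM by auto
      have "(r - s) \<odot>\<^bsub>M\<^esub> x \<oplus>\<^bsub>M\<^esub> s \<odot>\<^bsub>M\<^esub> x = r \<odot>\<^bsub>M\<^esub> x"
        using M.smult_l_distr[of "r - s" s x] that x by simp
      then have "(r - s) \<odot>\<^bsub>M\<^esub> x \<oplus>\<^bsub>M\<^esub> s \<odot>\<^bsub>M\<^esub> x \<oplus>\<^bsub>M\<^esub> y = s \<odot>\<^bsub>M\<^esub> x \<oplus>\<^bsub>M\<^esub> z" using that(5) by simp
      then have "s \<odot>\<^bsub>M\<^esub> x \<oplus>\<^bsub>M\<^esub> ((r - s) \<odot>\<^bsub>M\<^esub> x \<oplus>\<^bsub>M\<^esub> y) = s \<odot>\<^bsub>M\<^esub> x \<oplus>\<^bsub>M\<^esub> z"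
        using c x that by (simp add: M.M.a_ac)
      then have "(r - s) \<odot>\<^bsub>M\<^esub> x \<oplus>\<^bsub>M\<^esub> y = z" using c x that by simp
      moreover have "(r - s) \<odot>\<^bsub>M\<^esub> x \<oplus>\<^bsub>M\<^esub> y \<ominus>\<^bsub>M\<^esub> y = (r - s) \<odot>\<^bsub>M\<^esub> x"
        using c x that by (simp add: a_minus_def M.M.a_assoc M.M.r_neg)
      ultimately have "(r - s) \<odot>\<^bsub>M\<^esub> x = z \<ominus>\<^bsub>M\<^esub> y" by simp
      then have "r - s = 0" using free[of "r - s"] dN that by auto
      then show ?thesis using that(5) c by simp
    qed
    define \<sigma> where "\<sigma> v = (SOME r. r \<in> S \<and> (\<exists>y\<in>N. v = r \<odot>\<^bsub>M\<^esub> x \<oplus>\<^bsub>M\<^esub> y))" for v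
    define \<nu> where "\<nu> v = (SOME y. y \<in> N \<and> (\<exists>r\<in>S. v = r \<odot>\<^bsub>M\<^esub> x \<oplus>\<^bsub>M\<^esub> y))" for v
    have \<sigma>: "\<sigma> (r \<odot>\<^bsub>M\<^esub> x \<oplus>\<^bsub>M\<^esub> y) = r" "\<nu> (r \<odot>\<^bsub>M\<^esub> x \<oplus>\<^bsub>M\<^esub> y) = y" if "r \<in> S" "y \<in> N" for r y
      unfolding \<sigma>_def \<nu>_def using uniq that by (intro some_equality; blast)+
    define \<kappa> where "\<kappa> v = (\<iota> (\<nu> v))(p := \<sigma> v)" for v
    have \<kappa>: "\<kappa> (r \<odot>\<^bsub>M\<^esub> x \<oplus>\<^bsub>M\<^esub> y) = (\<iota> y)(p := r)" if "r \<in> S" "y \<in> N" for r y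
      using \<sigma> that by (simp add: \<kappa>_def)
    have "embeds M N' (Suc p) \<kappa>"
      unfolding embeds_def
    proof (intro conjI ballI impI)
      fix a assume "a \<in> N'"
      then obtain r y where a: "a = r \<odot>\<^bsub>M\<^esub> x \<oplus>\<^bsub>M\<^esub> y" "r \<in> S" "y \<in> N" by (auto simp: N'_def)
      have \<iota>y: "\<iota> y \<in> On p" using \<iota>D(1)[OF a(3) zN] .
      show "\<kappa> a \<in> On (Suc p)"
        using \<kappa>[OF a(2,3)] \<iota>y S_integral[OF a(2)] unfolding a(1) by (auto simp: On_def less_Suc_eq)
      show "a = \<zero>\<^bsub>M\<^esub>" if "\<kappa> a = 0"
      proof -
        have e: "(\<iota> y)(p := r) = 0" using that \<kappa>[OF a(2,3)] a(1) by simp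
        then have r0: "r = 0" by (metis fun_upd_same zero_fun_apply)
        have "\<iota> y p = 0" using \<iota>y by (auto simp: On_def)
        then have "\<iota> y = 0" using e r0 by (metis fun_upd_triv)
        then have "y = \<zero>\<^bsub>M\<^esub>" using \<iota>D(2)[OF a(3) zN] by simp
        then show ?thesis using a(1) r0 M.smult_l_null[OF x] by simp
      qed
      fix b assume "b \<in> N'"
      then obtain s z where b: "b = s \<odot>\<^bsub>M\<^esub> x \<oplus>\<^bsub>M\<^esub> z" "s \<in> S" "z \<in> N" by (auto simp: N'_def)
      have "\<kappa> (a \<oplus>\<^bsub>M\<^esub> b) = (\<iota> (y \<oplus>\<^bsub>M\<^esub> z))(p := r + s)"
        unfolding a(1) b(1) addN'[OF a(2) b(2) a(3) b(3)] using a b sN(5) by (intro \<kappa>) auto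
      then show "\<kappa> (a \<oplus>\<^bsub>M\<^esub> b) = \<kappa> a + \<kappa> b"
        using \<kappa>[OF a(2,3)] \<kappa>[OF b(2,3)] \<iota>D(3)[OF a(3) b(3)] unfolding a(1) b(1) by (auto simp: fun_eq_iff)
    next
      fix s :: "'k fls" and a assume s: "s \<in> S" and "a \<in> N'"
      then obtain r y where a: "a = r \<odot>\<^bsub>M\<^esub> x \<oplus>\<^bsub>M\<^esub> y" "r \<in> S" "y \<in> N" by (auto simp: N'_def)
      have "\<kappa> (s \<odot>\<^bsub>M\<^esub> a) = (\<iota> (s \<odot>\<^bsub>M\<^esub> y))(p := s * r)"
        unfolding a(1) smN'[OF a(2) s a(3)] using a s sN(4) by (intro \<kappa>) auto
      then show "\<kappa> (s \<odot>\<^bsub>M\<^esub> a) = sm s (\<kappa> a)"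
        using \<kappa>[OF a(2,3)] \<iota>D(4)[OF a(3) zN s] unfolding a(1) by (auto simp: fun_eq_iff)
    qed
    then show ?thesis using sub xX by blast
  qed
qed

text \<open>The span of the embedded module over the discrete valuation ring k[[t]] is free, and a
  least spanning set taken from generators of \<open>M\<close> is a basis. Coordinates with respect
  to it turn these generators into unit vectors.\<close>

theorem embed_frame:
  fixes M :: "('k::field fls, 'b, 'y) module_scheme"
  assumes fg: "fin_gen_module (semigroup_ring H) M" and tf: "torsion_free M"
  shows "\<exists>n N \<psi>. frame n N \<and> stable S N \<and> bij_betw \<psi> (carrier M) N \<and>
    (\<forall>x\<in>carrier M. \<forall>y\<in>carrier M. \<psi> (x \<oplus>\<^bsub>M\<^esub> y) = \<psi> x + \<psi> y) \<and>
    (\<forall>r\<in>S. \<forall>x\<in>carrier M. \<psi> (r \<odot>\<^bsub>M\<^esub> x) = sm r (\<psi> x))"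
proof -
  interpret M: module "semigroup_ring H" M using fg by (simp add: fin_gen_module_def)
  obtain X where X: "finite X" "X \<subseteq> carrier M"
    "\<And>N. submodule N (semigroup_ring H) M \<Longrightarrow> X \<subseteq> N \<Longrightarrow> N = carrier M"
    using fg unfolding fin_gen_module_def by blast
  obtain N1 p \<iota> where "submodule N1 (semigroup_ring H) M" "X \<subseteq> N1" "embeds M N1 p \<iota>"
    using embeds_fg[OF M.module_axioms tf X(1,2)] by blast
  then have \<iota>: "embeds M (carrier M) p \<iota>" using X(3) by blast
  have \<iota>D: "\<iota> y = 0 \<Longrightarrow> y = \<zero>\<^bsub>M\<^esub>" "\<iota> (y \<oplus>\<^bsub>M\<^esub> z) = \<iota> y + \<iota> z"
    "r \<in> S \<Longrightarrow> \<iota> (r \<odot>\<^bsub>M\<^esub> y) = sm r (\<iota> y)"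
    if "y \<in> carrier M" "z \<in> carrier M" for y z r using \<iota> that unfolding embeds_def by blast+
  have \<iota>0: "\<iota> \<zero>\<^bsub>M\<^esub> = 0" using \<iota>D(3)[of "\<zero>\<^bsub>M\<^esub>" "\<zero>\<^bsub>M\<^esub>" 0] by simp
  have \<iota>neg: "\<iota> (\<ominus>\<^bsub>M\<^esub> y) = - \<iota> y" if "y \<in> carrier M" for y
    using \<iota>D(2)[of "\<ominus>\<^bsub>M\<^esub> y" y] that \<iota>0 by (simp add: M.M.l_neg eq_neg_iff_add_eq_0)
  have \<iota>inj: "x = y" if "x \<in> carrier M" "y \<in> carrier M" "\<iota> x = \<iota> y" for x y
  proof -
    have "\<iota> (x \<oplus>\<^bsub>M\<^esub> \<ominus>\<^bsub>M\<^esub> y) = 0" using \<iota>D(2)[of x "\<ominus>\<^bsub>M\<^esub> y"] \<iota>neg that by simp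
    then have "x \<oplus>\<^bsub>M\<^esub> \<ominus>\<^bsub>M\<^esub> y = \<zero>\<^bsub>M\<^esub>" using \<iota>D(1)[of "x \<oplus>\<^bsub>M\<^esub> \<ominus>\<^bsub>M\<^esub> y" x] that by simp
    then have "\<ominus>\<^bsub>M\<^esub> (\<ominus>\<^bsub>M\<^esub> y) = x" using that by (intro M.M.minus_equality) auto
    then show ?thesis using that by simp
  qed
  define N0 where "N0 = \<iota> ` carrier M"
  define G where "G = \<iota> ` X"
  have "N0 \<subseteq> span_int G"
  proof -
    define L where "L = {x \<in> carrier M. \<iota> x \<in> span_int G}"
    note sp = stableD[OF stable_span_int[of G]]
    have "submodule L (semigroup_ring H) M"
    proof (rule M.submoduleI)
      fix a :: "'k fls" and x assume "a \<in> carrier (semigroup_ring H)" "x \<in> L"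
      then show "a \<odot>\<^bsub>M\<^esub> x \<in> L" using sp(4)[OF S_integral] \<iota>D(3)[of x x a] by (simp add: L_def)
    qed (use sp \<iota>0 \<iota>neg \<iota>D(2) in \<open>auto simp: L_def\<close>)
    moreover have "X \<subseteq> L" using X(1,2) span_int_superset[of G] by (auto simp: L_def G_def)
    ultimately have "L = carrier M" by (rule X(3))
    then show ?thesis by (auto simp: N0_def L_def)
  qed
  then have "\<exists>Y. (Y \<subseteq> G \<and> N0 \<subseteq> span_int Y) \<and> (\<forall>Y'. Y' \<subseteq> G \<and> N0 \<subseteq> span_int Y' \<longrightarrow> card Y \<le> card Y')"
    by (intro ex_has_least_nat[of _ G]) simp
  then obtain Y where Y: "Y \<subseteq> G" "N0 \<subseteq> span_int Y"
    and Ymin: "\<And>Y'. Y' \<subseteq> G \<Longrightarrow> N0 \<subseteq> span_int Y' \<Longrightarrow> card Y \<le> card Y'"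
    by (elim exE conjE) blast
  have G: "finite G" "G \<subseteq> N0" using X by (auto simp: G_def N0_def)
  have finY: "finite Y" using Y(1) G(1) finite_subset by blast
  have min: "\<not> N0 \<subseteq> span_int (Y - {y})" if "y \<in> Y" for y
  proof
    assume "N0 \<subseteq> span_int (Y - {y})"
    then have "card Y \<le> card (Y - {y})" using Y(1) by (intro Ymin) auto
    moreover have "card (Y - {y}) < card Y" using finY that by (rule card_Diff1_less)
    ultimately show False by simp
  qed
  define n where "n = card Y"
  obtain e where e: "bij_betw e {..<n} Y"
    using ex_bij_betw_nat_finite[OF finY] by (auto simp: n_def atLeast0LessThan)
  define \<kappa> where "\<kappa> f = (\<Sum>i<n. sm (f i) (e i))" for f
  have \<kappa>lin: "\<kappa> (f + g) = \<kappa> f + \<kappa> g" "\<kappa> (f - g) = \<kappa> f - \<kappa> g" "\<kappa> (sm r f) = sm r (\<kappa> f)" for f g r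
    by (simp_all add: \<kappa>_def fun_eq_iff fun_sum_apply sum.distrib sum_subtractf sum_distrib_left algebra_simps)
  have \<kappa>0: "f = 0" if f: "f \<in> On n" "\<kappa> f = 0" for f
  proof -
    have inv: "inv_into {..<n} e (e i) = i" if "i < n" for i
      using e that by (auto simp: bij_betw_def)
    have "(\<Sum>y\<in>Y. sm (f (inv_into {..<n} e y)) y) = (\<Sum>i<n. sm (f (inv_into {..<n} e (e i))) (e i))"
      using sum.reindex_bij_betw[OF e, of "\<lambda>y. sm (f (inv_into {..<n} e y)) y"] by simp
    also have "\<dots> = \<kappa> f" unfolding \<kappa>_def using inv by (intro sum.cong) auto
    finally have rel: "(\<Sum>y\<in>Y. sm (f (inv_into {..<n} e y)) y) = 0" using f(2) by simp
    have "f i = 0" if "i < n" for i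
    proof -
      have "f (inv_into {..<n} e (e i)) = 0"
        by (rule minimal_span_independent[OF finY Y(2) min rel]) (use bij_betwE[OF e] that in auto)
      then show ?thesis using inv[OF that] by simp
    qed
    then show ?thesis using f(1) by (auto simp: On_def fun_eq_iff not_less[symmetric])
  qed
  define N where "N = {f \<in> On n. \<kappa> f \<in> N0}"
  have N0c: "0 \<in> N0" "x + y \<in> N0" "x - y \<in> N0" "r \<in> S \<Longrightarrow> sm r x \<in> N0"
    if xy: "x \<in> N0" "y \<in> N0" for x y r
  proof -
    obtain a b where ab: "a \<in> carrier M" "b \<in> carrier M" "x = \<iota> a" "y = \<iota> b"
      using xy by (auto simp: N0_def)
    have im: "\<iota> u \<in> N0" if "u \<in> carrier M" for u using that by (simp add: N0_def)
    show "0 \<in> N0" using im[OF M.M.zero_closed] unfolding \<iota>0 .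
    show "x + y \<in> N0"
      unfolding ab(3,4) \<iota>D(2)[OF ab(1,2), symmetric] by (rule im[OF M.M.a_closed[OF ab(1,2)]])
    have "x - y = \<iota> (a \<oplus>\<^bsub>M\<^esub> \<ominus>\<^bsub>M\<^esub> b)"
      unfolding ab(3,4) \<iota>D(2)[OF ab(1) M.M.a_inv_closed[OF ab(2)]] \<iota>neg[OF ab(2)]
      by (rule diff_conv_add_uminus)
    then show "x - y \<in> N0" using im[OF M.M.a_closed[OF ab(1) M.M.a_inv_closed[OF ab(2)]]] by simp
    show "sm r x \<in> N0" if r: "r \<in> S"
      unfolding ab(3) \<iota>D(3)[OF ab(1,1) r, symmetric] by (rule im[OF M.smult_closed[OF _ ab(1)]]) (simp add: r)
  qed
  have z0: "0 \<in> N0" using imageI[OF M.M.zero_closed, of \<iota>] unfolding N0_def \<iota>0 .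
  have stN: "stable S N"
    unfolding stable_def
  proof (intro conjI ballI)
    have "\<kappa> 0 = 0" using \<kappa>lin(2)[of 0 0] by simp
    then show "0 \<in> N" using z0 stableD(1)[OF stable_On] by (simp add: N_def)
  next
    fix f g assume "f \<in> N" "g \<in> N"
    then show "f + g \<in> N" "f - g \<in> N"
      using N0c(2,3) stableD(2,3)[OF stable_On] unfolding N_def mem_Collect_eq \<kappa>lin by blast+
  next
    fix r :: "'k fls" and f assume "r \<in> S" "f \<in> N"
    then show "sm r f \<in> N"
      using N0c(4) stableD(4)[OF stable_On S_integral] unfolding N_def mem_Collect_eq \<kappa>lin by blast
  qed
  have fr: "frame n N"
    unfolding frame_def
  proof (intro conjI allI impI)
    show "N \<subseteq> On n" by (auto simp: N_def)
    fix i assume i: "i < n"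
    have "\<kappa> (unit i) = (\<Sum>j<n. if j = i then e i else 0)"
      unfolding \<kappa>_def by (rule sum.cong) (auto simp: unit_def)
    also have "\<dots> = e i" using i by simp
    finally show "unit i \<in> N" using bij_betwE[OF e] i Y(1) G(2) by (auto simp: N_def On_def unit_def)
  qed
  have bij\<kappa>: "bij_betw \<kappa> N N0"
    unfolding bij_betw_def
  proof
    show "inj_on \<kappa> N"
    proof (rule inj_onI)
      fix f g assume "f \<in> N" "g \<in> N" "\<kappa> f = \<kappa> g"
      then have fg: "f \<in> On n" "g \<in> On n" "\<kappa> (f - g) = 0" by (simp_all add: \<kappa>lin N_def)
      have "f - g = 0" by (rule \<kappa>0[OF stableD(3)[OF stable_On fg(1,2)] fg(3)])
      then show "f = g" by (rule eq_iff_diff_eq_0[THEN iffD2])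
    qed
    show "\<kappa> ` N = N0"
    proof (intro equalityI subsetI)
      fix v assume v: "v \<in> N0"
      then obtain c where c: "\<forall>y\<in>Y. c y \<in> supp_in {0..}" "v = (\<Sum>y\<in>Y. sm (c y) y)"
        using Y(2) unfolding span_int_def by blast
      define f where "f = (\<lambda>i. if i < n then c (e i) else 0)"
      have "\<kappa> f = (\<Sum>i<n. sm (c (e i)) (e i))" unfolding \<kappa>_def f_def by (rule sum.cong) auto
      also have "\<dots> = v" unfolding c(2) using sum.reindex_bij_betw[OF e, of "\<lambda>y. sm (c y) y"] by simp
      finally have "\<kappa> f = v" .
      moreover have "f \<in> On n" using c(1) bij_betwE[OF e] by (auto simp: On_def f_def)
      ultimately show "v \<in> \<kappa> ` N" using v by (auto simp: N_def)
    qed (auto simp: N_def)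
  qed
  define \<psi> where "\<psi> x = the_inv_into N \<kappa> (\<iota> x)" for x
  have \<kappa>\<psi>: "\<kappa> (\<psi> x) = \<iota> x" and \<psi>N: "\<psi> x \<in> N" if "x \<in> carrier M" for x
  proof -
    have "\<iota> x \<in> \<kappa> ` N" using bij\<kappa> that by (auto simp: bij_betw_def N0_def)
    then show "\<kappa> (\<psi> x) = \<iota> x" "\<psi> x \<in> N"
      unfolding \<psi>_def using bij\<kappa> by (auto simp: bij_betw_def f_the_inv_into_f the_inv_into_into)
  qed
  have \<kappa>inj: "f = g" if "f \<in> N" "g \<in> N" "\<kappa> f = \<kappa> g" for f g
    using bij\<kappa> that by (auto simp: bij_betw_def inj_on_def)
  have "bij_betw \<psi> (carrier M) N"
    unfolding bij_betw_def
  proof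
    show "inj_on \<psi> (carrier M)"
    proof (rule inj_onI)
      fix x y assume xy: "x \<in> carrier M" "y \<in> carrier M" "\<psi> x = \<psi> y"
      show "x = y" using \<kappa>\<psi>[OF xy(1)] \<kappa>\<psi>[OF xy(2)] xy(3) by (intro \<iota>inj[OF xy(1,2)]) simp
    qed
    show "\<psi> ` carrier M = N"
    proof (intro equalityI subsetI)
      fix f assume f: "f \<in> N"
      then have "\<kappa> f \<in> \<iota> ` carrier M" by (simp add: N_def N0_def)
      then obtain x where x: "x \<in> carrier M" "\<kappa> f = \<iota> x" by blast
      have "f = \<psi> x" using \<kappa>\<psi>[OF x(1)] x(2) by (intro \<kappa>inj[OF f \<psi>N[OF x(1)]]) simp
      then show "f \<in> \<psi> ` carrier M" using x(1) by blast
    next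
      fix f assume "f \<in> \<psi> ` carrier M"
      then show "f \<in> N" using \<psi>N by blast
    qed
  qed
  moreover have "\<psi> (x \<oplus>\<^bsub>M\<^esub> y) = \<psi> x + \<psi> y" if "x \<in> carrier M" "y \<in> carrier M" for x y
  proof (rule \<kappa>inj)
    show "\<psi> (x \<oplus>\<^bsub>M\<^esub> y) \<in> N" "\<psi> x + \<psi> y \<in> N"
      by (rule \<psi>N[OF M.M.a_closed[OF that]], rule stableD(2)[OF stN \<psi>N[OF that(1)] \<psi>N[OF that(2)]])
    show "\<kappa> (\<psi> (x \<oplus>\<^bsub>M\<^esub> y)) = \<kappa> (\<psi> x + \<psi> y)"
      unfolding \<kappa>lin(1) \<kappa>\<psi>[OF that(1)] \<kappa>\<psi>[OF that(2)] \<kappa>\<psi>[OF M.M.a_closed[OF that]] by (rule \<iota>D(2)[OF that])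
  qed
  moreover have "\<psi> (r \<odot>\<^bsub>M\<^esub> x) = sm r (\<psi> x)" if "r \<in> S" "x \<in> carrier M" for r x
  proof (rule \<kappa>inj)
    show "\<psi> (r \<odot>\<^bsub>M\<^esub> x) \<in> N" "sm r (\<psi> x) \<in> N"
      using \<psi>N[of "r \<odot>\<^bsub>M\<^esub> x"] stableD(4)[OF stN that(1) \<psi>N[OF that(2)]] that by simp_all
    have "\<kappa> (\<psi> (r \<odot>\<^bsub>M\<^esub> x)) = \<iota> (r \<odot>\<^bsub>M\<^esub> x)" using that by (intro \<kappa>\<psi>) simp
    then show "\<kappa> (\<psi> (r \<odot>\<^bsub>M\<^esub> x)) = \<kappa> (sm r (\<psi> x))"
      unfolding \<kappa>lin(3) \<kappa>\<psi>[OF that(2)] \<iota>D(3)[OF that(2,2,1)] .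
  qed
  ultimately show ?thesis using fr stN by blast
qed

end

section \<open>Reflexive and maximal Cohen--Macaulay modules\<close>

lemma finite_types: "finite types"
  by (simp add: types_def)

context numsg
begin

definition Smax :: "'k::field fls set" where "Smax = {f \<in> S. f $$ 0 = 0}"

lemma regular_simps [simp]:
  "carrier (regular_module (semigroup_ring H)) = S"
  "add (regular_module (semigroup_ring H)) = (+)"
  "zero (regular_module (semigroup_ring H)) = 0"
  "smult (regular_module (semigroup_ring H)) = (*)"
  by (simp_all add: regular_module_def)

lemma dual_carrier:
  "\<phi> \<in> carrier (dual_module (semigroup_ring H) M) \<longleftrightarrow> \<phi> \<in> carrier M \<rightarrow>\<^sub>E S \<and>
    (\<forall>x\<in>carrier M. \<forall>y\<in>carrier M. \<phi> (x \<oplus>\<^bsub>M\<^esub> y) = \<phi> x + \<phi> y) \<and>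
    (\<forall>r\<in>S. \<forall>x\<in>carrier M. \<phi> (r \<odot>\<^bsub>M\<^esub> x) = r * \<phi> x)"
  by (simp add: dual_module_def hom_module_def mod_hom_def)

lemma dual_ops:
  "\<phi> \<oplus>\<^bsub>dual_module (semigroup_ring H) M\<^esub> \<psi> = (\<lambda>x\<in>carrier M. \<phi> x + \<psi> x)"
  "r \<odot>\<^bsub>dual_module (semigroup_ring H) M\<^esub> \<phi> = (\<lambda>x\<in>carrier M. r * \<phi> x)"
  by (simp_all add: dual_module_def hom_module_def)

text \<open>Linear forms into R vanish on torsion, and on a reflexive module they separate
  points.\<close>

lemma reflexive_torsion_free:
  fixes M :: "('k::field fls, 'b, 'y) module_scheme"
  assumes "reflexive_module (semigroup_ring H) M"
  shows "torsion_free M"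
  unfolding torsion_free_def
proof (intro ballI impI)
  interpret M: module "semigroup_ring H" M
    using assms by (simp add: reflexive_module_def fin_gen_module_def)
  fix r :: "'k fls" and x assume r: "r \<in> S" and x: "x \<in> carrier M" and rx: "r \<odot>\<^bsub>M\<^esub> x = \<zero>\<^bsub>M\<^esub>"
  have inj: "inj_on (biduality_map (semigroup_ring H) M) (carrier M)"
    using assms by (simp add: reflexive_module_def bij_betw_def)
  have z: "\<phi> \<zero>\<^bsub>M\<^esub> = 0" if "\<phi> \<in> carrier (dual_module (semigroup_ring H) M)" for \<phi>
  proof -
    have "\<phi> (0 \<odot>\<^bsub>M\<^esub> \<zero>\<^bsub>M\<^esub>) = 0 * \<phi> \<zero>\<^bsub>M\<^esub>"
      using that unfolding dual_carrier by (metis M.M.zero_closed S_closed(1))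
    then show ?thesis using M.smult_r_null[of 0] by simp
  qed
  show "r = 0 \<or> x = \<zero>\<^bsub>M\<^esub>"
  proof (cases "r = 0")
    case False
    have "\<phi> x = \<phi> \<zero>\<^bsub>M\<^esub>" if \<phi>: "\<phi> \<in> carrier (dual_module (semigroup_ring H) M)" for \<phi>
    proof -
      have "r * \<phi> x = \<phi> \<zero>\<^bsub>M\<^esub>" using \<phi> r x rx unfolding dual_carrier by metis
      then show ?thesis using z[OF \<phi>] False by simp
    qed
    then have "biduality_map (semigroup_ring H) M x = biduality_map (semigroup_ring H) M \<zero>\<^bsub>M\<^esub>"
      using x by (auto simp: biduality_map_def fun_eq_iff)
    then show ?thesis using inj_onD[OF inj _ x M.M.zero_closed] by blast
  qed simp
qed

lemma concrete_model:
  fixes M :: "('k::field fls, 'b, 'y) module_scheme"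
  assumes fg: "fin_gen_module (semigroup_ring H) M" and tf: "torsion_free M"
    and ind: "indecomposable_module (semigroup_ring H) M"
  obtains n N \<psi> where "frame n N" "stable S N" "bij_betw \<psi> (carrier M) N"
    "\<And>x y. x \<in> carrier M \<Longrightarrow> y \<in> carrier M \<Longrightarrow> \<psi> (x \<oplus>\<^bsub>M\<^esub> y) = \<psi> x + \<psi> y"
    "\<And>r x. r \<in> S \<Longrightarrow> x \<in> carrier M \<Longrightarrow> \<psi> (r \<odot>\<^bsub>M\<^esub> x) = sm r (\<psi> x)"
    "mod_isomorphic (semigroup_ring H) M (cm N)"
    "indecomposable_module (semigroup_ring H) (cm N)"
proof -
  interpret M: module "semigroup_ring H" M using fg by (simp add: fin_gen_module_def)
  from embed_frame[OF fg tf] obtain n N \<psi> where *: "frame n N" "stable S N" "bij_betw \<psi> (carrier M) N"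
    "\<forall>x\<in>carrier M. \<forall>y\<in>carrier M. \<psi> (x \<oplus>\<^bsub>M\<^esub> y) = \<psi> x + \<psi> y"
    "\<forall>r\<in>S. \<forall>x\<in>carrier M. \<psi> (r \<odot>\<^bsub>M\<^esub> x) = sm r (\<psi> x)" by (elim exE conjE)
  let ?f = "restrict \<psi> (carrier M)"
  have f: "?f \<in> mod_hom (semigroup_ring H) M (cm N)"
    using bij_betwE[OF *(3)] *(4,5) by (auto simp: mod_hom_def)
  have b: "bij_betw ?f (carrier M) (carrier (cm N))"
    unfolding cm_simps using *(3) by (rule bij_betw_cong[THEN iffD1, rotated]) auto
  have "mod_isomorphic (semigroup_ring H) M (cm N)"
    unfolding mod_isomorphic_def using f b by blast
  moreover have "indecomposable_module (semigroup_ring H) (cm N)"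
    by (rule indecomposable_transfer[OF ind module_cm[OF *(2)] f b])
  ultimately show thesis using that * by blast
qed

text \<open>If no linear form on the reflexive module \<open>M\<close> takes a unit value, then \<open>\<phi> \<mapsto> b * \<phi> x\<close> is an
  element of the bidual, so \<open>M\<close> is stable under \<open>b\<close>.\<close>

lemma reflexive_dichotomy:
  fixes M :: "('k::field fls, 'b, 'y) module_scheme"
  assumes refl: "reflexive_module (semigroup_ring H) M"
    and ind: "indecomposable_module (semigroup_ring H) M"
  shows "mod_isomorphic (semigroup_ring H) M (cm (rank1 S)) \<or>
    (\<exists>n N. frame n N \<and> stable S N \<and> mod_isomorphic (semigroup_ring H) M (cm N) \<and>
      indecomposable_module (semigroup_ring H) (cm N) \<and>
      (\<forall>b. (\<forall>r\<in>Smax. b * r \<in> S) \<longrightarrow> (\<forall>x\<in>N. sm b x \<in> N)))"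
proof -
  have fg: "fin_gen_module (semigroup_ring H) M" using refl by (simp add: reflexive_module_def)
  interpret M: module "semigroup_ring H" M using fg by (simp add: fin_gen_module_def)
  obtain n N \<psi> where fr: "frame n N" and N: "stable S N" and bij: "bij_betw \<psi> (carrier M) N"
    and add: "\<And>x y. x \<in> carrier M \<Longrightarrow> y \<in> carrier M \<Longrightarrow> \<psi> (x \<oplus>\<^bsub>M\<^esub> y) = \<psi> x + \<psi> y"
    and lin: "\<And>r x. r \<in> S \<Longrightarrow> x \<in> carrier M \<Longrightarrow> \<psi> (r \<odot>\<^bsub>M\<^esub> x) = sm r (\<psi> x)"
    and iso: "mod_isomorphic (semigroup_ring H) M (cm N)"
    and indN: "indecomposable_module (semigroup_ring H) (cm N)"
    using concrete_model[OF fg reflexive_torsion_free[OF refl] ind] by blast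
  let ?D = "dual_module (semigroup_ring H) M"
  have \<psi>N: "\<psi> x \<in> N" if "x \<in> carrier M" for x using bij_betwE[OF bij] that by blast
  show ?thesis
  proof (cases "\<exists>\<phi>\<in>carrier ?D. \<exists>x\<in>carrier M. \<phi> x $$ 0 \<noteq> 0")
    case True
    then obtain \<phi> x where \<phi>: "\<phi> \<in> carrier ?D" and x: "x \<in> carrier M" "\<phi> x $$ 0 \<noteq> 0" by blast
    note \<phi>D = \<phi>[unfolded dual_carrier]
    define \<theta> where "\<theta> = inv_into (carrier M) \<psi>"
    have \<theta>M: "\<theta> v \<in> carrier M" and \<psi>\<theta>: "\<psi> (\<theta> v) = v" if "v \<in> N" for v
      using that bij unfolding \<theta>_def bij_betw_def by (auto simp: inv_into_into f_inv_into_f)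
    have \<theta>\<psi>: "\<theta> (\<psi> u) = u" if "u \<in> carrier M" for u
      using that bij unfolding \<theta>_def bij_betw_def by simp
    have \<theta>add: "\<theta> (v + w) = \<theta> v \<oplus>\<^bsub>M\<^esub> \<theta> w" if "v \<in> N" "w \<in> N" for v w
      using \<theta>\<psi>[of "\<theta> v \<oplus>\<^bsub>M\<^esub> \<theta> w"] add[of "\<theta> v" "\<theta> w"] \<theta>M \<psi>\<theta> that by simp
    have \<theta>sm: "\<theta> (sm r v) = r \<odot>\<^bsub>M\<^esub> \<theta> v" if "r \<in> S" "v \<in> N" for r v
      using \<theta>\<psi>[of "r \<odot>\<^bsub>M\<^esub> \<theta> v"] lin[of r "\<theta> v"] \<theta>M \<psi>\<theta> that by simp
    have "mod_isomorphic (semigroup_ring H) (cm N) (cm (rank1 S))"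
    proof (rule unit_valued_form[where \<phi> = "\<lambda>v. \<phi> (\<theta> v)" and ?x0.0 = "\<psi> x", OF indN N numsg_axioms N])
      show "\<phi> (\<theta> v) \<in> S" if "v \<in> N" for v using \<phi>D \<theta>M[OF that] by blast
      show "\<phi> (\<theta> (v + w)) = \<phi> (\<theta> v) + \<phi> (\<theta> w)" if "v \<in> N" "w \<in> N" for v w
        using \<theta>add[OF that] \<phi>D \<theta>M[OF that(1)] \<theta>M[OF that(2)] by simp
      show "\<phi> (\<theta> (sm r v)) = r * \<phi> (\<theta> v)" if "r \<in> S \<union> S" "v \<in> N" for r v
        using \<theta>sm[of r v] \<phi>D \<theta>M[OF that(2)] that by simp
      show "\<psi> x \<in> N" using \<psi>N[OF x(1)] .
      show "\<phi> (\<theta> (\<psi> x)) $$ 0 \<noteq> 0" using \<theta>\<psi>[OF x(1)] x(2) by simp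
    qed
    then show ?thesis using mod_isomorphic_trans[OF M.module_axioms iso] by blast
  next
    case False
    have stb: "sm b v \<in> N" if b: "\<forall>r\<in>Smax. b * r \<in> S" and v: "v \<in> N" for b v
    proof -
      obtain x where x: "x \<in> carrier M" "v = \<psi> x" using bij v unfolding bij_betw_def by blast
      define \<theta> where "\<theta> = (\<lambda>\<phi>\<in>carrier ?D. b * \<phi> x)"
      have c1: "(\<lambda>x\<in>carrier M. \<phi> x + \<phi>' x) \<in> carrier ?D" if "\<phi> \<in> carrier ?D" "\<phi>' \<in> carrier ?D" for \<phi> \<phi>'
        using that unfolding dual_carrier by (auto simp: algebra_simps PiE_iff)
      have c2: "(\<lambda>x\<in>carrier M. r * \<phi> x) \<in> carrier ?D" if "r \<in> S" "\<phi> \<in> carrier ?D" for r \<phi>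
        using that unfolding dual_carrier by (auto simp: algebra_simps PiE_iff)
      have "\<theta> \<in> carrier (dual_module (semigroup_ring H) ?D)"
        unfolding dual_carrier[of \<theta>]
      proof (intro conjI ballI)
        have "b * \<phi> x \<in> S" if "\<phi> \<in> carrier ?D" for \<phi>
        proof -
          have "\<phi> x $$ 0 = 0" using False x(1) that by blast
          moreover have "\<phi> x \<in> S" using x(1) that unfolding dual_carrier by blast
          ultimately have "\<phi> x \<in> Smax" unfolding Smax_def by blast
          then show ?thesis using b by blast
        qed
        then show "\<theta> \<in> carrier ?D \<rightarrow>\<^sub>E S" by (auto simp: \<theta>_def)
        show "\<theta> (\<phi> \<oplus>\<^bsub>?D\<^esub> \<phi>') = \<theta> \<phi> + \<theta> \<phi>'" if "\<phi> \<in> carrier ?D" "\<phi>' \<in> carrier ?D" for \<phi> \<phi>'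
          using c1[OF that] that x(1) by (simp add: \<theta>_def dual_ops distrib_left)
        show "\<theta> (r \<odot>\<^bsub>?D\<^esub> \<phi>) = r * \<theta> \<phi>" if "r \<in> S" "\<phi> \<in> carrier ?D" for r \<phi>
          using c2[OF that] that x(1) by (simp add: \<theta>_def dual_ops)
      qed
      then have "\<theta> \<in> biduality_map (semigroup_ring H) M ` carrier M"
        using refl by (simp add: reflexive_module_def bij_betw_def)
      then obtain y where y: "y \<in> carrier M" "\<theta> = biduality_map (semigroup_ring H) M y" by blast
      have ev: "\<phi> y = b * \<phi> x" if "\<phi> \<in> carrier ?D" for \<phi>
        using fun_cong[OF y(2), of \<phi>] that y(1) by (simp add: \<theta>_def biduality_map_def)
      have "\<psi> y i = b * \<psi> x i" for i
      proof -
        \<comment> \<open>After multiplication by t^cnd each coordinate is a linear form into R;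
          evaluating \<open>\<theta>\<close> at these forms shows that its preimage \<open>y\<close>
          is b x in coordinates.\<close>
        define \<phi> where "\<phi> = (\<lambda>u\<in>carrier M. tp (int cnd) * \<psi> u i)"
        have "\<psi> u i \<in> supp_in {0..}" if "u \<in> carrier M" for u
          using \<psi>N[OF that] fr unfolding frame_def On_def by (cases "i < n") auto
        then have mem: "tp (int cnd) * \<psi> u i \<in> S" if "u \<in> carrier M" for u
          using that by (meson tail_S tail_shift)
        have "\<phi> \<in> carrier ?D"
        proof -
          have "\<phi> \<in> carrier M \<rightarrow>\<^sub>E S" unfolding \<phi>_def using mem by (intro restrict_PiE_iff[THEN iffD2] ballI)
          moreover have "\<phi> (u \<oplus>\<^bsub>M\<^esub> v) = \<phi> u + \<phi> v" if "u \<in> carrier M" "v \<in> carrier M" for u v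
            using that by (simp add: \<phi>_def add[OF that] distrib_left)
          moreover have "\<phi> (r \<odot>\<^bsub>M\<^esub> u) = r * \<phi> u" if "r \<in> S" "u \<in> carrier M" for r u
            using that by (simp add: \<phi>_def lin[OF that] mult_ac)
          ultimately show ?thesis unfolding dual_carrier by blast
        qed
        from ev[OF this] have "tp (int cnd) * \<psi> y i = tp (int cnd) * (b * \<psi> x i)"
          using x(1) y(1) by (simp add: \<phi>_def mult_ac)
        then show ?thesis by simp
      qed
      then have "\<psi> y = sm b v" using x(2) by (simp add: fun_eq_iff)
      then show "sm b v \<in> N" using \<psi>N[OF y(1)] by simp
    qed
    show ?thesis using fr N iso indN stb by blast
  qed
qed

text \<open>R is local because a series in R with nonzero constant term has its inverse in
  R.\<close>

lemma Smax_max_ideal: "maximalideal Smax (semigroup_ring H :: 'k::field fls ring)"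
  and max_ideal_unique: "maximalideal I (semigroup_ring H :: 'k fls ring) \<Longrightarrow> I = Smax"
proof -
  interpret R: cring "semigroup_ring H :: 'k fls ring" by (rule cring_R)
  have neg: "\<ominus>\<^bsub>semigroup_ring H\<^esub> x = - x" if "x \<in> S" for x :: "'k fls"
    using that by (intro R.minus_equality) auto
  have idl: "ideal Smax (semigroup_ring H :: 'k fls ring)"
  proof (rule idealI[OF R.ring_axioms])
    show "subgroup Smax (add_monoid (semigroup_ring H :: 'k fls ring))"
    proof (rule R.add.subgroupI)
      show "Smax \<noteq> ({} :: 'k fls set)" using S_closed(1) by (auto simp: Smax_def)
      show "\<ominus>\<^bsub>semigroup_ring H\<^esub> a \<in> Smax" if "a \<in> Smax" for a :: "'k fls"
        using that neg by (auto simp: Smax_def)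
    qed (auto simp: Smax_def)
  next
    fix a x :: "'k fls" assume "a \<in> Smax" "x \<in> carrier (semigroup_ring H)"
    then show "x \<otimes>\<^bsub>semigroup_ring H\<^esub> a \<in> Smax" "a \<otimes>\<^bsub>semigroup_ring H\<^esub> x \<in> Smax"
      by (auto simp: Smax_def times_nth_0 S_integral)
  qed
  have unit: "J = S" if J: "ideal J (semigroup_ring H :: 'k fls ring)" and u: "u \<in> J" "u $$ 0 \<noteq> 0" for J u
  proof -
    interpret J: ideal J "semigroup_ring H :: 'k fls ring" by fact
    have uS: "u \<in> S" using u(1) J.a_subset by auto
    have "inverse u * u \<in> J" using J.I_l_closed[OF u(1), of "inverse u"] inverse_S[OF uS u(2)] by simp
    moreover have "u \<noteq> 0" using u(2) by auto
    ultimately have "1 \<in> J" by simp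
    then show ?thesis using J.one_imp_carrier by simp
  qed
  show "maximalideal Smax (semigroup_ring H :: 'k fls ring)"
  proof (rule maximalidealI[OF idl])
    show "carrier (semigroup_ring H) \<noteq> (Smax :: 'k fls set)"
    proof
      assume "carrier (semigroup_ring H) = (Smax :: 'k fls set)"
      then have "(1 :: 'k fls) \<in> Smax" using S_closed(2) by auto
      then show False by (simp add: Smax_def)
    qed
    fix J :: "'k fls set" assume J: "ideal J (semigroup_ring H)" "Smax \<subseteq> J" "J \<subseteq> carrier (semigroup_ring H)"
    show "J = Smax \<or> J = carrier (semigroup_ring H)"
    proof (cases "J \<subseteq> Smax")
      case False
      then obtain u where "u \<in> J" "u $$ 0 \<noteq> 0" using J(3) by (auto simp: Smax_def)
      from unit[OF J(1) this] show ?thesis by simp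
    qed (use J(2) in auto)
  qed
  show "I = Smax" if "maximalideal I (semigroup_ring H :: 'k fls ring)" for I
  proof -
    interpret I: maximalideal I "semigroup_ring H :: 'k fls ring" by fact
    have "I \<subseteq> Smax"
    proof
      fix u assume u: "u \<in> I"
      have "u $$ 0 = 0" using unit[OF I.ideal_axioms u] I.I_notcarr by (metis carrier_ring)
      then show "u \<in> Smax" using u I.a_subset by (auto simp: Smax_def)
    qed
    moreover have "(Smax :: 'k fls set) \<noteq> S"
    proof
      assume "(Smax :: 'k fls set) = S"
      then have "(1 :: 'k fls) \<in> Smax" using S_closed(2) by auto
      then show False by (simp add: Smax_def)
    qed
    ultimately show ?thesis using I.I_maximal[OF idl] by (auto simp: Smax_def)
  qed
qed

lemma max_ideal_eq: "max_ideal (semigroup_ring H :: 'k::field fls ring) = Smax"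
  unfolding max_ideal_def using Smax_max_ideal max_ideal_unique by (intro the_equality)

lemma krull_dim_ge_1: "1 \<le> krull_dim (semigroup_ring H :: 'k::field fls ring)"
proof -
  interpret R: cring "semigroup_ring H :: 'k fls ring" by (rule cring_R)
  have p1: "primeideal Smax (semigroup_ring H :: 'k fls ring)"
    by (rule R.maximalideal_prime[OF Smax_max_ideal])
  have p0: "primeideal {0} (semigroup_ring H :: 'k fls ring)"
  proof (rule primeidealI)
    show "ideal {0} (semigroup_ring H :: 'k fls ring)" using R.zeroideal by simp
    show "carrier (semigroup_ring H) \<noteq> {0 :: 'k fls}"
    proof
      assume "carrier (semigroup_ring H) = {0 :: 'k fls}"
      then have "(1 :: 'k fls) \<in> {0}" using S_closed(2) unfolding carrier_ring by metis
      then show False by simp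
    qed
  qed (auto simp: R.is_cring)
  have t: "tp (int (Suc cnd)) \<in> (Smax :: 'k fls set)"
    using tp_S[of "Suc cnd"] cnd[of "Suc cnd"] by (auto simp: Smax_def)
  have "(0 :: 'k fls) \<in> Smax" by (simp add: Smax_def)
  then have strict: "{0} \<subset> (Smax :: 'k fls set)" using t tp_nonzero by blast
  define Q :: "nat \<Rightarrow> 'k fls set" where "Q i = (if i = 0 then {0} else Smax)" for i
  have "\<exists>P. (\<forall>i\<le>1. primeideal (P i) (semigroup_ring H :: 'k fls ring)) \<and> (\<forall>i<1::nat. P i \<subset> P (Suc i))"
    using p0 p1 strict by (intro exI[of _ Q]) (auto simp: Q_def)
  then have "enat 1 \<in> {enat n | n. \<exists>P. (\<forall>i\<le>n. primeideal (P i) (semigroup_ring H :: 'k fls ring)) \<and> (\<forall>i<n. P i \<subset> P (Suc i))}"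
    by blast
  then show ?thesis unfolding krull_dim_def one_enat_def by (rule Sup_upper)
qed

text \<open>Positive depth provides some \<open>x\<close> in the maximal ideal that is regular on
  \<open>M\<close>. Every nonzero \<open>r\<close> divides a power of \<open>x\<close> in R, since
  x^m / r has high order for large \<open>m\<close>; so \<open>r\<close> is regular as well.\<close>

lemma max_CM_torsion_free:
  fixes M :: "('k::field fls, 'b, 'y) module_scheme"
  assumes CM: "max_CM_module (semigroup_ring H) M" and nz: "carrier M \<noteq> {\<zero>\<^bsub>M\<^esub>}"
  shows "torsion_free M"
proof -
  interpret M: module "semigroup_ring H" M
    using CM by (simp add: max_CM_module_def fin_gen_module_def)
  have "module_depth (semigroup_ring H) M \<ge> 1"
    using CM nz krull_dim_ge_1 by (simp add: max_CM_module_def)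
  then have "\<exists>xs. set xs \<subseteq> Smax \<and> regular_sequence (semigroup_ring H) M xs \<and> xs \<noteq> []"
  proof -
    { assume "\<not> ?thesis"
      then have "{enat (length xs) | xs. set xs \<subseteq> max_ideal (semigroup_ring H) \<and> regular_sequence (semigroup_ring H) M xs} \<subseteq> {0}"
        unfolding max_ideal_eq by (auto simp: zero_enat_def)
      then have "module_depth (semigroup_ring H) M \<le> Sup {0}"
        unfolding module_depth_def by (rule Sup_subset_mono)
      then have False using \<open>module_depth (semigroup_ring H) M \<ge> 1\<close> by simp }
    then show ?thesis by blast
  qed
  then obtain x xs where x: "x \<in> Smax" and reg: "regular_sequence (semigroup_ring H) M (x # xs)"
    by (metis list.set_intros(1) neq_Nil_conv subsetD)
  have xS: "x \<in> S" "x $$ 0 = 0" using x by (auto simp: Smax_def)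
  have xreg: "y = \<zero>\<^bsub>M\<^esub>" if "y \<in> carrier M" "x \<odot>\<^bsub>M\<^esub> y = \<zero>\<^bsub>M\<^esub>" for y
    using reg that unfolding regular_sequence_def by (auto dest!: spec[of _ 0])
  have xpow: "x ^ m \<in> S" for m by (induction m) (use xS in auto)
  have xpow_reg: "y = \<zero>\<^bsub>M\<^esub>" if "y \<in> carrier M" "(x ^ m) \<odot>\<^bsub>M\<^esub> y = \<zero>\<^bsub>M\<^esub>" for y m
    using that(2)
  proof (induction m)
    case 0
    then show ?case using M.smult_one[OF that(1)] by simp
  next
    case (Suc m)
    have c: "x \<in> carrier (semigroup_ring H)" "x ^ m \<in> carrier (semigroup_ring H)"
      unfolding carrier_ring by (rule xS(1), rule xpow)
    have "x \<odot>\<^bsub>M\<^esub> ((x ^ m) \<odot>\<^bsub>M\<^esub> y) = \<zero>\<^bsub>M\<^esub>"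
      using M.smult_assoc1[OF c that(1)] Suc.prems unfolding ring_simps power_Suc by (rule trans[OF sym])
    then have "(x ^ m) \<odot>\<^bsub>M\<^esub> y = \<zero>\<^bsub>M\<^esub>" by (rule xreg[OF M.smult_closed[OF c(2) that(1)]])
    then show ?case by (rule Suc.IH)
  qed
  have x1: "x \<in> supp_in {1..}"
  proof (rule supp_inI)
    fix i assume i: "x $$ i \<noteq> 0"
    have "i \<noteq> 0" using i xS(2) by blast
    moreover have "i \<in> {0..}" by (rule ccontr) (use i supp_inD[OF S_integral[OF xS(1)]] in blast)
    ultimately show "i \<in> {1..}" by simp
  qed
  have xm: "x ^ m \<in> tail m" for m
  proof (induction m)
    case (Suc m)
    have "x * x ^ m \<in> tail (Suc m)" by (rule supp_in_mult[OF x1 Suc]) auto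
    then show ?case by simp
  next
    case 0
    show ?case by (simp add: supp_in_closed(7))
  qed
  show ?thesis
    unfolding torsion_free_def
  proof (intro ballI impI)
    fix r :: "'k fls" and y assume r: "r \<in> S" and y: "y \<in> carrier M" and ry: "r \<odot>\<^bsub>M\<^esub> y = \<zero>\<^bsub>M\<^esub>"
    show "r = 0 \<or> y = \<zero>\<^bsub>M\<^esub>"
    proof (cases "r = 0")
      case False
      obtain m where m: "tp (int m) * inverse r \<in> tail cnd" using exists_tail[of "inverse r" cnd] by (elim exE)
      define s where "s = x ^ m * inverse r"
      obtain g where g: "g \<in> supp_in {0..}" "x ^ m = tp (int m) * g" using xm[of m] tail_shift by metis
      have "s = (tp (int m) * inverse r) * g" unfolding s_def g(2) by (simp add: mult_ac)
      also have "\<dots> \<in> tail cnd" by (rule supp_in_mult[OF m g(1)]) auto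
      finally have sS: "s \<in> S" by (rule tail_S)
      have "s * r = x ^ m" unfolding s_def mult.assoc left_inverse[OF False] by (rule mult_1_right)
      then have "(x ^ m) \<odot>\<^bsub>M\<^esub> y = (s * r) \<odot>\<^bsub>M\<^esub> y" by (rule arg_cong[OF sym])
      also have "\<dots> = \<zero>\<^bsub>M\<^esub>" using M.smult_assoc1[of s r y] sS r y ry by simp
      finally show ?thesis using xpow_reg[OF y] by blast
    qed simp
  qed
qed

section \<open>Finite type\<close>

lemma K357_finite_type:
  fixes \<C> :: "'k::field lmodule \<Rightarrow> bool"
  assumes tf: "\<And>M. \<C> M \<Longrightarrow> indecomposable_module (semigroup_ring H) M \<Longrightarrow> fin_gen_module (semigroup_ring H) M \<and> torsion_free M"
    and K: "(K357 :: 'k fls set) \<subseteq> S"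
  shows "finite_type (semigroup_ring H) \<C>"
  unfolding finite_type_def
proof (intro exI[of _ "(\<lambda>\<tau>. cm (type_module \<tau>)) ` types"] conjI allI impI)
  show "finite ((\<lambda>\<tau>. cm (type_module \<tau>) :: 'k lmodule) ` types)" using finite_types by blast
  fix M :: "'k lmodule" assume M: "\<C> M \<and> indecomposable_module (semigroup_ring H) M"
  then have fg: "fin_gen_module (semigroup_ring H) M" and t: "torsion_free M" using tf by blast+
  obtain n N \<psi> where "frame n N" "stable S N"
    "mod_isomorphic (semigroup_ring H) M (cm N)" "indecomposable_module (semigroup_ring H) (cm N)"
    using concrete_model[OF fg t] M by metis
  note * = this
  have mod: "module (semigroup_ring H) M" using fg by (simp add: fin_gen_module_def)
  show "\<exists>N\<in>(\<lambda>\<tau>. cm (type_module \<tau>)) ` types. mod_isomorphic (semigroup_ring H) M N"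
    using finite_357[OF *(4,1,2) stable_subset[OF *(2) K]] mod_isomorphic_trans[OF mod *(3)] by blast
qed

theorem CM_finite:
  "(K357 :: 'k::field fls set) \<subseteq> S \<Longrightarrow> CM_finite_type (semigroup_ring H :: 'k fls ring)"
  by (rule K357_finite_type)
    (auto simp: indecomposable_module_def max_CM_module_def intro!: max_CM_torsion_free)

theorem Ref_finite_S:
  "(K357 :: 'k::field fls set) \<subseteq> S \<Longrightarrow> Ref_finite_type (semigroup_ring H :: 'k fls ring)"
  by (rule K357_finite_type) (auto simp: reflexive_module_def intro!: reflexive_torsion_free)

theorem Ref_finite_K357:
  assumes K: "\<And>b r. b \<in> K357 \<Longrightarrow> r \<in> Smax \<Longrightarrow> b * r \<in> (S :: 'k::field fls set)"
  shows "Ref_finite_type (semigroup_ring H :: 'k fls ring)"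
  unfolding finite_type_def
proof (intro exI[of _ "insert (cm (rank1 S)) ((\<lambda>\<tau>. cm (type_module \<tau>)) ` types)"] conjI allI impI)
  show "finite (insert (cm (rank1 S)) ((\<lambda>\<tau>. cm (type_module \<tau>) :: 'k lmodule) ` types))"
    using finite_types by blast
  fix M :: "'k lmodule" assume M: "reflexive_module (semigroup_ring H) M \<and> indecomposable_module (semigroup_ring H) M"
  then have mod: "module (semigroup_ring H) M" by (simp add: indecomposable_module_def)
  from reflexive_dichotomy[OF conjunct1[OF M] conjunct2[OF M]]
  show "\<exists>N\<in>insert (cm (rank1 S)) ((\<lambda>\<tau>. cm (type_module \<tau>)) ` types). mod_isomorphic (semigroup_ring H) M N"
  proof (elim disjE exE conjE)
    fix n N assume fr: "frame n N" and N: "stable S N" and iso: "mod_isomorphic (semigroup_ring H) M (cm N)"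
      and ind: "indecomposable_module (semigroup_ring H) (cm N)"
      and st: "\<forall>b. (\<forall>r\<in>Smax. b * r \<in> S) \<longrightarrow> (\<forall>x\<in>N. sm b x \<in> N)"
    have "stable K357 N" using N st K by (auto simp: stable_def)
    from finite_357[OF ind fr N this] show ?thesis using mod_isomorphic_trans[OF mod iso] by blast
  qed auto
qed

theorem Ref_finite_symmetric:
  assumes H0: "numsg H0" and F0: "0 \<le> F0" "\<And>i. i \<in> int ` H0 \<longleftrightarrow> F0 - i \<notin> int ` H0"
    and sup: "{0, 3} \<union> {5..} \<subseteq> int ` H0 \<union> {F0}"
    and K: "\<And>b r. b \<in> numsg.S H0 \<Longrightarrow> r \<in> Smax \<Longrightarrow> b * r \<in> (S :: 'k::field fls set)"
  shows "Ref_finite_type (semigroup_ring H :: 'k fls ring)"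
  unfolding finite_type_def
proof (intro exI[of _ "{cm (rank1 S), cm (rank1 (numsg.S H0))} \<union> ((\<lambda>\<tau>. cm (type_module \<tau>)) ` types)"] conjI allI impI)
  show "finite ({cm (rank1 S), cm (rank1 (numsg.S H0))} \<union> ((\<lambda>\<tau>. cm (type_module \<tau>) :: 'k lmodule) ` types))"
    using finite_types by blast
  fix M :: "'k lmodule" assume M: "reflexive_module (semigroup_ring H) M \<and> indecomposable_module (semigroup_ring H) M"
  then have mod: "module (semigroup_ring H) M" by (simp add: indecomposable_module_def)
  from reflexive_dichotomy[OF conjunct1[OF M] conjunct2[OF M]]
  show "\<exists>N\<in>{cm (rank1 S), cm (rank1 (numsg.S H0))} \<union> ((\<lambda>\<tau>. cm (type_module \<tau>)) ` types). mod_isomorphic (semigroup_ring H) M N"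
  proof (elim disjE exE conjE)
    fix n N assume fr: "frame n N" and N: "stable S N" and iso: "mod_isomorphic (semigroup_ring H) M (cm N)"
      and ind: "indecomposable_module (semigroup_ring H) (cm N)"
      and st: "\<forall>b. (\<forall>r\<in>Smax. b * r \<in> S) \<longrightarrow> (\<forall>x\<in>N. sm b x \<in> N)"
    have "stable (numsg.S H0) N" using N st K by (auto simp: stable_def)
    from finite_symmetric[OF ind fr N H0 this F0 sup] show ?thesis
      using mod_isomorphic_trans[OF mod iso] by blast
  qed auto
qed

end

section \<open>A family of reflexive fractional ideals\<close>

lemma mod_isomorphic_sym:
  assumes "module R M" "mod_isomorphic R M N"
  shows "mod_isomorphic R N M"
proof -
  interpret M: module R M by fact
  obtain f where f: "f \<in> mod_hom R M N" and bij: "bij_betw f (carrier M) (carrier N)"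
    using assms(2) by (auto simp: mod_isomorphic_def)
  define g where "g = restrict (inv_into (carrier M) f) (carrier N)"
  have gM: "g y \<in> carrier M" and fg: "f (g y) = y" if "y \<in> carrier N" for y
    using that bij by (auto simp: g_def bij_betw_def inv_into_into f_inv_into_f)
  have gf: "g (f x) = x" if "x \<in> carrier M" for x
    using that bij by (auto simp: g_def bij_betw_def)
  have "g \<in> mod_hom R N M"
    unfolding mod_hom_def
  proof (intro CollectI conjI ballI)
    show "g \<in> carrier N \<rightarrow>\<^sub>E carrier M" unfolding g_def using gM[unfolded g_def] by auto
    show "g (x \<oplus>\<^bsub>N\<^esub> y) = g x \<oplus>\<^bsub>M\<^esub> g y" if "x \<in> carrier N" "y \<in> carrier N" for x y
    proof -
      have "f (g x \<oplus>\<^bsub>M\<^esub> g y) = x \<oplus>\<^bsub>N\<^esub> y"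
        using f gM that by (simp add: mod_hom_def fg)
      then show ?thesis using gf[OF M.M.a_closed[OF gM[OF that(1)] gM[OF that(2)]]] by simp
    qed
    show "g (r \<odot>\<^bsub>N\<^esub> x) = r \<odot>\<^bsub>M\<^esub> g x" if "r \<in> carrier R" "x \<in> carrier N" for r x
    proof -
      have "f (r \<odot>\<^bsub>M\<^esub> g x) = r \<odot>\<^bsub>N\<^esub> x"
        using f gM that by (simp add: mod_hom_def fg)
      then show ?thesis using gf[OF M.smult_closed[OF that(1) gM[OF that(2)]]] by simp
    qed
  qed
  moreover have "bij_betw g (carrier N) (carrier M)"
    by (rule bij_betwI[where g = f]) (use gM fg gf bij_betwE[OF bij] in auto)
  ultimately show ?thesis unfolding mod_isomorphic_def by blast
qed

lemma rank1_unit: "v \<in> rank1 I \<Longrightarrow> v = sm (v 0) (unit 0)"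
  by (auto simp: rank1_def unit_def fun_eq_iff)

lemma sm_unit_rank1: "sm f (unit 0) \<in> rank1 I \<longleftrightarrow> f \<in> I"
  by (auto simp: rank1_def unit_def)

lemma sm_unit_eq: "sm f (unit 0) = sm g (unit 0) \<longleftrightarrow> f = g"
  by (auto simp: unit_def fun_eq_iff)

context numsg
begin

text \<open>The gaps of \<open>H\<close> in this set are the pseudo-Frobenius numbers.\<close>

definition endo :: "nat set" where "endo = {b. \<forall>h\<in>H. 0 < h \<longrightarrow> b + h \<in> H}"

text \<open>The condition on F - x is written additively because subtraction is truncated; for
  proper \<open>H\<close> the Frobenius number is \<open>cnd - 1\<close>.\<close>

definition almost_symmetric :: bool
  where "almost_symmetric \<longleftrightarrow> (\<forall>x. x \<notin> H \<longrightarrow> x \<in> endo \<or> (\<exists>h\<in>H. h + x = cnd - 1))"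

text \<open>The fractional ideal R : I in k((t)), a model of the dual module by
  \<open>dual_rank1\<close>.\<close>

definition ring_dual :: "'k::field fls set \<Rightarrow> 'k fls set"
  where "ring_dual I = {q. \<forall>f\<in>I. q * f \<in> S}"

lemma common_denominator: "\<exists>N. tp (int N) * f \<in> (S :: 'k::field fls set) \<and> tp (int N) \<in> (S :: 'k fls set)"
proof -
  obtain n where n: "tp (int n) * f \<in> tail cnd" using exists_tail[of f cnd] by (elim exE)
  have "tp (int (cnd + n)) * f = tp (int cnd) * (tp (int n) * f)"
    by (simp add: tp_mult mult.assoc[symmetric])
  also have "\<dots> \<in> S" using S_mult[OF tp_S[THEN iffD2, OF cnd] tail_S[OF n]] by simp
  finally show ?thesis using cnd[of "cnd + n"] tp_S[of "cnd + n"] by (intro exI[of _ "cnd + n"]) simp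
qed

text \<open>A set of the form R : J is always an R-module.\<close>

lemma rank1_stable:
  assumes "\<And>z. z \<in> I \<longleftrightarrow> z \<in> ring_dual (ring_dual I)"
  shows "stable S (rank1 (I :: 'k::field fls set))"
proof -
  have c: "0 \<in> I" "f \<in> I \<Longrightarrow> g \<in> I \<Longrightarrow> f + g \<in> I" "f \<in> I \<Longrightarrow> g \<in> I \<Longrightarrow> f - g \<in> I"
    "r \<in> S \<Longrightarrow> f \<in> I \<Longrightarrow> r * f \<in> I" for f g r
  proof -
    show "0 \<in> I" unfolding assms ring_dual_def by auto
    show "f + g \<in> I" if "f \<in> I" "g \<in> I"
      using that unfolding assms by (simp add: ring_dual_def distrib_right)
    show "f - g \<in> I" if "f \<in> I" "g \<in> I"
      using that unfolding assms by (simp add: ring_dual_def left_diff_distrib)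
    show "r * f \<in> I" if "r \<in> S" "f \<in> I"
      using that unfolding assms by (simp add: ring_dual_def mult.assoc)
  qed
  show ?thesis unfolding stable_def rank1_def using c by auto
qed

text \<open>Two nonzero submodules of k((t)) meet: cross-multiplying elements of both, after
  clearing denominators, gives a nonzero common multiple.\<close>

lemma rank1_indecomposable:
  assumes st: "stable S (rank1 (I :: 'k::field fls set))" and 1: "1 \<in> I"
  shows "indecomposable_module (semigroup_ring H) (cm (rank1 I))"
  unfolding indecomposable_module_def
proof (intro conjI allI impI)
  let ?M = "cm (rank1 I)"
  show mod: "module (semigroup_ring H) ?M" by (rule module_cm[OF st])
  then interpret M: module "semigroup_ring H" ?M .
  have "unit 0 \<in> rank1 I" using sm_unit_rank1[of 1 I] 1 by simp
  moreover have "unit 0 \<noteq> (0 :: nat \<Rightarrow> 'k fls)" by (simp add: unit_def fun_eq_iff exI[of _ 0])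
  ultimately show "carrier ?M \<noteq> {\<zero>\<^bsub>?M\<^esub>}" unfolding cm_simps by blast
  fix A B assume AB: "submodule A (semigroup_ring H) ?M \<and> submodule B (semigroup_ring H) ?M \<and>
    A \<inter> B = {\<zero>\<^bsub>?M\<^esub>} \<and> A <+>\<^bsub>?M\<^esub> B = carrier ?M"
  note A = M.submoduleE[OF conjunct1[OF AB], unfolded cm_simps carrier_ring]
    and B = M.submoduleE[OF conjunct1[OF conjunct2[OF AB]], unfolded cm_simps carrier_ring]
  have z: "A \<inter> B = {0}" using AB by simp
  { assume "A \<noteq> {0}" "B \<noteq> {0}"
    moreover have "0 \<in> A" "0 \<in> B" using z by auto
    ultimately obtain a b where ab: "a \<in> A" "a \<noteq> 0" "b \<in> B" "b \<noteq> 0" by blast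
    have a: "a = sm (a 0) (unit 0)" and b: "b = sm (b 0) (unit 0)"
      using rank1_unit[of a I] rank1_unit[of b I] ab A(1) B(1) by blast+
    have nz: "a 0 \<noteq> 0" "b 0 \<noteq> 0" using a b ab by (metis sm_simps(2))+
    obtain e where e: "tp (int e) * a 0 \<in> tail cnd" using exists_tail[of "a 0" cnd] by (elim exE)
    obtain e' where e': "tp (int e') * b 0 \<in> tail cnd" using exists_tail[of "b 0" cnd] by (elim exE)
    have sh: "tp (int i) * f \<in> S" if "f \<in> tail cnd" for i and f :: "'k fls"
      using that by (intro tail_S) (auto simp: supp_in_def)
    have r: "tp (int e) * (tp (int e') * b 0) \<in> S" "tp (int e') * (tp (int e) * a 0) \<in> S"
      using sh[OF e'] sh[OF e] by blast+
    define v where "v = sm (tp (int e) * (tp (int e') * b 0)) a"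
    have "v = sm (tp (int e) * (tp (int e') * b 0)) (sm (a 0) (unit 0))" unfolding v_def using a by metis
    also have "\<dots> = sm (tp (int e') * (tp (int e) * a 0)) (sm (b 0) (unit 0))"
      unfolding sm_simps(5) by (simp add: mult_ac)
    also have "\<dots> = sm (tp (int e') * (tp (int e) * a 0)) b" using b by metis
    finally have v': "v = sm (tp (int e') * (tp (int e) * a 0)) b" .
    have "v \<in> A" unfolding v_def using A(4)[OF r(1) ab(1)] .
    moreover have "v \<in> B" unfolding v' using B(4)[OF r(2) ab(3)] .
    ultimately have "v = 0" using z by blast
    then have False unfolding v_def sm_eq_0 using nz ab by simp }
  then show "A = {\<zero>\<^bsub>?M\<^esub>} \<or> B = {\<zero>\<^bsub>?M\<^esub>}" unfolding cm_simps by blast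
qed

text \<open>A linear form is determined by its value \<open>q\<close> at 1: clearing the denominator
  of an argument by some t^N shows that the form is multiplication by \<open>q\<close>.\<close>

lemma dual_rank1:
  assumes st: "stable S (rank1 (I :: 'k::field fls set))" and 1: "1 \<in> I"
  shows "\<phi> \<in> carrier (dual_module (semigroup_ring H) (cm (rank1 I))) \<longleftrightarrow>
    (\<exists>q\<in>ring_dual I. \<phi> = (\<lambda>v\<in>rank1 I. q * v 0))"
proof
  assume "\<phi> \<in> carrier (dual_module (semigroup_ring H) (cm (rank1 I)))"
  then have ext: "\<phi> \<in> rank1 I \<rightarrow>\<^sub>E S" and lin: "\<And>r v. r \<in> S \<Longrightarrow> v \<in> rank1 I \<Longrightarrow> \<phi> (sm r v) = r * \<phi> v"
    unfolding dual_carrier by simp_all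
  define q where "q = \<phi> (unit 0)"
  have u: "unit 0 \<in> rank1 I" using sm_unit_rank1[of 1 I] 1 by simp
  have ev: "\<phi> v = q * v 0" if v: "v \<in> rank1 I" for v
  proof -
    obtain N where N: "tp (int N) * v 0 \<in> (S :: 'k fls set)" "tp (int N) \<in> (S :: 'k fls set)"
      using common_denominator[of "v 0"] by blast
    have "tp (int N) * \<phi> v = \<phi> (sm (tp (int N)) v)" using lin[OF N(2) v] by simp
    also have "sm (tp (int N)) v = sm (tp (int N) * v 0) (unit 0)"
      by (subst rank1_unit[OF v]) simp
    also have "\<phi> \<dots> = tp (int N) * v 0 * q" unfolding q_def using lin[OF N(1) u] .
    finally show ?thesis by (simp add: mult_ac)
  qed
  have "q * f \<in> S" if "f \<in> I" for f
  proof -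
    have f: "sm f (unit 0) \<in> rank1 I" using that sm_unit_rank1 by blast
    have "\<phi> (sm f (unit 0)) = q * f" using ev[OF f] by (simp add: unit_def)
    then show ?thesis using PiE_mem[OF ext f] by simp
  qed
  then have "q \<in> ring_dual I" by (simp add: ring_dual_def)
  moreover have "\<phi> = (\<lambda>v\<in>rank1 I. q * v 0)"
    using ext ev by (intro extensionalityI[of _ "rank1 I"]) (auto simp: PiE_def)
  ultimately show "\<exists>q\<in>ring_dual I. \<phi> = (\<lambda>v\<in>rank1 I. q * v 0)" by blast
next
  assume "\<exists>q\<in>ring_dual I. \<phi> = (\<lambda>v\<in>rank1 I. q * v 0)"
  then obtain q where q: "q \<in> ring_dual I" "\<phi> = (\<lambda>v\<in>rank1 I. q * v 0)" by blast
  have "q * v 0 \<in> S" if "v \<in> rank1 I" for v using that q(1) by (simp add: rank1_def ring_dual_def)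
  then show "\<phi> \<in> carrier (dual_module (semigroup_ring H) (cm (rank1 I)))"
    unfolding dual_carrier q(2) cm_simps restrict_PiE_iff
    using stableD(2,4)[OF st] by (simp add: distrib_left mult.left_commute)
qed

text \<open>The bidual is R : (R : I). Since t^cnd lies in R : I, a functional on the dual can be
  recovered from its value at this one form.\<close>

lemma rank1_reflexive:
  assumes fg: "fin_gen_module (semigroup_ring H) (cm (rank1 (I :: 'k::field fls set)))" and 1: "1 \<in> I"
    and O: "I \<subseteq> supp_in {0..}"
    and bi: "\<And>z. z \<in> I \<longleftrightarrow> z \<in> ring_dual (ring_dual I)"
  shows "reflexive_module (semigroup_ring H) (cm (rank1 I))"
  unfolding reflexive_module_def
proof (intro conjI fg)
  note st = rank1_stable[OF bi]
  let ?M = "cm (rank1 I)" and ?c = "tp (int cnd) :: 'k fls"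
  let ?D = "dual_module (semigroup_ring H) ?M"
  define \<phi> where "\<phi> q = (\<lambda>v\<in>rank1 I. q * v 0)" for q
  note dual = dual_rank1[OF st 1, folded \<phi>_def]
  have \<phi>D: "\<phi> q \<in> carrier ?D" if "q \<in> ring_dual I" for q using that unfolding dual by blast
  have c: "?c \<in> ring_dual I" unfolding ring_dual_def using O tail_S tail_shift by blast
  have bm: "biduality_map (semigroup_ring H) ?M v (\<phi> q) = q * v 0" if "v \<in> rank1 I" "q \<in> ring_dual I" for v q
    using that \<phi>D by (simp add: biduality_map_def) (simp add: \<phi>_def)
  have inj: "inj_on (biduality_map (semigroup_ring H) ?M) (rank1 I)"
  proof (rule inj_onI)
    fix v w assume v: "v \<in> rank1 I" and w: "w \<in> rank1 I"
      and eq: "biduality_map (semigroup_ring H) ?M v = biduality_map (semigroup_ring H) ?M w"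
    have "?c * v 0 = ?c * w 0" using bm[OF v c] bm[OF w c] eq by simp
    then have "v 0 = w 0" by simp
    then show "v = w" using rank1_unit[OF v] rank1_unit[OF w] by simp
  qed
  have mapsto: "biduality_map (semigroup_ring H) ?M v \<in> carrier (dual_module (semigroup_ring H) ?D)"
    if v: "v \<in> rank1 I" for v
    unfolding dual_carrier
  proof (intro conjI ballI)
    have ev: "biduality_map (semigroup_ring H) ?M v f = f v" if "f \<in> carrier ?D" for f
      using that v by (simp add: biduality_map_def)
    have fv: "f v \<in> S" if "f \<in> carrier ?D" for f using that v unfolding dual_carrier by auto
    show "biduality_map (semigroup_ring H) ?M v \<in> carrier ?D \<rightarrow>\<^sub>E S"
      using v fv by (simp add: biduality_map_def restrict_PiE_iff)
    show "biduality_map (semigroup_ring H) ?M v (f \<oplus>\<^bsub>?D\<^esub> g) =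
        biduality_map (semigroup_ring H) ?M v f + biduality_map (semigroup_ring H) ?M v g"
      if f: "f \<in> carrier ?D" and g: "g \<in> carrier ?D" for f g
    proof -
      obtain p q where "p \<in> ring_dual I" "f = \<phi> p" "q \<in> ring_dual I" "g = \<phi> q" using f g unfolding dual by blast
      then have "f \<oplus>\<^bsub>?D\<^esub> g = \<phi> (p + q)" "p + q \<in> ring_dual I"
        by (auto simp: dual_ops \<phi>_def ring_dual_def distrib_right intro!: restrict_ext)
      then have "f \<oplus>\<^bsub>?D\<^esub> g \<in> carrier ?D" using \<phi>D by simp
      then show ?thesis using ev f g v by (simp add: dual_ops)
    qed
    show "biduality_map (semigroup_ring H) ?M v (r \<odot>\<^bsub>?D\<^esub> f) = r * biduality_map (semigroup_ring H) ?M v f"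
      if r: "r \<in> S" and f: "f \<in> carrier ?D" for r f
    proof -
      obtain p where "p \<in> ring_dual I" "f = \<phi> p" using f unfolding dual by blast
      then have "r \<odot>\<^bsub>?D\<^esub> f = \<phi> (r * p)" "r * p \<in> ring_dual I"
        using r by (auto simp: dual_ops \<phi>_def ring_dual_def mult.assoc intro!: restrict_ext)
      then have "r \<odot>\<^bsub>?D\<^esub> f \<in> carrier ?D" using \<phi>D by simp
      then show ?thesis using ev f v by (simp add: dual_ops)
    qed
  qed
  have surj: "\<Theta> \<in> biduality_map (semigroup_ring H) ?M ` rank1 I"
    if \<Theta>: "\<Theta> \<in> carrier (dual_module (semigroup_ring H) ?D)" for \<Theta>
  proof -
    have ext: "\<Theta> \<in> carrier ?D \<rightarrow>\<^sub>E S"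
      and lin: "\<And>r f. r \<in> S \<Longrightarrow> f \<in> carrier ?D \<Longrightarrow> \<Theta> (r \<odot>\<^bsub>?D\<^esub> f) = r * \<Theta> f"
      using \<Theta> unfolding dual_carrier[of \<Theta>] by blast+
    define z where "z = tp (- int cnd) * \<Theta> (\<phi> ?c)"
    have sm\<phi>: "r \<odot>\<^bsub>?D\<^esub> \<phi> q = \<phi> (r * q)" for r q
      unfolding dual_ops \<phi>_def cm_simps by (intro restrict_ext) (simp add: mult.assoc)
    have ev: "\<Theta> (\<phi> q) = q * z" if q: "q \<in> ring_dual I" for q
    proof -
      obtain N where N: "tp (int N) * q \<in> (S :: 'k fls set)" "tp (int N) \<in> (S :: 'k fls set)"
        using common_denominator[of q] by blast
      have cS: "?c \<in> S" using tp_S[of cnd] cnd[of cnd] by simp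
      have "tp (int N) * ?c * \<Theta> (\<phi> q) = \<Theta> (\<phi> (tp (int N) * ?c * q))"
        using lin[OF S_mult[OF N(2) cS] \<phi>D[OF q]] unfolding sm\<phi> by simp
      also have "tp (int N) * ?c * q = tp (int N) * q * ?c" by (simp add: mult_ac)
      also have "\<Theta> (\<phi> (tp (int N) * q * ?c)) = tp (int N) * q * \<Theta> (\<phi> ?c)"
        using lin[OF N(1) \<phi>D[OF c]] unfolding sm\<phi> .
      finally have "?c * \<Theta> (\<phi> q) = q * \<Theta> (\<phi> ?c)" by (simp add: mult.assoc)
      then have "tp (- int cnd) * (?c * \<Theta> (\<phi> q)) = q * z" by (simp add: z_def mult_ac)
      then show ?thesis by (simp add: mult.assoc[symmetric] tp_mult tp_0)
    qed
    have "z * q \<in> S" if "q \<in> ring_dual I" for q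
      using PiE_mem[OF ext \<phi>D[OF that]] ev[OF that] by (simp add: mult.commute)
    then have "z \<in> I" unfolding bi by (simp add: ring_dual_def[of "ring_dual I"])
    then have v: "sm z (unit 0) \<in> rank1 I" using sm_unit_rank1 by blast
    have "\<Theta> = biduality_map (semigroup_ring H) ?M (sm z (unit 0))"
    proof (rule extensionalityI[of _ "carrier ?D"])
      show "\<Theta> \<in> extensional (carrier ?D)" using ext by (simp add: PiE_def)
      show "biduality_map (semigroup_ring H) ?M (sm z (unit 0)) \<in> extensional (carrier ?D)"
        using v by (simp add: biduality_map_def)
      fix f assume "f \<in> carrier ?D"
      then obtain q where q: "q \<in> ring_dual I" "f = \<phi> q" unfolding dual by blast
      show "\<Theta> f = biduality_map (semigroup_ring H) ?M (sm z (unit 0)) f"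
        unfolding q(2) bm[OF v q(1)] ev[OF q(1)] by (simp add: unit_def)
    qed
    then show ?thesis using v by blast
  qed
  show "bij_betw (biduality_map (semigroup_ring H) ?M) (carrier ?M) (carrier (dual_module (semigroup_ring H) ?D))"
    unfolding bij_betw_def cm_simps using inj mapsto surj by blast
qed


text \<open>The form \<open>f \<mapsto> f $$ (cnd - 1)\<close> makes the maximal ideal and the ring of \<open>endo\<close> dual to
  each other.\<close>

lemma ring_dual_test:
  assumes as: "almost_symmetric" and c: "cnd \<noteq> 0"
    and stb: "\<And>b f. b \<in> endo \<Longrightarrow> f \<in> I \<Longrightarrow> tp (int b) * f \<in> (I :: 'k::field fls set)"
    and q: "\<And>f. f \<in> I \<Longrightarrow> (q * f) $$ (int cnd - 1) = 0"
  shows "q \<in> ring_dual I"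
  unfolding ring_dual_def
proof (intro CollectI ballI)
  fix f assume f: "f \<in> I"
  have "i \<in> int ` H" if i: "(q * f) $$ i \<noteq> 0" for i
  proof (cases "i \<ge> int cnd")
    case True
    then have "i = int (nat i)" "nat i \<in> H" using cnd[of "nat i"] by auto
    then show ?thesis by blast
  next
    case False
    \<comment> \<open>This is F - i with F = cnd - 1. If it lay in \<open>endo\<close>, then t^x f
      would be in \<open>I\<close> and q t^x f would have a nonzero coefficient at F. So it lies
      outside \<open>endo\<close>, and almost symmetry puts F - x = i into \<open>H\<close>.\<close>
    define x where "x = nat (int cnd - 1 - i)"
    have x: "int x = int cnd - 1 - i" using False by (simp add: x_def)
    have nx: "x \<notin> endo"
    proof
      assume "x \<in> endo"
      from q[OF stb[OF this f]] have "(tp (int x) * (q * f)) $$ (int cnd - 1) = 0" by (simp add: mult_ac)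
      then show False using i x by simp
    qed
    then have "x \<notin> H" using Hadd by (auto simp: endo_def)
    then obtain h where h: "h \<in> H" "h + x = cnd - 1" using as nx unfolding almost_symmetric_def by blast
    have "int h = i" using h(2) x c by linarith
    then show ?thesis using h(1) by blast
  qed
  then show "q * f \<in> S" unfolding S_def by (rule supp_inI)
qed

text \<open>The values G = {1}, p = 2 and G = {1, 2}, p = 4 give the two families with parameter
  \<open>\<mu>\<close>.\<close>

definition lam_ideal :: "int set \<Rightarrow> int \<Rightarrow> 'k \<Rightarrow> 'k::field fls set"
  where "lam_ideal G p \<mu> = {f. (\<forall>i. i < 0 \<or> i \<in> G \<longrightarrow> f $$ i = 0) \<and> f $$ (p + 1) = \<mu> * f $$ p}"

text \<open>Each condition defining the ideal says that q f has coefficient 0 at cnd - 1, for a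
  monomial or binomial \<open>q\<close>. Such a \<open>q\<close> lies in R : I by
  \<open>ring_dual_test\<close>, so the elements of the bidual satisfy the same conditions.\<close>

lemma lam_ideal_bidual:
  fixes \<mu> :: "'k::field"
  assumes as: "almost_symmetric" and c: "cnd \<noteq> 0"
    and stb: "\<And>b f. b \<in> endo \<Longrightarrow> f \<in> lam_ideal G p \<mu> \<Longrightarrow> tp (int b) * f \<in> lam_ideal G p \<mu>"
  shows "z \<in> lam_ideal G p \<mu> \<longleftrightarrow> z \<in> ring_dual (ring_dual (lam_ideal G p \<mu>))"
proof
  assume "z \<in> lam_ideal G p \<mu>"
  then show "z \<in> ring_dual (ring_dual (lam_ideal G p \<mu>))" by (auto simp: ring_dual_def mult.commute)
next
  assume z: "z \<in> ring_dual (ring_dual (lam_ideal G p \<mu>))"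
  have F: "int cnd - 1 \<notin> int ` H"
    using cnd_pred[OF c] c by (metis imageE of_nat_1 of_nat_diff of_nat_eq_iff One_nat_def Suc_leI neq0_conv)
  have test: "(q * z) $$ (int cnd - 1) = 0"
    if "\<And>f. f \<in> lam_ideal G p \<mu> \<Longrightarrow> (q * f) $$ (int cnd - 1) = 0" for q
  proof -
    have "q \<in> ring_dual (lam_ideal G p \<mu>)" by (rule ring_dual_test[OF as c stb that])
    then have "z * q \<in> S" using z unfolding ring_dual_def[of "ring_dual _"] by blast
    then have "(z * q) $$ (int cnd - 1) = 0" unfolding S_def using F by (rule supp_inD)
    then show ?thesis by (simp add: mult.commute)
  qed
  have "z $$ i = 0" if "i < 0 \<or> i \<in> G" for i
    using test[of "tp (int cnd - 1 - i)"] that by (auto simp: lam_ideal_def)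
  moreover have "z $$ (p + 1) = \<mu> * z $$ p"
    \<comment> \<open>With F = cnd - 1 the binomial is t^(F - 1 - p) - \<mu> t^(F - p); it compares
      the coefficients at p + 1 and p.\<close>
    using test[of "tp (int cnd - 2 - p) - fls_const \<mu> * tp (int cnd - 1 - p)"]
    by (simp add: lam_ideal_def left_diff_distrib mult.assoc add.commute)
  ultimately show "z \<in> lam_ideal G p \<mu>" by (simp add: lam_ideal_def)
qed

lemma lam_ideal_fin_gen:
  fixes \<mu> :: "'k::field"
  assumes st: "stable S (rank1 (lam_ideal G p \<mu>))" and p: "0 \<le> p" "G \<subseteq> {0<..<p}"
  shows "fin_gen_module (semigroup_ring H) (cm (rank1 (lam_ideal G p \<mu>)))"
  unfolding fin_gen_module_def
proof (intro conjI)
  let ?M = "cm (rank1 (lam_ideal G p \<mu>))"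
  show mod: "module (semigroup_ring H) ?M" by (rule module_cm[OF st])
  then interpret M: module "semigroup_ring H" ?M .
  \<comment> \<open>Monomials adapted to the relation: the exponents p and p + 1 together contribute
    the single element y_p.\<close>
  define y :: "int \<Rightarrow> 'k fls" where
    "y i = (if i \<in> G \<or> i = p + 1 then 0 else if i = p then tp p + fls_const \<mu> * tp (p + 1) else tp i)" for i
  have pG: "p \<notin> G" "p + 1 \<notin> G" using p(2) by auto
  have yI: "y i \<in> lam_ideal G p \<mu>" if "0 \<le> i" for i
    using that p pG by (auto simp: y_def lam_ideal_def)
  \<comment> \<open>What remains beyond this order is t^(p + 2) times a series of order at least
    \<open>cnd\<close>, hence an R-multiple of the generator y_(p + 2).\<close>
  define N where "N = Suc (cnd + nat (p + 2))"
  define X where "X = (\<lambda>i. sm (y (int i)) (unit 0)) ` {..<N}"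
  have "Y = carrier ?M" if Y: "submodule Y (semigroup_ring H) ?M \<and> X \<subseteq> Y" for Y
  proof -
    note sub = M.submoduleE[OF conjunct1[OF Y], unfolded cm_simps carrier_ring]
    obtain w where w: "w \<in> Y" using sub(2) by blast
    have zero: "0 \<in> Y" using sub(4)[OF S_closed(1) w] unfolding sm_simps .
    have gen: "sm (\<Sum>i<n. fls_const (a i) * y (int i)) (unit 0) \<in> Y" if "n \<le> N" for a and n :: nat
      using that
    proof (induction n)
      case 0
      show ?case unfolding lessThan_0 sum.empty sm_simps by (rule zero)
    next
      case (Suc n)
      have "sm (y (int n)) (unit 0) \<in> Y" using Suc.prems Y unfolding X_def by auto
      then have n: "sm (fls_const (a n)) (sm (y (int n)) (unit 0)) \<in> Y" by (rule sub(4)[OF S_closed(6)])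
      have "n \<le> N" using Suc.prems by simp
      from sub(5)[OF Suc.IH[OF this] n] show ?case
        unfolding sum.lessThan_Suc sm_distrib sm_simps(5) .
    qed
    have "v \<in> Y" if v: "v \<in> rank1 (lam_ideal G p \<mu>)" for v
    proof -
      define f where "f = v 0"
      have f: "f \<in> lam_ideal G p \<mu>" using v by (simp add: f_def rank1_def)
      define s where "s = (\<Sum>i<N. fls_const (f $$ int i) * y (int i))"
      have s_nth: "s $$ n = f $$ n" if n: "n < int N" for n
      proof -
        have "s $$ n = (\<Sum>i<N. f $$ int i * y (int i) $$ n)" unfolding s_def by (simp add: fls_nth_sum)
        also have "\<dots> = (\<Sum>i<N. if i = nat n then f $$ n else 0)" if "0 \<le> n" "n \<noteq> p + 1"
        proof (rule sum.cong[OF refl])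
          fix i
          have "y (int i) $$ n = (if int i = n \<and> n \<notin> G then 1 else 0)"
            using that(2) pG unfolding y_def by auto
          moreover have "n \<in> G \<Longrightarrow> f $$ n = 0" using f by (simp add: lam_ideal_def)
          ultimately show "f $$ int i * y (int i) $$ n = (if i = nat n then f $$ n else 0)"
            using that(1) by auto
        qed
        moreover have "(\<Sum>i<N. f $$ int i * y (int i) $$ n) = (\<Sum>i<N. if i = nat p then f $$ n else 0)"
          if "n = p + 1"
        proof (rule sum.cong[OF refl])
          fix i
          have "y (int i) $$ (p + 1) = (if int i = p then \<mu> else 0)" using pG unfolding y_def by auto
          moreover have "f $$ (p + 1) = \<mu> * f $$ p" using f by (simp add: lam_ideal_def)
          ultimately show "f $$ int i * y (int i) $$ n = (if i = nat p then f $$ n else 0)"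
            using p(1) unfolding that by (auto simp: mult.commute)
        qed
        moreover have "(\<Sum>i<N. f $$ int i * y (int i) $$ n) = 0 \<and> f $$ n = 0" if "n < 0"
        proof
          have "y (int i) $$ n = 0" for i using that p(1) unfolding y_def by auto
          then show "(\<Sum>i<N. f $$ int i * y (int i) $$ n) = 0" by (intro sum.neutral ballI) simp
          show "f $$ n = 0" using f that by (simp add: lam_ideal_def)
        qed
        moreover have "nat p < N" "nat n < N" using p(1) n by (auto simp: N_def)
        ultimately show ?thesis by (cases "n < 0"; cases "n = p + 1") (simp_all add: sum.delta)
      qed
      define r where "r = tp (- (p + 2)) * (f - s)"
      have r: "r \<in> S"
      proof (rule tail_S, rule supp_inI)
        fix i assume "r $$ i \<noteq> 0"
        then have "f $$ (i + p + 2) \<noteq> s $$ (i + p + 2)" by (simp add: r_def algebra_simps)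
        then have "\<not> i + p + 2 < int N" using s_nth by metis
        then show "i \<in> {int cnd..}" using p by (simp add: N_def)
      qed
      have tY: "sm (y (p + 2)) (unit 0) \<in> Y"
      proof -
        have "nat (p + 2) < N" "int (nat (p + 2)) = p + 2" using p by (auto simp: N_def)
        then show ?thesis using Y unfolding X_def by (metis (no_types, lifting) image_eqI lessThan_iff subsetD)
      qed
      have "y (p + 2) = tp (p + 2)" using p by (auto simp: y_def)
      then have "f = s + r * y (p + 2)" by (simp add: r_def mult_ac tp_mult mult.assoc[symmetric] tp_0)
      then have "v = sm s (unit 0) + sm r (sm (y (p + 2)) (unit 0))"
        using rank1_unit[OF v] unfolding f_def[symmetric] by (simp only: sm_distrib sm_simps(5))
      moreover have "sm s (unit 0) \<in> Y" unfolding s_def by (rule gen) simp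
      ultimately show ?thesis using sub(5) sub(4)[OF r tY] by metis
    qed
    then show ?thesis using sub(1) by auto
  qed
  moreover have "sm (y (int i)) (unit 0) \<in> rank1 (lam_ideal G p \<mu>)" for i
    unfolding sm_unit_rank1 by (rule yI) simp
  then have "X \<subseteq> carrier ?M" unfolding X_def cm_simps by blast
  moreover have "finite X" by (simp add: X_def)
  ultimately show "\<exists>X. finite X \<and> X \<subseteq> carrier ?M \<and> (\<forall>N. submodule N (semigroup_ring H) ?M \<and> X \<subseteq> N \<longrightarrow> N = carrier ?M)"
    by blast
qed

text \<open>An isomorphism is multiplication by some \<open>g\<close> with g_0 nonzero, and g_1 = 0
  because 1 lies in \<open>G\<close>. The coefficients of g (t^p + \<mu> t^(p + 1)) at p and p + 1
  are then g_0 and \<mu> g_0, which the target relates by \<open>\<nu>\<close>.\<close>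

lemma lam_ideal_iso:
  fixes \<mu> \<nu> :: "'k::field"
  assumes G: "1 \<in> G" "G \<subseteq> {0<..<p}"
    and iso: "mod_isomorphic (semigroup_ring H) (cm (rank1 (lam_ideal G p \<mu>))) (cm (rank1 (lam_ideal G p \<nu>)))"
  shows "\<mu> = \<nu>"
proof -
  have p: "1 < p" using G by auto
  let ?I = "lam_ideal G p \<mu>" and ?J = "lam_ideal G p \<nu>"
  obtain \<phi> where \<phi>: "\<phi> \<in> mod_hom (semigroup_ring H) (cm (rank1 ?I)) (cm (rank1 ?J))"
    and bij: "bij_betw \<phi> (rank1 ?I) (rank1 ?J)" using iso by (auto simp: mod_isomorphic_def)
  have lin: "\<phi> (sm r v) = sm r (\<phi> v)" if "r \<in> S" "v \<in> rank1 ?I" for r v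
    using \<phi> that by (simp add: mod_hom_def)
  have one: "1 \<in> ?I" "1 \<in> ?J" using G p by (auto simp: lam_ideal_def)
  have u: "unit 0 \<in> rank1 ?I" using sm_unit_rank1[of 1 ?I] one by simp
  define g where "g = \<phi> (unit 0) 0"
  have ev: "\<phi> v 0 = g * v 0" if v: "v \<in> rank1 ?I" for v
  proof -
    obtain N where N: "tp (int N) * v 0 \<in> (S :: 'k fls set)" "tp (int N) \<in> (S :: 'k fls set)"
      using common_denominator[of "v 0"] by blast
    have "sm (tp (int N)) (\<phi> v) = \<phi> (sm (tp (int N)) v)" using lin[OF N(2) v] by simp
    also have "sm (tp (int N)) v = sm (tp (int N) * v 0) (unit 0)"
      by (subst rank1_unit[OF v]) simp
    also have "\<phi> \<dots> = sm (tp (int N) * v 0) (\<phi> (unit 0))" by (rule lin[OF N(1) u])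
    finally have "sm (tp (int N)) (\<phi> v) 0 = sm (tp (int N) * v 0) (\<phi> (unit 0)) 0" by (rule arg_cong)
    then show ?thesis by (simp add: g_def mult_ac)
  qed
  have gJ: "g * f \<in> ?J" if "f \<in> ?I" for f
  proof -
    have f: "sm f (unit 0) \<in> rank1 ?I" using that sm_unit_rank1 by blast
    have "\<phi> (sm f (unit 0)) \<in> rank1 ?J" using bij_betwE[OF bij] f by blast
    then have "\<phi> (sm f (unit 0)) 0 \<in> ?J" by (simp add: rank1_def)
    then show ?thesis unfolding ev[OF f] by (simp add: unit_def)
  qed
  have O: "f \<in> supp_in {0..}" if "f \<in> lam_ideal G p c" for f :: "'k fls" and c
    using that by (auto simp: lam_ideal_def intro!: supp_inI leI)
  have g: "g \<in> ?J" using gJ[OF one(1)] by simp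
  have "sm 1 (unit 0) \<in> \<phi> ` rank1 ?I" using bij one(2) sm_unit_rank1 unfolding bij_betw_def by blast
  then obtain v where v: "v \<in> rank1 ?I" "\<phi> v = sm 1 (unit 0)" by (metis (no_types) imageE)
  have "\<phi> v 0 = 1" unfolding v(2) by (simp add: unit_def)
  then have gv: "g * v 0 = 1" using ev[OF v(1)] by simp
  have vI: "v 0 \<in> ?I" using v(1) by (simp add: rank1_def)
  have "g $$ 0 * v 0 $$ 0 = 1" using times_nth_0[OF O[OF g] O[OF vI]] gv by simp
  then have g0: "g $$ 0 \<noteq> 0" by auto
  define w where "w = tp p + fls_const \<mu> * tp (p + 1)"
  have "p \<notin> G" "p + 1 \<notin> G" using G by auto
  then have "w \<in> ?I" using p using G by (auto simp: w_def lam_ideal_def)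
  from gJ[OF this] have "(g * w) $$ (p + 1) = \<nu> * (g * w) $$ p" by (simp add: lam_ideal_def)
  moreover have "g * w = tp p * g + fls_const \<mu> * (tp (p + 1) * g)" by (simp add: w_def algebra_simps)
  moreover have "g $$ 1 = 0" "g $$ (- 1) = 0" using g G by (simp_all add: lam_ideal_def)
  ultimately show ?thesis using g0 by simp
qed

theorem not_Ref_finite:
  assumes as: "almost_symmetric" and c: "cnd \<noteq> 0"
    and B: "endo \<inter> {1, 2, 3} = {} \<or> endo \<inter> {1, 2, 4, 5} = {}"
  shows "\<not> Ref_finite_type (semigroup_ring H :: 'k::field_char_0 fls ring)"
proof
  assume "Ref_finite_type (semigroup_ring H :: 'k fls ring)"
  then obtain \<S> :: "'k lmodule set" where fin: "finite \<S>" and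
    all: "\<forall>M :: 'k lmodule. reflexive_module (semigroup_ring H) M \<and> indecomposable_module (semigroup_ring H) M \<longrightarrow>
      (\<exists>N\<in>\<S>. mod_isomorphic (semigroup_ring H) M N)"
    unfolding finite_type_def by (elim exE conjE) (rule that)
  have "\<exists>(G :: int set) p. 1 \<in> G \<and> G \<subseteq> {0<..<p} \<and>
    (\<forall>b\<in>endo. \<forall>\<mu> :: 'k. \<forall>f\<in>lam_ideal G p \<mu>. tp (int b) * f \<in> lam_ideal G p \<mu>)"
  proof (cases "endo \<inter> {1, 2, 3} = {}")
    case True
    have "tp (int b) * f \<in> lam_ideal {1} 2 \<mu>" if b: "b \<in> endo" and f: "f \<in> lam_ideal {1} 2 \<mu>" for b f and \<mu> :: 'k
    proof (cases "b = 0")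
      case False
      have "b \<noteq> 1" "b \<noteq> 2" "b \<noteq> 3" using True b by blast+
      then have b4: "4 \<le> b" using False by linarith
      have "f $$ i = 0" if "i < 0" for i using f that by (simp add: lam_ideal_def)
      note z = this
      \<comment> \<open>The product t^b f has order at least 4, beyond the last exponent p + 1 = 3
        of the conditions.\<close>
      have "f $$ (i - int b) = 0" if "i \<le> 3" for i by (rule z) (use b4 that in simp)
      then show ?thesis unfolding lam_ideal_def mem_Collect_eq tp_times_nth by simp
    qed (use f in \<open>simp add: tp_0\<close>)
    then show ?thesis by (intro exI[of _ "{1}"] exI[of _ 2] conjI ballI allI) simp_all
  next
    case 2: False
    have "tp (int b) * f \<in> lam_ideal {1, 2} 4 \<mu>" if b: "b \<in> endo" and f: "f \<in> lam_ideal {1, 2} 4 \<mu>" for b f and \<mu> :: 'k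
    proof -
      have "b \<noteq> 1" "b \<noteq> 2" "b \<noteq> 4" "b \<noteq> 5" using 2 B b by blast+
      then consider "b = 0" | "b = 3" | "6 \<le> b" by linarith
      then show ?thesis
      proof cases
        case 1
        then show ?thesis using f by (simp add: tp_0)
      next
        case 2
        \<comment> \<open>As f_1 = f_2 = 0, the series t^3 f is zero at t^4 and t^5; this is why 3
          may belong to \<open>endo\<close> in the second family.\<close>
        have "f $$ i = 0" if "i \<le> 2" "i \<noteq> 0" for i
        proof -
          have "i < 0 \<or> i \<in> {1, 2}" using that by auto
          then show ?thesis using f unfolding lam_ideal_def by blast
        qed
        note z = this
        show ?thesis unfolding lam_ideal_def mem_Collect_eq tp_times_nth 2
          by (auto intro!: z) (simp add: z)
      next
        case 3
        have "f $$ i = 0" if "i < 0" for i using f that by (simp add: lam_ideal_def)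
        note z = this
        have "f $$ (i - int b) = 0" if "i \<le> 5" for i by (rule z) (use 3 that in simp)
        then show ?thesis unfolding lam_ideal_def mem_Collect_eq tp_times_nth by simp
      qed
    qed
    then show ?thesis by (intro exI[of _ "{1, 2}"] exI[of _ 4] conjI ballI allI) simp_all
  qed
  then obtain G :: "int set" and p :: int where G: "1 \<in> G" "G \<subseteq> {0<..<p}"
    and stb': "\<forall>b\<in>endo. \<forall>\<mu> :: 'k. \<forall>f\<in>lam_ideal G p \<mu>. tp (int b) * f \<in> lam_ideal G p \<mu>"
    by (elim exE conjE)
  have stb: "tp (int b) * f \<in> lam_ideal G p \<mu>" if "b \<in> endo" "f \<in> lam_ideal G p \<mu>" for b f and \<mu> :: 'k
    using stb' that by blast
  let ?M = "\<lambda>\<mu> :: 'k. cm (rank1 (lam_ideal G p \<mu>))"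
  have p: "0 \<le> p" using G by auto
  have 1: "1 \<in> lam_ideal G p \<mu>" for \<mu> :: 'k using G p by (auto simp: lam_ideal_def)
  note bi = lam_ideal_bidual[OF as c stb]
  note st = rank1_stable[OF bi]
  have O: "lam_ideal G p \<mu> \<subseteq> supp_in {0..}" for \<mu> :: 'k
    by (auto simp: lam_ideal_def intro!: supp_inI leI)
  have "reflexive_module (semigroup_ring H) (?M \<mu>)" for \<mu>
    by (rule rank1_reflexive[OF lam_ideal_fin_gen[OF st p G(2)] 1 O bi])
  then have "\<exists>N\<in>\<S>. mod_isomorphic (semigroup_ring H) (?M \<mu>) N" for \<mu>
    using all rank1_indecomposable[OF st 1] by blast
  then obtain N where N: "\<And>\<mu>. N \<mu> \<in> \<S>" "\<And>\<mu>. mod_isomorphic (semigroup_ring H) (?M \<mu>) (N \<mu>)" by metis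
  have "inj N"
  proof (rule injI)
    fix \<mu> \<nu> :: 'k assume eq: "N \<mu> = N \<nu>"
    have "mod_isomorphic (semigroup_ring H) (N \<mu>) (?M \<nu>)"
      unfolding eq by (rule mod_isomorphic_sym[OF module_cm[OF st] N(2)])
    from mod_isomorphic_trans[OF module_cm[OF st] N(2) this] show "\<mu> = \<nu>"
      by (rule lam_ideal_iso[OF G])
  qed
  moreover have "finite (range N)" using N(1) by (intro finite_subset[OF _ fin]) auto
  ultimately have "finite (UNIV :: 'k set)" using finite_imageD by blast
  then show False using infinite_UNIV_char_0 by blast
qed

end

section \<open>Symmetric semigroups\<close>

context numsg
begin

section \<open>Injective modules\<close>

text \<open>Zorn's lemma gives a maximal graph of a linear map extending \<open>\<phi>\<close>. For
  any \<open>x\<close> the multipliers r with r x in its domain form an ideal \<open>J\<close>;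
  extending over \<open>J\<close> supplies a value \<open>e\<close> for \<open>x\<close>, so by
  maximality \<open>x\<close> was in the domain.\<close>

lemma baer_criterion:
  fixes E :: "'k::field lmodule"
  assumes E: "module (semigroup_ring H) E"
    and ext: "\<And>J g. J \<subseteq> S \<Longrightarrow> 0 \<in> J \<Longrightarrow> (\<And>x y. x \<in> J \<Longrightarrow> y \<in> J \<Longrightarrow> x + y \<in> J) \<Longrightarrow>
      (\<And>r x. r \<in> S \<Longrightarrow> x \<in> J \<Longrightarrow> r * x \<in> J) \<Longrightarrow>
      (\<And>x. x \<in> J \<Longrightarrow> g x \<in> carrier E) \<Longrightarrow>
      (\<And>x y. x \<in> J \<Longrightarrow> y \<in> J \<Longrightarrow> g (x + y) = g x \<oplus>\<^bsub>E\<^esub> g y) \<Longrightarrow>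
      (\<And>r x. r \<in> S \<Longrightarrow> x \<in> J \<Longrightarrow> g (r * x) = r \<odot>\<^bsub>E\<^esub> g x) \<Longrightarrow>
      \<exists>e\<in>carrier E. \<forall>r\<in>J. g r = r \<odot>\<^bsub>E\<^esub> e"
  shows "injective_module (semigroup_ring H) E"
  unfolding injective_module_def
proof (intro conjI allI impI ballI E)
  fix M :: "'k lmodule" and N \<phi>
  assume MN: "module (semigroup_ring H) M \<and> submodule N (semigroup_ring H) M"
    and \<phi>: "\<phi> \<in> mod_hom (semigroup_ring H) (M\<lparr>carrier := N\<rparr>) E"
  interpret M: module "semigroup_ring H" M using MN by blast
  interpret E: module "semigroup_ring H" E by (rule E)
  note N = M.submoduleE[OF conjunct2[OF MN], unfolded carrier_ring]
  have \<phi>E: "\<phi> x \<in> carrier E" if "x \<in> N" for x using \<phi> that by (auto simp: mod_hom_def)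
  have \<phi>add: "\<phi> (x \<oplus>\<^bsub>M\<^esub> y) = \<phi> x \<oplus>\<^bsub>E\<^esub> \<phi> y" if "x \<in> N" "y \<in> N" for x y
    using \<phi> that by (simp add: mod_hom_def)
  have \<phi>lin: "\<phi> (r \<odot>\<^bsub>M\<^esub> x) = r \<odot>\<^bsub>E\<^esub> \<phi> x" if "r \<in> S" "x \<in> N" for r x
    using \<phi> that by (simp add: mod_hom_def)
  define G0 where "G0 = {(x, \<phi> x) | x. x \<in> N}"
  define P where "P G \<longleftrightarrow> G0 \<subseteq> G \<and> G \<subseteq> carrier M \<times> carrier E \<and>
    (\<forall>x y x' y'. (x, y) \<in> G \<longrightarrow> (x', y') \<in> G \<longrightarrow> (x \<oplus>\<^bsub>M\<^esub> x', y \<oplus>\<^bsub>E\<^esub> y') \<in> G) \<and>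
    (\<forall>r\<in>S. \<forall>x y. (x, y) \<in> G \<longrightarrow> (r \<odot>\<^bsub>M\<^esub> x, r \<odot>\<^bsub>E\<^esub> y) \<in> G) \<and>
    (\<forall>x y y'. (x, y) \<in> G \<longrightarrow> (x, y') \<in> G \<longrightarrow> y = y')" for G
  have P0: "P G0"
    unfolding P_def G0_def using N(1,4,5) \<phi>E \<phi>add \<phi>lin by fastforce
  have "\<exists>G\<in>Collect P. \<forall>X\<in>Collect P. G \<subseteq> X \<longrightarrow> X = G"
  proof (rule subset_Zorn_nonempty)
    show "Collect P \<noteq> {}" using P0 by blast
    fix \<C> assume ne: "\<C> \<noteq> {}" and ch: "subset.chain (Collect P) \<C>"
    have PC: "P G" if "G \<in> \<C>" for G using ch that by (auto simp: subset.chain_def)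
    have two: "\<exists>G\<in>\<C>. p \<in> G \<and> q \<in> G" if pq: "p \<in> \<Union>\<C>" "q \<in> \<Union>\<C>" for p q
    proof -
      obtain A B where AB: "A \<in> \<C>" "p \<in> A" "B \<in> \<C>" "q \<in> B" using pq by blast
      then have "A \<subseteq> B \<or> B \<subseteq> A" using ch unfolding subset.chain_def by blast
      then show ?thesis using AB by blast
    qed
    show "\<Union>\<C> \<in> Collect P"
      unfolding mem_Collect_eq P_def
    proof (intro conjI allI impI ballI)
      show "G0 \<subseteq> \<Union>\<C>" using ne PC unfolding P_def by blast
      show "\<Union>\<C> \<subseteq> carrier M \<times> carrier E" using PC unfolding P_def by blast
    next
      fix x y x' y' assume "(x, y) \<in> \<Union>\<C>" "(x', y') \<in> \<Union>\<C>"
      from two[OF this] obtain G where G: "G \<in> \<C>" "(x, y) \<in> G" "(x', y') \<in> G" by blast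
      then have "(x \<oplus>\<^bsub>M\<^esub> x', y \<oplus>\<^bsub>E\<^esub> y') \<in> G" using PC[OF G(1)] unfolding P_def by metis
      then show "(x \<oplus>\<^bsub>M\<^esub> x', y \<oplus>\<^bsub>E\<^esub> y') \<in> \<Union>\<C>" using G(1) by blast
    next
      fix r :: "'k fls" and x y assume "r \<in> S" "(x, y) \<in> \<Union>\<C>"
      then show "(r \<odot>\<^bsub>M\<^esub> x, r \<odot>\<^bsub>E\<^esub> y) \<in> \<Union>\<C>" using PC unfolding P_def by (meson UnionE UnionI)
    next
      fix x y y' assume "(x, y) \<in> \<Union>\<C>" "(x, y') \<in> \<Union>\<C>"
      from two[OF this] obtain G where G: "G \<in> \<C>" "(x, y) \<in> G" "(x, y') \<in> G" by blast
      then show "y = y'" using PC[OF G(1)] unfolding P_def by metis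
    qed
  qed
  then obtain G where PG: "P G" and max: "\<And>X. P X \<Longrightarrow> G \<subseteq> X \<Longrightarrow> X = G" by blast
  have GM: "x \<in> carrier M" "y \<in> carrier E" if "(x, y) \<in> G" for x y using PG that unfolding P_def by auto
  have Gadd: "(x \<oplus>\<^bsub>M\<^esub> x', y \<oplus>\<^bsub>E\<^esub> y') \<in> G" if "(x, y) \<in> G" "(x', y') \<in> G" for x y x' y'
    using PG that unfolding P_def by metis
  have Glin: "(r \<odot>\<^bsub>M\<^esub> x, r \<odot>\<^bsub>E\<^esub> y) \<in> G" if "r \<in> S" "(x, y) \<in> G" for r x y
    using PG that unfolding P_def by metis
  have Gfun: "y = y'" if "(x, y) \<in> G" "(x, y') \<in> G" for x y y'
    using PG that unfolding P_def by metis
  have GN: "(x, \<phi> x) \<in> G" if "x \<in> N" for x using PG that unfolding P_def G0_def by blast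
  have G00: "(\<zero>\<^bsub>M\<^esub>, \<zero>\<^bsub>E\<^esub>) \<in> G"
  proof -
    obtain x where "x \<in> N" using N(2) by blast
    then show ?thesis
      using Glin[OF S_closed(1) GN] GM[OF GN] M.smult_l_null E.smult_l_null unfolding ring_simps by metis
  qed
  have total: "\<exists>y. (x, y) \<in> G" if x: "x \<in> carrier M" for x
  proof -
    define J where "J = {r \<in> S. \<exists>y. (r \<odot>\<^bsub>M\<^esub> x, y) \<in> G}"
    define g where "g r = (THE y. (r \<odot>\<^bsub>M\<^esub> x, y) \<in> G)" for r
    have gI: "g r = y" if "(r \<odot>\<^bsub>M\<^esub> x, y) \<in> G" for r y
      unfolding g_def
      by (rule the_equality, rule that, erule Gfun, rule that)
    have g: "(r \<odot>\<^bsub>M\<^esub> x, g r) \<in> G" if "r \<in> J" for r using that gI by (auto simp: J_def)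
    have JS: "r \<in> S" if "r \<in> J" for r using that by (simp add: J_def)
    have JI: "r \<in> J \<and> g r = y" if "r \<in> S" "(r \<odot>\<^bsub>M\<^esub> x, y) \<in> G" for r y
      using that gI by (auto simp: J_def)
    have Jadd: "r + s \<in> J \<and> g (r + s) = g r \<oplus>\<^bsub>E\<^esub> g s" if "r \<in> J" "s \<in> J" for r s
    proof (rule JI)
      show "r + s \<in> S" using JS[OF that(1)] JS[OF that(2)] by simp
      have "(r + s) \<odot>\<^bsub>M\<^esub> x = r \<odot>\<^bsub>M\<^esub> x \<oplus>\<^bsub>M\<^esub> s \<odot>\<^bsub>M\<^esub> x"
        using M.smult_l_distr[of r s x] JS[OF that(1)] JS[OF that(2)] x by simp
      then show "((r + s) \<odot>\<^bsub>M\<^esub> x, g r \<oplus>\<^bsub>E\<^esub> g s) \<in> G" using Gadd[OF g[OF that(1)] g[OF that(2)]] by simp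
    qed
    have Jlin: "r * s \<in> J \<and> g (r * s) = r \<odot>\<^bsub>E\<^esub> g s" if "r \<in> S" "s \<in> J" for r s
    proof (rule JI)
      show "r * s \<in> S" using that(1) JS[OF that(2)] by simp
      have "(r * s) \<odot>\<^bsub>M\<^esub> x = r \<odot>\<^bsub>M\<^esub> (s \<odot>\<^bsub>M\<^esub> x)"
        using M.smult_assoc1[of r s x] that(1) JS[OF that(2)] x by simp
      then show "((r * s) \<odot>\<^bsub>M\<^esub> x, r \<odot>\<^bsub>E\<^esub> g s) \<in> G" using Glin[OF that(1) g[OF that(2)]] by simp
    qed
    have "0 \<odot>\<^bsub>M\<^esub> x = \<zero>\<^bsub>M\<^esub>" using M.smult_l_null[OF x] by simp
    then have "0 \<in> J" using JI[OF S_closed(1), of "\<zero>\<^bsub>E\<^esub>"] G00 by simp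
    then have "\<exists>e\<in>carrier E. \<forall>r\<in>J. g r = r \<odot>\<^bsub>E\<^esub> e"
      by (intro ext) (use JS Jadd Jlin GM(2)[OF g] in blast)+
    then obtain e where e: "e \<in> carrier E" "\<And>r. r \<in> J \<Longrightarrow> g r = r \<odot>\<^bsub>E\<^esub> e" by blast
    \<comment> \<open>The graph generated by \<open>G\<close> and the pair (x, e); it is single
      valued because \<open>e\<close> has the prescribed multiples for all multipliers in
      \<open>J\<close>.\<close>
    define G' where "G' = {(u \<oplus>\<^bsub>M\<^esub> r \<odot>\<^bsub>M\<^esub> x, y \<oplus>\<^bsub>E\<^esub> r \<odot>\<^bsub>E\<^esub> e) | u y r. (u, y) \<in> G \<and> r \<in> S}"
    have G'I: "(u \<oplus>\<^bsub>M\<^esub> r \<odot>\<^bsub>M\<^esub> x, y \<oplus>\<^bsub>E\<^esub> r \<odot>\<^bsub>E\<^esub> e) \<in> G'" if "(u, y) \<in> G" "r \<in> S" for u y r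
      using that unfolding G'_def by blast
    have rx: "r \<odot>\<^bsub>M\<^esub> x \<in> carrier M" "r \<odot>\<^bsub>E\<^esub> e \<in> carrier E" if "r \<in> S" for r
      using that x e(1) by auto
    have GG': "G \<subseteq> G'"
    proof clarify
      fix u y assume uy: "(u, y) \<in> G"
      have "0 \<odot>\<^bsub>M\<^esub> x = \<zero>\<^bsub>M\<^esub>" "0 \<odot>\<^bsub>E\<^esub> e = \<zero>\<^bsub>E\<^esub>"
        using M.smult_l_null[OF x] E.smult_l_null[OF e(1)] by simp_all
      then show "(u, y) \<in> G'" using G'I[OF uy S_closed(1)] GM[OF uy] by simp
    qed
    have "P G'"
      unfolding P_def
    proof (intro conjI allI impI ballI)
      show "G0 \<subseteq> G'" using GG' PG unfolding P_def by blast
      show "G' \<subseteq> carrier M \<times> carrier E"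
        unfolding G'_def using GM rx by blast
    next
      fix a b a' b' assume "(a, b) \<in> G'" "(a', b') \<in> G'"
      then obtain u y r u' y' r' where 1: "(u, y) \<in> G" "r \<in> S" "a = u \<oplus>\<^bsub>M\<^esub> r \<odot>\<^bsub>M\<^esub> x" "b = y \<oplus>\<^bsub>E\<^esub> r \<odot>\<^bsub>E\<^esub> e"
        and 2: "(u', y') \<in> G" "r' \<in> S" "a' = u' \<oplus>\<^bsub>M\<^esub> r' \<odot>\<^bsub>M\<^esub> x" "b' = y' \<oplus>\<^bsub>E\<^esub> r' \<odot>\<^bsub>E\<^esub> e"
        unfolding G'_def by blast
      have "(r + r') \<odot>\<^bsub>M\<^esub> x = r \<odot>\<^bsub>M\<^esub> x \<oplus>\<^bsub>M\<^esub> r' \<odot>\<^bsub>M\<^esub> x" "(r + r') \<odot>\<^bsub>E\<^esub> e = r \<odot>\<^bsub>E\<^esub> e \<oplus>\<^bsub>E\<^esub> r' \<odot>\<^bsub>E\<^esub> e"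
        using M.smult_l_distr[of r r' x] E.smult_l_distr[of r r' e] 1(2) 2(2) x e(1) by simp_all
      then have "a \<oplus>\<^bsub>M\<^esub> a' = (u \<oplus>\<^bsub>M\<^esub> u') \<oplus>\<^bsub>M\<^esub> (r + r') \<odot>\<^bsub>M\<^esub> x" "b \<oplus>\<^bsub>E\<^esub> b' = (y \<oplus>\<^bsub>E\<^esub> y') \<oplus>\<^bsub>E\<^esub> (r + r') \<odot>\<^bsub>E\<^esub> e"
        unfolding 1(3,4) 2(3,4) using GM[OF 1(1)] GM[OF 2(1)] rx[OF 1(2)] rx[OF 2(2)]
        by (simp_all add: M.M.a_ac E.M.a_ac)
      then show "(a \<oplus>\<^bsub>M\<^esub> a', b \<oplus>\<^bsub>E\<^esub> b') \<in> G'" using G'I[OF Gadd[OF 1(1) 2(1)] S_closed(3)[OF 1(2) 2(2)]] by simp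
    next
      fix s :: "'k fls" and a b assume s: "s \<in> S" and "(a, b) \<in> G'"
      then obtain u y r where 1: "(u, y) \<in> G" "r \<in> S" "a = u \<oplus>\<^bsub>M\<^esub> r \<odot>\<^bsub>M\<^esub> x" "b = y \<oplus>\<^bsub>E\<^esub> r \<odot>\<^bsub>E\<^esub> e"
        unfolding G'_def by blast
      have "s \<odot>\<^bsub>M\<^esub> a = s \<odot>\<^bsub>M\<^esub> u \<oplus>\<^bsub>M\<^esub> (s * r) \<odot>\<^bsub>M\<^esub> x" "s \<odot>\<^bsub>E\<^esub> b = s \<odot>\<^bsub>E\<^esub> y \<oplus>\<^bsub>E\<^esub> (s * r) \<odot>\<^bsub>E\<^esub> e"
        unfolding 1(3,4)
        using M.smult_r_distr[of s u "r \<odot>\<^bsub>M\<^esub> x"] E.smult_r_distr[of s y "r \<odot>\<^bsub>E\<^esub> e"]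
          M.smult_assoc1[of s r x] E.smult_assoc1[of s r e] s 1(2) GM[OF 1(1)] rx[OF 1(2)] x e(1) by simp_all
      then show "(s \<odot>\<^bsub>M\<^esub> a, s \<odot>\<^bsub>E\<^esub> b) \<in> G'" using G'I[OF Glin[OF s 1(1)] S_mult[OF s 1(2)]] by simp
    next
      fix a b b' assume "(a, b) \<in> G'" "(a, b') \<in> G'"
      then obtain u y r u' y' r' where 1: "(u, y) \<in> G" "r \<in> S" "a = u \<oplus>\<^bsub>M\<^esub> r \<odot>\<^bsub>M\<^esub> x" "b = y \<oplus>\<^bsub>E\<^esub> r \<odot>\<^bsub>E\<^esub> e"
        and 2: "(u', y') \<in> G" "r' \<in> S" "a = u' \<oplus>\<^bsub>M\<^esub> r' \<odot>\<^bsub>M\<^esub> x" "b' = y' \<oplus>\<^bsub>E\<^esub> r' \<odot>\<^bsub>E\<^esub> e"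
        unfolding G'_def by blast
      define s where "s = r - r'"
      have s: "s \<in> S" "r = s + r'" using 1(2) 2(2) by (auto simp: s_def)
      have rM: "r \<odot>\<^bsub>M\<^esub> x = s \<odot>\<^bsub>M\<^esub> x \<oplus>\<^bsub>M\<^esub> r' \<odot>\<^bsub>M\<^esub> x" and rE: "r \<odot>\<^bsub>E\<^esub> e = s \<odot>\<^bsub>E\<^esub> e \<oplus>\<^bsub>E\<^esub> r' \<odot>\<^bsub>E\<^esub> e"
        using M.smult_l_distr[of s r' x] E.smult_l_distr[of s r' e] s 2(2) x e(1) by simp_all
      have "(u \<oplus>\<^bsub>M\<^esub> s \<odot>\<^bsub>M\<^esub> x) \<oplus>\<^bsub>M\<^esub> r' \<odot>\<^bsub>M\<^esub> x = u' \<oplus>\<^bsub>M\<^esub> r' \<odot>\<^bsub>M\<^esub> x"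
        using 1(3) 2(3) unfolding rM using GM[OF 1(1)] rx[OF s(1)] rx[OF 2(2)] by (simp add: M.M.a_assoc)
      then have uu: "u \<oplus>\<^bsub>M\<^esub> s \<odot>\<^bsub>M\<^esub> x = u'"
        using GM[OF 1(1)] GM[OF 2(1)] rx[OF s(1)] rx[OF 2(2)] by (simp add: M.M.add.right_cancel)
      have m1: "- 1 \<in> (S :: 'k fls set)" using S_closed(4)[OF S_closed(2)] .
      have nM: "(- 1) \<odot>\<^bsub>M\<^esub> w = \<ominus>\<^bsub>M\<^esub> w" if "w \<in> carrier M" for w
      proof -
        have "(- 1) \<odot>\<^bsub>M\<^esub> w \<oplus>\<^bsub>M\<^esub> w = (- 1 + 1) \<odot>\<^bsub>M\<^esub> w"
          using M.smult_l_distr[of "- 1" 1 w] m1 that M.smult_one[OF that] by simp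
        also have "\<dots> = \<zero>\<^bsub>M\<^esub>" using M.smult_l_null[OF that] by simp
        finally show ?thesis using M.M.minus_equality M.smult_closed[of "- 1" w] m1 that by simp
      qed
      have nE: "(- 1) \<odot>\<^bsub>E\<^esub> w = \<ominus>\<^bsub>E\<^esub> w" if "w \<in> carrier E" for w
      proof -
        have "(- 1) \<odot>\<^bsub>E\<^esub> w \<oplus>\<^bsub>E\<^esub> w = (- 1 + 1) \<odot>\<^bsub>E\<^esub> w"
          using E.smult_l_distr[of "- 1" 1 w] m1 that E.smult_one[OF that] by simp
        also have "\<dots> = \<zero>\<^bsub>E\<^esub>" using E.smult_l_null[OF that] by simp
        finally show ?thesis using E.M.minus_equality E.smult_closed[of "- 1" w] m1 that by simp
      qed
      have "(\<ominus>\<^bsub>M\<^esub> u \<oplus>\<^bsub>M\<^esub> u', \<ominus>\<^bsub>E\<^esub> y \<oplus>\<^bsub>E\<^esub> y') \<in> G"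
        using Gadd[OF Glin[OF m1 1(1)] 2(1)] nM[OF GM(1)[OF 1(1)]] nE[OF GM(2)[OF 1(1)]] by simp
      moreover have "\<ominus>\<^bsub>M\<^esub> u \<oplus>\<^bsub>M\<^esub> u' = s \<odot>\<^bsub>M\<^esub> x"
        unfolding uu[symmetric] using GM(1)[OF 1(1)] rx[OF s(1)] by (simp add: M.M.r_neg1)
      ultimately have "s \<in> J \<and> g s = \<ominus>\<^bsub>E\<^esub> y \<oplus>\<^bsub>E\<^esub> y'" using JI[OF s(1)] by simp
      then have "s \<odot>\<^bsub>E\<^esub> e = \<ominus>\<^bsub>E\<^esub> y \<oplus>\<^bsub>E\<^esub> y'" using e(2) by metis
      then have "y \<oplus>\<^bsub>E\<^esub> s \<odot>\<^bsub>E\<^esub> e = y'"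
        using GM(2)[OF 1(1)] GM(2)[OF 2(1)] by (simp add: E.M.r_neg2)
      then show "b = b'" unfolding 1(4) 2(4) rE
        using GM(2)[OF 1(1)] rx(2)[OF s(1)] rx(2)[OF 2(2)] by (simp add: E.M.a_assoc[symmetric])
    qed
    from max[OF this GG'] have eq: "G' = G" .
    have "1 \<odot>\<^bsub>M\<^esub> x = x" using M.smult_one[OF x] by simp
    then have "(x, \<zero>\<^bsub>E\<^esub> \<oplus>\<^bsub>E\<^esub> 1 \<odot>\<^bsub>E\<^esub> e) \<in> G" using G'I[OF G00 S_closed(2)] x unfolding eq by simp
    then show ?thesis by blast
  qed
  define \<psi> where "\<psi> = (\<lambda>x\<in>carrier M. THE y. (x, y) \<in> G)"
  have \<psi>I: "\<psi> x = y" if "(x, y) \<in> G" for x y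
  proof -
    have "(THE y. (x, y) \<in> G) = y" by (rule the_equality, rule that, erule Gfun, rule that)
    then show ?thesis using GM(1)[OF that] by (simp add: \<psi>_def)
  qed
  have \<psi>: "(x, \<psi> x) \<in> G" if "x \<in> carrier M" for x using total[OF that] \<psi>I by metis
  have "\<psi> \<in> mod_hom (semigroup_ring H) M E"
    unfolding mod_hom_def
  proof (intro CollectI conjI ballI)
    show "\<psi> \<in> carrier M \<rightarrow>\<^sub>E carrier E"
      using GM(2)[OF \<psi>] by (intro PiE_I) (simp_all add: \<psi>_def)
    show "\<psi> (x \<oplus>\<^bsub>M\<^esub> y) = \<psi> x \<oplus>\<^bsub>E\<^esub> \<psi> y" if "x \<in> carrier M" "y \<in> carrier M" for x y
      by (rule \<psi>I[OF Gadd[OF \<psi>[OF that(1)] \<psi>[OF that(2)]]])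
    show "\<psi> (r \<odot>\<^bsub>M\<^esub> x) = r \<odot>\<^bsub>E\<^esub> \<psi> x" if "r \<in> carrier (semigroup_ring H)" "x \<in> carrier M" for r x
      by (rule \<psi>I[OF Glin[OF that(1)[unfolded carrier_ring] \<psi>[OF that(2)]]])
  qed
  moreover have "\<forall>x\<in>N. \<psi> x = \<phi> x" using \<psi>I[OF GN] by blast
  ultimately show "\<exists>\<psi>\<in>mod_hom (semigroup_ring H) M E. \<forall>x\<in>N. \<psi> x = \<phi> x" by blast
qed

section \<open>The module k((t))/R\<close>

text \<open>The part of \<open>f\<close> supported outside \<open>H\<close>, a canonical
  representative of \<open>f\<close> modulo R. It is a finite sum: the exponents are bounded below
  by the order of \<open>f\<close> and above by \<open>cnd\<close>.\<close>

definition gap :: "'k::field fls \<Rightarrow> 'k fls"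
  where "gap f = (\<Sum>i\<in>{fls_subdegree f..<int cnd} - int ` H. fls_const (f $$ i) * tp i)"

lemma gap_nth [simp]: "gap f $$ n = (if n \<in> int ` H then 0 else f $$ n)"
proof -
  have "gap f $$ n = (\<Sum>i\<in>{fls_subdegree f..<int cnd} - int ` H. if n = i then f $$ i else 0)"
    unfolding gap_def fls_nth_sum by (intro sum.cong) auto
  also have "\<dots> = (if n \<in> {fls_subdegree f..<int cnd} - int ` H then f $$ n else 0)"
    by (simp add: sum.delta)
  also have "\<dots> = (if n \<in> int ` H then 0 else f $$ n)"
  proof -
    have "n \<in> int ` H" if "n \<ge> int cnd"
      using that cnd[of "nat n"] by (intro image_eqI[of _ _ "nat n"]) auto
    then show ?thesis by (auto simp: not_le)
  qed
  finally show ?thesis .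
qed

lemma gap_eq_0: "gap f = 0 \<longleftrightarrow> f \<in> S"
  unfolding S_def supp_in_def by (auto simp: fls_eq_iff split: if_splits)

lemma gap_add: "gap (f + g) = gap f + gap g" and gap_diff: "gap (f - g) = gap f - gap g"
  and gap_gap: "gap (gap f) = gap f"
  by (simp_all add: fls_eq_iff)

lemma gap_mult: "r \<in> S \<Longrightarrow> gap (r * gap f) = gap (r * f)"
proof -
  assume r: "r \<in> S"
  have "gap (f - gap f) = 0" by (simp add: gap_diff gap_gap)
  then have "f - gap f \<in> S" unfolding gap_eq_0 .
  then have "gap (r * (f - gap f)) = 0" unfolding gap_eq_0 using r by simp
  then show ?thesis by (simp add: right_diff_distrib gap_diff)
qed

text \<open>The quotient k((t))/R with representatives as elements; the action multiplies and
  reduces by \<open>gap\<close>.\<close>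

definition gap_module :: "'k::field lmodule" where
  "gap_module = \<lparr>carrier = rank1 (range gap), mult = undefined, one = undefined, zero = 0, add = (+),
     smult = (\<lambda>r v. sm (gap (r * v 0)) (unit 0))\<rparr>"

lemma gap_module_simps [simp]:
  "carrier gap_module = rank1 (range gap)" "zero gap_module = 0" "add gap_module = (+)"
  "smult gap_module = (\<lambda>r v. sm (gap (r * v 0)) (unit 0))"
  by (simp_all add: gap_module_def)

lemma range_gap: "f \<in> range gap \<longleftrightarrow> gap f = f"
  by (metis gap_gap rangeE rangeI)

lemma rank1_gap_fixed: "v \<in> rank1 (range gap) \<Longrightarrow> sm (gap (v 0)) (unit 0) = v"
proof -
  assume v: "v \<in> rank1 (range gap)"
  then have "gap (v 0) = v 0" by (simp add: rank1_def range_gap)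
  then show ?thesis using rank1_unit[OF v] by simp
qed

lemma rank1_eqI: "v \<in> rank1 I \<Longrightarrow> w \<in> rank1 J \<Longrightarrow> v 0 = w 0 \<Longrightarrow> v = w"
  using rank1_unit by metis

lemma module_gap: "module (semigroup_ring H) (gap_module :: 'k::field lmodule)"
proof (rule moduleI)
  show "cring (semigroup_ring H :: 'k fls ring)" by (rule cring_R)
  have add: "v + w \<in> rank1 (range gap)" if "v \<in> rank1 (range gap)" "w \<in> rank1 (range gap)" for v w :: "nat \<Rightarrow> 'k fls"
    using that by (simp add: rank1_def range_gap gap_add)
  have sc: "sm (gap f) (unit 0) \<in> rank1 (range gap)" for f :: "'k fls"
    by (simp add: sm_unit_rank1)
  have u0: "unit 0 0 = 1" by (simp add: unit_def)
  show "abelian_group (gap_module :: 'k lmodule)"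
  proof (rule abelian_groupI)
    fix x :: "nat \<Rightarrow> 'k fls" assume x: "x \<in> carrier gap_module"
    have "gap (- (x 0)) = - gap (x 0)" by (simp add: fls_eq_iff)
    then have "- x \<in> rank1 (range gap)" using x by (simp add: rank1_def range_gap)
    then show "\<exists>y\<in>carrier gap_module. y \<oplus>\<^bsub>gap_module\<^esub> x = \<zero>\<^bsub>gap_module\<^esub>"
      by (intro bexI[of _ "- x"]) simp_all
  next
    show "(\<zero>\<^bsub>gap_module\<^esub> :: nat \<Rightarrow> 'k fls) \<in> carrier gap_module"
      using sc[of 0] by (simp add: rank1_def range_gap fls_eq_iff)
  qed (use add in \<open>simp_all add: add_ac\<close>)
  show "a \<odot>\<^bsub>gap_module\<^esub> x \<in> carrier gap_module" for a :: "'k fls" and x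
    unfolding gap_module_simps by (rule sc)
  show "\<one>\<^bsub>semigroup_ring H\<^esub> \<odot>\<^bsub>gap_module\<^esub> x = x" if "x \<in> carrier gap_module" for x :: "nat \<Rightarrow> 'k fls"
    using rank1_gap_fixed that by simp
  show "(a \<oplus>\<^bsub>semigroup_ring H\<^esub> b) \<odot>\<^bsub>gap_module\<^esub> x = a \<odot>\<^bsub>gap_module\<^esub> x \<oplus>\<^bsub>gap_module\<^esub> b \<odot>\<^bsub>gap_module\<^esub> x"
    for a b :: "'k fls" and x
    unfolding gap_module_simps ring_simps distrib_right gap_add sm_distrib ..
  show "(a \<otimes>\<^bsub>semigroup_ring H\<^esub> b) \<odot>\<^bsub>gap_module\<^esub> x = a \<odot>\<^bsub>gap_module\<^esub> (b \<odot>\<^bsub>gap_module\<^esub> x)"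
    if "a \<in> carrier (semigroup_ring H)" for a b :: "'k fls" and x
    using that gap_mult[of a "b * x 0"] by (simp add: u0 mult.assoc)
  show "a \<odot>\<^bsub>gap_module\<^esub> (x \<oplus>\<^bsub>gap_module\<^esub> y) = a \<odot>\<^bsub>gap_module\<^esub> x \<oplus>\<^bsub>gap_module\<^esub> a \<odot>\<^bsub>gap_module\<^esub> y"
    for a :: "'k fls" and x y
    unfolding gap_module_simps plus_fun_apply distrib_left gap_add sm_distrib ..
qed

text \<open>Linearity on an ideal gives a g(r) = r g(a), so \<open>g\<close> is multiplication by
  g(a)/a for any nonzero \<open>a\<close> in it.\<close>

lemma injective_field: "injective_module (semigroup_ring H) (cm (rank1 (UNIV :: 'k::field fls set)))"
proof (rule baer_criterion)
  have "stable S (rank1 (UNIV :: 'k fls set))" by (auto simp: stable_def rank1_def)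
  then show "module (semigroup_ring H) (cm (rank1 (UNIV :: 'k fls set)))" by (rule module_cm)
  fix J :: "'k fls set" and g
  assume J: "J \<subseteq> S" and 0: "0 \<in> J" and g: "\<And>x. x \<in> J \<Longrightarrow> g x \<in> carrier (cm (rank1 UNIV))"
    and lin: "\<And>r x. r \<in> S \<Longrightarrow> x \<in> J \<Longrightarrow> g (r * x) = r \<odot>\<^bsub>cm (rank1 UNIV)\<^esub> g x"
  have g0: "g 0 = 0" using lin[OF S_closed(1) 0] by simp
  show "\<exists>e\<in>carrier (cm (rank1 UNIV)). \<forall>r\<in>J. g r = r \<odot>\<^bsub>cm (rank1 UNIV)\<^esub> e"
  proof (cases "\<exists>a\<in>J. a \<noteq> 0")
    case True
    then obtain a where a: "a \<in> J" "a \<noteq> 0" by blast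
    have eq: "g r = sm r (sm (inverse a) (g a))" if r: "r \<in> J" for r
    proof -
      have "sm a (g r) = g (a * r)" using lin[of a r] a(1) r J by auto
      also have "\<dots> = sm r (g a)" using lin[of r a] a(1) r J by (auto simp: mult.commute)
      finally have "sm (inverse a) (sm a (g r)) = sm (inverse a) (sm r (g a))" by simp
      then show ?thesis unfolding sm_simps left_inverse[OF a(2)] by (simp add: mult.commute)
    qed
    have "sm (inverse a) (g a) \<in> rank1 UNIV" using g[OF a(1)] by (simp add: rank1_def)
    then show ?thesis using eq by (intro bexI[of _ "sm (inverse a) (g a)"]) simp_all
  next
    case False
    then have "g r = sm r 0" if "r \<in> J" for r using that g0 by auto
    then show ?thesis by (intro bexI[of _ 0]) (simp_all add: rank1_def)
  qed
qed

text \<open>If \<open>H\<close> is symmetric, an element \<open>f\<close> of \<open>k((t))/R\<close> is determined by the functional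
  \<open>r \<mapsto> (r * f) $$ (cnd - 1)\<close> on \<open>R\<close>.\<close>

lemma injective_gap:
  assumes sym: "\<And>i. i \<in> int ` H \<longleftrightarrow> int cnd - 1 - i \<notin> int ` H"
  shows "injective_module (semigroup_ring H) (gap_module :: 'k::field lmodule)"
proof (rule baer_criterion[OF module_gap])
  fix J :: "'k fls set" and g
  assume J: "J \<subseteq> S" and 0: "0 \<in> J" and Jadd: "\<And>x y. x \<in> J \<Longrightarrow> y \<in> J \<Longrightarrow> x + y \<in> J"
    and Jm: "\<And>r x. r \<in> S \<Longrightarrow> x \<in> J \<Longrightarrow> r * x \<in> J"
    and gC: "\<And>x. x \<in> J \<Longrightarrow> g x \<in> carrier gap_module"
    and gadd: "\<And>x y. x \<in> J \<Longrightarrow> y \<in> J \<Longrightarrow> g (x + y) = g x \<oplus>\<^bsub>gap_module\<^esub> g y"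
    and glin: "\<And>r x. r \<in> S \<Longrightarrow> x \<in> J \<Longrightarrow> g (r * x) = r \<odot>\<^bsub>gap_module\<^esub> g x"
  define F where "F = int cnd - 1"
  define h where "h x = g x 0" for x
  have hgap: "gap (h x) = h x" if "x \<in> J" for x using gC[OF that] by (simp add: h_def rank1_def range_gap)
  have hadd: "h (x + y) = h x + h y" if "x \<in> J" "y \<in> J" for x y using gadd[OF that] by (simp add: h_def)
  have hlin: "h (r * x) = gap (r * h x)" if "r \<in> S" "x \<in> J" for r x
    using glin[OF that] by (simp add: h_def unit_def)
  have F: "F \<notin> int ` H" using sym[of 0] H0 unfolding F_def by (metis diff_zero image_eqI of_nat_0)
  have main: "\<exists>q. \<forall>r\<in>J. h r = gap (r * q)"
  proof (cases "\<exists>a\<in>J. a \<noteq> 0")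
    case True
    then obtain a where a: "a \<in> J" "a \<noteq> 0" by blast
    obtain m1 where m1: "tp (int m1) * inverse a \<in> tail cnd" using exists_tail[of "inverse a" cnd] by (elim exE)
    obtain m2 where m2: "tp (int m2) * h (tp (int m1)) \<in> tail cnd" using exists_tail[of "h (tp (int m1))" cnd] by (elim exE)
    have tJ: "f \<in> J" if f: "f \<in> tail m1" for f
    proof -
      obtain f' where f': "f' \<in> supp_in {0..}" "f = tp (int m1) * f'" using f tail_shift by blast
      have "tp (int m1) * inverse a * f' \<in> tail cnd" by (rule supp_in_mult[OF m1 f'(1)]) auto
      from Jm[OF tail_S[OF this] a(1)] have "tp (int m1) * inverse a * f' * a \<in> J" .
      moreover have "tp (int m1) * inverse a * f' * a = f * (inverse a * a)" unfolding f'(2) by (simp only: mult_ac)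
      ultimately show ?thesis using a(2) by simp
    qed
    define m where "m = m1 + m2 + cnd"
    \<comment> \<open>A nonzero ideal contains all series of high order, and those of still higher
      order are sent to 0; so the functional below depends on finitely many coefficients.\<close>
    have van: "f \<in> J \<and> h f = 0" if f: "f \<in> tail m" for f
    proof
      show "f \<in> J" by (rule tJ, rule supp_in_mono[OF f]) (auto simp: m_def)
      define f' where "f' = tp (- int m1) * f"
      have f': "f = f' * tp (int m1)" by (simp add: f'_def mult_ac tp_mult mult.assoc[symmetric] tp_0)
      have "f' \<in> tail cnd" using f by (auto simp: f'_def m_def supp_in_def)
      then have S: "f' \<in> S" by (rule tail_S)
      define f'' where "f'' = tp (- int m2) * f'"
      have f'': "f' = f'' * tp (int m2)" by (simp add: f''_def mult_ac tp_mult mult.assoc[symmetric] tp_0)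
      have "f'' \<in> supp_in {0..}" using f by (auto simp: f''_def f'_def m_def supp_in_def)
      then have "f'' * (tp (int m2) * h (tp (int m1))) \<in> tail cnd" by (rule supp_in_mult[OF _ m2]) auto
      then have "f' * h (tp (int m1)) \<in> S" unfolding f'' mult.assoc by (rule tail_S)
      then have "gap (f' * h (tp (int m1))) = 0" unfolding gap_eq_0 .
      moreover have "tp (int m1) \<in> J" by (rule tJ) auto
      ultimately show "h f = 0" using hlin[OF S, of "tp (int m1)"] f' by simp
    qed
    define G where "G v c \<longleftrightarrow> v \<in> J \<and> c = h v $$ F" for v c
    have vs: "vector_space (\<lambda>c f. fls_const c * f :: 'k fls)"
      by unfold_locales (simp_all add: algebra_simps fls_plus_const[symmetric] fls_const_mult_const[symmetric] del: fls_const_mult_const)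
    have "linrel (\<lambda>c f. fls_const c * f) (*) G"
      unfolding linrel_def
    proof (intro conjI allI impI)
      show "G 0 0" using 0 hlin[OF S_closed(1) 0] by (simp add: G_def)
      show "G (x + x') (y + y')" if "G x y" "G x' y'" for x y x' y'
        using that Jadd hadd by (simp add: G_def)
      show "G (fls_const c * x) (c * y)" if "G x y" for c x y
        using that Jm[OF S_closed(6)] hlin[OF S_closed(6)] F by (simp add: G_def)
    qed
    from linear_selection[OF vs vector_space_mult this] obtain l
      where l: "Vector_Spaces.linear (\<lambda>c f. fls_const c * f) (*) l" and lG: "\<And>v w. G v w \<Longrightarrow> G v (l v)" by blast
    interpret l: Vector_Spaces.linear "\<lambda>c f. fls_const c * f" "(*)" l by fact
    have lh: "l r = h r $$ F" if "r \<in> J" for r using lG[of r "h r $$ F"] that by (simp add: G_def)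
    \<comment> \<open>Encodes the functional: the coefficient of q r at F is the sum of r_i l(t^i)
      over i < m.\<close>
    define q where "q = (\<Sum>i<m. fls_const (l (tp (int i))) * tp (F - int i))"
    have qF: "(q * r) $$ F = h r $$ F" if r: "r \<in> J" for r
    proof -
      define s where "s = (\<Sum>i<m. fls_const (r $$ int i) * tp (int i))"
      have s_nth: "s $$ n = (if n < int m then r $$ n else 0)" for n
      proof -
        have "s $$ n = (\<Sum>i<m. if i = nat n \<and> 0 \<le> n then r $$ n else 0)"
          unfolding s_def fls_nth_sum by (intro sum.cong) auto
        also have "\<dots> = (if n < int m \<and> 0 \<le> n then r $$ n else 0)" by (cases "0 \<le> n") (auto simp: sum.delta)
        also have "\<dots> = (if n < int m then r $$ n else 0)"
          using supp_inD[OF S_integral, of r n] r J by auto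
        finally show ?thesis .
      qed
      have "r - s \<in> tail m" by (rule supp_inI) (use s_nth in \<open>auto split: if_splits\<close>)
      then have t: "r - s \<in> J" "h (r - s) = 0" using van by auto
      have "l r = l (r - s) + l s" using l.add[of "r - s" s] by simp
      also have "l (r - s) = 0" using lh[OF t(1)] t(2) by simp
      also have "l s = (\<Sum>i<m. r $$ int i * l (tp (int i)))" unfolding s_def l.sum l.scale ..
      also have "\<dots> = (q * r) $$ F"
        unfolding q_def sum_distrib_right fls_nth_sum by (intro sum.cong) (simp_all add: mult.assoc mult.commute[of "r $$ _"])
      finally show ?thesis using lh[OF r] by simp
    qed
    have "h r $$ i = gap (r * q) $$ i" if r: "r \<in> J" for r i
    proof (cases "i \<in> int ` H")
      case True
      then show ?thesis using hgap[OF r] gap_nth by metis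
    next
      case False
      \<comment> \<open>By symmetry t^(F - i) is in R, and multiplication by it turns the
        coefficient at i into the one at F.\<close>
      then have "F - i \<in> int ` H" using sym[of i] unfolding F_def by blast
      then have tS: "tp (F - i) \<in> (S :: 'k fls set)" unfolding S_def by (rule supp_in_closed(8))
      have "h r $$ i = gap (tp (F - i) * h r) $$ F" using F by simp
      also have "\<dots> = h (tp (F - i) * r) $$ F" using hlin[OF tS r] by simp
      also have "\<dots> = (q * (tp (F - i) * r)) $$ F" using qF[OF Jm[OF tS r]] by simp
      also have "q * (tp (F - i) * r) = tp (F - i) * (r * q)" by (simp add: mult_ac)
      also have "\<dots> $$ F = gap (r * q) $$ i" using False by simp
      finally show ?thesis .
    qed
    then show ?thesis by (intro exI[of _ q] ballI fls_eqI)
  next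
    case False
    have "h 0 = gap 0" using hlin[OF S_closed(1) 0] by simp
    then have "h r = gap (r * 0)" if "r \<in> J" for r using that False by auto
    then show ?thesis by blast
  qed
  then obtain q where q: "\<And>r. r \<in> J \<Longrightarrow> h r = gap (r * q)" by blast
  show "\<exists>e\<in>carrier gap_module. \<forall>r\<in>J. g r = r \<odot>\<^bsub>gap_module\<^esub> e"
  proof (intro bexI ballI)
    show e: "sm (gap q) (unit 0) \<in> carrier gap_module" by (simp add: sm_unit_rank1)
    fix r assume r: "r \<in> J"
    have rS: "r \<in> S" using r J by blast
    show "g r = r \<odot>\<^bsub>gap_module\<^esub> (sm (gap q) (unit 0))"
    proof (rule rank1_eqI)
      show "g r \<in> rank1 (range gap)" using gC[OF r] by simp
      show "r \<odot>\<^bsub>gap_module\<^esub> (sm (gap q) (unit 0)) \<in> rank1 (range gap)"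
        by (simp add: sm_unit_rank1)
      show "g r 0 = (r \<odot>\<^bsub>gap_module\<^esub> (sm (gap q) (unit 0))) 0"
        using q[OF r] gap_mult[OF rS, of q] by (simp add: h_def unit_def)
    qed
  qed
qed

lemma injective_zero: "injective_module (semigroup_ring H) (cm {0 :: nat \<Rightarrow> 'k::field fls})"
proof (rule baer_criterion)
  show "module (semigroup_ring H) (cm {0 :: nat \<Rightarrow> 'k fls})" by (rule module_cm) (simp add: stable_def)
qed auto

text \<open>The inclusion of R in k((t)) and the projection onto k((t))/R form an injective
  resolution of length one.\<close>

theorem symmetric_gorenstein:
  assumes sym: "\<And>i. i \<in> int ` H \<longleftrightarrow> int cnd - 1 - i \<notin> int ` H"
  shows "gorenstein (semigroup_ring H :: 'k::field fls ring)"
proof -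
  define I :: "nat \<Rightarrow> 'k lmodule" where
    "I j = (if j = 0 then cm (rank1 UNIV) else if j = 1 then gap_module else cm {0})" for j
  define \<epsilon> :: "'k fls \<Rightarrow> nat \<Rightarrow> 'k fls" where "\<epsilon> = (\<lambda>f\<in>S. sm f (unit 0))"
  define d :: "nat \<Rightarrow> (nat \<Rightarrow> 'k fls) \<Rightarrow> nat \<Rightarrow> 'k fls" where
    "d j = (if j = 0 then (\<lambda>v\<in>rank1 UNIV. sm (gap (v 0)) (unit 0)) else (\<lambda>v\<in>carrier (I j). 0))" for j
  have u0: "unit 0 0 = (1 :: 'k fls)" by (simp add: unit_def)
  have I0: "I 0 = cm (rank1 UNIV)" and I1: "I (Suc 0) = gap_module" and I2: "I (Suc (Suc j)) = cm {0}" for j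
    by (simp_all add: I_def)
  have add0: "v + w \<in> rank1 UNIV" "sm r v \<in> rank1 UNIV"
    if "v \<in> rank1 (UNIV :: 'k fls set)" "w \<in> rank1 (UNIV :: 'k fls set)" for v w r
    using that by (simp_all add: rank1_def)
  have zg: "(0 :: nat \<Rightarrow> 'k fls) \<in> rank1 (range gap)" by (simp add: rank1_def range_gap fls_eq_iff)
  have "injective_module (semigroup_ring H) (I j)" for j
    unfolding I_def by (simp add: injective_field injective_gap[OF sym] injective_zero)
  moreover have "\<epsilon> \<in> mod_hom (semigroup_ring H) (regular_module (semigroup_ring H)) (I 0)"
    unfolding mod_hom_def \<epsilon>_def I0 using sm_unit_rank1[of _ UNIV]
    by (auto simp: sm_distrib simp del: sm_apply plus_fun_apply)
  moreover have "inj_on \<epsilon> (carrier (semigroup_ring H))"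
    unfolding \<epsilon>_def by (rule inj_onI) (use sm_unit_eq in auto)
  moreover have "d j \<in> mod_hom (semigroup_ring H) (I j) (I (Suc j))" for j
  proof -
    consider "j = 0" | "j = 1" | i where "j = Suc (Suc i)" by (metis One_nat_def not0_implies_Suc)
    then show ?thesis
    proof cases
      case 1
      show ?thesis unfolding 1 I0 I1 mod_hom_def
      proof (intro CollectI conjI ballI)
        show "d 0 \<in> carrier (cm (rank1 UNIV)) \<rightarrow>\<^sub>E carrier gap_module"
          unfolding d_def by (simp add: sm_unit_rank1)
        show "d 0 (x \<oplus>\<^bsub>cm (rank1 UNIV)\<^esub> y) = d 0 x \<oplus>\<^bsub>gap_module\<^esub> d 0 y"
          if "x \<in> carrier (cm (rank1 UNIV))" "y \<in> carrier (cm (rank1 UNIV))" for x y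
        proof -
          have "d 0 (x + y) = sm (gap ((x + y) 0)) (unit 0)" using that add0(1)[of x y] by (simp add: d_def)
          also have "\<dots> = sm (gap (x 0)) (unit 0) + sm (gap (y 0)) (unit 0)"
            unfolding plus_fun_apply gap_add sm_distrib ..
          also have "\<dots> = d 0 x + d 0 y" using that by (simp add: d_def)
          finally show ?thesis by simp
        qed
        show "d 0 (r \<odot>\<^bsub>cm (rank1 UNIV)\<^esub> x) = r \<odot>\<^bsub>gap_module\<^esub> d 0 x"
          if "r \<in> carrier (semigroup_ring H)" "x \<in> carrier (cm (rank1 UNIV))" for r x
        proof -
          have "d 0 (sm r x) = sm (gap (r * x 0)) (unit 0)" using that add0(2)[of x x r] by (simp add: d_def)
          moreover have "d 0 x 0 = gap (x 0)" using that by (simp add: d_def u0)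
          ultimately show ?thesis using that gap_mult[of r "x 0"] by simp
        qed
      qed
    next
      case 2
      then show ?thesis using module_gap zg unfolding mod_hom_def d_def I_def
        by (auto simp: rank1_def range_gap gap_add gap_gap unit_def)
    next
      case (3 i)
      then show ?thesis unfolding mod_hom_def d_def I_def by auto
    qed
  qed
  moreover have "{x \<in> carrier (I 0). d 0 x = \<zero>\<^bsub>I 1\<^esub>} = \<epsilon> ` carrier (semigroup_ring H)"
  proof -
    have "d 0 x = 0 \<longleftrightarrow> x 0 \<in> S" if "x \<in> rank1 UNIV" for x
    proof -
      have "unit 0 \<noteq> (0 :: nat \<Rightarrow> 'k fls)" using u0 by (metis zero_fun_apply zero_neq_one)
      then show ?thesis using that by (simp add: d_def sm_eq_0 gap_eq_0 del: zero_fun_apply)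
    qed
    moreover have "x \<in> rank1 UNIV \<and> x 0 \<in> S \<longleftrightarrow> (\<exists>f\<in>S. x = sm f (unit 0))" for x :: "nat \<Rightarrow> 'k fls"
      using rank1_unit[of x UNIV] sm_unit_rank1[of _ UNIV] u0 by (auto simp del: sm_apply) (simp add: u0)
    ultimately show ?thesis unfolding I0 One_nat_def I1 \<epsilon>_def by (auto simp: image_iff simp del: sm_apply)
  qed
  moreover have "{x \<in> carrier (I (Suc j)). d (Suc j) x = \<zero>\<^bsub>I (Suc (Suc j))\<^esub>} = d j ` carrier (I j)" for j
  proof -
    have "{x \<in> carrier (I (Suc j)). d (Suc j) x = \<zero>\<^bsub>I (Suc (Suc j))\<^esub>} = carrier (I (Suc j))"
      unfolding I2 by (auto simp: d_def)
    also have "\<dots> = d j ` carrier (I j)"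
    proof (cases j)
      case 0
      have "x \<in> d 0 ` rank1 UNIV" if x: "x \<in> rank1 (range gap)" for x :: "nat \<Rightarrow> 'k fls"
      proof (rule image_eqI)
        show "x \<in> rank1 UNIV" using x by (simp add: rank1_def)
        then show "x = d 0 x" using rank1_gap_fixed[OF x] by (simp add: d_def)
      qed
      moreover have "d 0 x \<in> rank1 (range gap)" if "x \<in> rank1 UNIV" for x
        using that by (simp add: d_def sm_unit_rank1)
      ultimately show ?thesis unfolding 0 I0 I1 by auto
    next
      case (Suc i)
      have "carrier (I (Suc i)) \<noteq> {}" using zg by (auto simp: I_def)
      then show ?thesis unfolding Suc I2 by (auto simp: d_def)
    qed
    finally show ?thesis .
  qed
  moreover have "carrier (I j) = {\<zero>\<^bsub>I j\<^esub>}" if "j > 1" for j using that by (simp add: I_def)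
  ultimately show ?thesis
    unfolding gorenstein_def by (intro exI[of _ I] exI[of _ \<epsilon>] exI[of _ d] conjI allI exI[of _ 1] impI)
qed

end

section \<open>Invariants of semigroup rings\<close>

lemma inj_tp: "inj (tp :: int \<Rightarrow> 'k::field fls)"
proof (rule injI)
  fix i j assume "tp i = (tp j :: 'k fls)"
  then have "(tp i :: 'k fls) $$ i = tp j $$ i" by simp
  then show "i = j" by (simp split: if_splits)
qed

definition proj :: "int set \<Rightarrow> 'k::field fls \<Rightarrow> 'k fls"
  where "proj D f = (\<Sum>i\<in>D. fls_const (f $$ i) * tp i)"

lemma tp_combination_nth:
  "finite D \<Longrightarrow> (\<Sum>i\<in>D. fls_const (c i) * tp i) $$ n = (if n \<in> D then c n else 0)"
proof -
  assume D: "finite D"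
  have "(\<Sum>i\<in>D. fls_const (c i) * tp i) $$ n = (\<Sum>i\<in>D. if n = i then c i else 0)"
    unfolding fls_nth_sum by (intro sum.cong) auto
  then show ?thesis using D by (simp add: sum.delta)
qed

lemma proj_nth: "finite D \<Longrightarrow> proj D f $$ n = (if n \<in> D then f $$ n else 0)"
  unfolding proj_def by (rule tp_combination_nth)

lemma sum_tp_image:
  "(\<Sum>b\<in>tp ` D. fls_const (c b) * b) = (\<Sum>i\<in>D. fls_const (c (tp i)) * tp i)"
  by (rule sum.reindex_cong[OF inj_on_subset[OF inj_tp subset_UNIV]]) simp_all

lemma monomial_quotient_basis:
  assumes WV: "W \<subseteq> V" and fin: "finite (V - W)"
  shows "quotient_basis (supp_in V) (supp_in W) (tp ` (V - W) :: 'k::field fls set)"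
  unfolding quotient_basis_def
proof (intro conjI ballI)
  let ?D = "V - W" and ?B = "tp ` (V - W) :: 'k fls set"
  show "finite ?B" using fin by simp
  show "?B \<subseteq> supp_in V" by auto
  fix v :: "'k fls" assume v: "v \<in> supp_in V"
  have iff: "v - (\<Sum>b\<in>?B. fls_const (c b) * b) \<in> supp_in W \<longleftrightarrow> (\<forall>i\<in>?D. c (tp i) = v $$ i)" for c
  proof -
    have nth: "(v - (\<Sum>b\<in>?B. fls_const (c b) * b)) $$ n = v $$ n - (if n \<in> ?D then c (tp n) else 0)" for n
      unfolding sum_tp_image fls_minus_nth tp_combination_nth[OF fin] ..
    show ?thesis unfolding supp_in_def mem_Collect_eq nth using v WV by (auto simp: supp_in_def)
  qed
  show "\<exists>!c. c \<in> extensional ?B \<and> v - (\<Sum>b\<in>?B. fls_const (c b) * b) \<in> supp_in W"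
    unfolding iff
  proof (rule ex1I)
    show "restrict (\<lambda>b. v $$ (inv_into UNIV tp b)) ?B \<in> extensional ?B \<and>
        (\<forall>i\<in>?D. restrict (\<lambda>b. v $$ (inv_into UNIV tp b)) ?B (tp i) = v $$ i)"
      by (simp add: inv_f_f[OF inj_tp])
    fix c assume c: "c \<in> extensional ?B \<and> (\<forall>i\<in>?D. c (tp i) = v $$ i)"
    show "c = restrict (\<lambda>b. v $$ (inv_into UNIV tp b)) ?B"
      by (rule extensionalityI[of _ ?B]) (use c in \<open>auto simp: inv_f_f[OF inj_tp]\<close>)
  qed
qed

text \<open>The coordinates in V - W identify the quotient with a finite dimensional space in which
  the images of \<open>B\<close> and the monomials are two bases. This makes
  \<open>quotient_dim\<close> well defined.\<close>

lemma quotient_basis_card: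
  fixes B :: "'k::field fls set"
  assumes WV: "W \<subseteq> V" and fin: "finite (V - W)" and B: "quotient_basis (supp_in V) (supp_in W) B"
  shows "card B = card (V - W)"
proof -
  let ?D = "V - W" and ?p = "proj (V - W) :: 'k fls \<Rightarrow> 'k fls"
  interpret vector_space "\<lambda>c f. fls_const c * f :: 'k fls"
    by unfold_locales (simp_all add: algebra_simps fls_plus_const[symmetric] fls_const_mult_const[symmetric] del: fls_const_mult_const)
  have finB: "finite B" and BV: "B \<subseteq> supp_in V"
    and uni: "\<And>v. v \<in> supp_in V \<Longrightarrow> \<exists>!c. c \<in> extensional B \<and> v - (\<Sum>b\<in>B. fls_const (c b) * b) \<in> supp_in W"
    using B unfolding quotient_basis_def by blast+
  have p_sum: "?p (\<Sum>b\<in>B. fls_const (u b) * b) = (\<Sum>b\<in>B. fls_const (u b) * ?p b)" for u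
    proof (rule fls_eqI)
    fix n
    show "?p (\<Sum>b\<in>B. fls_const (u b) * b) $$ n = (\<Sum>b\<in>B. fls_const (u b) * ?p b) $$ n"
      by (cases "n \<in> ?D") (simp_all add: proj_nth[OF fin] fls_nth_sum del: Diff_iff)
  qed
  have p0: "f \<in> supp_in W" if "?p f = 0" "f \<in> supp_in V" for f
  proof (rule supp_inI, rule ccontr)
    fix i assume i: "f $$ i \<noteq> 0" "i \<notin> W"
    have "i \<in> V" using supp_inD[OF that(2)] i(1) by blast
    then have "?p f $$ i = f $$ i" using i(2) by (simp add: proj_nth[OF fin])
    then show False using that(1) i(1) by simp
  qed
  have ind0: "u b = 0" if s: "(\<Sum>b\<in>B. fls_const (u b) * ?p b) = 0" and b: "b \<in> B" for u b
  proof -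
    have "(\<Sum>b\<in>B. fls_const (u b) * b) \<in> supp_in V" using BV by (intro supp_in_sum supp_in_closed) auto
    then have W: "(\<Sum>b\<in>B. fls_const (u b) * b) \<in> supp_in W" by (rule p0[OF trans[OF p_sum s]])
    let ?Q = "\<lambda>c. c \<in> extensional B \<and> 0 - (\<Sum>b\<in>B. fls_const (c b) * b) \<in> supp_in W"
    have "(\<Sum>b\<in>B. fls_const (restrict u B b) * b) = (\<Sum>b\<in>B. fls_const (u b) * b)" by (intro sum.cong) auto
    then have Qu: "?Q (restrict u B)" using W by simp
    have "(\<Sum>b\<in>B. fls_const (restrict (\<lambda>_. 0) B b) * b) = (0 :: 'k fls)" by (intro sum.neutral) auto
    then have Q0: "?Q (restrict (\<lambda>_. 0) B)" by simp
    \<comment> \<open>Uniqueness of coefficients for the vector 0 makes every combination that lies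
      in \<open>supp_in W\<close> trivial.\<close>
    have "restrict u B = restrict (\<lambda>_. 0) B"
    proof (rule ex1E[OF uni[OF supp_in_closed(1)]])
      fix c assume c: "\<forall>c'. ?Q c' \<longrightarrow> c' = c"
      show ?thesis using c[rule_format, OF Qu] c[rule_format, OF Q0] by simp
    qed
    from fun_cong[OF this, of b] show "u b = 0" using b by simp
  qed
  have inj: "inj_on ?p B"
  proof (rule inj_onI, rule ccontr)
    fix b1 b2 assume b: "b1 \<in> B" "b2 \<in> B" "?p b1 = ?p b2" "b1 \<noteq> b2"
    let ?u = "\<lambda>b. (if b = b1 then 1 else 0) - (if b = b2 then 1 else (0 :: 'k))"
    have "(\<Sum>b\<in>B. fls_const (?u b) * ?p b) = (\<Sum>b\<in>B. (if b = b1 then ?p b else 0) - (if b = b2 then ?p b else 0))"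
      using b(4) by (intro sum.cong) auto
    also have "\<dots> = ?p b1 - ?p b2" using finB b(1,2) by (simp add: sum_subtractf sum.delta)
    finally have "(\<Sum>b\<in>B. fls_const (?u b) * ?p b) = 0" using b(3) by simp
    from ind0[OF this b(1)] show False using b(4) by simp
  qed
  have "independent (?p ` B)"
  proof (rule independent_if_scalars_zero)
    fix f x assume s: "(\<Sum>x\<in>?p ` B. fls_const (f x) * x) = 0" and x: "x \<in> ?p ` B"
    then obtain b where b: "b \<in> B" "x = ?p b" by blast
    have "(\<Sum>b\<in>B. fls_const (f (?p b)) * ?p b) = 0"
      using s unfolding sum.reindex[OF inj] comp_def .
    from ind0[OF this b(1)] show "f x = 0" using b(2) by simp
  qed (use finB in simp)
  moreover have "?p ` B \<subseteq> span (tp ` ?D)"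
    unfolding proj_def by (intro image_subsetI span_sum span_scale) (blast intro: span_base)
  ultimately have le: "card (?p ` B) \<le> card (tp ` ?D :: 'k fls set)"
    using independent_span_bound[of "tp ` ?D"] fin by blast
  have "independent (tp ` ?D :: 'k fls set)"
  proof (rule independent_if_scalars_zero)
    fix f :: "'k fls \<Rightarrow> 'k" and x :: "'k fls" assume s: "(\<Sum>x\<in>tp ` ?D. fls_const (f x) * x) = 0" and x: "x \<in> tp ` ?D"
    then obtain i where i: "i \<in> ?D" "x = tp i" by blast
    have "(\<Sum>x\<in>tp ` ?D. fls_const (f x) * x) $$ i = f (tp i)"
      unfolding sum_tp_image tp_combination_nth[OF fin] using i(1) by simp
    then show "f x = 0" using s i(2) by simp
  qed (use fin in simp)
  moreover have "tp ` ?D \<subseteq> span (?p ` B)"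
  proof
    fix x :: "'k fls" assume "x \<in> tp ` ?D"
    then obtain i where i: "i \<in> ?D" "x = tp i" by blast
    then have xV: "x \<in> supp_in V" by auto
    from uni[OF this] obtain c where c: "x - (\<Sum>b\<in>B. fls_const (c b) * b) \<in> supp_in W" by blast
    have "?p x = x" using i by (intro fls_eqI) (auto simp: proj_nth[OF fin])
    moreover have "?p x = ?p (\<Sum>b\<in>B. fls_const (c b) * b)"
    proof (rule fls_eqI)
      fix n
      have "(x - (\<Sum>b\<in>B. fls_const (c b) * b)) $$ n = 0" if "n \<in> ?D" using supp_inD[OF c] that by blast
      then show "?p x $$ n = ?p (\<Sum>b\<in>B. fls_const (c b) * b) $$ n" by (simp add: proj_nth[OF fin])
    qed
    ultimately have "x = (\<Sum>b\<in>B. fls_const (c b) * ?p b)" unfolding p_sum by simp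
    moreover have "(\<Sum>b\<in>B. fls_const (c b) * ?p b) \<in> span (?p ` B)"
      by (intro span_sum span_scale) (blast intro: span_base)
    ultimately show "x \<in> span (?p ` B)" by metis
  qed
  ultimately have "card (tp ` ?D :: 'k fls set) \<le> card (?p ` B)"
    using independent_span_bound[of "?p ` B"] finB by blast
  then have "card (?p ` B) = card (tp ` ?D :: 'k fls set)" using le by simp
  then show ?thesis
    using card_image[OF inj] card_image[OF inj_on_subset[OF inj_tp subset_UNIV], of ?D] by simp
qed

lemma quotient_dim_monomial:
  assumes "W \<subseteq> V" "finite (V - W)"
  shows "quotient_dim (supp_in V) (supp_in W :: 'k::field fls set) = card (V - W)"
  unfolding quotient_dim_def
proof (rule the_equality)
  have "card (tp ` (V - W) :: 'k fls set) = card (V - W)"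
    by (rule card_image[OF inj_on_subset[OF inj_tp subset_UNIV]])
  then show "\<exists>B. quotient_basis (supp_in V) (supp_in W :: 'k fls set) B \<and> card B = card (V - W)"
    using monomial_quotient_basis[OF assms] by blast
qed (use quotient_basis_card[OF assms] in blast)

section \<open>Lengths of monomial quotients\<close>

context numsg
begin

lemma module_laurent: "module (semigroup_ring H) (laurent_module :: ('k::field fls, 'k fls) module)"
proof (rule moduleI)
  show "cring (semigroup_ring H :: 'k fls ring)" by (rule cring_R)
  show "abelian_group (laurent_module :: ('k fls, 'k fls) module)"
  proof (rule abelian_groupI)
    fix x :: "'k fls"
    show "\<exists>y\<in>carrier laurent_module. y \<oplus>\<^bsub>laurent_module\<^esub> x = \<zero>\<^bsub>laurent_module\<^esub>"
      by (intro bexI[of _ "- x"]) (simp_all add: laurent_module_def regular_module_def fls_subring_def)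
  qed (simp_all add: laurent_module_def regular_module_def fls_subring_def add_ac)
qed (simp_all add: laurent_module_def regular_module_def fls_subring_def algebra_simps)

lemma laurent_simps:
  "carrier laurent_module = UNIV" "add laurent_module = (+)" "zero laurent_module = 0" "smult laurent_module = (*)"
  by (simp_all add: laurent_module_def regular_module_def fls_subring_def)

lemma submodule_laurentD:
  assumes "submodule L (semigroup_ring H) (laurent_module :: ('k::field fls, 'k fls) module)"
  shows "f \<in> L \<Longrightarrow> g \<in> L \<Longrightarrow> f + g \<in> L" "r \<in> S \<Longrightarrow> f \<in> L \<Longrightarrow> r * f \<in> L"
proof -
  interpret module "semigroup_ring H" "laurent_module :: ('k fls, 'k fls) module" by (rule module_laurent)
  note E = submoduleE[OF assms, unfolded laurent_simps carrier_ring]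
  show "f \<in> L \<Longrightarrow> g \<in> L \<Longrightarrow> f + g \<in> L" "r \<in> S \<Longrightarrow> f \<in> L \<Longrightarrow> r * f \<in> L"
    using E(4,5) by blast+
qed

lemma submodule_monomial:
  assumes "\<And>i h. i \<in> V \<Longrightarrow> h \<in> H \<Longrightarrow> i + int h \<in> V"
  shows "submodule (supp_in V) (semigroup_ring H) (laurent_module :: ('k::field fls, 'k fls) module)"
proof -
  interpret module "semigroup_ring H" "laurent_module :: ('k fls, 'k fls) module" by (rule module_laurent)
  show ?thesis
  proof (rule submoduleI; (unfold laurent_simps carrier_ring)?)
    fix a :: "'k fls" assume a: "a \<in> supp_in V"
    have "\<ominus>\<^bsub>laurent_module\<^esub> a = - a" by (intro M.minus_equality) (simp_all add: laurent_simps)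
    then show "\<ominus>\<^bsub>laurent_module\<^esub> a \<in> supp_in V" using a by simp
  next
    fix a x :: "'k fls" assume "a \<in> S" "x \<in> supp_in V"
    then show "a * x \<in> supp_in V"
      unfolding S_def by (rule supp_in_mult) (use assms in \<open>auto simp: add.commute\<close>)
  qed auto
qed

text \<open>Leading exponents of elements of \<open>L\<close>, where only exponents in
  \<open>D\<close> count.\<close>

definition lead :: "int set \<Rightarrow> 'k::field fls set \<Rightarrow> int set"
  where "lead D L = {i \<in> D. \<exists>f\<in>L. f $$ i \<noteq> 0 \<and> (\<forall>j\<in>D. j < i \<longrightarrow> f $$ j = 0)}"

text \<open>Among the elements of \<open>L'\<close> outside \<open>L\<close> take one whose leading
  exponent is largest. If an element of \<open>L\<close> had the same leading exponent, subtracting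
  a multiple of it would give an element outside \<open>L\<close> with a larger one.\<close>

lemma lead_strict:
  fixes L L' :: "'k::field fls set"
  assumes fin: "finite (V - W)"
    and L: "submodule L (semigroup_ring H) laurent_module" "supp_in W \<subseteq> L"
    and L': "submodule L' (semigroup_ring H) laurent_module" "L' \<subseteq> supp_in V" and LL': "L \<subset> L'"
  shows "lead (V - W) L \<subset> lead (V - W) L'"
proof -
  let ?D = "V - W"
  define K where "K = {i \<in> ?D. \<exists>f\<in>L' - L. f $$ i \<noteq> 0 \<and> (\<forall>j\<in>?D. j < i \<longrightarrow> f $$ j = 0)}"
  have least: "\<exists>i\<in>?D. (f $$ i \<noteq> 0 \<and> (\<forall>j\<in>?D. j < i \<longrightarrow> f $$ j = 0))" if f: "f \<in> L' - L" for f
  proof -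
    let ?N = "{i \<in> ?D. f $$ i \<noteq> 0}"
    have "?N \<noteq> {}"
    proof
      assume e: "?N = {}"
      have "f \<in> supp_in W"
      proof (rule supp_inI)
        fix i assume "f $$ i \<noteq> 0"
        moreover then have "i \<in> V" using f L'(2) supp_inD by blast
        ultimately show "i \<in> W" using e by blast
      qed
      then show False using f L(2) by blast
    qed
    moreover have "finite ?N" by (rule finite_subset[OF _ fin]) blast
    ultimately have m: "Min ?N \<in> ?N" and le: "\<And>j. j \<in> ?N \<Longrightarrow> Min ?N \<le> j" by (metis (no_types, lifting) Min_in, metis (no_types, lifting) Min_le)
    have "f $$ j = 0" if "j \<in> ?D" "j < Min ?N" for j using le[of j] that by force
    then show ?thesis using m by (intro bexI[of _ "Min ?N"]) blast+
  qed
  have finK: "finite K" unfolding K_def by (rule finite_subset[OF _ fin]) blast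
  obtain f0 where "f0 \<in> L' - L" using LL' by blast
  then have "K \<noteq> {}" using least unfolding K_def by blast
  define i where "i = Max K"
  have iK: "i \<in> K" unfolding i_def by (rule Max_in[OF finK \<open>K \<noteq> {}\<close>])
  have imax: "j \<le> i" if "j \<in> K" for j unfolding i_def by (rule Max_ge[OF finK that])
  obtain f where f: "f \<in> L' - L" "f $$ i \<noteq> 0" "\<forall>j\<in>?D. j < i \<longrightarrow> f $$ j = 0" and iD: "i \<in> ?D"
    using iK unfolding K_def by blast
  have "i \<notin> lead ?D L"
  proof
    assume "i \<in> lead ?D L"
    then obtain g where g: "g \<in> L" "g $$ i \<noteq> 0" "\<forall>j\<in>?D. j < i \<longrightarrow> g $$ j = 0" unfolding lead_def by blast
    define c where "c = f $$ i / g $$ i"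
    define f' where "f' = f + fls_const (- c) * g"
    have "f' \<in> L'" unfolding f'_def
      using submodule_laurentD[OF L'(1)] f(1) g(1) LL' S_closed(6) by blast
    moreover have "f' \<notin> L"
    proof
      assume "f' \<in> L"
      then have "f' + fls_const c * g \<in> L" using submodule_laurentD[OF L(1)] g(1) S_closed(6) by blast
      moreover have "f' + fls_const c * g = f" by (rule fls_eqI) (simp add: f'_def)
      ultimately show False using f(1) by simp
    qed
    ultimately have f': "f' \<in> L' - L" by blast
    from least[OF this] obtain j where j: "j \<in> ?D" "f' $$ j \<noteq> 0" "\<forall>l\<in>?D. l < j \<longrightarrow> f' $$ l = 0" by blast
    then have "j \<in> K" using f' unfolding K_def by blast
    then have "j \<le> i" by (rule imax)
    moreover have "f' $$ i = 0" using g(2) by (simp add: f'_def c_def)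
    ultimately have "j < i" using j(2) by (cases "j = i") auto
    then have "f' $$ j = 0" using f(3) g(3) j(1) by (simp add: f'_def)
    then show False using j(2) by simp
  qed
  moreover have "i \<in> lead ?D L'" using f iD unfolding lead_def by blast
  moreover have "lead ?D L \<subseteq> lead ?D L'" using LL' unfolding lead_def by blast
  ultimately show ?thesis by blast
qed

lemma quotient_length_monomial:
  assumes WV: "W \<subseteq> V" and fin: "finite (V - W)"
    and V: "\<And>i h. i \<in> V \<Longrightarrow> h \<in> H \<Longrightarrow> i + int h \<in> V"
    and W: "\<And>i h. i \<in> W \<Longrightarrow> h \<in> H \<Longrightarrow> i + int h \<in> W"
  shows "quotient_length (semigroup_ring H) (supp_in V) (supp_in W :: 'k::field fls set) = enat (card (V - W))"
  unfolding quotient_length_def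
proof (rule antisym)
  let ?C = "\<lambda>n L. (\<forall>i\<le>n. submodule (L i) (semigroup_ring H) laurent_module \<and> supp_in W \<subseteq> L i \<and> L i \<subseteq> (supp_in V :: 'k fls set)) \<and>
    (\<forall>i<n. L i \<subset> L (Suc i))"
  show "Sup {enat n | n. \<exists>L. ?C n L} \<le> enat (card (V - W))"
  proof (rule Sup_least)
    fix x assume "x \<in> {enat n | n. \<exists>L. ?C n L}"
    then obtain n L where x: "x = enat n" and L: "?C n L" by blast
    have "i \<le> card (lead (V - W) (L i))" if "i \<le> n" for i
      using that
    proof (induction i)
      case (Suc i)
      have "lead (V - W) (L i) \<subset> lead (V - W) (L (Suc i))"
        using L Suc.prems by (intro lead_strict[OF fin]) auto
      moreover have "finite (lead (V - W) (L (Suc i)))" unfolding lead_def by (rule finite_subset[OF _ fin]) blast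
      ultimately have "card (lead (V - W) (L i)) < card (lead (V - W) (L (Suc i)))" by (rule psubset_card_mono[rotated])
      then show ?case using Suc by simp
    qed simp
    then have "n \<le> card (lead (V - W) (L n))" by simp
    also have "\<dots> \<le> card (V - W)" by (rule card_mono[OF fin]) (auto simp: lead_def)
    finally show "x \<le> enat (card (V - W))" by (simp add: x)
  qed
  define n where "n = card (V - W)"
  define xs where "xs = sorted_list_of_set (V - W)"
  have xs: "set xs = V - W" "length xs = n" "distinct xs" "sorted xs"
    using fin by (simp_all add: xs_def n_def)
  \<comment> \<open>The chain adjoins exponents from the largest downwards: adding elements of
    \<open>H\<close> never lowers an exponent, so these sets are stable.\<close>
  define L :: "nat \<Rightarrow> 'k fls set" where "L i = supp_in (W \<union> set (drop (n - i) xs))" for i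
  have "?C n L"
  proof (intro conjI allI impI)
    fix i assume i: "i \<le> n"
    show "submodule (L i) (semigroup_ring H) laurent_module"
      unfolding L_def
    proof (rule submodule_monomial)
      fix j h assume j: "j \<in> W \<union> set (drop (n - i) xs)" and h: "h \<in> H"
      show "j + int h \<in> W \<union> set (drop (n - i) xs)"
      proof (cases "j \<in> W")
        case False
        then have jd: "j \<in> set (drop (n - i) xs)" using j by blast
        then have "j \<in> V" using set_drop_subset[of "n - i" xs] xs(1) by blast
        then have jh: "j + int h \<in> V" using V h by blast
        show ?thesis
        proof (cases "j + int h \<in> W")
          case False
          then have "j + int h \<in> set xs" using jh xs(1) by blast
          moreover have "j + int h \<in> set (drop (n - i) xs)" if "j + int h \<in> set (take (n - i) xs)"
          proof -
            have "j + int h \<le> j"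
            proof -
              have "\<forall>x\<in>set (take (n - i) xs). \<forall>y\<in>set (drop (n - i) xs). x \<le> y"
                using xs(4) sorted_append[of "take (n - i) xs" "drop (n - i) xs"] by simp
              then show ?thesis using that jd by blast
            qed
            then show ?thesis using jd by (simp add: order.antisym)
          qed
          ultimately show ?thesis by (metis UnCI Un_iff append_take_drop_id set_append)
        qed blast
      qed (use W h in blast)
    qed
    show "supp_in W \<subseteq> L i" unfolding L_def using supp_in_mono by blast
    show "L i \<subseteq> supp_in V"
      unfolding L_def using supp_in_mono WV set_drop_subset[of "n - i" xs] xs(1) by blast
  next
    fix i assume i: "i < n"
    define m where "m = n - Suc i"
    have m: "n - i = Suc m" "m < length xs" using i xs(2) by (auto simp: m_def)
    have d: "drop m xs = xs ! m # drop (Suc m) xs" using m(2) by (simp add: Cons_nth_drop_Suc)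
    have "L i \<subseteq> L (Suc i)"
      unfolding L_def m(1) m_def[symmetric] d using supp_in_mono by (metis Un_mono order_refl set_subset_Cons subsetI)
    moreover have "xs ! m \<notin> W \<union> set (drop (Suc m) xs)"
    proof -
      have "distinct (drop m xs)" using xs(3) by simp
      then have "xs ! m \<notin> set (drop (Suc m) xs)" unfolding d by simp
      then show ?thesis using nth_mem[OF m(2)] xs(1) by blast
    qed
    then have "tp (xs ! m) \<notin> L i" unfolding L_def m(1) by (auto simp: supp_in_def)
    moreover have "tp (xs ! m) \<in> L (Suc i)" unfolding L_def m_def[symmetric] d by auto
    ultimately show "L i \<subset> L (Suc i)" by blast
  qed
  then show "enat (card (V - W)) \<le> Sup {enat n | n. \<exists>L. ?C n L}"
    unfolding n_def by (intro Sup_upper) blast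
qed

end

lemma supp_in_colon:
  "(\<forall>f\<in>supp_in A. \<alpha> * f \<in> supp_in C) \<longleftrightarrow> (\<alpha> :: 'k::field fls) \<in> supp_in {i. \<forall>j\<in>A. i + j \<in> C}"
proof
  assume *: "\<forall>f\<in>supp_in A. \<alpha> * f \<in> supp_in C"
  show "\<alpha> \<in> supp_in {i. \<forall>j\<in>A. i + j \<in> C}"
  proof (rule supp_inI, safe)
    fix i j assume i: "\<alpha> $$ i \<noteq> 0" and j: "j \<in> A"
    have "\<alpha> * tp j \<in> supp_in C" using * supp_in_closed(8)[OF j] by blast
    moreover have "(\<alpha> * tp j) $$ (i + j) \<noteq> 0" using i by simp
    ultimately show "i + j \<in> C" using supp_inD by blast
  qed
next
  assume "\<alpha> \<in> supp_in {i. \<forall>j\<in>A. i + j \<in> C}"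
  then show "\<forall>f\<in>supp_in A. \<alpha> * f \<in> supp_in C" using supp_in_mult by blast
qed

lemma supp_in_Int: "f \<in> supp_in A \<and> f \<in> supp_in B \<longleftrightarrow> f \<in> supp_in (A \<inter> B)"
  by (auto simp: supp_in_def)

lemma power_series_eq: "(power_series :: 'k::field fls set) = supp_in {0..}"
proof safe
  fix f :: "'k fls" assume "f \<in> power_series"
  then show "f \<in> supp_in {0..}" by (auto simp: power_series_def supp_in_def split: if_splits)
next
  fix f :: "'k fls" assume f: "f \<in> supp_in {0..}"
  have "fls_subdegree f \<ge> 0" using f subdegree_supp[of f 0] by (cases "f = 0") auto
  then have "f = fps_to_fls (fls_regpart f)" by (simp add: fls_regpart_to_fls_trivial)
  then show "f \<in> power_series" unfolding power_series_def by blast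
qed

section \<open>Multiplicity, conductor, type and reduced type in terms of the semigroup\<close>

context numsg
begin

definition lowest :: nat where "lowest = (LEAST a. 0 < a \<and> a \<in> H)"

lemma lowest: "0 < lowest" "lowest \<in> H"
proof -
  have "0 < Suc cnd \<and> Suc cnd \<in> H" using cnd by simp
  then show "0 < lowest" "lowest \<in> H" unfolding lowest_def by (metis (mono_tags, lifting) LeastI)+
qed

lemma lowest_le: "a \<in> H \<Longrightarrow> 0 < a \<Longrightarrow> lowest \<le> a"
  unfolding lowest_def by (rule Least_le) simp

lemma multiplicity_ring_eq: "multiplicity_ring (semigroup_ring H :: 'k::field fls ring) = lowest"
  unfolding multiplicity_ring_def lowest_def tp_power carrier_ring tp_S ..

lemma Smax_eq: "Smax = (supp_in (int ` (H - {0})) :: 'k::field fls set)"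
proof -
  have "f $$ 0 = 0 \<and> f \<in> supp_in (int ` H) \<longleftrightarrow> f \<in> supp_in (int ` (H - {0}))" for f :: "'k fls"
  proof safe
    assume f: "f $$ 0 = 0" "f \<in> supp_in (int ` H)"
    show "f \<in> supp_in (int ` (H - {0}))"
    proof (rule supp_inI)
      fix i assume i: "f $$ i \<noteq> 0"
      then obtain h where "i = int h" "h \<in> H" using supp_inD[OF f(2), of i] by blast
      moreover from this have "h \<noteq> 0" using i f(1) by (metis of_nat_0)
      ultimately show "i \<in> int ` (H - {0})" by blast
    qed
  next
    assume f: "f \<in> supp_in (int ` (H - {0}))"
    have "0 \<notin> int ` (H - {0})" by auto
    then show "f $$ 0 = 0" by (rule supp_inD[OF f])
    show "f \<in> supp_in (int ` H)" by (rule supp_in_mono[OF f]) auto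
  qed
  then show ?thesis unfolding Smax_def S_def by blast
qed

lemma frac_of_eq: "frac_of (semigroup_ring H :: 'k::field fls ring) = UNIV"
proof safe
  fix f :: "'k fls"
  obtain N where "tp (int N) * f \<in> (S :: 'k fls set)" "tp (int N) \<in> (S :: 'k fls set)"
    using common_denominator[of f] by (elim exE conjE) (rule that)
  then show "f \<in> frac_of (semigroup_ring H)"
    unfolding frac_of_def carrier_ring
    by (intro CollectI exI[of _ "tp (int N) * f"] exI[of _ "tp (int N)"]) simp
qed simp

lemma conductor_eq: "conductor (semigroup_ring H :: 'k::field fls ring) = tail cnd"
proof -
  have "{i. \<forall>j\<in>{0..}. i + j \<in> int ` H} = {int cnd..}"
  proof safe
    fix i :: int assume i: "\<forall>j\<in>{0..}. i + j \<in> int ` H"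
    have "i + 0 \<in> int ` H" using bspec[OF i, of 0] by simp
    then have i0: "0 \<le> i" by auto
    have "n \<in> H" if "n \<ge> nat i" for n
    proof -
      have "i + (int n - i) \<in> int ` H" using bspec[OF i, of "int n - i"] that by simp
      then show ?thesis by auto
    qed
    then have "cnd \<le> nat i" by (rule cnd_least)
    then show "int cnd \<le> i" using i0 by simp
  next
    fix i j :: int assume "int cnd \<le> i" "0 \<le> j"
    then show "i + j \<in> int ` H" using cnd[of "nat (i + j)"] by (intro image_eqI[of _ _ "nat (i + j)"]) auto
  qed
  then show ?thesis
    unfolding conductor_def colon_def frac_of_eq carrier_ring power_series_eq S_def supp_in_colon by simp
qed

lemma endo_int: "{i. \<forall>j\<in>int ` (H - {0}). i + j \<in> int ` (H - {0})} = int ` endo"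
proof (intro equalityI subsetI, unfold mem_Collect_eq)
  fix i assume i: "\<forall>j\<in>int ` (H - {0}). i + j \<in> int ` (H - {0})"
  have ih: "\<exists>g. i + int h = int g \<and> g \<in> H \<and> 0 < g" if "h \<in> H" "0 < h" for h
  proof -
    have "i + int h \<in> int ` (H - {0})" using that by (intro bspec[OF i]) simp
    then obtain g where "i + int h = int g" "g \<in> H - {0}" by (rule imageE)
    then show ?thesis by (intro exI[of _ g]) simp
  qed
  obtain h where "i + int lowest = int h" "h \<in> H" "0 < h" using ih[OF lowest(2,1)] by (elim exE conjE)
  \<comment> \<open>Positive elements of \<open>H\<close> are at least \<open>lowest\<close>, so i +
    lowest cannot be smaller than \<open>lowest\<close>.\<close>
  then have i0: "0 \<le> i" using lowest_le[of h] by linarith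
  have "nat i + h \<in> H" if h: "h \<in> H" "0 < h" for h
  proof -
    obtain g where g: "i + int h = int g" "g \<in> H" using ih[OF h] by (elim exE conjE)
    have "nat i + h = g" using g(1) i0 by linarith
    then show ?thesis using g(2) by simp
  qed
  then have "nat i \<in> endo" by (simp add: endo_def)
  then show "i \<in> int ` endo" using i0 by (intro image_eqI[of _ _ "nat i"]) simp_all
next
  fix i assume "i \<in> int ` endo"
  then obtain b where "i = int b" "b \<in> endo" by (rule imageE)
  then show "\<forall>j\<in>int ` (H - {0}). i + j \<in> int ` (H - {0})"
    by (auto simp: endo_def simp flip: of_nat_add)
qed

lemma endo_ring_eq:
  "endo_ring_max_ideal (semigroup_ring H :: 'k::field fls ring) = semigroup_ring endo"
  unfolding endo_ring_max_ideal_def colon_def frac_of_eq max_ideal_eq Smax_eq supp_in_colon endo_int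
  by (simp add: semigroup_ring_def supp_in_def)

lemma H_endo: "h \<in> H \<Longrightarrow> h \<in> endo"
  using Hadd by (simp add: endo_def)

lemma numsg_endo: "numsg endo"
proof
  have "x + y \<in> endo" if x: "x \<in> endo" and y: "y \<in> endo" for x y
    unfolding endo_def
  proof (intro CollectI ballI impI)
    fix h assume h: "h \<in> H" "0 < h"
    then have "y + h \<in> H" "0 < y + h" using y by (auto simp: endo_def)
    then have "x + (y + h) \<in> H" using x by (simp add: endo_def)
    then show "x + y + h \<in> H" by (simp add: add.assoc)
  qed
  moreover have "finite (- endo)" using Hfin H_endo by (auto intro: finite_subset)
  ultimately show "numerical_semigroup endo" using H_endo[OF H0] by (simp add: numerical_semigroup_def)
qed

definition shifted :: "int set" where "shifted = (\<lambda>h. int (lowest + h)) ` H"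

lemma min_reduction_eq: "min_reduction (semigroup_ring H :: 'k::field fls ring) = supp_in shifted"
  unfolding min_reduction_def multiplicity_ring_eq tp_power carrier_ring
proof safe
  fix r :: "'k fls" assume "r \<in> S"
  then show "tp (int lowest) * r \<in> supp_in shifted"
    unfolding S_def by (rule supp_in_mult[of _ "{int lowest}", rotated]) (auto simp: shifted_def)
next
  fix f :: "'k fls" assume f: "f \<in> supp_in shifted"
  have "tp (- int lowest) * f \<in> S"
    unfolding S_def by (rule supp_in_mult[OF _ f, of _ "{- int lowest}"]) (auto simp: shifted_def)
  then show "f \<in> (*) (tp (int lowest)) ` S"
    by (intro image_eqI[of _ _ "tp (- int lowest) * f"]) (simp_all add: mult.assoc[symmetric] tp_mult tp_0)
qed

abbreviation pf :: "nat set" where "pf \<equiv> endo - H"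

lemma finite_pf: "finite pf"
  by (rule finite_subset[OF _ Hfin]) blast

lemma lowest_ge_2: "H \<noteq> UNIV \<Longrightarrow> 2 \<le> lowest"
proof (rule ccontr)
  assume "H \<noteq> UNIV" "\<not> 2 \<le> lowest"
  then have 1: "1 \<in> H" using lowest by (metis One_nat_def Suc_leI le_antisym not_less_eq_eq numeral_2_eq_2)
  have "n \<in> H" for n by (induction n) (use H0 Hadd[OF _ 1] in auto)
  then show False using \<open>H \<noteq> UNIV\<close> by blast
qed

lemma lowest_le_cnd: "H \<noteq> UNIV \<Longrightarrow> lowest \<le> cnd"
proof (rule ccontr)
  assume H: "H \<noteq> UNIV" "\<not> lowest \<le> cnd"
  then have "lowest - 1 \<in> H" using cnd[of "lowest - 1"] by simp
  then show False using lowest_le[of "lowest - 1"] lowest_ge_2[OF H(1)] by simp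
qed

text \<open>With e the multiplicity, a monomial of t^e R : m outside t^e R is t^(e + p) for a
  pseudo-Frobenius number p; the point to be settled is that the exponent 0 does not occur.\<close>

lemma CM_type_eq:
  assumes "H \<noteq> UNIV"
  shows "CM_type (semigroup_ring H :: 'k::field fls ring) = card pf"
proof -
  define V where "V = int ` H \<inter> {i. \<forall>j\<in>int ` (H - {0}). i + j \<in> shifted}"
  have "colon S (supp_in shifted) (supp_in (int ` (H - {0}))) = (supp_in V :: 'k fls set)"
    unfolding colon_def supp_in_colon V_def S_def using supp_in_Int by blast
  then have "CM_type (semigroup_ring H :: 'k fls ring) = quotient_dim (supp_in V) (supp_in shifted :: 'k fls set)"
    unfolding CM_type_def min_reduction_eq max_ideal_eq Smax_eq carrier_ring by simp
  moreover have VW: "V - shifted = (\<lambda>p. int (lowest + p)) ` pf"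
  proof safe
    fix i assume i: "i \<in> V" "i \<notin> shifted"
    then obtain x where x: "i = int x" "x \<in> H" by (auto simp: V_def)
    have sh: "\<exists>y\<in>H. x + h = lowest + y" if "h \<in> H" "0 < h" for h
    proof -
      have "i + int h \<in> shifted" using i(1) that unfolding V_def by auto
      then show ?thesis by (auto simp: x(1) shifted_def simp flip: of_nat_add)
    qed
    have "x \<noteq> 0"
    proof
      assume x0: "x = 0"
      \<comment> \<open>For exponent 0 every positive element of \<open>H\<close> would stay in
        \<open>H\<close> after subtraction of \<open>lowest\<close>. As 1 is a gap, no number 1 + k
        * lowest would lie in \<open>H\<close>, against the finiteness of the complement.\<close>
      have "Suc (lowest * k) \<notin> H" for k
      proof (induction k)
        case 0
        show ?case using lowest_le[of 1] lowest_ge_2[OF assms] by auto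
      next
        case (Suc k)
        show ?case
        proof
          assume "Suc (lowest * Suc k) \<in> H"
          from sh[OF this] obtain y where y: "y \<in> H" "Suc (lowest * Suc k) = lowest + y" by (auto simp: x0)
          then have "y = Suc (lowest * k)" by simp
          then show False using Suc y(1) by simp
        qed
      qed
      moreover have "Suc (lowest * cnd) \<in> H"
      proof (rule cnd)
        have "1 * cnd \<le> lowest * cnd" using lowest(1) by (intro mult_le_mono1) simp
        then show "cnd \<le> Suc (lowest * cnd)" by linarith
      qed
      ultimately show False by blast
    qed
    then have "lowest \<le> x" using lowest_le x(2) by blast
    define p where "p = x - lowest"
    have xp: "x = lowest + p" using \<open>lowest \<le> x\<close> by (simp add: p_def)
    have "p \<in> endo" unfolding endo_def
    proof (intro CollectI ballI impI)
      fix h assume "h \<in> H" "0 < h"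
      from sh[OF this] show "p + h \<in> H" by (auto simp: xp)
    qed
    moreover have "p \<notin> H" using i(2) by (auto simp: x(1) xp shifted_def)
    ultimately show "i \<in> (\<lambda>p. int (lowest + p)) ` pf" by (auto simp: x(1) xp)
  next
    fix p assume p: "p \<in> endo" "p \<notin> H"
    have "lowest + p \<in> H" using p(1) lowest by (auto simp: endo_def add.commute)
    moreover have "int (lowest + p) + int h \<in> shifted" if "h \<in> H" "0 < h" for h
      using p(1) that unfolding shifted_def by (intro image_eqI[of _ _ "p + h"]) (auto simp: endo_def)
    ultimately show "int (lowest + p) \<in> V" unfolding V_def by (auto simp del: of_nat_add)
    assume "int (lowest + p) \<in> shifted"
    then show False using p(2) by (auto simp: shifted_def)
  qed
  moreover have "shifted \<subseteq> V"
  proof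
    fix i assume "i \<in> shifted"
    then obtain h where h: "h \<in> H" "i = int (lowest + h)" by (auto simp: shifted_def)
    have "i + int h' \<in> shifted" if "h' \<in> H" for h'
      unfolding shifted_def using h Hadd[OF h(1) that] by (intro image_eqI[of _ _ "h + h'"]) auto
    then show "i \<in> V" using h Hadd[OF lowest(2) h(1)] unfolding V_def by (auto simp del: of_nat_add)
  qed
  moreover have "inj_on (\<lambda>p. int (lowest + p)) pf" by (auto intro: inj_onI)
  ultimately show ?thesis using quotient_dim_monomial[of shifted V] finite_pf by (simp add: card_image)
qed

lemma tail_sum_eq:
  "{c + x | c x. c \<in> tail n \<and> x \<in> supp_in B} = (supp_in ({int n..} \<union> B) :: 'k::field fls set)"
proof safe
  fix c x :: "'k fls" assume "c \<in> tail n" "x \<in> supp_in B"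
  then have "c \<in> supp_in ({int n..} \<union> B)" "x \<in> supp_in ({int n..} \<union> B)" using supp_in_mono by blast+
  then show "c + x \<in> supp_in ({int n..} \<union> B)" by (rule supp_in_closed(2))
next
  fix f :: "'k fls" assume f: "f \<in> supp_in ({int n..} \<union> B)"
  define x where "x = proj {fls_subdegree f..<int n} f"
  have nth: "x $$ i = (if i < int n then f $$ i else 0)" for i
    unfolding x_def by (auto simp: proj_nth)
  have "f - x \<in> tail n" by (rule supp_inI) (auto simp: nth split: if_splits)
  moreover have "x \<in> supp_in B"
  proof (rule supp_inI)
    fix i assume "x $$ i \<noteq> 0"
    then have "f $$ i \<noteq> 0" "i < int n" by (auto simp: nth split: if_splits)
    then show "i \<in> B" using supp_inD[OF f, of i] by auto
  qed
  moreover have "f = (f - x) + x" by simp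
  ultimately show "\<exists>c x. f = c + x \<and> c \<in> tail n \<and> x \<in> supp_in B" by blast
qed

text \<open>With e the multiplicity, these are the g for which t^(g + e) lies in the conductor but
  not in t^e R.\<close>

definition top_gaps :: "nat set" where "top_gaps = {g. g \<notin> H \<and> cnd \<le> g + lowest}"

lemma finite_top_gaps: "finite top_gaps"
  by (rule finite_subset[OF _ Hfin]) (auto simp: top_gaps_def)

lemma reduced_type_eq:
  assumes "H \<noteq> UNIV"
  shows "reduced_type (semigroup_ring H :: 'k::field fls ring) = card top_gaps"
proof -
  let ?V = "{int cnd..} \<union> shifted"
  have "?V - shifted = (\<lambda>g. int (lowest + g)) ` top_gaps"
  proof safe
    fix i assume i: "int cnd \<le> i" "i \<notin> shifted"
    define g where "g = nat i - lowest"
    have ig: "i = int (lowest + g)" using i(1) lowest_le_cnd[OF assms] by (simp add: g_def)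
    have "g \<notin> H" using i(2) by (auto simp: ig shifted_def)
    then show "i \<in> (\<lambda>g. int (lowest + g)) ` top_gaps" using i(1) by (auto simp: ig top_gaps_def)
  qed (auto simp: top_gaps_def shifted_def)
  moreover have "inj_on (\<lambda>g. int (lowest + g)) top_gaps" by (auto intro: inj_onI)
  ultimately show ?thesis
    unfolding reduced_type_def conductor_eq min_reduction_eq tail_sum_eq
    using quotient_dim_monomial[of shifted ?V] finite_top_gaps by (simp add: card_image)
qed

text \<open>The two lengths count the gaps and the elements of \<open>H\<close> below the
  conductor.\<close>

lemma almost_gorenstein_eq:
  assumes "H \<noteq> UNIV"
  shows "almost_gorenstein (semigroup_ring H :: 'k::field fls ring) \<longleftrightarrow>
    card (- H) + 1 = card (H \<inter> {..<cnd}) + card pf"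
proof -
  have 1: "{0..} - int ` H = int ` (- H)"
  proof safe
    fix i :: int assume "0 \<le> i" "i \<notin> int ` H"
    moreover then have "i = int (nat i)" by simp
    ultimately show "i \<in> int ` (- H)" by (metis ComplI image_eqI)
  qed auto
  have 2: "int ` H - {int cnd..} = int ` (H \<inter> {..<cnd})" by auto
  have H: "i + int h \<in> int ` H" if i: "i \<in> int ` H" and h: "h \<in> H" for i h
  proof -
    obtain g where "i = int g" "g \<in> H" using i by blast
    then show ?thesis using Hadd[OF \<open>g \<in> H\<close> h] by (intro image_eqI[of _ _ "g + h"]) auto
  qed
  have tail: "{int cnd..} \<subseteq> int ` H"
  proof
    fix i assume "i \<in> {int cnd..}"
    then show "i \<in> int ` H" using cnd[of "nat i"] by (intro image_eqI[of _ _ "nat i"]) auto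
  qed
  have "quotient_length (semigroup_ring H :: 'k fls ring) (supp_in {0..}) (supp_in (int ` H)) = enat (card ({0..} - int ` H))"
    by (rule quotient_length_monomial) (use H Hfin in \<open>auto simp: 1\<close>)
  then have "quotient_length (semigroup_ring H :: 'k fls ring) power_series S = enat (card (- H))"
    unfolding power_series_eq S_def 1 by (simp add: card_image)
  moreover have "quotient_length (semigroup_ring H :: 'k fls ring) (supp_in (int ` H)) (tail cnd) = enat (card (int ` H - {int cnd..}))"
    by (rule quotient_length_monomial[OF tail]) (use H in \<open>auto simp: 2\<close>)
  then have "quotient_length (semigroup_ring H :: 'k fls ring) S (tail cnd) = enat (card (H \<inter> {..<cnd}))"
    unfolding S_def 2 by (simp add: card_image)
  ultimately show ?thesis
    unfolding almost_gorenstein_def carrier_ring conductor_eq CM_type_eq[OF assms]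
    by (simp add: one_enat_def)
qed

end

section \<open>Almost symmetric semigroups\<close>

lemma semigroup_gen_base: "a \<in> A \<Longrightarrow> a \<in> semigroup_gen A"
  using semigroup_gen.add[OF _ semigroup_gen.zero, of a A] by simp

lemma semigroup_gen_closed:
  "x \<in> semigroup_gen A \<Longrightarrow> y \<in> semigroup_gen A \<Longrightarrow> x + y \<in> semigroup_gen A"
  by (induction x rule: semigroup_gen.induct) (auto simp: add.assoc intro: semigroup_gen.add)

lemma semigroup_gen_below:
  "x \<in> semigroup_gen A \<Longrightarrow> x < g \<Longrightarrow> x \<in> semigroup_gen (A - {g})"
  by (induction x rule: semigroup_gen.induct) (auto intro: semigroup_gen.intros)

lemma semigroup_ring_inject:
  assumes "semigroup_ring X = (semigroup_ring Y :: 'k::field fls ring)"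
  shows "X = Y"
proof -
  have mem: "x \<in> Z \<longleftrightarrow> (tp (int x) :: 'k fls) \<in> carrier (semigroup_ring Z)" for x Z
    by (auto simp: semigroup_ring_def fls_subring_def)
  show ?thesis using assms by (auto simp: mem)
qed

locale generated = numsg +
  fixes A :: "nat set"
  assumes gen: "minimally_generates A H"
begin

lemma gen_H: "semigroup_gen A = H" and minimal: "B \<subset> A \<Longrightarrow> semigroup_gen B \<noteq> H"
  using gen by (auto simp: minimally_generates_def)

lemma A_H: "g \<in> A \<Longrightarrow> g \<in> H"
  using semigroup_gen_base gen_H by blast

text \<open>If both summands were positive, they would be smaller than \<open>g\<close> and hence
  generated without it; then \<open>g\<close> would be redundant.\<close>

lemma irreducible:
  assumes g: "g \<in> A" and xy: "x \<in> H" "y \<in> H" "g = x + y" shows "x = 0 \<or> y = 0"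
proof (rule ccontr)
  assume "\<not> (x = 0 \<or> y = 0)"
  then have "x \<in> semigroup_gen (A - {g})" "y \<in> semigroup_gen (A - {g})"
    using xy unfolding gen_H[symmetric] by (auto intro!: semigroup_gen_below)
  then have gg: "g \<in> semigroup_gen (A - {g})" unfolding xy(3) by (rule semigroup_gen_closed)
  have "x \<in> semigroup_gen (A - {g})" if "x \<in> semigroup_gen A" for x
    using that
  proof (induction rule: semigroup_gen.induct)
    case (add b x)
    then have "b \<in> semigroup_gen (A - {g})" using gg semigroup_gen_base[of b "A - {g}"] by blast
    then show ?case using add.IH by (rule semigroup_gen_closed)
  qed (rule semigroup_gen.zero)
  moreover have "x \<in> semigroup_gen A" if "x \<in> semigroup_gen (A - {g})" for x
    using that by (induction rule: semigroup_gen.induct) (auto intro: semigroup_gen.intros)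
  ultimately have "semigroup_gen (A - {g}) = H" unfolding gen_H[symmetric] by blast
  then show False using minimal[of "A - {g}"] g by blast
qed

lemma zero_notin: "0 \<notin> A"
proof
  assume 0: "0 \<in> A"
  have "x \<in> semigroup_gen (A - {0})" if "x \<in> semigroup_gen A" for x
    using that
  proof (induction rule: semigroup_gen.induct)
    case (add b x)
    then show ?case by (cases "b = 0") (auto intro: semigroup_gen.add)
  qed (rule semigroup_gen.zero)
  moreover have "x \<in> semigroup_gen A" if "x \<in> semigroup_gen (A - {0})" for x
    using that by (induction rule: semigroup_gen.induct) (auto intro: semigroup_gen.intros)
  ultimately have "semigroup_gen (A - {0}) = H" unfolding gen_H[symmetric] by blast
  then show False using minimal[of "A - {0}"] 0 by blast
qed

lemma lowest_A: "lowest \<in> A"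
proof -
  have "lowest \<in> semigroup_gen A" using lowest(2) gen_H by simp
  then obtain b x where b: "b \<in> A" "lowest = b + x" using lowest(1) by (cases rule: semigroup_gen.cases) auto
  then have "lowest \<le> b" using zero_notin A_H by (intro lowest_le) (metis neq0_conv)+
  then show ?thesis using b by simp
qed

lemma A_ge: "g \<in> A \<Longrightarrow> lowest \<le> g"
  using zero_notin A_H by (intro lowest_le) (metis neq0_conv)+

end

context numsg
begin

definition frob :: nat where "frob = cnd - 1"

lemma lowest_multiple: "x \<in> H \<Longrightarrow> x + lowest * k \<in> H"
  by (induction k) (use Hadd[OF lowest(2)] in \<open>auto simp: add.assoc[symmetric] add.commute[of lowest] add.left_commute\<close>)

text \<open>Pseudo-Frobenius numbers are nonzero modulo the multiplicity and pairwise incongruent: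
  the larger of two congruent ones would be the smaller plus a positive element of \<open>H\<close>,
  hence in \<open>H\<close>.\<close>

lemma pf_card_less:
  shows "card pf < lowest"
proof -
  have inj: "inj_on (\<lambda>p. p mod lowest) pf"
  proof (rule linorder_inj_onI)
    fix p q assume pq: "p < q" "p \<in> pf" "q \<in> pf"
    show "p mod lowest \<noteq> q mod lowest"
    proof
      assume "p mod lowest = q mod lowest"
      then have "lowest dvd q - p" using pq(1) mod_eq_dvd_iff_nat[of p q lowest] by (metis less_imp_le)
      then obtain k where k: "q - p = lowest * k" by blast
      have "lowest * k \<in> H" using lowest_multiple[OF H0] by simp
      then have "p + lowest * k \<in> H" using pq k by (auto simp: endo_def)
      moreover have "p + lowest * k = q" using k pq(1) by linarith
      ultimately show False using pq(3) by simp
    qed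
  qed auto
  have "p mod lowest \<in> {0<..<lowest}" if "p \<in> pf" for p
  proof -
    have "p mod lowest \<noteq> 0"
    proof
      assume "p mod lowest = 0"
      then have "lowest dvd p" by (rule mod_0_imp_dvd)
      then obtain k where "p = lowest * k" by (rule dvdE)
      then show False using lowest_multiple[OF H0, of k] that by simp
    qed
    then show ?thesis using lowest(1) by simp
  qed
  then have "(\<lambda>p. p mod lowest) ` pf \<subseteq> {0<..<lowest}" by blast
  from card_mono[OF _ this] have "card pf \<le> lowest - 1" unfolding card_image[OF inj] by simp
  then show ?thesis using lowest(1) by linarith
qed

end

locale almost_symmetric_semigroup = numsg +
  assumes proper: "H \<noteq> UNIV" and card_eq: "card (- H) + 1 = card (H \<inter> {..<cnd}) + card pf"
begin

lemma cnd_frob: "cnd = Suc frob" and frob_notin: "frob \<notin> H"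
proof -
  have "cnd \<noteq> 0" using lowest_le_cnd[OF proper] lowest(1) by auto
  then show "cnd = Suc frob" "frob \<notin> H" using cnd_pred by (auto simp: frob_def)
qed

lemma above_frob: "frob < x \<Longrightarrow> x \<in> H"
  using cnd[of x] cnd_frob by simp

lemma gap_le: "x \<notin> H \<Longrightarrow> x \<le> frob"
  using above_frob by (meson not_le)

lemma frob_pf: "frob \<in> pf"
  using frob_notin above_frob by (auto simp: endo_def)

lemma frob_diff: "h \<in> H \<Longrightarrow> frob - h \<in> H \<Longrightarrow> h \<le> frob \<Longrightarrow> False"
  using Hadd[of h "frob - h"] frob_notin by simp

text \<open>The gaps outside \<open>frob - H\<close> always contain the pseudo-Frobenius numbers other than \<open>frob\<close>;
  the length equation says that there are as many.\<close>

lemma pf_eq: "{x. x \<notin> H \<and> frob - x \<notin> H} = pf - {frob}"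
proof -
  let ?L = "{x. x \<notin> H \<and> frob - x \<notin> H}" and ?N = "H \<inter> {..<cnd}"
  have sub: "pf - {frob} \<subseteq> ?L"
  proof
    fix p assume p: "p \<in> pf - {frob}"
    then have le: "p \<le> frob" using gap_le by blast
    have "frob - p \<notin> H"
    proof
      assume d: "frob - p \<in> H"
      have "p + h \<in> H" if "h \<in> H" "0 < h" for h using p that by (simp add: endo_def)
      from this[OF d] have "p + (frob - p) \<in> H" using p le by force
      then show False using le frob_notin by simp
    qed
    then show "p \<in> ?L" using p by simp
  qed
  have finL: "finite ?L" by (rule finite_subset[OF _ Hfin]) blast
  \<comment> \<open>A gap is either the reflection of an element of \<open>H\<close> below the
    conductor or has a gap as its own reflection.\<close>
  have "- H = (\<lambda>h. frob - h) ` ?N \<union> ?L"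
  proof (intro equalityI subsetI)
    fix x assume x: "x \<in> - H"
    show "x \<in> (\<lambda>h. frob - h) ` ?N \<union> ?L"
    proof (cases "frob - x \<in> H")
      case True
      then have "x = frob - (frob - x)" "frob - x \<in> ?N" using gap_le[of x] x cnd_frob by auto
      then show ?thesis by blast
    qed (use x in simp)
  next
    fix x assume "x \<in> (\<lambda>h. frob - h) ` ?N \<union> ?L"
    then consider h where "h \<in> H" "h < cnd" "x = frob - h" | "x \<notin> H" by blast
    then show "x \<in> - H"
    proof cases
      case (1 h)
      have "h \<le> frob" using 1(2) cnd_frob by simp
      then show ?thesis using frob_diff[OF 1(1)] 1(3) by blast
    qed simp
  qed
  moreover have "frob - (frob - h) = h" if "h \<in> ?N" for h using that cnd_frob by auto
  then have "(\<lambda>h. frob - h) ` ?N \<inter> ?L = {}" by auto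
  moreover have "inj_on (\<lambda>h. frob - h) ?N" using cnd_frob by (auto intro!: inj_onI)
  ultimately have "card (- H) = card ?N + card ?L"
    using card_Un_disjoint[of "(\<lambda>h. frob - h) ` ?N" ?L] finL by (simp add: card_image)
  then have "card ?L + 1 = card pf" using card_eq by simp
  then have "card ?L = card (pf - {frob})" using frob_pf finite_pf by (simp del: Diff_iff)
  then show ?thesis using card_subset_eq[OF finL sub] by simp
qed

lemma almost_symmetric: "almost_symmetric"
  unfolding almost_symmetric_def
proof (intro allI impI)
  fix x assume x: "x \<notin> H"
  show "x \<in> endo \<or> (\<exists>h\<in>H. h + x = cnd - 1)"
  proof (cases "frob - x \<in> H")
    case True
    then show ?thesis using gap_le[OF x] by (intro disjI2 bexI[of _ "frob - x"]) (auto simp: cnd_frob)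
  qed (use x pf_eq in blast)
qed

text \<open>When frob is the only pseudo-Frobenius number, \<open>pf_eq\<close> leaves no gap whose
  reflection is a gap; integers outside the range from 0 to frob are immediate.\<close>

lemma symmetric_if_pf_single:
  assumes "pf = {frob}"
  shows "i \<in> int ` H \<longleftrightarrow> int cnd - 1 - i \<notin> int ` H"
proof -
  have L: "x \<in> H \<or> frob - x \<in> H" for x using pf_eq assms by blast
  have mem: "j \<in> int ` H \<longleftrightarrow> 0 \<le> j \<and> nat j \<in> H" for j by (auto simp: image_iff intro: bexI[of _ "nat j"])
  consider "i < 0" | "int frob < i" | "0 \<le> i" "i \<le> int frob" by linarith
  then show ?thesis
  proof cases
    case 1
    then show ?thesis using above_frob[of "nat (int frob - i)"] by (simp add: mem cnd_frob)
  next
    case 2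
    then show ?thesis using above_frob[of "nat i"] by (simp add: mem cnd_frob)
  next
    case 3
    define x where "x = nat i"
    have x: "i = int x" "x \<le> frob" using 3 by (auto simp: x_def)
    have "nat (int cnd - 1 - i) = frob - x" using x by (simp add: cnd_frob)
    then show ?thesis using L[of x] frob_diff[of x] x by (auto simp: mem cnd_frob)
  qed
qed

text \<open>With a single pseudo-Frobenius number the semigroup is symmetric and R is
  Gorenstein.\<close>

lemma card_pf_ge_2:
  assumes "\<not> gorenstein (semigroup_ring H :: 'k::field fls ring)"
  shows "2 \<le> card pf"
proof (rule ccontr)
  assume "\<not> 2 \<le> card pf"
  moreover have "card pf \<noteq> 0" using frob_pf finite_pf by auto
  ultimately have "card pf = 1" by linarith
  then have "pf = {frob}" using frob_pf by (metis card_1_singletonE singletonD)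
  then show False using symmetric_gorenstein[OF symmetric_if_pf_single] assms by blast
qed

lemma not_in_pf: "p \<in> pf \<Longrightarrow> p \<notin> H" "p \<in> pf \<Longrightarrow> p \<in> endo"
  by auto

text \<open>The description in \<open>pf_eq\<close> is invariant under reflection at frob.\<close>

lemma pf_reflect: "p \<in> pf \<Longrightarrow> p \<noteq> frob \<Longrightarrow> frob - p \<in> pf \<and> frob - p \<noteq> frob"
proof -
  assume p: "p \<in> pf" "p \<noteq> frob"
  then have "p \<in> {x. x \<notin> H \<and> frob - x \<notin> H}" unfolding pf_eq by blast
  moreover have "frob - (frob - p) = p" using gap_le[of p] p(1) by simp
  ultimately have "frob - p \<in> {x. x \<notin> H \<and> frob - x \<notin> H}" by simp
  then show ?thesis unfolding pf_eq by blast
qed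

text \<open>Besides frob there is exactly one pseudo-Frobenius number, so the reflection at frob
  fixes it.\<close>

lemma pf_lowest_3:
  assumes "lowest = 3" "2 \<le> card pf"
  obtains f where "pf = {f, 2 * f}" "frob = 2 * f" "f \<notin> H"
proof -
  have "card pf = 2" using pf_card_less assms by linarith
  then obtain x y where "pf = {x, y}" "x \<noteq> y" unfolding card_2_iff by (elim exE conjE)
  then have "\<exists>f. pf = {f, frob} \<and> f \<noteq> frob" using frob_pf by (metis insert_commute insert_iff singletonD)
  then obtain f where f: "pf = {f, frob}" "f \<noteq> frob" by (elim exE conjE)
  have fp: "f \<in> pf" using f(1) by blast
  have "frob - f = f" using pf_reflect[OF fp f(2)] f(1) by blast
  moreover have "f \<notin> H" using not_in_pf(1)[OF fp] .
  ultimately have "frob = 2 * f" "f \<notin> H" using gap_le[of f] by auto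
  then show thesis using that[of f] f(1) by simp
qed

lemma lowest_ge: "2 \<le> lowest" and lowest_below: "0 < x \<Longrightarrow> x < lowest \<Longrightarrow> x \<notin> H"
  using lowest_ge_2[OF proper] lowest_le[of x] by auto

lemma lowest_frob: "lowest \<le> Suc frob"
  using lowest_le_cnd[OF proper] cnd_frob by simp

lemma frob_top: "frob \<in> top_gaps"
  using frob_notin lowest(1) by (simp add: top_gaps_def cnd_frob)

text \<open>Adding a positive element of \<open>H\<close>, which is at least the multiplicity,
  passes the conductor. Maximal reduced type therefore means equality.\<close>

lemma top_gaps_pf: "top_gaps \<subseteq> pf"
proof
  fix g assume g: "g \<in> top_gaps"
  have "g + h \<in> H" if "h \<in> H" "0 < h" for h
  proof (rule cnd)
    show "cnd \<le> g + h" using g lowest_le[OF that] by (simp add: top_gaps_def)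
  qed
  then show "g \<in> pf" using g by (auto simp: top_gaps_def endo_def)
qed

lemma endo_mult_S:
  fixes b r :: "'k::field fls"
  assumes "b \<in> supp_in (int ` endo)" "r \<in> Smax"
  shows "b * r \<in> S"
  using assms unfolding Smax_eq S_def
  by (rule supp_in_mult) (auto simp: endo_def simp flip: of_nat_add)

lemma Ref_finite_endo:
  assumes "3 \<in> endo" "\<And>i. 5 \<le> i \<Longrightarrow> i \<in> endo"
  shows "Ref_finite_type (semigroup_ring H :: 'k::field fls ring)"
proof (rule Ref_finite_K357, rule endo_mult_S)
  fix b r :: "'k fls" assume b: "b \<in> K357" "r \<in> Smax"
  have "{0, 3} \<union> {5..} \<subseteq> int ` endo"
  proof
    fix i :: int assume i: "i \<in> {0, 3} \<union> {5..}"
    then have "nat i \<in> endo" using assms(1) assms(2)[of "nat i"] H_endo[OF H0] by auto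
    then show "i \<in> int ` endo" using i by (intro image_eqI[of _ _ "nat i"]) auto
  qed
  then show "b \<in> supp_in (int ` endo)" using b(1) unfolding K357_def by (rule supp_in_mono[rotated])
qed

text \<open>The set \<open>E\<close> is \<open>endo\<close> inside the integers, where the
  reflection F - i is not truncated.\<close>

lemma Ref_finite_endo_symmetric:
  assumes e: "\<And>x. x \<in> endo \<longleftrightarrow> int x \<in> E" and E: "E \<subseteq> {0..}"
    and F: "0 \<le> F" "\<And>i. i \<in> E \<longleftrightarrow> F - i \<notin> E" and sup: "{0, 3} \<union> {5..} \<subseteq> E \<union> {F}"
  shows "Ref_finite_type (semigroup_ring H :: 'k::field fls ring)"
proof -
  have E: "int ` endo = E"
  proof (intro equalityI subsetI)
    fix i assume "i \<in> E"
    then have "nat i \<in> endo" "i = int (nat i)" using e[of "nat i"] E by auto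
    then show "i \<in> int ` endo" by blast
  qed (use e in auto)
  show ?thesis
  proof (rule Ref_finite_symmetric[OF numsg_endo F(1), unfolded E, OF F(2) sup])
    fix b r :: "'k fls" assume "b \<in> numsg.S endo" "r \<in> Smax"
    then show "b * r \<in> S" unfolding numsg.S_def[OF numsg_endo] by (rule endo_mult_S)
  qed
qed

end

section \<open>Explicit generators\<close>

lemma semigroup_gen_eqI:
  assumes H: "numsg H" and A: "A \<subseteq> H"
    and step: "\<And>x. x \<in> H \<Longrightarrow> x \<noteq> 0 \<Longrightarrow> x \<notin> A \<Longrightarrow> \<exists>a\<in>A. 0 < a \<and> a \<le> x \<and> x - a \<in> H"
  shows "semigroup_gen A = H"
proof (intro equalityI subsetI)
  interpret numsg H by fact
  fix x assume "x \<in> semigroup_gen A"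
  then show "x \<in> H" by (induction rule: semigroup_gen.induct) (use A H0 Hadd in auto)
next
  fix x assume "x \<in> H"
  then show "x \<in> semigroup_gen A"
  proof (induction x rule: less_induct)
    case (less x)
    show ?case
    proof (cases "x = 0 \<or> x \<in> A")
      case True
      then show ?thesis using semigroup_gen.zero semigroup_gen_base by auto
    next
      case False
      then obtain a where a: "a \<in> A" "0 < a" "a \<le> x" "x - a \<in> H" using step[OF less.prems] by blast
      then have "x - a \<in> semigroup_gen A" by (intro less.IH) auto
      from semigroup_gen.add[OF a(1) this] show ?thesis using a(3) by simp
    qed
  qed
qed

lemma semigroup_gen_3_7_11: "semigroup_gen {3, 7, 11} = {0, 3, 6, 7} \<union> {9..}"
proof (rule semigroup_gen_eqI)
  have "- ({0, 3, 6, 7} \<union> {9..}) \<subseteq> {..<9 :: nat}" by auto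
  then have "finite (- ({0, 3, 6, 7} \<union> {9..} :: nat set))" by (rule finite_subset) simp
  then show "numsg ({0, 3, 6, 7} \<union> {9..})" by unfold_locales (auto simp: numerical_semigroup_def)
  fix x :: nat assume "x \<in> {0, 3, 6, 7} \<union> {9..}" "x \<noteq> 0" "x \<notin> {3, 7, 11}"
  then have "3 \<le> x \<and> x - 3 \<in> {0, 3, 6, 7} \<union> {9..}" by auto
  then show "\<exists>a\<in>{3, 7, 11}. 0 < a \<and> a \<le> x \<and> x - a \<in> {0, 3, 6, 7} \<union> {9..}" by auto
qed auto

lemma semigroup_gen_3_8_13: "semigroup_gen {3, 8, 13} = {0, 3, 6, 8, 9} \<union> {11..}"
proof (rule semigroup_gen_eqI)
  have "- ({0, 3, 6, 8, 9} \<union> {11..}) \<subseteq> {..<11 :: nat}" by auto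
  then have "finite (- ({0, 3, 6, 8, 9} \<union> {11..} :: nat set))" by (rule finite_subset) simp
  then show "numsg ({0, 3, 6, 8, 9} \<union> {11..})" by unfold_locales (auto simp: numerical_semigroup_def)
  fix x :: nat assume "x \<in> {0, 3, 6, 8, 9} \<union> {11..}" "x \<noteq> 0" "x \<notin> {3, 8, 13}"
  then have "3 \<le> x \<and> x - 3 \<in> {0, 3, 6, 8, 9} \<union> {11..}" by auto
  then show "\<exists>a\<in>{3, 8, 13}. 0 < a \<and> a \<le> x \<and> x - a \<in> {0, 3, 6, 8, 9} \<union> {11..}" by auto
qed auto

section \<open>The semigroups in the four statements\<close>

context almost_symmetric_semigroup
begin

lemma multiple_3: "lowest = 3 \<Longrightarrow> x \<in> H \<Longrightarrow> x + 3 * k \<in> H"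
  using lowest_multiple[of x k] by simp

text \<open>Among the \<open>lowest\<close> numbers just below the conductor only frob is a gap. If
  the multiplicity is at least 4, this keeps 1, 2, 3 out of \<open>endo\<close>. If it is 3, the
  pseudo-Frobenius numbers are f and 2 f; then f = 4 and f = 5 give the two semigroups, and f at
  least 7 keeps 1, 2, 4, 5 out of \<open>endo\<close>.\<close>

lemma Ref_finite_minimal_reduced:
  assumes pf2: "2 \<le> card pf" and red: "card top_gaps = 1"
  shows "Ref_finite_type (semigroup_ring H :: 'k::field_char_0 fls ring) \<longleftrightarrow>
    H = semigroup_gen {3, 7, 11} \<or> H = semigroup_gen {3, 8, 13}"
proof -
  have top: "g = frob" if "g \<notin> H" "cnd \<le> g + lowest" for g
  proof -
    have "g \<in> top_gaps" using that by (simp add: top_gaps_def)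
    then show ?thesis using red frob_top by (metis card_1_singletonE singletonD)
  qed
  have low: "3 \<le> lowest" using pf_card_less pf2 by linarith
  have c0: "cnd \<noteq> 0" using cnd_frob by simp
  show ?thesis
  proof (cases "lowest = 3")
    case False
    then have low4: "4 \<le> lowest" using low by simp
    have "p \<notin> endo" if p: "0 < p" "p \<le> 3" for p
    proof
      assume pe: "p \<in> endo"
      have pH: "p \<notin> H" using lowest_below p low4 by simp
      then have pp: "p \<in> pf" using pe by blast
      show False
      proof (cases "p = frob")
        case True
        have "1 \<notin> H" using lowest_below[of 1] low4 by simp
        then have "1 = frob" using top[of 1] True p low4 cnd_frob by simp
        then show False using lowest_frob low4 by simp
      next
        case False
        \<comment> \<open>The reflection would be a second gap at distance at most 3 from frob,
          which is less than the multiplicity.\<close>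
        from pf_reflect[OF pp this] have "frob - p \<notin> H" "frob - p \<noteq> frob" by blast+
        then show False using top[of "frob - p"] p low4 cnd_frob by simp
      qed
    qed
    then have "endo \<inter> {1, 2, 3} = {}" by auto
    then have "\<not> Ref_finite_type (semigroup_ring H :: 'k fls ring)"
      using not_Ref_finite[OF almost_symmetric c0] by blast
    moreover have "3 \<notin> H" using lowest_below[of 3] low4 by simp
    then have "H \<noteq> semigroup_gen {3, 7, 11}" "H \<noteq> semigroup_gen {3, 8, 13}"
      using semigroup_gen_base[of 3] by auto
    ultimately show ?thesis by blast
  next
    case low3: True
    obtain f where f: "pf = {f, 2 * f}" "frob = 2 * f" "f \<notin> H" using pf_lowest_3[OF low3 pf2] by blast
    note m3 = multiple_3[OF low3]
    have H3: "3 \<in> H" using lowest(2) low3 by simp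
    have F1: "2 * f - 1 \<in> H" if "1 \<le> f"
      using top[of "2 * f - 1"] that f(2) low3 cnd_frob by (cases "2 * f - 1 \<in> H") auto
    have F2: "2 * f - 2 \<in> H" if "1 \<le> f"
      using top[of "2 * f - 2"] that f(2) low3 cnd_frob by (cases "2 * f - 2 \<in> H") auto
    \<comment> \<open>For f = 1 and f = 2 the gap f would be 2 f - 1 or 2 f - 2, both of which lie
      in \<open>H\<close>; the values 0, 3 and 6 are multiples of the multiplicity.\<close>
    have "f \<noteq> 0" using f(3) H0 by metis
    moreover have "f \<noteq> 1" using f(3) F1 by auto
    moreover have "f \<noteq> 2" using f(3) F2 by auto
    moreover have "f \<noteq> 3" using f(3) H3 by metis
    moreover have "f \<noteq> 6" using f(3) m3[OF H3, of 1] by auto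
    ultimately have fn: "f = 4 \<or> f = 5 \<or> 7 \<le> f" by linarith
    have small: "1 \<notin> H" "2 \<notin> H" using lowest_below[of 1] lowest_below[of 2] low3 by simp_all
    have endo: "x \<in> endo \<longleftrightarrow> x \<in> H \<or> x = f \<or> x = 2 * f" for x
      using f(1) H_endo[of x] by blast
    consider "f = 4" | "f = 5" | "7 \<le> f" using fn by blast
    then show ?thesis
    proof cases
      case 1
      have n: "4 \<notin> H" "8 \<notin> H" "5 \<notin> H" "7 \<in> H" "6 \<in> H"
        using 1 f(3) frob_notin f(2) F1 F2 m3[of 5 1] by auto
      have mem: "x \<in> H \<longleftrightarrow> x \<in> {0, 3, 6, 7} \<union> {9..}" for x
      proof -
        consider "x = 0" | "x = 1" | "x = 2" | "x = 3" | "x = 4" | "x = 5" | "x = 6" | "x = 7" | "x = 8" | "9 \<le> x"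
          by linarith
        then show ?thesis using n small H0 H3 above_frob[of x] 1 f(2) by cases auto
      qed
      then have H: "H = semigroup_gen {3, 7, 11}" unfolding semigroup_gen_3_7_11 by blast
      have "Ref_finite_type (semigroup_ring H :: 'k fls ring)"
      \<comment> \<open>Here \<open>endo\<close> is generated by 3 and 4; it is symmetric with
        Frobenius number 5.\<close>
      proof (rule Ref_finite_endo_symmetric[of "{0, 3, 4} \<union> {6..}" 5])
        show "x \<in> endo \<longleftrightarrow> int x \<in> {0, 3, 4} \<union> {6..}" for x
          unfolding endo mem 1 by auto
        show "i \<in> {0, 3, 4} \<union> {6..} \<longleftrightarrow> 5 - i \<notin> {0, 3, 4} \<union> {6..}" for i :: int
          by auto
      qed auto
      then show ?thesis using H by blast
    next
      case 2
      have n: "5 \<notin> H" "10 \<notin> H" "9 \<in> H" "8 \<in> H" "4 \<notin> H" "7 \<notin> H" "6 \<in> H"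
        using 2 f(3) frob_notin f(2) F1 F2 m3[of 7 1] m3[of 4 2] m3[OF H3, of 1] by auto
      have mem: "x \<in> H \<longleftrightarrow> x \<in> {0, 3, 6, 8, 9} \<union> {11..}" for x
      proof -
        have "x \<in> {0, 1, 2, 3, 4, 5, 6, 7, 8, 9, 10} \<or> 11 \<le> x"
          by (simp only: insert_iff empty_iff) presburger
        then show ?thesis using n small H0 H3 above_frob[of x] 2 f(2) by auto
      qed
      then have H: "H = semigroup_gen {3, 8, 13}" unfolding semigroup_gen_3_8_13 by blast
      have "Ref_finite_type (semigroup_ring H :: 'k fls ring)"
      \<comment> \<open>Here \<open>endo\<close> is generated by 3 and 5; it is symmetric with
        Frobenius number 7, and adjoining 7 gives exactly the exponents of K.\<close>
      proof (rule Ref_finite_endo_symmetric[of "{0, 3, 5, 6} \<union> {8..}" 7])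
        show "x \<in> endo \<longleftrightarrow> int x \<in> {0, 3, 5, 6} \<union> {8..}" for x
          unfolding endo mem 2 by auto
        show "i \<in> {0, 3, 5, 6} \<union> {8..} \<longleftrightarrow> 7 - i \<notin> {0, 3, 5, 6} \<union> {8..}" for i :: int
          by auto
      qed auto
      then show ?thesis using H by blast
    next
      case 3
      have F: "2 * f \<notin> H" using frob_notin f(2) by simp
      \<comment> \<open>With 3 and 4 in \<open>H\<close> every number above 5 would lie in
        \<open>H\<close>, but frob = 2 f is at least 14. The same argument excludes 5, where the
        bound is 7.\<close>
      have "4 \<notin> H"
      proof
        assume 4: "4 \<in> H"
        then have "8 \<in> H" using Hadd[OF 4 4] by simp
        have "2 * f \<in> H"
        proof -
          consider "2 * f mod 3 = 0" | "2 * f mod 3 = 1" | "2 * f mod 3 = 2" by linarith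
          then show ?thesis
          proof cases
            case 1
            then have "2 * f = 0 + 3 * (2 * f div 3)" by presburger
            then show ?thesis using m3[OF H0] by metis
          next
            case 2
            then have "2 * f = 4 + 3 * ((2 * f - 4) div 3)" using 3 by presburger
            then show ?thesis using m3[OF 4] by metis
          next
            case 3
            then have "2 * f = 8 + 3 * ((2 * f - 8) div 3)" using \<open>7 \<le> f\<close> by presburger
            then show ?thesis using m3[OF \<open>8 \<in> H\<close>] by metis
          qed
        qed
        then show False using F by simp
      qed
      moreover have "5 \<notin> H"
      proof
        assume 5: "5 \<in> H"
        then have "10 \<in> H" using Hadd[OF 5 5] by simp
        have "2 * f \<in> H"
        proof -
          consider "2 * f mod 3 = 0" | "2 * f mod 3 = 1" | "2 * f mod 3 = 2" by linarith
          then show ?thesis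
          proof cases
            case 1
            then have "2 * f = 0 + 3 * (2 * f div 3)" by presburger
            then show ?thesis using m3[OF H0] by metis
          next
            case 2
            then have "2 * f = 10 + 3 * ((2 * f - 10) div 3)" using 3 by presburger
            then show ?thesis using m3[OF \<open>10 \<in> H\<close>] by metis
          next
            case 3
            then have "2 * f = 5 + 3 * ((2 * f - 5) div 3)" using \<open>7 \<le> f\<close> by presburger
            then show ?thesis using m3[OF 5] by metis
          qed
        qed
        then show False using F by simp
      qed
      ultimately have "endo \<inter> {1, 2, 4, 5} = {}" using small 3 by (auto simp: endo)
      then have "\<not> Ref_finite_type (semigroup_ring H :: 'k fls ring)"
        using not_Ref_finite[OF almost_symmetric c0] by blast
      moreover have "H \<noteq> semigroup_gen {3, 7, 11}" "H \<noteq> semigroup_gen {3, 8, 13}"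
        using F 3 unfolding semigroup_gen_3_7_11 semigroup_gen_3_8_13 by auto
      ultimately show ?thesis by blast
    qed
  qed
qed

text \<open>As f is a top gap and the conductor is 2 f + 1, the inequality 2 f + 1 <= f + 3
  holds.\<close>

lemma top_gaps_lowest_3:
  assumes pf2: "2 \<le> card pf" and red: "card top_gaps = card pf" and low3: "lowest = 3"
  obtains f where "f \<in> pf" "f \<in> {1, 2}" "frob \<le> 4"
proof -
  obtain f where f: "pf = {f, 2 * f}" "frob = 2 * f" "f \<notin> H" using pf_lowest_3[OF low3 pf2] by blast
  have "top_gaps = pf" using card_subset_eq[OF finite_pf top_gaps_pf red] .
  then have "f \<in> top_gaps" using f(1) by blast
  then have "f \<le> 2" using low3 cnd_frob f(2) by (simp add: top_gaps_def)
  moreover have "f \<noteq> 0" using f(3) H0 by metis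
  ultimately have "f \<in> {1, 2}" by auto
  then show thesis using that[of f] f(1,2) \<open>f \<le> 2\<close> by simp
qed

text \<open>Since frob is at most 4, the semigroup contains 3 and everything from 5 on, so that R
  itself contains K.\<close>

lemma CM_finite_lowest_3:
  assumes pf2: "2 \<le> card pf" and red: "card top_gaps = card pf" and low3: "lowest = 3"
  shows "CM_finite_type (semigroup_ring H :: 'k::field fls ring)"
    and "Ref_finite_type (semigroup_ring H :: 'k::field fls ring)"
proof -
  have le: "frob \<le> 4" using top_gaps_lowest_3[OF assms] by blast
  have "{0, 3} \<union> {5..} \<subseteq> int ` H"
  proof
    fix i :: int assume i: "i \<in> {0, 3} \<union> {5..}"
    then have "nat i \<in> H" using H0 lowest(2) low3 above_frob[of "nat i"] le by auto
    then show "i \<in> int ` H" using i by (intro image_eqI[of _ _ "nat i"]) auto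
  qed
  then have K: "(K357 :: 'c::field fls set) \<subseteq> S" unfolding K357_def S_def using supp_in_mono by blast
  show "CM_finite_type (semigroup_ring H :: 'k::field fls ring)" by (rule CM_finite[OF K])
  show "Ref_finite_type (semigroup_ring H :: 'k::field fls ring)" by (rule Ref_finite_S[OF K])
qed

text \<open>The pseudo-Frobenius numbers are the top gaps. If 1 is one of them, then frob = lowest -
  1; if 2 is and 1 is not, then frob = lowest + 1. So \<open>H\<close> is known, and
  \<open>endo\<close> contains everything from 2 on: both sides of the equivalence hold.\<close>

lemma Ref_finite_endo_lowest_le_2:
  assumes pf2: "2 \<le> card pf" and red: "card top_gaps = card pf" and e: "numsg.lowest endo \<le> 2"
  shows "Ref_finite_type (semigroup_ring H :: 'k::field fls ring)"
    and "H = semigroup_gen {lowest..2 * lowest - 1} \<or> H = semigroup_gen ({lowest} \<union> {lowest + 2..2 * lowest + 1})"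
proof -
  interpret E: numsg endo by (rule numsg_endo)
  have tp: "top_gaps = pf" using card_subset_eq[OF finite_pf top_gaps_pf red] .
  have low: "3 \<le> lowest" using pf_card_less pf2 by linarith
  have n12: "1 \<notin> H" "2 \<notin> H" using lowest_below[of 1] lowest_below[of 2] low by simp_all
  have "1 \<in> endo \<or> 2 \<in> endo"
  proof -
    have "E.lowest = 1 \<or> E.lowest = 2" using e E.lowest(1) by linarith
    then show ?thesis using E.lowest(2) by auto
  qed
  then consider "1 \<in> pf" | "1 \<notin> pf" "2 \<in> pf" using n12 by blast
  then have "(Ref_finite_type (semigroup_ring H :: 'k fls ring)) \<and> (H = semigroup_gen {lowest..2 * lowest - 1} \<or>
    H = semigroup_gen ({lowest} \<union> {lowest + 2..2 * lowest + 1}))"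
  proof cases
    case 1
    then have "1 \<in> top_gaps" using tp by simp
    then have "cnd \<le> Suc lowest" by (simp add: top_gaps_def)
    \<comment> \<open>The bounds leave lowest - 1 and lowest as values of frob, and the latter is in
      \<open>H\<close>.\<close>
    moreover have "frob \<noteq> lowest" using frob_notin lowest(2) by metis
    ultimately have fl: "Suc frob = lowest" using cnd_frob lowest_frob by simp
    have H: "x \<in> H" if "lowest \<le> x" for x using above_frob[of x] that fl by simp
    have "semigroup_gen {lowest..2 * lowest - 1} = H"
    proof (rule semigroup_gen_eqI[OF numsg_axioms])
      fix x assume x: "x \<in> H" "x \<noteq> 0" "x \<notin> {lowest..2 * lowest - 1}"
      then have "2 * lowest \<le> x" using lowest_le[of x] by auto
      then show "\<exists>a\<in>{lowest..2 * lowest - 1}. 0 < a \<and> a \<le> x \<and> x - a \<in> H"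
        using low H[of "x - lowest"] by (intro bexI[of _ lowest]) auto
    qed (use H in auto)
    moreover have "i \<in> endo" if "1 \<le> i" for i
      unfolding endo_def using H lowest_le by (auto intro: trans_le_add2)
    ultimately show ?thesis using Ref_finite_endo by auto
  next
    case 2
    then have "2 \<in> top_gaps" "1 \<notin> top_gaps" using tp by simp_all
    then have "cnd \<le> lowest + 2" "\<not> cnd \<le> lowest + 1" using n12 by (simp_all add: top_gaps_def)
    then have fl: "frob = lowest + 1" using cnd_frob by simp
    have H: "x \<in> H \<longleftrightarrow> x \<noteq> lowest + 1" if "lowest \<le> x" for x
      using above_frob[of x] that fl frob_notin lowest(2) by (cases "x = lowest") auto
    have "semigroup_gen ({lowest} \<union> {lowest + 2..2 * lowest + 1}) = H"
    proof (rule semigroup_gen_eqI[OF numsg_axioms])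
      fix x assume x: "x \<in> H" "x \<noteq> 0" "x \<notin> {lowest} \<union> {lowest + 2..2 * lowest + 1}"
      then have "2 * lowest + 2 \<le> x" using lowest_le[of x] H[of x] by auto
      then show "\<exists>a\<in>{lowest} \<union> {lowest + 2..2 * lowest + 1}. 0 < a \<and> a \<le> x \<and> x - a \<in> H"
        using low H[of "x - lowest"] by (intro bexI[of _ lowest]) auto
    qed (use H in auto)
    moreover have "i \<in> endo" if "2 \<le> i" for i
      unfolding endo_def
    proof (intro CollectI ballI impI)
      fix h assume "h \<in> H" "0 < h"
      then have "lowest \<le> h" using lowest_le by blast
      then show "i + h \<in> H" using H[of "i + h"] that by simp
    qed
    ultimately show ?thesis using Ref_finite_endo by auto
  qed
  then show "Ref_finite_type (semigroup_ring H :: 'k fls ring)"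
    "H = semigroup_gen {lowest..2 * lowest - 1} \<or> H = semigroup_gen ({lowest} \<union> {lowest + 2..2 * lowest + 1})" by blast+
qed

text \<open>As 3 is a top gap and 2 is not, frob = lowest + 2. The gap 1 is not pseudo-Frobenius, so
  its reflection lowest + 1 lies in \<open>H\<close> by \<open>pf_eq\<close>. This determines
  \<open>H\<close>, and \<open>endo\<close> contains everything from 3 on.\<close>

lemma Ref_finite_endo_lowest_3:
  assumes pf2: "2 \<le> card pf" and red: "card top_gaps = card pf" and e: "numsg.lowest endo = 3"
  shows "Ref_finite_type (semigroup_ring H :: 'k::field fls ring)"
    and "4 \<le> lowest" and "H = semigroup_gen ({lowest..2 * lowest - 1} - {lowest + 2})"
proof -
  interpret E: numsg endo by (rule numsg_endo)
  have tp: "top_gaps = pf" using card_subset_eq[OF finite_pf top_gaps_pf red] .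
  have low: "3 \<le> lowest" using pf_card_less pf2 by linarith
  have e12: "1 \<notin> endo" "2 \<notin> endo" using E.lowest_le[of 1] E.lowest_le[of 2] e by auto
  have e3: "3 \<in> endo" using E.lowest(2) e by simp
  have "lowest \<noteq> 3"
  proof
    assume "lowest = 3"
    from top_gaps_lowest_3[OF pf2 red this] obtain f where "f \<in> pf" "f \<in> {1, 2}" by blast
    then show False using e12 by auto
  qed
  then show low4: "4 \<le> lowest" using low by simp
  have n: "1 \<notin> H" "2 \<notin> H" "3 \<notin> H" using lowest_below[of 1] lowest_below[of 2] lowest_below[of 3] low4 by simp_all
  have "3 \<in> top_gaps" "2 \<notin> top_gaps" using tp e3 e12 n by simp_all
  then have "cnd \<le> lowest + 3" "\<not> cnd \<le> lowest + 2" using n by (simp_all add: top_gaps_def)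
  then have fl: "frob = lowest + 2" using cnd_frob by simp
  have "lowest + 1 \<in> H"
  proof (rule ccontr)
    assume "lowest + 1 \<notin> H"
    then have "1 \<in> {x. x \<notin> H \<and> frob - x \<notin> H}" using n fl by simp
    then show False unfolding pf_eq using e12 by simp
  qed
  then have H: "x \<in> H \<longleftrightarrow> x \<noteq> lowest + 2" if "lowest \<le> x" for x
    using above_frob[of x] that fl frob_notin lowest(2)
    by (cases "x = lowest"; cases "x = lowest + 1") auto
  let ?A = "{lowest..2 * lowest - 1} - {lowest + 2}"
  have "semigroup_gen ?A = H"
  proof (rule semigroup_gen_eqI[OF numsg_axioms])
    fix x assume x: "x \<in> H" "x \<noteq> 0" "x \<notin> ?A"
    then have x2: "2 * lowest \<le> x" using lowest_le[of x] H[of x] by auto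
    show "\<exists>a\<in>?A. 0 < a \<and> a \<le> x \<and> x - a \<in> H"
    \<comment> \<open>Subtracting \<open>lowest\<close> from this number would hit the gap lowest +
      2; it is twice the generator lowest + 1.\<close>
    proof (cases "x = 2 * lowest + 2")
      case True
      then show ?thesis using low4 H[of "lowest + 1"] by (intro bexI[of _ "lowest + 1"]) auto
    next
      case False
      then show ?thesis using low4 H[of "x - lowest"] x2 by (intro bexI[of _ lowest]) auto
    qed
  qed (use H in auto)
  then show "H = semigroup_gen ?A" by simp
  have "i \<in> endo" if "3 \<le> i" for i
    unfolding endo_def
  proof (intro CollectI ballI impI)
    fix h assume "h \<in> H" "0 < h"
    then have "lowest \<le> h" using lowest_le by blast
    then show "i + h \<in> H" using H[of "i + h"] that by simp
  qed
  then show "Ref_finite_type (semigroup_ring H :: 'k fls ring)" by (intro Ref_finite_endo) auto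
qed

end

context generated
begin

text \<open>In minimal multiplicity every residue class modulo \<open>lowest\<close> contains a generator, so that
  \<open>g - lowest\<close> is pseudo-Frobenius for every other generator \<open>g\<close>.\<close>

lemma minimal_multiplicity:
  assumes proper: "H \<noteq> UNIV" and card: "card A = lowest" and fin: "finite A"
  shows "lowest \<le> Suc (card pf)"
proof -
  have pos: "0 < g" if "g \<in> A" for g using that zero_notin by (metis neq0_conv)
  have inj: "inj_on (\<lambda>g. g mod lowest) A"
  proof (rule linorder_inj_onI)
    fix g g' assume g: "g < g'" "g \<in> A" "g' \<in> A"
    show "g mod lowest \<noteq> g' mod lowest"
    proof
      assume "g mod lowest = g' mod lowest"
      then have "lowest dvd g' - g" using g(1) mod_eq_dvd_iff_nat[of g g' lowest] by (metis less_imp_le)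
      then obtain k where k: "g' - g = lowest * k" by (rule dvdE)
      have "lowest * k \<in> H" using lowest_multiple[OF H0, of k] by simp
      moreover have "g' = g + lowest * k" using k g(1) by linarith
      ultimately show False using irreducible[OF g(3) A_H[OF g(2)]] pos[OF g(2)] k g(1) by fastforce
    qed
  qed auto
  \<comment> \<open>Distinct minimal generators are incongruent, and there are as many of them as
    residue classes.\<close>
  have "(\<lambda>g. g mod lowest) ` A = {..<lowest}"
    by (rule card_subset_eq) (use lowest(1) in \<open>auto simp: card_image[OF inj] card\<close>)
  then have surj: "\<exists>w\<in>A. w mod lowest = x mod lowest" for x
    using lowest(1) by (metis (no_types, lifting) imageE lessThan_iff mod_less_divisor)
  have "g - lowest \<in> pf" if g: "g \<in> A - {lowest}" for g
  proof -
    have gl: "lowest < g" using A_ge[of g] g by auto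
    have gA: "g \<in> A" using g by simp
    have "g - lowest \<notin> H"
      using irreducible[OF gA lowest(2), of "g - lowest"] gl lowest(1) by fastforce
    moreover have "g - lowest + h \<in> H" if h: "h \<in> H" "0 < h" for h
    proof -
      obtain w where w: "w \<in> A" "w mod lowest = (g + h) mod lowest" using surj by blast
      have wn: "w \<noteq> g + (h + lowest * k)" for k
        using irreducible[OF w(1) A_H[OF gA] lowest_multiple[OF h(1)], of k] pos[OF gA] h(2) by fastforce
      \<comment> \<open>Otherwise \<open>w\<close> would be g + (h + k * lowest), a sum of two
        positive elements of \<open>H\<close>, although it is a minimal generator.\<close>
      have "w < g + h"
      proof (rule ccontr)
        assume "\<not> w < g + h"
        then have le: "g + h \<le> w" by simp
        then have "lowest dvd w - (g + h)" using w(2) mod_eq_dvd_iff_nat[of "g + h" w lowest] by simp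
        then obtain k where "w - (g + h) = lowest * k" by (rule dvdE)
        then have "w = g + (h + lowest * k)" using le by linarith
        then show False using wn by blast
      qed
      then have "lowest dvd g + h - w" using w(2) mod_eq_dvd_iff_nat[of w "g + h" lowest] by simp
      then obtain k where k: "g + h - w = lowest * k" by (rule dvdE)
      \<comment> \<open>The multiple of \<open>lowest\<close> is positive, so one copy can be
        subtracted without leaving \<open>H\<close>.\<close>
      then obtain j where "k = Suc j" using \<open>w < g + h\<close> by (cases k) auto
      then have "g - lowest + h = w + lowest * j" using k \<open>w < g + h\<close> gl by simp
      then show ?thesis using lowest_multiple[OF A_H[OF w(1)]] by simp
    qed
    ultimately show ?thesis by (simp add: endo_def)
  qed
  then have "(\<lambda>g. g - lowest) ` (A - {lowest}) \<subseteq> pf" by blast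
  moreover have "inj_on (\<lambda>g. g - lowest) (A - {lowest})"
    using A_ge by (auto intro!: inj_onI simp: eq_diff_iff)
  ultimately have "card (A - {lowest}) \<le> card pf" using card_inj_on_le finite_pf by blast
  then show ?thesis using lowest_A fin card by (simp add: card_Diff_singleton)
qed

end

theorem theorem5:
  fixes H :: "nat set" and a :: "nat \<Rightarrow> nat" and n :: nat
    and R :: "'k::{alg_closed_field, field_char_0} fls ring"
  assumes "numerical_semigroup H" and "H \<noteq> UNIV"
    and "strict_mono_on {1..n} a" and "minimally_generates (a ` {1..n}) H"
    and "R = semigroup_ring H"
    and "almost_gorenstein R" and "\<not> gorenstein R"
  shows
    "(minimal_reduced_type R \<longrightarrow>
       (Ref_finite_type R \<longleftrightarrow>
          R = semigroup_ring (semigroup_gen {3, 7, 11}) \<or>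
          R = semigroup_ring (semigroup_gen {3, 8, 13})))
   \<and> (maximal_reduced_type R \<and> CM_type R = 2 \<and> multiplicity_ring R = n \<longrightarrow>
       CM_finite_type R \<and> Ref_finite_type R)
   \<and> (maximal_reduced_type R \<and> multiplicity_ring (endo_ring_max_ideal R) \<le> 2 \<longrightarrow>
       (Ref_finite_type R \<longleftrightarrow>
          R = semigroup_ring (semigroup_gen {a 1..2 * a 1 - 1}) \<or>
          R = semigroup_ring (semigroup_gen ({a 1} \<union> {a 1 + 2..2 * a 1 + 1}))))
   \<and> (maximal_reduced_type R \<and> multiplicity_ring (endo_ring_max_ideal R) = 3 \<longrightarrow>
       (Ref_finite_type R \<longleftrightarrow>
          a 1 \<ge> 4 \<and> R = semigroup_ring (semigroup_gen ({a 1..2 * a 1 - 1} - {a 1 + 2}))))"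
proof -
  interpret numsg H by (unfold_locales) (rule assms(1))
  interpret generated H "a ` {1..n}" by (unfold_locales) (rule assms(4))
  interpret almost_symmetric_semigroup H
  proof
    show "H \<noteq> UNIV" by (rule assms(2))
    show "card (- H) + 1 = card (H \<inter> {..<cnd}) + card pf"
      using assms(6) unfolding assms(5) almost_gorenstein_eq[OF assms(2)] .
  qed
  have R: "R = semigroup_ring H" by (rule assms(5))
  have inj: "R = semigroup_ring X \<longleftrightarrow> H = X" for X
    unfolding R using semigroup_ring_inject by blast
  have pf2: "2 \<le> card pf" using card_pf_ge_2 assms(7) unfolding R by blast
  have minred: "minimal_reduced_type R \<longleftrightarrow> card top_gaps = 1"
    unfolding minimal_reduced_type_def R reduced_type_eq[OF assms(2)] ..
  have maxred: "maximal_reduced_type R \<longleftrightarrow> card top_gaps = card pf"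
    unfolding maximal_reduced_type_def R reduced_type_eq[OF assms(2)] CM_type_eq[OF assms(2)] ..
  have endo: "multiplicity_ring (endo_ring_max_ideal R) = numsg.lowest endo"
    unfolding R endo_ring_eq by (rule numsg.multiplicity_ring_eq[OF numsg_endo])
  have injA: "inj_on a {1..n}" using assms(3) by (rule strict_mono_on_imp_inj_on)
  have a1: "a 1 = lowest"
  proof -
    obtain i where i: "i \<in> {1..n}" "lowest = a i" using lowest_A by blast
    have 1: "1 \<in> {1..n}" using i(1) by simp
    have "a 1 \<le> a i" using strict_mono_on_imp_mono_on[OF assms(3)] 1 i(1) by (auto simp: mono_on_def)
    moreover have "lowest \<le> a 1" using A_ge[of "a 1"] 1 by blast
    ultimately show ?thesis using i(2) by simp
  qed
  \<comment> \<open>Minimal multiplicity bounds the multiplicity by the type plus one, while the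
    type is always smaller than the multiplicity.\<close>
  have low3: "lowest = 3" if "card pf = 2" "lowest = n"
  proof -
    have "card (a ` {1..n}) = lowest" using injA that(2) by (simp add: card_image)
    from minimal_multiplicity[OF assms(2) this] show ?thesis using pf_card_less that(1) by simp
  qed
  show ?thesis
    unfolding minred maxred endo inj a1
    unfolding R multiplicity_ring_eq CM_type_eq[OF assms(2)]
  proof (intro conjI impI)
    assume "card top_gaps = 1"
    then show "Ref_finite_type (semigroup_ring H :: 'k fls ring) \<longleftrightarrow>
        H = semigroup_gen {3, 7, 11} \<or> H = semigroup_gen {3, 8, 13}"
      by (rule Ref_finite_minimal_reduced[OF pf2])
  next
    assume "card top_gaps = card pf \<and> card pf = 2 \<and> lowest = n"
    then have *: "card top_gaps = card pf" "lowest = 3" using low3 by blast+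
    show "CM_finite_type (semigroup_ring H :: 'k fls ring)" "Ref_finite_type (semigroup_ring H :: 'k fls ring)"
      using CM_finite_lowest_3[OF pf2 *] by blast+
  next
    assume "card top_gaps = card pf \<and> numsg.lowest endo \<le> 2"
    then show "Ref_finite_type (semigroup_ring H :: 'k fls ring) \<longleftrightarrow>
        H = semigroup_gen {lowest..2 * lowest - 1} \<or> H = semigroup_gen ({lowest} \<union> {lowest + 2..2 * lowest + 1})"
      using Ref_finite_endo_lowest_le_2[OF pf2] by blast
  next
    assume "card top_gaps = card pf \<and> numsg.lowest endo = 3"
    then show "Ref_finite_type (semigroup_ring H :: 'k fls ring) \<longleftrightarrow>
        4 \<le> lowest \<and> H = semigroup_gen ({lowest..2 * lowest - 1} - {lowest + 2})"
      using Ref_finite_endo_lowest_3[OF pf2] by blast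
  qed
qed

end
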